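(* Let $n\ge3$, let $\Omega\subset\mathbb R^n$ be open and connected, and let $u\in C^4(\Omega)$ satisfy $u<0$ in $\Omega$. Assume that the graph of $u$ is $\Gamma_2$-admissible and that $$\sigma_2(\kappa[u])=(1+|Du|^2)^{-2}\quad\text{in }\Omega.$$ Set $v=-\sqrt{-u}$. If $D^2v\ge0$ in $\Omega$, then $\operatorname{rank} D^2v$ is constant in $\Omega$.
   Context: $\kappa[u]=(\kappa_1[u],\ldots,\kappa_n[u])$ denotes the principal curvatures of the graph $\{(x,u(x)):x\in\Omega\}\subset\mathbb R^{n+1}$, i.e. the eigenvalues of the symmetric matrix $$\frac{1}{\sqrt{1+|Du|^2}}\,(I+Du\otimes Du)^{-1/2}\,D^2u\,(I+Du\otimes Du)^{-1/2}.$$ For $\lambda\in\mathbb R^n$, $\sigma_1(\lambda)=\sum_i\lambda_i$ and $\sigma_2(\lambda)=\sum_{i<j}\lambda_i\lambda_j$. The Gårding cone is $\Gamma_2=\{\lambda\in\mathbb R^n:\sigma_1(\lambda)>0,\ \sigma_2(\lambda)>0\}$. The graph of $u$ is called $\Gamma_2$-admissible if $\kappa[u](x)\in\Gamma_2$ at every point $x$. *)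

theory Defs
  imports "HOL-Analysis.Analysis"
begin

definition gradient :: "(real^'n \<Rightarrow> real) \<Rightarrow> real^'n \<Rightarrow> real^'n" where
  "gradient f x = (\<chi> i. frechet_derivative f (at x) (axis i 1))"

definition hessian :: "(real^'n \<Rightarrow> real) \<Rightarrow> real^'n \<Rightarrow> real^'n^'n" where
  "hessian f x = jacobian (gradient f) (at x)"

(* The class C^k; meaningful only on open sets, since gradient is the full derivative at x. *)
primrec Ck_on :: "nat \<Rightarrow> (real^'n \<Rightarrow> real) \<Rightarrow> (real^'n) set \<Rightarrow> bool" where
  "Ck_on 0 f S \<longleftrightarrow> continuous_on S f"
| "Ck_on (Suc k) f S \<longleftrightarrow>
     f differentiable_on S \<and> (\<forall>i. Ck_on k (\<lambda>x. gradient f x $ i) S)"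

definition pos_semidef :: "real^'n^'n \<Rightarrow> bool" where
  "pos_semidef A \<longleftrightarrow> transpose A = A \<and> (\<forall>z. 0 \<le> z \<bullet> (A *v z))"

(* A positive semidefinite matrix has exactly one positive semidefinite square root. *)
definition mat_sqrt :: "real^'n^'n \<Rightarrow> real^'n^'n" where
  "mat_sqrt A = (THE B. pos_semidef B \<and> B ** B = A)"

definition outer_prod :: "real^'n \<Rightarrow> real^'n \<Rightarrow> real^'n^'n" where
  "outer_prod p q = (\<chi> i j. p $ i * q $ j)"

(* The eigenvalues with algebraic multiplicity, in an unspecified order: the vector is determined
   up to a permutation of its entries, and is used only through symmetric functions of them.
   It exists whenever the characteristic polynomial splits over the reals, in particular for
   symmetric A. *)
definition eigenvalues :: "real^'n^'n \<Rightarrow> real^'n" where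
  "eigenvalues A = (SOME l. \<forall>t. det (mat t - A) = (\<Prod>i\<in>UNIV. t - l $ i))"

definition curvature_matrix :: "(real^'n \<Rightarrow> real) \<Rightarrow> real^'n \<Rightarrow> real^'n^'n" where
  "curvature_matrix u x =
     (let p = gradient u x;
          R = matrix_inv (mat_sqrt (mat 1 + outer_prod p p))
      in (1 / sqrt (1 + (norm p)\<^sup>2)) *\<^sub>R (R ** hessian u x ** R))"

definition principal_curvatures :: "(real^'n \<Rightarrow> real) \<Rightarrow> real^'n \<Rightarrow> real^'n" where
  "principal_curvatures u x = eigenvalues (curvature_matrix u x)"

definition sigma1 :: "real^'n \<Rightarrow> real" where
  "sigma1 l = (\<Sum>i\<in>UNIV. l $ i)"

(* The index type carries no order, so the pairs i < j become the two-element sets of indices. *)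
definition sigma2 :: "real^'n \<Rightarrow> real" where
  "sigma2 l = (\<Sum>S\<in>{S. card S = 2}. \<Prod>i\<in>S. l $ i)"

definition Gamma2 :: "(real^'n) set" where
  "Gamma2 = {l. sigma1 l > 0 \<and> sigma2 l > 0}"

definition Gamma2_admissible_on :: "(real^'n) set \<Rightarrow> (real^'n \<Rightarrow> real) \<Rightarrow> bool" where
  "Gamma2_admissible_on S u \<longleftrightarrow> (\<forall>x\<in>S. principal_curvatures u x \<in> Gamma2)"

end

theory Submission
  imports Defs "HOL-Analysis.Analysis" "HOL-Computational_Algebra.Polynomial" "HOL-Library.Multiset"
begin

text \<open>
  With \<open>p = Du\<close> and \<open>M = - v D\<^sup>2v - Dv \<otimes> Dv\<close> the equation is polynomial in \<open>p\<close> and \<open>M\<close>. Let \<open>k\<close> be the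
  minimal rank of \<open>D\<^sup>2v\<close>, and suppose that the closed set where it is attained is not all of \<open>\<Omega>\<close>. A ball
  inside the complement touches this set, and near the touching point the sum of the \<open>n - k\<close> smallest eigenvalues
  of \<open>D\<^sup>2v\<close> is compared with a small multiple of a Hopf barrier for the ball. By Ky Fan's principle the sum is a
  minimum of traces over orthonormal frames, so at a minimum of the difference one may differentiate along moving
  frames instead of eigenvalues. Differentiating the equation twice in the null directions bounds the linearised
  operator applied to the sum from above by the sum and its gradient, provided that a quadratic form in third
  derivatives is coercive modulo the linearised equation; this is an explicit sum of squares, treated separately
  for \<open>k = 2\<close>. The barrier satisfies the opposite strict inequality, so the minimum cannot exist.\<close>

section \<open>Symmetric matrices\<close>

text \<open>The obstacle is the dependence of the equation on Du. Differentiating it twice in a null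
  direction of D^2v brings in the component of Dv in that direction, which need not be small where
  the eigenvalue is. Let psi be the sum of the small eigenvalues and P the projection onto their
  eigenvectors. Nonnegativity of D^2v alone makes third derivatives with two null indices O(sqrt
  psi), so most errors are O(psi) or are absorbed by coercivity; one of size |P Dv|^2 sqrt(psi) is
  left. It is absorbed by |P Dv|^4. This quantity is available because the coercivity estimate has a
  surplus: of the three units of \<open>y^2 * Theta p p m m\<close> in the form only one is spent on
  positivity, \<open>y\<close> is a component of Dv up to a bounded factor, and
  \<open>Theta p p m m\<close> dominates |P Dv|^2 up to a constant as soon as two eigenvalues stay
  away from zero. The remaining first-order errors contain the third derivatives only through their
  trace over the null directions, formally the gradient of psi. Rank at most one is excluded by the
  equation, whose left side would be nonpositive.\<close>

notation scaleR (infixr "*R" 75)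

lemmas sq_eq = power2_eq_square
 and scaleR_mv = scaleR_matrix_vector_assoc[symmetric]
 and mv_assoc = matrix_vector_mul_assoc[symmetric]
 and mv_scaleR = matrix_vector_mult_scaleR
 and add_mv = matrix_vector_mult_add_rdistrib
 and diff_mv = matrix_vector_mult_diff_rdistrib
 and mv_add = matrix_vector_right_distrib
 and norm_sq = power2_norm_eq_inner

text \<open>Indexed by the coordinate type itself, so that orthonormality already makes
  \<open>b\<close> a basis of the whole space, without any counting of vectors.\<close>

definition orthobasis :: "('n => real^'n) => bool" where
 "orthobasis b \<longleftrightarrow> (\<forall>i j. b i \<bullet> b j = (if i = j then 1 else 0))"

lemma symmetric_inner: "transpose A = A ==> x \<bullet> (A *v y) = (A *v x) \<bullet> y" for A :: "real^'n^'n"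
 by (metis dot_lmul_matrix vector_transpose_matrix)

lemma symmetric_component: "transpose A = A ==> A $ i $ j = A $ j $ i"
proof -
 assume "transpose A = A"
 then have "transpose A $ j $ i = A $ j $ i" by simp
 then show ?thesis by (simp add: transpose_def)
qed

lemma symmetricI: "(!!i j. A $ i $ j = A $ j $ i) ==> transpose A = A"
 by (simp add: transpose_def vec_eq_iff)

text \<open>First-order condition at a minimum, without derivatives: for small \<open>t\<close> the
  linear term dominates. Testing \<open>t = - c / D\<close> with any positive \<open>D > d\<close>
  suffices.\<close>

lemma quadratic_nonneg_imp_zero:
 fixes c d :: real
 assumes "!!t. 2 * t * c + t^2 * d >= 0"
 shows "c = 0"
proof (rule ccontr)
 assume c: "c ~= 0"
 define D where "D = \<bar>d\<bar> + 1"
 have D: "D > 0" "d < D" by (auto simp: D_def)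
 have "0 <= 2 * (- c / D) * c + (- c / D)^2 * d" by (rule assms)
 also have "... = (c^2 / D) * (d / D - 2)" using D by (simp add: field_simps sq_eq)
 finally have "0 <= (c^2 / D) * (d / D - 2)" .
 moreover have "d / D < 1" using D by simp
 moreover have "c^2 / D > 0" using c D by simp
 ultimately show False by (smt (verit) mult_pos_neg)
qed

text \<open>A maximiser of the Rayleigh quotient on the invariant subspace is an eigenvector: its
  residual \<open>r\<close> lies in the subspace, and the variation in the direction
  \<open>r\<close> itself forces \<open>r \<bullet> r = 0\<close>.\<close>

lemma symmetric_max_eigenvector:
 fixes A :: "real^'n^'n"
 assumes A: "transpose A = A" and W: "subspace W" "W ~= {0}" and inv: "!!x. x : W ==> A *v x : W"
 obtains x l where "x : W" "norm x = 1" "A *v x = l *R x"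
proof -
 define K where "K = W \<inter> sphere 0 1"
 have comp: "compact K" unfolding K_def by (intro closed_Int_compact closed_subspace W compact_sphere)
 obtain w where w: "w : W" "w ~= 0" using W subspace_0 by blast
 then have "(1 / norm w) *R w : K" by (simp add: K_def subspace_scale W)
 then have ne: "K ~= {}" by auto
 have "continuous_on K (%x. x \<bullet> (A *v x))"
  by (intro continuous_intros linear_continuous_on matrix_vector_mul_bounded_linear)
 then obtain x where x: "x : K" and mx: "!!y. y : K ==> y \<bullet> (A *v y) <= x \<bullet> (A *v x)"
  using continuous_attains_sup[OF comp ne] by blast
 define l where "l = x \<bullet> (A *v x)"
 have xW: "x : W" "norm x = 1" using x by (auto simp: K_def)
 have N: "y \<bullet> (A *v y) <= l * (y \<bullet> y)" if "y : W" for y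
 proof (cases "y = 0")
  case False
  have "(1 / norm y) *R y : K" using that False by (simp add: K_def subspace_scale W)
  from mx[OF this] have "(1 / norm y)^2 * (y \<bullet> (A *v y)) <= l"
   by (simp add: l_def mv_scaleR sq_eq)
  then show ?thesis using False by (simp add: field_simps norm_sq)
 qed simp
 define r where "r = A *v x - l *R x"
 have rW: "r : W" unfolding r_def by (intro subspace_diff subspace_scale W inv xW)
 have "- (r \<bullet> r) = 0"
 proof (rule quadratic_nonneg_imp_zero)
  fix t :: real
  have "x + t *R r : W" using xW rW W by (simp add: subspace_add subspace_scale)
  from N[OF this] have "0 <= l * ((x + t *R r) \<bullet> (x + t *R r)) - (x + t *R r) \<bullet> (A *v (x + t *R r))" by simp
  also have "... = (l * (x \<bullet> x) - l) + 2 * t * (l * (x \<bullet> r) - r \<bullet> (A *v x)) + t^2 * (l * (r \<bullet> r) - r \<bullet> (A *v r))"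
   using symmetric_inner[OF A, of x r]
   by (simp add: l_def[symmetric] mv_add mv_scaleR inner_add_left inner_add_right inner_commute
     sq_eq algebra_simps)
  also have "l * (x \<bullet> r) - r \<bullet> (A *v x) = - (r \<bullet> r)"
   by (simp add: r_def inner_diff_left inner_diff_right inner_commute algebra_simps)
  also have "l * (x \<bullet> x) - l = 0" using xW by (simp add: norm_eq_1)
  finally show "0 <= 2 * t * - (r \<bullet> r) + t^2 * (l * (r \<bullet> r) - r \<bullet> (A *v r))" by simp
 qed
 then have "A *v x = l *R x" by (simp add: r_def)
 then show ?thesis using that xW by blast
qed

text \<open>Induction over index sets: the orthogonal complement of the eigenvectors already found
  is invariant, and a dimension count shows that it is nonzero as long as an index is
  missing.\<close>

theorem symmetric_eigenbasis:
 fixes A :: "real^'n^'n"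
 assumes A: "transpose A = A"
 obtains b l where "orthobasis b" "!!i. A *v b i = l i *R b i"
proof -
 have "\<exists>b l. (\<forall>i\<in>J. \<forall>j\<in>J. b i \<bullet> b j = (if i = j then 1 else 0)) \<and> (\<forall>i\<in>J. A *v b i = l i *R (b i :: real^'n))" for J :: "'n set"
 proof (induction J rule: finite_induct[OF finite])
  case 1 show ?case by simp
 next
  case (2 k J)
  then obtain b l where b: "\<forall>i\<in>J. \<forall>j\<in>J. b i \<bullet> b j = (if i = j then 1 else 0)" and l: "\<forall>i\<in>J. A *v b i = l i *R b i" by blast
  define W where "W = {x. \<forall>i\<in>J. b i \<bullet> x = 0}"
  have subW: "subspace W" unfolding W_def subspace_def by (auto simp: inner_add_right)
  have "dim (b ` J) <= card (b ` J)" by (rule dim_le_card') simp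
  also have "... <= card J" by (rule card_image_le) simp
  also have "... < card (UNIV :: 'n set)" using 2 by (intro psubset_card_mono) auto
  finally have "dim (span (b ` J)) < DIM(real^'n)" by simp
  then have "span (b ` J) \<subset> UNIV" using dim_UNIV by (metis less_irrefl top.not_eq_extremum)
  then obtain x where x: "x ~= 0" "!!y. y : span (b ` J) ==> orthogonal x y"
   using orthogonal_to_subspace_exists_gen[of "b ` J" UNIV] by (auto simp: span_UNIV)
  have "b i \<bullet> x = 0" if "i : J" for i
   using x(2)[OF span_base[OF imageI[OF that]]] by (simp add: orthogonal_def inner_commute)
  then have "x : W" by (simp add: W_def)
  then have W0: "W ~= {0}" using x by blast
  have inv: "A *v x : W" if "x : W" for x using that l unfolding W_def by (simp add: symmetric_inner[OF A])
  obtain x m where xm: "x : W" "norm x = 1" "A *v x = m *R x"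
   using symmetric_max_eigenvector[OF A subW W0 inv] by blast
  have "\<forall>i\<in>insert k J. \<forall>j\<in>insert k J. (b(k := x)) i \<bullet> (b(k := x)) j = (if i = j then 1 else 0)"
   using b xm 2 by (auto simp: W_def norm_eq_1 inner_commute)
  moreover have "\<forall>i\<in>insert k J. A *v (b(k := x)) i = (l(k := m)) i *R (b(k := x)) i"
   using l xm 2 by auto
  ultimately show ?case by blast
 qed
 from this[of UNIV] show ?thesis using that by (auto simp: orthobasis_def)
qed

text \<open>Orthonormal rows give orthonormal columns, because a left inverse of a square matrix is
  a right inverse.\<close>

lemma orthobasis_completeness:
 fixes b :: "'n => real^'n"
 assumes "orthobasis b"
 shows "(\<Sum>i\<in>UNIV. b i $ j * b i $ k) = (if j = k then 1 else 0)"
proof -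
 define O' where "O' = (\<chi> i. b i)"
 have "O' ** transpose O' = mat 1"
  using assms by (simp add: O'_def orthobasis_def matrix_matrix_mult_def transpose_def mat_def vec_eq_iff inner_vec_def)
 then have "transpose O' ** O' = mat 1" by (metis matrix_left_right_inverse)
 then have "(transpose O' ** O') $ j $ k = (mat 1 :: real^'n^'n) $ j $ k" by simp
 then show ?thesis by (simp add: O'_def matrix_matrix_mult_def transpose_def mat_def)
qed

lemma orthobasis_expansion:
 fixes b :: "'n => real^'n"
 assumes "orthobasis b"
 shows "(\<Sum>i\<in>UNIV. (b i \<bullet> x) *R b i) = x"
proof -
 have "(\<Sum>i\<in>UNIV. (b i \<bullet> x) *R b i) $ k = x $ k" for k
 proof -
  have "(\<Sum>i\<in>UNIV. (b i \<bullet> x) *R b i) $ k = (\<Sum>i\<in>UNIV. \<Sum>j\<in>UNIV. b i $ j * b i $ k * x $ j)"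
   by (simp add: inner_vec_def sum_distrib_left mult_ac)
  also have "... = (\<Sum>j\<in>UNIV. (\<Sum>i\<in>UNIV. b i $ j * b i $ k) * x $ j)"
   by (subst sum.swap) (simp add: sum_distrib_right)
  also have "... = x $ k" by (simp add: orthobasis_completeness[OF assms] if_distrib[of "%c. c * _"] cong: if_cong)
  finally show ?thesis .
 qed
 then show ?thesis by (simp add: vec_eq_iff)
qed

lemma orthobasis_inner:
 fixes b :: "'n => real^'n"
 assumes "orthobasis b"
 shows "(\<Sum>i\<in>UNIV. (b i \<bullet> x) * (b i \<bullet> y)) = x \<bullet> y"
proof -
 have "x \<bullet> y = (\<Sum>i\<in>UNIV. (b i \<bullet> x) *R b i) \<bullet> y" by (simp add: orthobasis_expansion[OF assms])
 also have "... = (\<Sum>i\<in>UNIV. (b i \<bullet> x) * (b i \<bullet> y))" by (simp add: inner_sum_left)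
 finally show ?thesis by simp
qed

lemma orthobasis_ext:
 fixes b :: "'n => real^'n" and A C :: "real^'n^'n"
 assumes "orthobasis b" "!!i. A *v b i = C *v b i"
 shows "A = C"
proof -
 have "A *v x = C *v x" for x
 proof -
  have "A *v (\<Sum>i\<in>UNIV. (b i \<bullet> x) *R b i) = C *v (\<Sum>i\<in>UNIV. (b i \<bullet> x) *R b i)"
   by (simp add: linear_sum[OF matrix_vector_mul_linear] mv_scaleR assms(2))
  then show ?thesis by (simp add: orthobasis_expansion[OF assms(1)])
 qed
 then show ?thesis by (simp add: matrix_eq)
qed

lemma orthobasis_trace:
 fixes b :: "'n => real^'n" and A :: "real^'n^'n"
 assumes "orthobasis b"
 shows "trace A = (\<Sum>i\<in>UNIV. b i \<bullet> (A *v b i))"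
proof -
 have "(\<Sum>i\<in>UNIV. b i \<bullet> (A *v b i)) = (\<Sum>i\<in>UNIV. \<Sum>j\<in>UNIV. \<Sum>k\<in>UNIV. A $ j $ k * (b i $ j * b i $ k))"
  by (simp add: inner_vec_def matrix_vector_mult_def sum_distrib_left mult_ac)
 also have "... = (\<Sum>j\<in>UNIV. \<Sum>i\<in>UNIV. \<Sum>k\<in>UNIV. A $ j $ k * (b i $ j * b i $ k))" by (rule sum.swap)
 also have "... = (\<Sum>j\<in>UNIV. \<Sum>k\<in>UNIV. \<Sum>i\<in>UNIV. A $ j $ k * (b i $ j * b i $ k))"
  by (rule sum.cong[OF refl]) (rule sum.swap)
 also have "... = (\<Sum>j\<in>UNIV. \<Sum>k\<in>UNIV. A $ j $ k * (if j = k then 1 else 0))"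
  by (simp add: sum_distrib_left[symmetric] orthobasis_completeness[OF assms])
 also have "... = trace A" by (simp add: trace_def if_distrib[of "%c. _ * c"] cong: if_cong)
 finally show ?thesis by simp
qed

lemma matrix_inner_columns:
 fixes A C :: "real^'n^'n"
 shows "A \<bullet> C = trace (transpose A ** C)"
proof -
 have "A \<bullet> C = (\<Sum>i\<in>UNIV. \<Sum>j\<in>UNIV. A $ i $ j * C $ i $ j)" by (simp add: inner_vec_def)
 also have "... = (\<Sum>j\<in>UNIV. \<Sum>i\<in>UNIV. A $ i $ j * C $ i $ j)" by (rule sum.swap)
 finally show ?thesis by (simp add: trace_def matrix_matrix_mult_def transpose_def)
qed

lemma orthobasis_matrix_inner:
 fixes b :: "'n => real^'n" and A C :: "real^'n^'n"
 assumes "orthobasis b"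
 shows "A \<bullet> C = (\<Sum>i\<in>UNIV. (A *v b i) \<bullet> (C *v b i))"
proof -
 have "A \<bullet> C = (\<Sum>i\<in>UNIV. b i \<bullet> ((transpose A ** C) *v b i))"
  unfolding matrix_inner_columns by (rule orthobasis_trace[OF assms])
 also have "... = (\<Sum>i\<in>UNIV. (A *v b i) \<bullet> (C *v b i))"
  by (intro sum.cong refl) (metis dot_lmul_matrix inner_commute matrix_vector_mul_assoc transpose_matrix_vector)
 finally show ?thesis .
qed

lemma orthobasis_matrix_inner2:
 fixes b :: "'n => real^'n" and A C :: "real^'n^'n"
 assumes "orthobasis b"
 shows "A \<bullet> C = (\<Sum>i\<in>UNIV. \<Sum>j\<in>UNIV. (b i \<bullet> (A *v b j)) * (b i \<bullet> (C *v b j)))"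
 by (subst sum.swap) (simp add: orthobasis_inner[OF assms] orthobasis_matrix_inner[OF assms])

lemma outer_prod_mult: "outer_prod p q *v x = (q \<bullet> x) *R p"
 by (simp add: vec_eq_iff outer_prod_def matrix_vector_mult_def inner_vec_def sum_distrib_left sum_distrib_right mult_ac)

lemma trace_outer_prod: "trace (outer_prod p q) = p \<bullet> q"
 by (simp add: trace_def outer_prod_def inner_vec_def)

lemma inner_outer_prod: "A \<bullet> outer_prod p q = p \<bullet> (A *v q)" for A :: "real^'n^'n"
 by (simp add: inner_vec_def outer_prod_def matrix_vector_mult_def sum_distrib_left mult_ac)

lemma transpose_outer_prod: "transpose (outer_prod p q) = outer_prod q p"
 by (simp add: transpose_def outer_prod_def vec_eq_iff mult.commute)

lemma norm_matrix_vector_le: "norm (A *v x) <= norm A * norm x" for A :: "real^'n^'n"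
proof -
 have "(norm (A *v x))^2 = (\<Sum>i\<in>UNIV. ((A $ i) \<bullet> x)^2)"
  unfolding norm_sq inner_vec_def[of "A *v x"] by (simp add: matrix_vector_mul_component sq_eq)
 also have "... <= (\<Sum>i\<in>UNIV. (A $ i \<bullet> A $ i) * (x \<bullet> x))"
  by (intro sum_mono Cauchy_Schwarz_ineq)
 also have "... = (norm A * norm x)^2"
  by (simp add: power_mult_distrib norm_sq sum_distrib_right inner_vec_def[of A])
 finally show ?thesis by (rule power2_le_imp_le) simp
qed

lemma matrix_sum_mult: "(\<Sum>i\<in>I. F i) *v x = (\<Sum>i\<in>I. F i *v x)" for F :: "'a => real^'n^'n"
 by (induction I rule: infinite_finite_induct) (simp_all add: add_mv)

lemma eigenbasis_symmetric_matrix: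
 fixes b :: "'n => real^'n" and A :: "real^'n^'n"
 assumes "orthobasis b" "!!i. A *v b i = l i *R b i"
 shows "A = (\<Sum>i\<in>UNIV. l i *R outer_prod (b i) (b i))"
proof (rule orthobasis_ext[OF assms(1)])
 fix j
 have "(\<Sum>i\<in>UNIV. l i *R outer_prod (b i) (b i)) *v b j = (\<Sum>i\<in>UNIV. (l i *R outer_prod (b i) (b i)) *v b j)"
  by (rule matrix_sum_mult)
 also have "... = (\<Sum>i\<in>UNIV. if i = j then l j *R b j else 0)"
  using assms(1) by (intro sum.cong refl) (auto simp: scaleR_mv outer_prod_mult orthobasis_def)
 finally show "A *v b j = (\<Sum>i\<in>UNIV. l i *R outer_prod (b i) (b i)) *v b j" by (simp add: assms(2))
qed

lemma pos_semidef_eigenvalue_nonneg: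
 assumes "pos_semidef A" "A *v x = l *R x" "x \<bullet> x = 1"
 shows "l >= 0"
proof -
 have "0 <= x \<bullet> (A *v x)" using assms(1) by (simp add: pos_semidef_def)
 then show ?thesis using assms by simp
qed

lemma rank_eigenbasis:
 fixes b :: "'n => real^'n" and A :: "real^'n^'n"
 assumes b: "orthobasis b" and l: "!!i. A *v b i = l i *R b i"
 shows "rank A = card {i. l i ~= 0}"
proof -
 define J where "J = {i. l i ~= 0}"
 have inj: "inj_on b J" using b by (intro inj_onI) (metis orthobasis_def zero_neq_one)
 have ind: "independent (b ` J)"
  using b by (intro pairwise_orthogonal_independent)
   (auto simp: pairwise_def orthogonal_def orthobasis_def dest: arg_cong[of _ _ "%x. x \<bullet> x"])
 have "range (%x. A *v x) = span (b ` J)"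
 proof
  show "range (%x. A *v x) \<subseteq> span (b ` J)"
  proof clarify
   fix x
   have "A *v x = A *v (\<Sum>i\<in>UNIV. (b i \<bullet> x) *R b i)" by (simp add: orthobasis_expansion[OF b])
   also have "... = (\<Sum>i\<in>UNIV. (b i \<bullet> x) *R l i *R b i)"
    by (simp add: linear_sum[OF matrix_vector_mul_linear] mv_scaleR l)
   also have "... : span (b ` J)"
   proof (rule span_sum)
    fix i show "(b i \<bullet> x) *R l i *R b i : span (b ` J)"
    proof (cases "l i = 0")
     case False
     then have "b i : span (b ` J)" by (intro span_base) (simp add: J_def)
     then show ?thesis by (intro span_scale)
    qed (simp add: span_zero)
   qed
   finally show "A *v x : span (b ` J)" .
  qed
  show "span (b ` J) \<subseteq> range (%x. A *v x)"
  proof (rule span_minimal)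
   show "b ` J \<subseteq> range (%x. A *v x)"
   proof clarify
    fix i assume "i : J"
    then have "A *v ((1 / l i) *R b i) = b i" by (simp add: mv_scaleR l J_def)
    then show "b i : range (%x. A *v x)" by (metis rangeI)
   qed
   show "subspace (range (%x. A *v x))"
    by (metis linear_subspace_image matrix_vector_mul_linear subspace_UNIV)
  qed
 qed
 then have "rank A = dim (span (b ` J))" by (simp add: rank_dim_range)
 also have "... = card J" using ind inj by (simp add: dim_eq_card_independent card_image)
 finally show ?thesis by (simp add: J_def)
qed

section \<open>Elementary symmetric functions of the eigenvalues\<close>

text \<open>\<open>eigenvalues\<close> is an unspecified choice, so only the multiset of roots of
  the characteristic polynomial can be recovered from it. The multiset determines all power sums,
  and these determine \<open>sigma1\<close> and \<open>sigma2\<close>.\<close>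

lemma prod_linear_factors_unique:
 fixes l l' :: "real^'n"
 assumes "!!t. (\<Prod>i\<in>UNIV. t - l $ i) = (\<Prod>i\<in>UNIV. t - l' $ i)"
 shows "image_mset (($) l) (mset_set UNIV) = image_mset (($) l') (mset_set UNIV)"
proof -
 define P where "P l = (\<Prod>i\<in>(UNIV::'n set). [:- (l $ i), 1:])" for l :: "real^'n"
 have "poly (P l) t = (\<Prod>i\<in>UNIV. t - l $ i)" for l t by (simp add: P_def poly_prod)
 then have "P l = P l'" using assms by (intro poly_eqI_degree[of UNIV] poly_ext) auto
 moreover have "proots (P l) = image_mset (($) l) (mset_set UNIV)" for l
 proof -
  have "proots (P l) = (\<Sum>i\<in>UNIV. proots [:- (l $ i), 1:])" unfolding P_def by (rule proots_prod) auto
  also have "... = (\<Sum>i\<in>UNIV. {# l $ i #})" by simp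
  also have "... = image_mset (($) l) (mset_set UNIV)"
   by (induction "UNIV :: 'n set" rule: infinite_finite_induct) (simp_all add: sum_unfold_sum_mset)
  finally show ?thesis .
 qed
 ultimately show ?thesis by metis
qed

text \<open>Newton's identity. A two-element set of indices comes from exactly two ordered pairs off
  the diagonal, which turns the unordered sum into a double sum.\<close>

lemma sigma2_eq: "sigma2 l = ((sigma1 l)^2 - (\<Sum>i\<in>UNIV. (l $ i)^2)) / 2" for l :: "real^'n"
proof -
 define P where "P = {p :: 'n \<times> 'n. fst p ~= snd p}"
 define T where "T = {S :: 'n set. card S = 2}"
 have "(\<Sum>S\<in>T. \<Sum>p\<in>{p:P. {fst p, snd p} = S}. l $ fst p * l $ snd p) = (\<Sum>p\<in>P. l $ fst p * l $ snd p)"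
  by (rule sum.group) (auto simp: P_def T_def)
 moreover have "(\<Sum>p\<in>{p:P. {fst p, snd p} = S}. l $ fst p * l $ snd p) = 2 * (\<Prod>i\<in>S. l $ i)" if "S : T" for S
 proof -
  have "card S = 2" using that by (simp add: T_def)
  then obtain i j where ij: "S = {i, j}" "i ~= j" unfolding card_2_iff by blast
  then have "{p:P. {fst p, snd p} = S} = {(i, j), (j, i)}" by (auto simp: P_def doubleton_eq_iff)
  then show ?thesis using ij by simp
 qed
 ultimately have "2 * sigma2 l = (\<Sum>p\<in>P. l $ fst p * l $ snd p)"
  by (simp add: sigma2_def T_def sum_distrib_left)
 moreover have "(sigma1 l)^2 = (\<Sum>p\<in>UNIV. l $ fst p * l $ snd p)"
  by (simp add: sigma1_def sq_eq sum_product sum.cartesian_product UNIV_Times_UNIV[symmetric] case_prod_unfold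
    del: UNIV_Times_UNIV)
 moreover have "(\<Sum>p\<in>UNIV. l $ fst p * l $ snd p) = (\<Sum>p\<in>P. l $ fst p * l $ snd p) + (\<Sum>p\<in>-P. l $ fst p * l $ snd p)"
  using sum.subset_diff[of P UNIV "%p. l $ fst p * l $ snd p"] by (simp add: Compl_eq_Diff_UNIV)
 moreover have "(\<Sum>p\<in>-P. l $ fst p * l $ snd p) = (\<Sum>i\<in>UNIV. (l $ i)^2)"
 proof -
  have "-P = (%i. (i, i)) ` UNIV" by (auto simp: P_def)
  then show ?thesis by (simp add: sum.reindex inj_on_def sq_eq)
 qed
 ultimately show ?thesis by simp
qed

text \<open>The matrix with columns \<open>b i\<close> conjugates \<open>A\<close> to a diagonal
  matrix. The relation is used in multiplied-out form and cancelled at the level of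
  determinants.\<close>

lemma det_eigenbasis:
 fixes b :: "'n => real^'n" and A :: "real^'n^'n"
 assumes b: "orthobasis b" and l: "!!i. A *v b i = l i *R b i"
 shows "det (mat t - A) = (\<Prod>i\<in>UNIV. t - l i)"
proof -
 define O' where "O' = transpose (\<chi> i. b i)"
 define D :: "real^'n^'n" where "D = (\<chi> i j. if i = j then t - l i else 0)"
 have O1: "transpose O' ** O' = mat 1"
  using b by (simp add: O'_def orthobasis_def matrix_matrix_mult_def transpose_def mat_def vec_eq_iff inner_vec_def)
 have Oc: "O' *v axis i 1 = b i" for i
  by (simp add: O'_def matrix_vector_mult_basis column_transpose row_def vec_eq_iff)
 have "(mat t - A) ** O' = O' ** D"
 proof (rule orthobasis_ext[of "%i. axis i 1"])
  show "orthobasis (%i. axis i 1 :: real^'n)" by (simp add: orthobasis_def inner_axis_axis)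
  fix i
  have "D *v axis i 1 = (t - l i) *R axis i 1"
   unfolding matrix_vector_mult_basis by (auto simp: D_def vec_eq_iff column_def axis_def)
  moreover have "mat t *v x = t *R x" for x :: "real^'n"
   by (simp add: vec_eq_iff matrix_vector_mult_def mat_def if_distrib[of "%c. c * _"] cong: if_cong)
  ultimately show "((mat t - A) ** O') *v axis i 1 = (O' ** D) *v axis i 1"
   by (simp add: mv_assoc Oc diff_mv l mv_scaleR scaleR_left_diff_distrib[symmetric])
 qed
 then have "det (mat t - A) * det O' = det O' * det D" by (metis det_mul)
 moreover have "det O' ~= 0"
  using O1 by (metis det_I det_mul det_transpose mult_zero_left zero_neq_one)
 ultimately have "det (mat t - A) = det D" by simp
 then show ?thesis by (simp add: D_def det_diagonal)
qed

text \<open>An eigenbasis exhibits a real splitting of the characteristic polynomial, so the choice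
  in \<open>eigenvalues\<close> is meaningful; uniqueness of the roots then carries every sum
  \<open>F\<close> of a function of the eigenvalues over to it.\<close>

lemma eigenvalues_symmetric:
 fixes A :: "real^'n^'n"
 assumes A: "transpose A = A"
 shows sigma1_eigenvalues: "sigma1 (eigenvalues A) = trace A"
  and sigma2_eigenvalues: "sigma2 (eigenvalues A) = ((trace A)^2 - A \<bullet> A) / 2"
proof -
 obtain b l where b: "orthobasis b" and l: "!!i. A *v b i = l i *R b i" using symmetric_eigenbasis[OF A] by blast
 have ex: "\<forall>t. det (mat t - A) = (\<Prod>i\<in>UNIV. t - (\<chi> i. l i) $ i)" using det_eigenbasis[OF b l] by simp
 have "\<forall>t. det (mat t - A) = (\<Prod>i\<in>UNIV. t - eigenvalues A $ i)"
  unfolding eigenvalues_def by (rule someI) (rule ex)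
 then have M: "image_mset (($) (eigenvalues A)) (mset_set UNIV) = image_mset (($) (\<chi> i. l i)) (mset_set UNIV)"
  using ex by (intro prod_linear_factors_unique) metis
 have F: "(\<Sum>i\<in>UNIV. f (eigenvalues A $ i)) = (\<Sum>i\<in>UNIV. f (l i))" for f :: "real => real"
 proof -
  have "\<Sum>\<^sub># (image_mset f (image_mset (($) (eigenvalues A)) (mset_set UNIV))) = \<Sum>\<^sub># (image_mset f (image_mset (($) (\<chi> i. l i)) (mset_set UNIV)))"
   using M by simp
  then show ?thesis by (simp add: image_mset.compositionality comp_def sum_unfold_sum_mset)
 qed
 have t: "trace A = (\<Sum>i\<in>UNIV. l i)" using b by (simp add: orthobasis_trace[OF b] l orthobasis_def)
 have n: "A \<bullet> A = (\<Sum>i\<in>UNIV. (l i)^2)" using b by (simp add: orthobasis_matrix_inner[OF b] l orthobasis_def sq_eq)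
 show s1: "sigma1 (eigenvalues A) = trace A" using F[of "%x. x"] by (simp add: sigma1_def t)
 show "sigma2 (eigenvalues A) = ((trace A)^2 - A \<bullet> A) / 2"
  using F[of "%x. x^2"] by (simp add: sigma2_eq s1 n)
qed

section \<open>Partial derivatives and the classes \<open>C\<^sup>k\<close>\<close>

lemma has_derivative_gradient:
 assumes "f differentiable (at x)"
 shows "(f has_derivative (%h. gradient f x \<bullet> h)) (at x)"
proof -
 have D: "(f has_derivative frechet_derivative f (at x)) (at x)" using assms by (simp add: frechet_derivative_works)
 then have lin: "linear (frechet_derivative f (at x))" by (rule has_derivative_linear)
 have "frechet_derivative f (at x) h = gradient f x \<bullet> h" for h
 proof -
  have "h = (\<Sum>i\<in>UNIV. h $ i *R axis i 1)" by (simp add: vec_eq_iff axis_def sum_component if_distrib cong: if_cong)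
  then have "frechet_derivative f (at x) h = (\<Sum>i\<in>UNIV. h $ i * frechet_derivative f (at x) (axis i 1))"
   using linear_sum[OF lin, of "%i. h $ i *R axis i 1" UNIV] by (simp add: linear_scale[OF lin])
  then show ?thesis by (simp add: gradient_def inner_vec_def mult.commute)
 qed
 then have "frechet_derivative f (at x) = (%h. gradient f x \<bullet> h)" by auto
 then show ?thesis using D by simp
qed

lemma gradient_unique:
 assumes "(f has_derivative (%h. g \<bullet> h)) (at x)"
 shows "gradient f x = g"
proof -
 have "frechet_derivative f (at x) = (%h. g \<bullet> h)" using frechet_derivative_at[OF assms] by simp
 then show ?thesis by (simp add: gradient_def vec_eq_iff inner_axis)
qed

lemma differentiable_on_open_at: "open S ==> f differentiable_on S ==> x : S ==> f differentiable (at x)"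
 by (simp add: differentiable_on_eq_differentiable_at)

lemma differentiable_cong_open:
 assumes "open S" "x : S" "!!y. y : S ==> f y = g y" "f differentiable (at x)"
 shows "g differentiable (at x)" "gradient g x = gradient f x"
proof -
 have D: "(g has_derivative (%h. gradient f x \<bullet> h)) (at x)"
  by (rule has_derivative_transform_within_open[OF has_derivative_gradient[OF assms(4)] assms(1,2)]) (rule assms(3))
 then show "g differentiable (at x)" by (auto simp: differentiable_def)
 show "gradient g x = gradient f x" by (rule gradient_unique[OF D])
qed

text \<open>On an open set the derivative at a point depends only on the values in the set. Formulas
  for a gradient that hold on \<open>S\<close> can therefore be substituted under
  \<open>Ck_on\<close>.\<close>

lemma Ck_on_cong:
 assumes "open S"
 shows "Ck_on k f S ==> (!!x. x : S ==> f x = g x) ==> Ck_on k g S"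
proof (induction k arbitrary: f g)
 case 0 then show ?case by (simp cong: continuous_on_cong)
next
 case (Suc k)
 have d: "f differentiable (at x)" if "x : S" for x using Suc.prems that assms by (simp add: differentiable_on_open_at)
 have "g differentiable (at x)" "gradient g x = gradient f x" if "x : S" for x
  using differentiable_cong_open[OF assms that Suc.prems(2) d[OF that]] by auto
 then show ?case using Suc.prems Suc.IH[of "%x. gradient f x $ i" "%x. gradient g x $ i" for i] assms
  by (auto simp: differentiable_on_eq_differentiable_at)
qed

lemma Ck_on_Suc: "Ck_on (Suc k) f S ==> Ck_on k f S"
proof (induction k arbitrary: f)
 case 0 then show ?case by (simp add: differentiable_imp_continuous_on)
next
 case (Suc k) then show ?case by (metis Ck_on.simps(2))
qed

lemma Ck_on_mono: "Ck_on k f S ==> j <= k ==> Ck_on j f S"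
proof (induction k)
 case (Suc k) then show ?case by (metis Ck_on_Suc le_Suc_eq)
qed simp

lemma Ck_on_differentiable: "open S ==> Ck_on k f S ==> k > 0 ==> x : S ==> f differentiable (at x)"
 by (cases k) (auto simp: differentiable_on_open_at)

lemma Ck_on_continuous: "Ck_on k f S ==> continuous_on S f"
 using Ck_on_mono[of k f S 0] by simp

lemma Ck_on_const: "Ck_on k (%x. c) S" for S :: "(real^'n) set"
proof (induction k arbitrary: c)
 case 0 then show ?case by simp
next
 case (Suc k)
 have "gradient (%x. c) x = 0" for x :: "real^'n" by (rule gradient_unique) simp
 then show ?case using Suc by simp
qed

lemma Ck_on_add:
 assumes "open S" shows "Ck_on k f S ==> Ck_on k g S ==> Ck_on k (%x. f x + g x) S"
proof (induction k arbitrary: f g)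
 case 0 then show ?case by (simp add: continuous_on_add)
next
 case (Suc k)
 have "gradient (%x. f x + g x) x = gradient f x + gradient g x" if x: "x : S" for x
 proof (rule gradient_unique)
  have "f differentiable (at x)" "g differentiable (at x)" using Suc.prems x assms by (simp_all add: differentiable_on_open_at)
  then show "((%x. f x + g x) has_derivative (%h. (gradient f x + gradient g x) \<bullet> h)) (at x)"
   unfolding inner_add_left by (intro has_derivative_add has_derivative_gradient)
 qed
 note G = this
 have c: "Ck_on k (%x. gradient f x $ i + gradient g x $ i) S" for i
  by (rule Suc.IH) (use Suc.prems in simp_all)
 have "Ck_on k (%x. gradient (%x. f x + g x) x $ i) S" for i
  by (rule Ck_on_cong[OF assms c[of i]]) (simp add: G)
 then show ?case using Suc.prems by (auto intro: differentiable_on_add)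
qed

lemma Ck_on_mult:
 assumes "open S" shows "Ck_on k f S ==> Ck_on k g S ==> Ck_on k (%x. f x * g x) S"
proof (induction k arbitrary: f g)
 case 0 then show ?case by (simp add: continuous_on_mult)
next
 case (Suc k)
 have "gradient (%x. f x * g x) x = f x *R gradient g x + g x *R gradient f x" if x: "x : S" for x
 proof (rule gradient_unique)
  have "f differentiable (at x)" "g differentiable (at x)" using Suc.prems x assms by (simp_all add: differentiable_on_open_at)
  from has_derivative_mult[OF this[THEN has_derivative_gradient]]
  show "((%x. f x * g x) has_derivative (%h. (f x *R gradient g x + g x *R gradient f x) \<bullet> h)) (at x)"
   by (simp add: inner_add_left mult.commute)
 qed
 note G = this
 have fg: "Ck_on k f S" "Ck_on k g S" using Suc.prems by (auto intro: Ck_on_Suc simp del: Ck_on.simps)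
 have "Ck_on k (%x. f x * gradient g x $ i) S" "Ck_on k (%x. g x * gradient f x $ i) S" for i
  by (rule Suc.IH, use Suc.prems fg in simp_all)+
 then have c: "Ck_on k (%x. f x * gradient g x $ i + g x * gradient f x $ i) S" for i
  by (rule Ck_on_add[OF assms])
 have "Ck_on k (%x. gradient (%x. f x * g x) x $ i) S" for i
  by (rule Ck_on_cong[OF assms c[of i]]) (simp add: G)
 then show ?case using Suc.prems by (auto intro: differentiable_on_mult)
qed

text \<open>The derivative of 1/f is a polynomial in 1/f and the derivative of f, so the induction
  feeds the regularity already gained back into the right side.\<close>

lemma Ck_on_inverse:
 assumes "open S" shows "Ck_on k f S ==> (!!x. x : S ==> f x ~= 0) ==> Ck_on k (%x. inverse (f x)) S"
proof (induction k arbitrary: f)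
 case 0 then show ?case by (simp add: continuous_on_inverse)
next
 case (Suc k)
 have D: "((%x. inverse (f x)) has_derivative (%h. ((- 1) * (inverse (f x) * inverse (f x))) *R gradient f x \<bullet> h)) (at x)" if "x : S" for x
 proof -
  have "f differentiable (at x)" using Suc.prems that assms by (simp add: differentiable_on_open_at)
  from Deriv.has_derivative_inverse[OF Suc.prems(2)[OF that] has_derivative_gradient[OF this]]
  show ?thesis by (simp add: mult_ac)
 qed
 have g: "gradient (%x. inverse (f x)) x = ((- 1) * (inverse (f x) * inverse (f x))) *R gradient f x" if "x : S" for x
  by (rule gradient_unique[OF D[OF that]])
 have "Ck_on k (%x. inverse (f x)) S" using Suc Ck_on_Suc by blast
 then have c: "Ck_on k (%x. ((- 1) * (inverse (f x) * inverse (f x))) * gradient f x $ i) S" for i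
  using Suc.prems by (intro Ck_on_mult Ck_on_const assms) auto
 have "Ck_on k (%x. gradient (%x. inverse (f x)) x $ i) S" for i
  by (rule Ck_on_cong[OF assms c[of i]]) (simp add: g)
 moreover have "(%x. inverse (f x)) differentiable_on S" unfolding differentiable_on_eq_differentiable_at[OF assms]
  using D by (auto simp: differentiable_def)
 ultimately show ?case by simp
qed

lemma neg_sqrt_neg_gradient:
 assumes "u differentiable (at x)" "u x < 0"
 shows "((%x. - sqrt (- u x)) has_derivative (%h. (inverse (-2 * (- sqrt (- u x)))) *R gradient u x \<bullet> h)) (at x)"
proof -
 have "((%x. sqrt (- u x)) has_derivative (%h. - (gradient u x \<bullet> h) * (inverse (sqrt (- u x)) / 2))) (at x)"
  using assms by (intro DERIV_compose_FDERIV[OF DERIV_real_sqrt] has_derivative_minus has_derivative_gradient) auto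
 from has_derivative_minus[OF this] show ?thesis by (simp add: field_simps)
qed

text \<open>Bootstrapping: with v = - sqrt(-u) the gradient is Du / (-2 v), an expression in v
  itself. Hence v in C^k gives Dv in C^k, that is one more derivative.\<close>

lemma Ck_on_neg_sqrt_neg:
 assumes "open S" shows "Ck_on k u S ==> (!!x. x : S ==> u x < 0) ==> Ck_on k (%x. - sqrt (- u x)) S"
proof (induction k)
 case 0 then show ?case by (auto intro!: continuous_intros)
next
 case (Suc k)
 have d: "u differentiable (at x)" if "x : S" for x using Suc.prems that assms by (simp add: differentiable_on_open_at)
 have D: "((%x. - sqrt (- u x)) has_derivative (%h. (inverse (-2 * (- sqrt (- u x)))) *R gradient u x \<bullet> h)) (at x)" if "x : S" for x
  using that Suc.prems d by (intro neg_sqrt_neg_gradient) auto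
 have g: "gradient (%x. - sqrt (- u x)) x = inverse (-2 * (- sqrt (- u x))) *R gradient u x" if "x : S" for x
  by (rule gradient_unique[OF D[OF that]])
 have "Ck_on k (%x. - sqrt (- u x)) S" using Suc Ck_on_Suc by blast
 moreover have "(-2) * (- sqrt (- u x)) ~= 0" if "x : S" for x using Suc.prems(2)[OF that] by simp
 ultimately have c: "Ck_on k (%x. inverse ((-2) * (- sqrt (- u x))) * gradient u x $ i) S" for i
  using Suc.prems by (intro Ck_on_mult Ck_on_inverse Ck_on_const assms) auto
 have "Ck_on k (%x. gradient (%x. - sqrt (- u x)) x $ i) S" for i
  by (rule Ck_on_cong[OF assms c[of i]]) (simp add: g)
 moreover have "(%x. - sqrt (- u x)) differentiable_on S" unfolding differentiable_on_eq_differentiable_at[OF assms]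
  using D by (auto simp: differentiable_def)
 ultimately show ?case by simp
qed

lemma line_has_derivative:
 assumes "f differentiable (at (x + t *R e))"
 shows "((%t. f (x + t *R e)) has_real_derivative gradient f (x + t *R e) \<bullet> e) (at t)"
proof -
 have "((%t. x + t *R e) has_derivative (%h. 0 + h *R e)) (at t)"
  by (intro has_derivative_add has_derivative_const has_derivative_scaleR_left has_derivative_ident)
 then have "((%t. x + t *R e) has_derivative (%h. h *R e)) (at t)" by simp
 from has_derivative_compose[OF this, of f "%h. gradient f (x + t *R e) \<bullet> h"] has_derivative_gradient[OF assms]
 have "((%t. f (x + t *R e)) has_derivative (%h. gradient f (x + t *R e) \<bullet> (h *R e))) (at t)" by simp
 then show ?thesis by (simp add: has_field_derivative_def mult_commute_abs)
qed

text \<open>The mixed second difference is evaluated by the mean value theorem, once in each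
  direction. It is symmetric in \<open>i\<close> and \<open>j\<close>, and this is what forces the
  mixed partials to agree in the limit.\<close>

lemma second_difference_mvt:
 fixes f :: "real^'n => real"
 assumes S: "open S" and f: "Ck_on 2 f S" and h: "h > 0"
  and ball: "!!s t. 0 <= s ==> s <= h ==> 0 <= t ==> t <= h ==> x + s *R axis i 1 + t *R axis j 1 : S"
 obtains s t where "0 <= s" "s <= h" "0 <= t" "t <= h"
  "f (x + h *R axis i 1 + h *R axis j 1) - f (x + h *R axis i 1) - (f (x + h *R axis j 1) - f x)
  = h * h * gradient (%x. gradient f x $ i) (x + s *R axis i 1 + t *R axis j 1) $ j"
proof -
 have f1: "f differentiable (at y)" if "y : S" for y using Ck_on_differentiable[OF S f _ that] by simp
 have "Ck_on 1 (%x. gradient f x $ i) S" using f by (simp add: numeral_2_eq_2)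
 then have f2: "(%x. gradient f x $ i) differentiable (at y)" if "y : S" for y
  by (rule Ck_on_differentiable[OF S _ _ that]) simp
 define g where "g s = f ((x + h *R axis j 1) + s *R axis i 1) - f (x + s *R axis i 1)" for s
 have mem1: "x + s *R axis i 1 : S" if "0 <= s" "s <= h" for s using ball[of s 0] that h by simp
 have mem2: "x + h *R axis j 1 + s *R axis i 1 : S" if "0 <= s" "s <= h" for s using ball[of s h] that h by (simp add: add_ac)
 have Dg: "(g has_real_derivative gradient f ((x + h *R axis j 1) + s *R axis i 1) $ i - gradient f (x + s *R axis i 1) $ i) (at s)"
  if "0 <= s" "s <= h" for s
  unfolding g_def using DERIV_diff[OF line_has_derivative[OF f1[OF mem2[OF that]]] line_has_derivative[OF f1[OF mem1[OF that]]]]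
  by (simp add: inner_axis)
 obtain s where s: "0 < s" "s < h" "g h - g 0 = (h - 0) * (gradient f ((x + h *R axis j 1) + s *R axis i 1) $ i - gradient f (x + s *R axis i 1) $ i)"
  using MVT2[OF h, of g "%s. gradient f ((x + h *R axis j 1) + s *R axis i 1) $ i - gradient f (x + s *R axis i 1) $ i"] Dg by auto
 define k where "k t = gradient f ((x + s *R axis i 1) + t *R axis j 1) $ i" for t
 have Dk: "(k has_real_derivative gradient (%x. gradient f x $ i) ((x + s *R axis i 1) + t *R axis j 1) $ j) (at t)"
  if "0 <= t" "t <= h" for t
 proof -
  have "x + s *R axis i 1 + t *R axis j 1 : S" using that s by (intro ball) auto
  from line_has_derivative[OF f2[OF this]] show ?thesis unfolding k_def by (simp add: inner_axis)
 qed
 obtain t where t: "0 < t" "t < h" "k h - k 0 = (h - 0) * gradient (%x. gradient f x $ i) ((x + s *R axis i 1) + t *R axis j 1) $ j"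
  using MVT2[OF h, of k "%t. gradient (%x. gradient f x $ i) ((x + s *R axis i 1) + t *R axis j 1) $ j"] Dk by auto
 have "g h - g 0 = h * (k h - k 0)" using s(3) by (simp add: k_def add_ac)
 then have "g h - g 0 = h * h * gradient (%x. gradient f x $ i) (x + s *R axis i 1 + t *R axis j 1) $ j"
  using t(3) by simp
 moreover have "g h - g 0 = f (x + h *R axis i 1 + h *R axis j 1) - f (x + h *R axis i 1) - (f (x + h *R axis j 1) - f x)"
  by (simp add: g_def add_ac)
 ultimately show ?thesis using that[of s t] s t by simp
qed

theorem mixed_partials_commute:
 fixes f :: "real^'n => real"
 assumes S: "open S" and f: "Ck_on 2 f S" and x: "x : S"
 shows "gradient (%x. gradient f x $ i) x $ j = gradient (%x. gradient f x $ j) x $ i"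
proof (rule ccontr)
 define a where "a i j y = gradient (%x. gradient f x $ i) y $ j" for i j y
 assume "gradient (%x. gradient f x $ i) x $ j ~= gradient (%x. gradient f x $ j) x $ i"
 then have ne: "a i j x ~= a j i x" by (simp add: a_def)
 define e where "e = \<bar>a i j x - a j i x\<bar> / 2"
 have e: "e > 0" using ne by (simp add: e_def)
 have cont: "continuous_on S (a i j)" for i j using f by (simp add: a_def numeral_2_eq_2)
 obtain r where r: "r > 0" "ball x r \<subseteq> S" using S x open_contains_ball by blast
 obtain d1 where d1: "d1 > 0" "!!y. y : S ==> dist y x < d1 ==> dist (a i j y) (a i j x) < e"
  using cont[of i j] x e unfolding continuous_on_iff by meson
 obtain d2 where d2: "d2 > 0" "!!y. y : S ==> dist y x < d2 ==> dist (a j i y) (a j i x) < e"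
  using cont[of j i] x e unfolding continuous_on_iff by meson
 \<comment> \<open>Every intermediate point lies within \<open>2 * h\<close> of \<open>x\<close>; a
   quarter of the smallest radius keeps it strictly inside.\<close>
 define h where "h = min r (min d1 d2) / 4"
 have h: "h > 0" "2 * h < r" "2 * h < d1" "2 * h < d2" using r d1 d2 by (auto simp: h_def)
 have near: "dist (x + s *R axis i 1 + t *R axis j 1) x <= 2 * h" if "0 <= s" "s <= h" "0 <= t" "t <= h" for s t i j
 proof -
  have "norm (s *R axis i 1 + t *R axis j 1 :: real^'n) <= s + t"
   using norm_triangle_ineq[of "s *R axis i 1 :: real^'n" "t *R axis j 1"] that by (simp add: norm_axis_1)
  then show ?thesis using that by (simp add: dist_norm add.assoc)
 qed
 have mem: "x + s *R axis i 1 + t *R axis j 1 : S" if "0 <= s" "s <= h" "0 <= t" "t <= h" for s t i j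
  using near[OF that, of i j] h r by (auto simp: dist_commute subset_iff)
 obtain s t where st: "0 <= s" "s <= h" "0 <= t" "t <= h"
  "f (x + h *R axis i 1 + h *R axis j 1) - f (x + h *R axis i 1) - (f (x + h *R axis j 1) - f x)
  = h * h * a i j (x + s *R axis i 1 + t *R axis j 1)"
  using second_difference_mvt[OF S f h(1), of x i j] mem unfolding a_def by blast
 obtain s' t' where st': "0 <= s'" "s' <= h" "0 <= t'" "t' <= h"
  "f (x + h *R axis j 1 + h *R axis i 1) - f (x + h *R axis j 1) - (f (x + h *R axis i 1) - f x)
  = h * h * a j i (x + s' *R axis j 1 + t' *R axis i 1)"
  using second_difference_mvt[OF S f h(1), of x j i] mem unfolding a_def by blast
 have "h * h * a i j (x + s *R axis i 1 + t *R axis j 1) = h * h * a j i (x + s' *R axis j 1 + t' *R axis i 1)"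
 proof -
  have comm: "x + h *R axis j 1 + h *R axis i 1 = x + h *R axis i 1 + h *R axis j 1" by (simp add: add_ac)
  show ?thesis using st(5) st'(5) unfolding comm by linarith
 qed
 then have eq: "a i j (x + s *R axis i 1 + t *R axis j 1) = a j i (x + s' *R axis j 1 + t' *R axis i 1)"
  using h(1) unfolding mult_cancel_left by simp
 have "dist (a i j (x + s *R axis i 1 + t *R axis j 1)) (a i j x) < e"
  using near[OF st(1-4), of i j] h by (intro d1(2) mem[OF st(1-4)]) linarith
 moreover have "dist (a j i (x + s' *R axis j 1 + t' *R axis i 1)) (a j i x) < e"
  using near[OF st'(1-4), of j i] h by (intro d2(2) mem[OF st'(1-4)]) linarith
 ultimately show False using eq unfolding e_def dist_real_def by (smt (verit) field_sum_of_halves)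
qed

section \<open>Directional derivatives of the Hessian\<close>

lemma gradient_has_derivative_vec:
 fixes F :: "real^'n => real^'m"
 assumes "!!i. (%x. F x $ i) differentiable (at x)"
 shows "(F has_derivative (%h. \<chi> i. gradient (%x. F x $ i) x \<bullet> h)) (at x)"
 by (subst has_derivative_componentwise_within)
  (auto simp: Basis_vec_def inner_axis intro!: has_derivative_gradient assms)

text \<open>Connects the Jacobian in the definition of \<open>hessian\<close> with the iterated
  gradients of which \<open>Ck_on\<close> speaks.\<close>

lemma hessian_component:
 assumes "!!i. (%x. gradient f x $ i) differentiable (at x)"
 shows "hessian f x $ i $ j = gradient (%x. gradient f x $ i) x $ j"
proof -
 have "frechet_derivative (gradient f) (at x) = (%h. \<chi> i. gradient (%x. gradient f x $ i) x \<bullet> h)"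
  using frechet_derivative_at[OF gradient_has_derivative_vec[OF assms]] by simp
 then show ?thesis by (simp add: hessian_def jacobian_def matrix_def inner_axis)
qed

definition mdir :: "(real^'n => real^'n^'n) => real^'n => real^'n => real^'n^'n" where
 "mdir F x e = (\<chi> i j. gradient (%x. F x $ i $ j) x \<bullet> e)"

lemma mdir_line:
 assumes "!!i j. (%x. F x $ i $ j) differentiable (at (x + t *R e))"
 shows "((%t. F (x + t *R e)) has_vector_derivative mdir F (x + t *R e) e) (at t)"
proof -
 have "((%t. F (x + t *R e) $ i $ j) has_real_derivative mdir F (x + t *R e) e $ i $ j) (at t)" for i j
  using line_has_derivative[OF assms] by (simp add: mdir_def)
 then have "((%t. F (x + t *R e) $ i $ j) has_derivative (%h. h * mdir F (x + t *R e) e $ i $ j)) (at t)" for i j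
  by (simp add: has_field_derivative_def mult_commute_abs)
 then show ?thesis unfolding has_vector_derivative_def
  by (subst has_derivative_componentwise_within) (auto simp: Basis_vec_def inner_axis)
qed

section \<open>Sums of squares for the quadratic form in the third derivatives\<close>

lemma sum_sum_split_diag:
 fixes g :: "'a => 'a => real"
 assumes "finite H"
 shows "(\<Sum>j\<in>H. \<Sum>k\<in>H. g j k) = (\<Sum>j\<in>H. g j j) + (\<Sum>j\<in>H. \<Sum>k\<in>H. if j = k then 0 else g j k)"
proof -
 have "(\<Sum>k\<in>H. g j k) = g j j + (\<Sum>k\<in>H. if j = k then 0 else g j k)" if "j : H" for j
 proof -
  have "(\<Sum>k\<in>H. g j k) = g j j + (\<Sum>k\<in>H - {j}. g j k)"
   using assms that by (rule sum.remove)
  moreover have "(\<Sum>k\<in>H. if j = k then 0 else g j k) = 0 + (\<Sum>k\<in>H - {j}. if j = k then 0 else g j k)"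
   using sum.remove[OF assms that, of "%k. if j = k then 0 else g j k"] by simp
  moreover have "(\<Sum>k\<in>H - {j}. if j = k then 0 else g j k) = (\<Sum>k\<in>H - {j}. g j k)"
   by (rule sum.cong) auto
  ultimately show ?thesis by simp
 qed
 then show ?thesis by (simp add: sum.distrib)
qed

lemma sum_sum_symmetrise:
 fixes g :: "'a => 'a => real"
 shows "2 * (\<Sum>j\<in>H. \<Sum>k\<in>H. g j k) = (\<Sum>j\<in>H. \<Sum>k\<in>H. g j k + g k j)"
proof -
 have "(\<Sum>j\<in>H. \<Sum>k\<in>H. g k j) = (\<Sum>j\<in>H. \<Sum>k\<in>H. g j k)" by (rule sum.swap)
 then show ?thesis by (simp add: sum.distrib)
qed

lemma sum_square_pair_le:
 fixes mu :: "'a => real"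
 assumes "finite H" "j : H" "k : H" "j ~= k"
 shows "(mu j)^2 + (mu k)^2 <= (\<Sum>i\<in>H. (mu i)^2)"
proof -
 have "(mu j)^2 + (mu k)^2 = (\<Sum>i\<in>{j,k}. (mu i)^2)" using assms by simp
 also have "... <= (\<Sum>i\<in>H. (mu i)^2)" using assms by (intro sum_mono2) auto
 finally show ?thesis .
qed

lemma sum_pair_le:
 fixes mu :: "'a => real"
 assumes "finite H" "j : H" "k : H" "j ~= k" "!!i. i : H ==> mu i >= 0"
 shows "mu j + mu k <= (\<Sum>i\<in>H. mu i)"
proof -
 have "mu j + mu k = (\<Sum>i\<in>{j,k}. mu i)" using assms by simp
 also have "... <= (\<Sum>i\<in>H. mu i)" using assms by (intro sum_mono2) auto
 finally show ?thesis .
qed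

text \<open>Put \<open>r = S - mj - mk\<close>. Each quotient is at least its denominator plus
  \<open>r\<close>, divided by \<open>S\<close>: the difference of the two sides is a positive
  multiple of r^2 + (Q - mj^2 - mk^2). The two lower bounds add up to 1 + r / S.\<close>

lemma offdiag_coefficient:
 fixes S Q mj mk :: real
 assumes "mj > 0" "mk > 0" "S >= mj + mk" "Q >= mj^2 + mk^2"
 shows "(S - ((S^2 - Q) / 2) / S - mk) / mj + (S - ((S^2 - Q) / 2) / S - mj) / mk >= 1"
proof -
 have S: "S > 0" using assms by linarith
 define r where "r = S - mj - mk"
 have r: "r >= 0" using assms r_def by simp
 have A: "(S - ((S^2 - Q) / 2) / S - b) / a >= (a + r) / S"
  if "a > 0" "a + b + r = S" "Q >= a^2 + b^2" for a b
 proof -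
  have eq: "(S - ((S^2 - Q) / 2) / S - b) = (S^2 + Q - 2 * b * S) / (2 * S)"
   using S by (simp add: field_simps sq_eq)
  have "S^2 + Q - 2 * b * S - 2 * (a * (a + r)) = r^2 + (Q - a^2 - b^2)"
   unfolding that(2)[symmetric] by (simp add: sq_eq algebra_simps)
  then have "2 * (a * (a + r)) <= S^2 + Q - 2 * b * S" using that(3) by (smt (verit) zero_le_power2)
  then have "2 * (a * (a + r)) / (2 * S) <= (S^2 + Q - 2 * b * S) / (2 * S)"
   using S by (intro divide_right_mono) auto
  then have "a * ((a + r) / S) <= (S - ((S^2 - Q) / 2) / S - b)" unfolding eq by simp
  then show ?thesis using that(1) by (simp add: field_simps)
 qed
 have "(mj + r) / S + (mk + r) / S = (S + r) / S" using r_def by (simp add: add_divide_distrib[symmetric])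
 also have "... = 1 + r / S" using S by (simp add: add_divide_distrib)
 finally have "(mj + r) / S + (mk + r) / S = 1 + r / S" .
 moreover have "r / S >= 0" using r S by simp
 ultimately show ?thesis
  using A[of mj mk] A[of mk mj] assms r_def by (smt (verit))
qed

text \<open>The diagonal part is a sum over pairs of indices of squares: with
  \<^term>\<open>f i = y i / mu i + x\<close> the pair term is \<open>(S (f i + f j) - (mu i - mu j) (f i - f j))\<^sup>2 / 4\<close> plus a
  nonnegative multiple of \<open>(f i - f j)\<^sup>2\<close>.\<close>
lemma diag_form_nonneg:
 fixes mu y :: "'a => real" and x :: real
 assumes fin: "finite H" and mu: "!!i. i : H ==> mu i >= 0"
  and supp: "!!i. i : H ==> mu i = 0 ==> y i = 0"
  and S: "S = (\<Sum>i\<in>H. mu i)" "S > 0" and Q: "Q = (\<Sum>i\<in>H. (mu i)^2)" and s2: "s2 = (S^2 - Q) / 2"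
  and tr: "(\<Sum>i\<in>H. y i) = 0"
 shows "(\<Sum>i\<in>H. (y i)^2 * ((S - s2 / S - mu i) / mu i - 1 / 2)) - 2 * x * (\<Sum>i\<in>H. mu i * y i) + x^2 * s2 >= 0"
proof -
 \<comment> \<open>Where \<open>mu i = 0\<close> also \<open>y i = 0\<close>, so the value 0 is
   consistent with \<open>y i = mu i * f i - x * mu i\<close>.\<close>
 define f where "f i = (if mu i = 0 then 0 else y i / mu i + x)" for i
 define pr where "pr i j = ((S^2 + Q) / 2 - S * mu i) * (f i)^2 + ((S^2 + Q) / 2 - S * mu j) * (f j)^2
   + (S * (mu i + mu j) - Q) * f i * f j" for i j
 \<comment> \<open>The digits are exponents: each of these moments is a sum of a power of
   \<open>mu\<close> times a power of \<open>f\<close>. Together with \<open>S\<close> and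
   \<open>Q\<close> they express every sum that occurs.\<close>
 define m11 where "m11 = (\<Sum>i\<in>H. mu i * f i)"
 define m12 where "m12 = (\<Sum>i\<in>H. mu i * (f i)^2)"
 define m21 where "m21 = (\<Sum>i\<in>H. (mu i)^2 * f i)"
 define m22 where "m22 = (\<Sum>i\<in>H. (mu i)^2 * (f i)^2)"
 have y: "y i = mu i * f i - x * mu i" if "i : H" for i
  using supp[OF that] by (auto simp: f_def field_simps)
 \<comment> \<open>The trace condition makes \<open>x\<close> the \<open>mu\<close>-weighted mean of
   \<open>f\<close>, which allows \<open>x\<close> to be eliminated from the form.\<close>
 have m11x: "m11 = x * S"
 proof -
  have "0 = (\<Sum>i\<in>H. mu i * f i - x * mu i)" using tr y by simp
  also have "... = m11 - x * S" by (simp add: sum_subtractf m11_def S sum_distrib_left)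
  finally show ?thesis by simp
 qed
 have L: "(\<Sum>i\<in>H. (y i)^2 * ((S - s2 / S - mu i) / mu i - 1 / 2))
   = (S - s2 / S) * m12 - 2 * x * (S - s2 / S) * m11 + x^2 * (S - s2 / S) * S
    - 3 / 2 * m22 + 3 * x * m21 - 3 / 2 * x^2 * Q"
 proof -
  have "(y i)^2 * ((S - s2 / S - mu i) / mu i - 1 / 2)
   = (S - s2 / S) * (mu i * (f i)^2) - 2 * x * (S - s2 / S) * (mu i * f i) + x^2 * (S - s2 / S) * mu i
    - 3 / 2 * ((mu i)^2 * (f i)^2) + 3 * x * ((mu i)^2 * f i) - 3 / 2 * x^2 * (mu i)^2" if "i : H" for i
  proof (cases "mu i = 0")
   case True then show ?thesis using y[OF that] by simp
  next
   case False
   define c where "c = S - s2 / S"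
   have k1: "(mu i * f i - x * mu i)^2 * ((c - mu i) / mu i - 1 / 2)
    = (f i - x)^2 * (mu i * (c - mu i) - (mu i)^2 / 2)"
   proof -
    have "(mu i)^2 * ((c - mu i) / mu i - 1 / 2) = mu i * (c - mu i) - (mu i)^2 / 2"
    proof -
     have "(mu i)^2 * ((c - mu i) / mu i) = mu i * (c - mu i)"
      using False by (simp add: sq_eq)
     then show ?thesis by (simp add: right_diff_distrib)
    qed
    moreover have "(mu i * f i - x * mu i)^2 = (f i - x)^2 * (mu i)^2"
     by (simp add: power_mult_distrib[symmetric] algebra_simps)
    ultimately show ?thesis by (simp add: mult.assoc)
   qed
   show ?thesis unfolding y[OF that] c_def[symmetric] k1
    by (simp add: sq_eq algebra_simps)
  qed
  then have "(\<Sum>i\<in>H. (y i)^2 * ((S - s2 / S - mu i) / mu i - 1 / 2)) = (\<Sum>i\<in>H. (S - s2 / S) * (mu i * (f i)^2) - 2 * x * (S - s2 / S) * (mu i * f i) + x^2 * (S - s2 / S) * mu i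
    - 3 / 2 * ((mu i)^2 * (f i)^2) + 3 * x * ((mu i)^2 * f i) - 3 / 2 * x^2 * (mu i)^2)" by (rule sum.cong[OF refl])
  then show ?thesis unfolding m11_def m12_def m21_def m22_def S(1) Q
   by (simp only: sum.distrib sum_subtractf sum_distrib_left)
 qed
 have G: "(\<Sum>i\<in>H. mu i * y i) = m21 - x * Q"
 proof -
  have "(\<Sum>i\<in>H. mu i * y i) = (\<Sum>i\<in>H. (mu i)^2 * f i - x * (mu i)^2)"
   by (rule sum.cong) (auto simp: y sq_eq algebra_simps)
  then show ?thesis by (simp add: m21_def Q sum_subtractf sum_distrib_left)
 qed
 have pairs: "(\<Sum>i\<in>H. \<Sum>j\<in>H. mu i * mu j * pr i j)
   = 2 * S * ((S^2 + Q) / 2 * m12 - S * m22) + 2 * S * m21 * m11 - Q * m11^2"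
 proof -
  have "mu i * mu j * pr i j = (((S^2 + Q) / 2) * (mu i * (f i)^2) - S * ((mu i)^2 * (f i)^2)) * mu j
    + mu i * (((S^2 + Q) / 2) * (mu j * (f j)^2) - S * ((mu j)^2 * (f j)^2))
    + (S * ((mu i)^2 * f i)) * (mu j * f j) + (mu i * f i) * (S * ((mu j)^2 * f j))
    - (Q * (mu i * f i)) * (mu j * f j)" for i j
   unfolding pr_def by (simp add: sq_eq algebra_simps add_divide_distrib)
  then have pe: "(\<Sum>i\<in>H. \<Sum>j\<in>H. mu i * mu j * pr i j)
   = (\<Sum>i\<in>H. ((S^2 + Q) / 2) * (mu i * (f i)^2) - S * ((mu i)^2 * (f i)^2)) * S
    + S * (\<Sum>j\<in>H. ((S^2 + Q) / 2) * (mu j * (f j)^2) - S * ((mu j)^2 * (f j)^2))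
    + (\<Sum>i\<in>H. S * ((mu i)^2 * f i)) * m11 + m11 * (\<Sum>j\<in>H. S * ((mu j)^2 * f j))
    - (\<Sum>i\<in>H. Q * (mu i * f i)) * m11"
   unfolding S(1) m11_def sum_product by (simp only: sum.distrib sum_subtractf)
  have e1: "(\<Sum>i\<in>H. ((S^2 + Q) / 2) * (mu i * (f i)^2) - S * ((mu i)^2 * (f i)^2)) = (S^2 + Q) / 2 * m12 - S * m22"
   by (simp only: sum_subtractf sum_distrib_left[symmetric] m12_def m22_def)
  have e2: "(\<Sum>i\<in>H. S * ((mu i)^2 * f i)) = S * m21" "(\<Sum>i\<in>H. Q * (mu i * f i)) = Q * m11"
   by (simp_all only: sum_distrib_left[symmetric] m21_def m11_def)
  show ?thesis unfolding pe e1 e2 by (simp add: sq_eq algebra_simps)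
 qed
 have diagp: "(\<Sum>i\<in>H. mu i * mu i * pr i i) = S^2 * m22"
 proof -
  have "mu i * mu i * pr i i = S^2 * ((mu i)^2 * (f i)^2)" for i
   unfolding pr_def by (simp add: sq_eq algebra_simps)
  then show ?thesis by (simp add: m22_def sum_distrib_left)
 qed
 have offp: "(\<Sum>i\<in>H. \<Sum>j\<in>H. if i = j then 0 else mu i * mu j * pr i j) >= 0"
 proof (intro sum_nonneg)
  fix i j assume ij: "i : H" "j : H"
  show "0 <= (if i = j then 0 else mu i * mu j * pr i j)"
  proof (cases "i = j")
   case False
   have "pr i j = (S * (f i + f j) - (mu i - mu j) * (f i - f j))^2 / 4
    + ((S - mu i - mu j)^2 / 4 + (Q - (mu i)^2 - (mu j)^2) / 2) * (f i - f j)^2"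
    unfolding pr_def by (simp add: sq_eq field_simps)
   moreover have "Q - (mu i)^2 - (mu j)^2 >= 0" using sum_square_pair_le[OF fin ij False, of mu] Q by simp
   ultimately have "pr i j >= 0" by simp
   then show ?thesis using mu ij by simp
  qed simp
 qed
 have s2': "s2 / S = S / 2 - Q / (2 * S)" using S(2) s2 by (simp add: field_simps sq_eq)
 \<comment> \<open>\<open>2 * S^2\<close> times the form is the sum over all ordered pairs minus its
   diagonal, so exactly the nonnegative pairs of distinct indices remain.\<close>
 have "2 * S^2 * ((\<Sum>i\<in>H. (y i)^2 * ((S - s2 / S - mu i) / mu i - 1 / 2)) - 2 * x * (\<Sum>i\<in>H. mu i * y i) + x^2 * s2)
  = (\<Sum>i\<in>H. \<Sum>j\<in>H. mu i * mu j * pr i j) - S^2 * m22"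
  unfolding L G pairs m11x unfolding s2' s2 using S(2) by (simp add: field_simps sq_eq)
 also have "... >= 0" using sum_sum_split_diag[OF fin, of "%i j. mu i * mu j * pr i j"] diagp offp by linarith
 finally have "0 <= 2 * S^2 * ((\<Sum>i\<in>H. (y i)^2 * ((S - s2 / S - mu i) / mu i - 1 / 2)) - 2 * x * (\<Sum>i\<in>H. mu i * y i) + x^2 * s2)" .
 then show ?thesis using S(2) by (simp add: zero_le_mult_iff)
qed

text \<open>Off the diagonal \<open>Y j k\<close> and \<open>Y k j\<close> coincide, and their joint
  coefficient is nonnegative: the bound 1 of \<open>offdiag_coefficient\<close> pays exactly for the
  two halves that are subtracted. The diagonal is \<open>diag_form_nonneg\<close>.\<close>

lemma trace_free_form_nonneg:
 fixes mu :: "'a => real" and Y :: "'a => 'a => real" and x :: real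
 assumes fin: "finite H" and mu: "!!i. i : H ==> mu i >= 0"
  and sym: "!!i j. i : H ==> j : H ==> Y i j = Y j i"
  and supp: "!!i j. i : H ==> j : H ==> mu i = 0 ==> Y i j = 0"
  and S: "S = (\<Sum>i\<in>H. mu i)" "S > 0" and Q: "Q = (\<Sum>i\<in>H. (mu i)^2)" and s2: "s2 = (S^2 - Q) / 2"
  and tr: "(\<Sum>i\<in>H. Y i i) = 0"
 shows "(\<Sum>j\<in>H. \<Sum>k\<in>H. (Y j k)^2 * ((S - s2 / S - mu k) / mu j)) - (\<Sum>j\<in>H. \<Sum>k\<in>H. (Y j k)^2) / 2
  - 2 * x * (\<Sum>i\<in>H. mu i * Y i i) + x^2 * s2 >= 0"
proof -
 define g where "g j k = (Y j k)^2 * ((S - s2 / S - mu k) / mu j - 1 / 2)" for j k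
 have "(\<Sum>j\<in>H. \<Sum>k\<in>H. (Y j k)^2 * ((S - s2 / S - mu k) / mu j)) - (\<Sum>j\<in>H. \<Sum>k\<in>H. (Y j k)^2) / 2
  = (\<Sum>j\<in>H. \<Sum>k\<in>H. g j k)"
  unfolding g_def by (simp add: sum_subtractf algebra_simps sum_divide_distrib)
 also have "... = (\<Sum>j\<in>H. g j j) + (\<Sum>j\<in>H. \<Sum>k\<in>H. if j = k then 0 else g j k)"
  by (rule sum_sum_split_diag[OF fin])
 finally have *: "(\<Sum>j\<in>H. \<Sum>k\<in>H. (Y j k)^2 * ((S - s2 / S - mu k) / mu j)) - (\<Sum>j\<in>H. \<Sum>k\<in>H. (Y j k)^2) / 2
  = (\<Sum>j\<in>H. g j j) + (\<Sum>j\<in>H. \<Sum>k\<in>H. if j = k then 0 else g j k)" .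
 have "(\<Sum>j\<in>H. \<Sum>k\<in>H. (if j = k then 0 else g j k) + (if k = j then 0 else g k j)) >= 0"
 proof (intro sum_nonneg)
  fix j k assume jk: "j : H" "k : H"
  show "0 <= (if j = k then 0 else g j k) + (if k = j then 0 else g k j)"
  proof (cases "j = k \<or> mu j = 0 \<or> mu k = 0")
   case True then show ?thesis using supp[of j k] supp[of k j] sym[of j k] jk by (auto simp: g_def)
  next
   case False
   then have pos: "mu j > 0" "mu k > 0" "j ~= k" using mu jk by (auto simp: less_le)
   have eq: "g j k + g k j = (Y j k)^2 * ((S - s2 / S - mu k) / mu j + (S - s2 / S - mu j) / mu k - 1)"
    unfolding g_def sym[OF jk(2) jk(1)] by (simp add: algebra_simps)
   have "S >= mu j + mu k" "Q >= (mu j)^2 + (mu k)^2"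
    using sum_pair_le[OF fin jk pos(3) mu] sum_square_pair_le[OF fin jk pos(3), of mu] S Q by auto
   then have "(S - s2 / S - mu k) / mu j + (S - s2 / S - mu j) / mu k >= 1"
    unfolding s2 using pos by (intro offdiag_coefficient) auto
   then have "g j k + g k j >= 0" unfolding eq by simp
   then show ?thesis using pos by auto
  qed
 qed
 then have off: "(\<Sum>j\<in>H. \<Sum>k\<in>H. if j = k then 0 else g j k) >= 0"
  using sum_sum_symmetrise[of "%j k. if j = k then 0 else g j k" H] by linarith
 have "(\<Sum>i\<in>H. (Y i i)^2 * ((S - s2 / S - mu i) / mu i - 1 / 2)) - 2 * x * (\<Sum>i\<in>H. mu i * Y i i) + x^2 * s2 >= 0"
  using supp by (intro diag_form_nonneg[OF fin mu _ S Q s2 tr]) auto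
 then show ?thesis using * off by (simp add: g_def)
qed

lemma sum_cs:
 fixes f g :: "'a => real"
 shows "(\<Sum>i\<in>H. f i * g i)^2 <= (\<Sum>i\<in>H. (f i)^2) * (\<Sum>i\<in>H. (g i)^2)"
 by (rule Cauchy_Schwarz_ineq_sum)

text \<open>The trace of diag(mu) is at least its trace on the plane spanned by \<open>b\<close> and
  \<open>v\<close>. Multiplied by the Gram determinant this is a statement about the diagonal
  entries of the orthogonal projection onto the plane, each of which is at most 1. No division by
  the Gram determinant occurs, so parallel vectors are covered.\<close>

lemma trace_ge_two_vectors:
 fixes mu b v :: "'a => real"
 assumes fin: "finite H" and mu: "!!i. i : H ==> mu i >= 0" and B: "B = (\<Sum>i\<in>H. (b i)^2)" "B > 0"
  and be: "be = (\<Sum>i\<in>H. b i * v i)" and V: "V = (\<Sum>i\<in>H. (v i)^2)" and S: "S = (\<Sum>i\<in>H. mu i)"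
 shows "be^2 * S - 2 * be * (\<Sum>i\<in>H. mu i * b i * v i) + V * (\<Sum>i\<in>H. mu i * (b i)^2) + B * (\<Sum>i\<in>H. mu i * (v i)^2) <= B * S * V"
proof -
 \<comment> \<open>\<open>B\<close> times the component of \<open>v\<close> orthogonal to
   \<open>b\<close>: Gram-Schmidt without division.\<close>
 define w where "w i = B * v i - be * b i" for i
 have wb: "(\<Sum>i\<in>H. b i * w i) = 0"
 proof -
  have "(\<Sum>i\<in>H. b i * w i) = (\<Sum>i\<in>H. B * (b i * v i) - be * (b i)^2)"
   by (rule sum.cong) (auto simp: w_def sq_eq algebra_simps)
  also have "... = B * be - be * B" by (simp only: sum_subtractf sum_distrib_left[symmetric] B(1)[symmetric] be[symmetric])
  finally show ?thesis by simp
 qed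
 have ww: "(\<Sum>i\<in>H. (w i)^2) = B * (B * V - be^2)"
 proof -
  have "(\<Sum>i\<in>H. (w i)^2) = (\<Sum>i\<in>H. B^2 * (v i)^2 - 2 * B * be * (b i * v i) + be^2 * (b i)^2)"
   by (rule sum.cong) (auto simp: w_def sq_eq algebra_simps)
  also have "... = B^2 * V - 2 * B * be * be + be^2 * B"
   by (simp add: sum.distrib sum_subtractf V be B(1) sum_distrib_left)
  finally show ?thesis by (simp add: sq_eq algebra_simps)
 qed
 have WV: "B * V - be^2 >= 0" using ww B(2)
  by (metis sum_nonneg zero_le_power2 zero_le_mult_iff less_le_not_le)
 have bessel: "(b i)^2 * (B * V - be^2) + (w i)^2 <= B * (B * V - be^2)" if i: "i : H" for i
 proof -
  define D where "D = B * V - be^2"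
  show ?thesis
  proof (cases "D = 0")
   case True
   then have "\<forall>j\<in>H. (w j)^2 = 0" using ww fin by (simp add: D_def sum_nonneg_eq_0_iff)
   then show ?thesis using True i by (simp add: D_def)
  next
   case False
   then have D: "D > 0" using WV by (simp add: D_def)
   \<comment> \<open>\<open>B * D\<close> times a column of the projection onto the plane.
     Idempotence of the projection is \<open>c1\<close>; bounding the square of the diagonal entry
     by the whole column then shows that this entry is at most 1.\<close>
   define c where "c j = D * b i * b j + w i * w j" for j
   have c1: "(\<Sum>j\<in>H. (c j)^2) = B * D * (D * (b i)^2 + (w i)^2)"
   proof -
    have "(\<Sum>j\<in>H. (c j)^2) = (\<Sum>j\<in>H. D^2 * (b i)^2 * (b j)^2 + 2 * D * b i * w i * (b j * w j) + (w i)^2 * (w j)^2)"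
     by (rule sum.cong) (auto simp: c_def sq_eq algebra_simps)
    also have "... = D^2 * (b i)^2 * B + 2 * D * b i * w i * 0 + (w i)^2 * (B * D)"
     by (simp only: sum.distrib wb[symmetric] ww D_def[symmetric] B(1) sum_distrib_left)
      (simp add: ww[unfolded D_def[symmetric]] sum_distrib_left[symmetric] B(1)[symmetric])
    finally show ?thesis by (simp add: sq_eq algebra_simps)
   qed
   have "(c i)^2 <= (\<Sum>j\<in>H. (c j)^2)" using fin i by (intro member_le_sum) auto
   moreover have ci: "c i = D * (b i)^2 + (w i)^2" by (simp add: c_def sq_eq algebra_simps)
   ultimately have "(c i)^2 <= B * D * c i" using c1 by simp
   moreover have "c i >= 0" using ci D by simp
   ultimately have "c i <= B * D" using D B(2)
    by (metis mult_le_cancel_right sq_eq less_eq_real_def linorder_not_le mult_pos_pos)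
   then show ?thesis using ci by (simp add: D_def algebra_simps)
  qed
 qed
 have "(\<Sum>i\<in>H. mu i * ((b i)^2 * (B * V - be^2) + (w i)^2)) <= (\<Sum>i\<in>H. mu i * (B * (B * V - be^2)))"
  using bessel mu by (intro sum_mono mult_left_mono) auto
 also have "... = S * (B * (B * V - be^2))" by (simp add: S sum_distrib_right)
 finally have 1: "(\<Sum>i\<in>H. mu i * ((b i)^2 * (B * V - be^2) + (w i)^2)) <= S * (B * (B * V - be^2))" .
 have "(\<Sum>i\<in>H. mu i * ((b i)^2 * (B * V - be^2) + (w i)^2))
   = (\<Sum>i\<in>H. B * V * (mu i * (b i)^2) + B^2 * (mu i * (v i)^2) - 2 * B * be * (mu i * b i * v i))"
  by (rule sum.cong) (auto simp: w_def sq_eq algebra_simps)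
 also have "... = B * (V * (\<Sum>i\<in>H. mu i * (b i)^2) + B * (\<Sum>i\<in>H. mu i * (v i)^2) - 2 * be * (\<Sum>i\<in>H. mu i * b i * v i))"
  by (simp add: sum.distrib sum_subtractf sum_distrib_left sq_eq algebra_simps)
 finally have "B * (V * (\<Sum>i\<in>H. mu i * (b i)^2) + B * (\<Sum>i\<in>H. mu i * (v i)^2) - 2 * be * (\<Sum>i\<in>H. mu i * b i * v i)) <= B * (S * (B * V - be^2))"
  using 1 by (simp add: algebra_simps)
 then have "V * (\<Sum>i\<in>H. mu i * (b i)^2) + B * (\<Sum>i\<in>H. mu i * (v i)^2) - 2 * be * (\<Sum>i\<in>H. mu i * b i * v i) <= S * (B * V - be^2)"
  using B(2) by simp
 then show ?thesis by (simp add: algebra_simps)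
qed

text \<open>Shaped after the expansion of the squared rows of \<open>W\<close> in
  \<open>cross_form_nonneg\<close>, where it serves both the inner and the outer sum.\<close>

lemma sum_linear_combination:
 fixes p :: "'a => real"
 shows "(\<Sum>k\<in>H. p k + c1 * (e * q k - b * r k) + c2 * (m * (e1 * s1 k - e2 * s2 k + e3 * s3 k)))
  = sum p H + c1 * (e * sum q H - b * sum r H) + c2 * (m * (e1 * sum s1 H - e2 * sum s2 H + e3 * sum s3 H))"
 by (simp add: sum.distrib sum_subtractf sum_distrib_left right_diff_distrib distrib_left mult.assoc)

text \<open>The sum-of-squares decomposition behind this comes from testing the quadratic form of \<open>Y\<close> with the
  matrix \<open>(b \<bullet> v) I - b v\<^sup>T\<close>, whose pairing with a trace-free symmetric \<open>Y\<close> is \<open>- v \<bullet> Y b\<close>.\<close>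
lemma cross_form_nonneg:
 fixes mu b z :: "'a => real" and Y :: "'a => 'a => real"
 assumes fin: "finite H" and mu: "!!i. i : H ==> mu i >= 0"
  and sym: "!!i j. i : H ==> j : H ==> Y i j = Y j i"
  and supp: "!!i j. i : H ==> j : H ==> mu i = 0 ==> Y i j = 0"
  and suppz: "!!i. i : H ==> mu i = 0 ==> z i = 0"
  and S: "S = (\<Sum>i\<in>H. mu i)" "S > 0" and B: "B = (\<Sum>i\<in>H. (b i)^2)"
  and tr: "(\<Sum>i\<in>H. Y i i) = 0"
 shows "(\<Sum>j\<in>H. (z j)^2 * (S / mu j - 1)) - 2 * (\<Sum>j\<in>H. \<Sum>k\<in>H. z j * b k * Y j k / mu j)
  + B / S * (\<Sum>j\<in>H. \<Sum>k\<in>H. (Y j k)^2 / mu j) >= 0"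
proof (cases "B = 0")
 case True
 then have b0: "b i = 0" if "i : H" for i using that B fin by (simp add: sum_nonneg_eq_0_iff)
 have "(\<Sum>j\<in>H. \<Sum>k\<in>H. z j * b k * Y j k / mu j) = 0" by (intro sum.neutral ballI) (simp add: b0)
 moreover have "(z j)^2 * (S / mu j - 1) >= 0" if j: "j : H" for j
 proof (cases "mu j = 0")
  case True then show ?thesis using suppz j by simp
 next
  case False
  have "mu j <= S" unfolding S using fin j mu by (intro member_le_sum) auto
  then show ?thesis using False mu[OF j] by simp
 qed
 then have "(\<Sum>j\<in>H. (z j)^2 * (S / mu j - 1)) >= 0" by (rule sum_nonneg)
 ultimately show ?thesis using True by simp
next
 case False
 then have B0: "B > 0" using B by (metis sum_nonneg zero_le_power2 less_eq_real_def)
 define v where "v j = S * z j" for j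
 define be where "be = (\<Sum>i\<in>H. b i * v i)"
 define V where "V = (\<Sum>i\<in>H. (v i)^2)"
 define bv where "bv = (\<Sum>i\<in>H. mu i * b i * v i)"
 define bb where "bb = (\<Sum>i\<in>H. mu i * (b i)^2)"
 define vv where "vv = (\<Sum>i\<in>H. mu i * (v i)^2)"
 define Yb where "Yb j = (\<Sum>k\<in>H. Y j k * b k)" for j
 define Yv where "Yv j = (\<Sum>k\<in>H. Y j k * v k)" for j
 define A where "A = (\<Sum>j\<in>H. \<Sum>k\<in>H. (Y j k)^2 / mu j)"
 define C where "C = (\<Sum>j\<in>H. v j * Yb j / mu j)"
 define Dv where "Dv = (\<Sum>j\<in>H. (v j)^2 / mu j)"
 define rr where "rr = (\<Sum>j\<in>H. (Yb j)^2 / mu j)"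
 define G where "G = (\<Sum>j\<in>H. b j * Yv j)"
 \<comment> \<open>\<open>Y / mu\<close> shifted by the test matrix. The shift annihilates
   \<open>b\<close> on the right, so \<open>W\<close> acts on \<open>b\<close> just as
   \<open>Y / mu\<close> does; this is \<open>Wb\<close>.\<close>
 define W where "W j k = Y j k / mu j + ((if j = k then be else 0) - b j * v k) / (B * S)" for j k
 have G': "(\<Sum>j\<in>H. v j * Yb j) = G"
 proof -
  have "(\<Sum>j\<in>H. v j * Yb j) = (\<Sum>j\<in>H. \<Sum>k\<in>H. v j * (Y j k * b k))" by (simp add: Yb_def sum_distrib_left)
  also have "... = (\<Sum>k\<in>H. \<Sum>j\<in>H. v j * (Y j k * b k))" by (rule sum.swap)
  also have "... = (\<Sum>k\<in>H. \<Sum>j\<in>H. b k * (Y k j * v j))"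
   by (intro sum.cong refl) (simp add: sym)
  finally show ?thesis by (simp add: G_def Yv_def sum_distrib_left)
 qed
 have W2: "mu j * (\<Sum>k\<in>H. (W j k)^2) = (\<Sum>k\<in>H. (Y j k)^2 / mu j) + 2 / (B * S) * (be * Y j j - b j * Yv j)
   + 1 / (B * S)^2 * (be^2 * mu j - 2 * be * (mu j * b j * v j) + mu j * (b j)^2 * V)" if j: "j : H" for j
 proof (cases "mu j = 0")
  case True then show ?thesis using supp[OF j _ True] by (simp add: Yv_def j)
 next
  case mj: False
  have "(\<Sum>k\<in>H. mu j * (W j k)^2) = (\<Sum>k\<in>H. (Y j k)^2 / mu j + 2 / (B * S) * (be * (if j = k then Y j k else 0) - b j * (Y j k * v k))
   + 1 / (B * S)^2 * (mu j * (be^2 * (if j = k then 1 else 0) - 2 * be * b j * (if j = k then v k else 0) + (b j)^2 * (v k)^2)))"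
  proof (rule sum.cong[OF refl])
   fix k
   define e where "e = (if j = k then be else 0) - b j * v k"
   have "mu j * (W j k)^2 = (Y j k)^2 / mu j + 2 / (B * S) * (Y j k * e) + 1 / (B * S)^2 * (mu j * e^2)"
    unfolding W_def e_def[symmetric] using mj B0 S(2) by (simp add: power2_sum power_divide sq_eq field_simps)
   moreover have "Y j k * e = be * (if j = k then Y j k else 0) - b j * (Y j k * v k)"
    by (simp add: e_def algebra_simps)
   moreover have "e^2 = be^2 * (if j = k then 1 else 0) - 2 * be * b j * (if j = k then v k else 0) + (b j)^2 * (v k)^2"
    by (simp add: e_def sq_eq algebra_simps)
   ultimately show "mu j * (W j k)^2 = (Y j k)^2 / mu j + 2 / (B * S) * (be * (if j = k then Y j k else 0) - b j * (Y j k * v k))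
   + 1 / (B * S)^2 * (mu j * (be^2 * (if j = k then 1 else 0) - 2 * be * b j * (if j = k then v k else 0) + (b j)^2 * (v k)^2))"
    by simp
  qed
  also have "... = (\<Sum>k\<in>H. (Y j k)^2 / mu j) + 2 / (B * S) * (be * (\<Sum>k\<in>H. if j = k then Y j k else 0) - b j * (\<Sum>k\<in>H. Y j k * v k))
   + 1 / (B * S)^2 * (mu j * (be^2 * (\<Sum>k\<in>H. if j = k then 1 else 0) - 2 * be * b j * (\<Sum>k\<in>H. if j = k then v k else 0) + (b j)^2 * (\<Sum>k\<in>H. (v k)^2)))"
   by (rule sum_linear_combination)
  also have "... = (\<Sum>k\<in>H. (Y j k)^2 / mu j) + 2 / (B * S) * (be * Y j j - b j * Yv j)
   + 1 / (B * S)^2 * (mu j * (be^2 - 2 * be * b j * v j + (b j)^2 * V))"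
   using fin j by (simp add: Yv_def V_def)
  finally show ?thesis by (simp add: sum_distrib_left algebra_simps)
 qed
 have Wb: "mu j * (\<Sum>k\<in>H. W j k * b k)^2 = (Yb j)^2 / mu j" if j: "j : H" for j
 proof -
  have "(\<Sum>k\<in>H. W j k * b k) = (\<Sum>k\<in>H. Y j k * b k / mu j + ((if j = k then be * b k else 0) - b j * (b k * v k)) / (B * S))"
   by (rule sum.cong) (auto simp: W_def algebra_simps)
  also have "... = Yb j / mu j + (be * b j - b j * be) / (B * S)"
   using fin j by (simp add: sum.distrib sum_divide_distrib[symmetric] sum_subtractf sum_distrib_left[symmetric] Yb_def be_def)
  finally have "(\<Sum>k\<in>H. W j k * b k) = Yb j / mu j" by simp
  then show ?thesis by (simp add: sq_eq)
 qed
 have F1: "(\<Sum>j\<in>H. mu j * (B * (\<Sum>k\<in>H. (W j k)^2) - (\<Sum>k\<in>H. W j k * b k)^2))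
   = B * A - 2 / S * G + (be^2 * S - 2 * be * bv + V * bb) / (B * S^2) - rr"
 proof -
  have "(\<Sum>j\<in>H. mu j * (B * (\<Sum>k\<in>H. (W j k)^2) - (\<Sum>k\<in>H. W j k * b k)^2))
   = (\<Sum>j\<in>H. B * (mu j * (\<Sum>k\<in>H. (W j k)^2)) - (Yb j)^2 / mu j)"
   by (rule sum.cong) (auto simp: Wb[symmetric] algebra_simps)
  also have "... = B * (\<Sum>j\<in>H. mu j * (\<Sum>k\<in>H. (W j k)^2)) - rr"
   by (simp add: sum_subtractf sum_distrib_left rr_def)
  also have "(\<Sum>j\<in>H. mu j * (\<Sum>k\<in>H. (W j k)^2)) = (\<Sum>j\<in>H. (\<Sum>k\<in>H. (Y j k)^2 / mu j) + 2 / (B * S) * (be * Y j j - b j * Yv j)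
   + 1 / (B * S)^2 * (be^2 * mu j - 2 * be * (mu j * b j * v j) + mu j * (b j)^2 * V))"
   by (rule sum.cong) (auto simp: W2)
  also have "... = A + 2 / (B * S) * (be * 0 - G) + 1 / (B * S)^2 * (be^2 * S - 2 * be * bv + bb * V)"
   using sum_linear_combination[where H = H and p = "%j. \<Sum>k\<in>H. (Y j k)^2 / mu j" and ?c1.0 = "2 / (B * S)"
     and e = be and q = "%j. Y j j" and b = 1 and r = "%j. b j * Yv j" and ?c2.0 = "1 / (B * S)^2" and m = 1
     and ?e1.0 = "be^2" and ?s1.0 = mu and ?e2.0 = "2 * be" and ?s2.0 = "%j. mu j * b j * v j"
     and ?e3.0 = V and ?s3.0 = "%j. mu j * (b j)^2"]
   unfolding A_def G_def bv_def bb_def S(1) tr by (simp add: mult.commute)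
  finally have X: "(\<Sum>j\<in>H. mu j * (B * (\<Sum>k\<in>H. (W j k)^2) - (\<Sum>k\<in>H. W j k * b k)^2))
   = B * (A + 2 / (B * S) * (be * 0 - G) + 1 / (B * S)^2 * (be^2 * S - 2 * be * bv + bb * V)) - rr" .
  have "B * (A + 2 / (B * S) * (be * 0 - G) + 1 / (B * S)^2 * (be^2 * S - 2 * be * bv + bb * V))
   = B * A - 2 / S * G + (be^2 * S - 2 * be * bv + V * bb) / (B * S^2)"
   using B0 S(2) by (simp add: sq_eq field_simps)
  then show ?thesis unfolding X by simp
 qed
 have F2: "(\<Sum>j\<in>H. mu j * (Yb j / mu j - v j / mu j + v j / S)^2) = rr - 2 * C + 2 * G / S + Dv - 2 * V / S + vv / S^2"
 proof -
  have e: "(\<Sum>j\<in>H. mu j * (Yb j / mu j - v j / mu j + v j / S)^2) = (\<Sum>j\<in>H. (Yb j)^2 / mu j - 2 * (v j * Yb j / mu j)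
   + 2 / S * (v j * Yb j) + (v j)^2 / mu j - 2 / S * (v j)^2 + 1 / S^2 * (mu j * (v j)^2))"
  proof (rule sum.cong[OF refl])
   fix j assume j: "j : H"
   show "mu j * (Yb j / mu j - v j / mu j + v j / S)^2 = (Yb j)^2 / mu j - 2 * (v j * Yb j / mu j)
   + 2 / S * (v j * Yb j) + (v j)^2 / mu j - 2 / S * (v j)^2 + 1 / S^2 * (mu j * (v j)^2)"
   proof (cases "mu j = 0")
    case True
    then have "v j = 0" using suppz j by (simp add: v_def)
    then show ?thesis using True by simp
   next
    case False then show ?thesis using S(2) by (simp add: sq_eq field_simps)
   qed
  qed
  show ?thesis unfolding e rr_def C_def G'[symmetric] Dv_def V_def vv_def
   by (simp only: sum.distrib sum_subtractf sum_distrib_left[symmetric]) simp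
 qed
 have row: "mu j * (B * (\<Sum>k\<in>H. (W j k)^2) - (\<Sum>k\<in>H. W j k * b k)^2) >= 0" if "j : H" for j
  using sum_cs[of "W j" b H] mu[OF that] B by (simp add: mult.commute)
 have F1nn: "(\<Sum>j\<in>H. mu j * (B * (\<Sum>k\<in>H. (W j k)^2) - (\<Sum>k\<in>H. W j k * b k)^2)) >= 0"
  by (rule sum_nonneg) (rule row)
 have F2nn: "(\<Sum>j\<in>H. mu j * (Yb j / mu j - v j / mu j + v j / S)^2) >= 0" using mu by (intro sum_nonneg) auto
 have F3: "(be^2 * S - 2 * be * bv + V * bb) / B + vv <= S * V"
 proof -
  have "be^2 * S - 2 * be * bv + V * bb + B * vv <= B * S * V"
   unfolding bv_def bb_def vv_def by (rule trace_ge_two_vectors[OF fin mu B B0 be_def V_def S(1)])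
  then have "(be^2 * S - 2 * be * bv + V * bb + B * vv) / B <= B * S * V / B"
   using B0 by (intro divide_right_mono) auto
  then show ?thesis using B0 by (simp add: add_divide_distrib)
 qed
 have P: "(\<Sum>j\<in>H. (z j)^2 * (S / mu j - 1)) = Dv / S - V / S^2"
 proof -
  have "(z j)^2 * (S / mu j - 1) = 1 / S * ((v j)^2 / mu j) - 1 / S^2 * (v j)^2" if "j : H" for j
   using S(2) by (simp add: v_def sq_eq field_simps)
  then have e: "(\<Sum>j\<in>H. (z j)^2 * (S / mu j - 1)) = (\<Sum>j\<in>H. 1 / S * ((v j)^2 / mu j) - 1 / S^2 * (v j)^2)"
   by (rule sum.cong[OF refl])
  show ?thesis unfolding e Dv_def V_def by (simp only: sum_subtractf sum_distrib_left[symmetric]) simp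
 qed
 have P': "(\<Sum>j\<in>H. \<Sum>k\<in>H. z j * b k * Y j k / mu j) = C / S"
  using S(2) by (simp add: C_def Yb_def v_def sum_distrib_left sum_divide_distrib mult_ac)
 \<comment> \<open>\<open>S\<close> times the form is a sum of three nonnegative pieces: the
   Cauchy-Schwarz defects \<open>F1\<close> of the rows of \<open>W\<close> against
   \<open>b\<close>, the completed square \<open>F2\<close> linking \<open>Yb\<close> and
   \<open>v\<close>, and the defect in the trace inequality \<open>F3\<close>.\<close>
 have "S * ((\<Sum>j\<in>H. (z j)^2 * (S / mu j - 1)) - 2 * (\<Sum>j\<in>H. \<Sum>k\<in>H. z j * b k * Y j k / mu j)
  + B / S * (\<Sum>j\<in>H. \<Sum>k\<in>H. (Y j k)^2 / mu j)) = Dv - V / S - 2 * C + B * A"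
  unfolding P P' A_def[symmetric] using S(2) by (simp add: field_simps sq_eq)
 also have "... = (B * A - 2 / S * G + (be^2 * S - 2 * be * bv + V * bb) / (B * S^2) - rr)
  + (rr - 2 * C + 2 * G / S + Dv - 2 * V / S + vv / S^2)
  + (S * V - ((be^2 * S - 2 * be * bv + V * bb) / B + vv)) / S^2"
  using S(2) B0 by (simp add: field_simps sq_eq)
 also have "... >= 0" using F1nn F2nn F3 unfolding F1 F2 by simp
 finally show ?thesis using S(2) by (simp add: zero_le_mult_iff)
qed

text \<open>The form bounded below in \<open>structural_bound\<close>, in an orthonormal basis with
  first vector along \<open>p\<close> and with the pseudo-inverse of \<open>m\<close> replaced by
  that of its block orthogonal to \<open>p\<close>. \<open>Z11\<close>, \<open>z\<close>,
  \<open>Z\<close> are the corner, column and block of the symmetric matrix, \<open>a\<close>,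
  \<open>b\<close>, diag(mu) those of \<open>M\<close>, and \<open>w\<close> is 1 + |p|^2. The
  summands are, in this order, \<open>Phi\<close> of the matrix with itself, twice
  \<open>Phi\<close> of \<open>M\<close> with the inverse square, and the terms in
  \<open>y\<close>.\<close>

abbreviation cone_form :: "'a set => ('a => real) => ('a => real) => ('a => real) => ('a => 'a => real) => real => real => real
 => real => real => real => real => real => real" where
 "cone_form H mu b z Z a w y Z11 S s2 t smZ \<equiv> Z11 * (t * S) - (\<Sum>j\<in>H. (z j)^2) + w * (((t * S)^2 - (\<Sum>j\<in>H. \<Sum>k\<in>H. (Z j k)^2)) / 2)
  + (S * (\<Sum>j\<in>H. (z j)^2 / mu j) + a * (\<Sum>j\<in>H. \<Sum>k\<in>H. (Z j k)^2 / mu j) - 2 * (\<Sum>j\<in>H. \<Sum>k\<in>H. z j * b k * Z j k / mu j)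
    + w * (S * (\<Sum>j\<in>H. \<Sum>k\<in>H. (Z j k)^2 / mu j) - (\<Sum>j\<in>H. \<Sum>k\<in>H. mu k * (Z j k)^2 / mu j)))
  + (w - 1) * (4 * y * smZ + 3 * y^2 * s2)"

text \<open>The block is split into \<open>t\<close> times diag(mu) and a trace-free
  \<open>Y\<close>. Eliminating \<open>a\<close> through \<open>sig\<close> leaves the positive term
  with coefficient \<open>sig / S\<close> and parts that complete the two sums of squares above;
  what is left over in the direction of diag(mu) is \<open>t\<close> times the linearised equation
  \<open>d\<close>.\<close>

lemma cone_form_identity:
 fixes mu b z :: "'a => real" and Z :: "'a => 'a => real" and a w y Z11 :: real
 assumes fin: "finite H"
  and supp: "!!i j. i : H ==> j : H ==> mu i = 0 ==> Z i j = 0"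
  and suppb: "!!i. i : H ==> mu i = 0 ==> b i = 0"
  and suppz: "!!i. i : H ==> mu i = 0 ==> z i = 0"
  and S: "S = (\<Sum>i\<in>H. mu i)" "S > 0" and Q: "Q = (\<Sum>i\<in>H. (mu i)^2)" and s2: "s2 = (S^2 - Q) / 2"
  and B: "B = (\<Sum>i\<in>H. (b i)^2)" and sig: "sig = a * S - B + w * s2"
  and tau: "(\<Sum>i\<in>H. Z i i) = t * S"
  and Y: "Y = (%j k. Z j k - (if j = k then t * mu j else 0))"
  and smZ: "smZ = (S * (t * S) - (\<Sum>i\<in>H. mu i * Z i i)) / 2"
  and d: "d = S * Z11 + a * (t * S) - 2 * (\<Sum>j\<in>H. b j * z j) + 2 * w * smZ + 2 * y * (w - 1) * s2"
  and P2: "P2 = (%x. (\<Sum>j\<in>H. \<Sum>k\<in>H. (Y j k)^2 * ((S - s2 / S - mu k) / mu j)) - (\<Sum>j\<in>H. \<Sum>k\<in>H. (Y j k)^2) / 2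
  - 2 * x * (\<Sum>i\<in>H. mu i * Y i i) + x^2 * s2)"
 shows "(\<Sum>i\<in>H. Y i i) = 0"
  and "smZ = s2 * t - (\<Sum>i\<in>H. mu i * Y i i) / 2"
  and "(\<Sum>j\<in>H. \<Sum>k\<in>H. (Z j k)^2) = (\<Sum>j\<in>H. \<Sum>k\<in>H. (Y j k)^2) + 2 * t * (\<Sum>i\<in>H. mu i * Y i i) + t^2 * Q"
  and "cone_form H mu b z Z a w y Z11 S s2 t smZ
  = t * d + ((\<Sum>j\<in>H. (z j)^2 * (S / mu j - 1)) - 2 * (\<Sum>j\<in>H. \<Sum>k\<in>H. z j * b k * Y j k / mu j)
    + B / S * (\<Sum>j\<in>H. \<Sum>k\<in>H. (Y j k)^2 / mu j))
   + sig / S * (\<Sum>j\<in>H. \<Sum>k\<in>H. (Y j k)^2 / mu j) + P2 t + (w - 1) * P2 (t + y) + 2 * (w - 1) * y^2 * s2"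
proof -
 define A where "A = (\<Sum>j\<in>H. \<Sum>k\<in>H. (Y j k)^2 / mu j)"
 define AM where "AM = (\<Sum>j\<in>H. \<Sum>k\<in>H. mu k * (Y j k)^2 / mu j)"
 define NY where "NY = (\<Sum>j\<in>H. \<Sum>k\<in>H. (Y j k)^2)"
 define g where "g = (\<Sum>i\<in>H. mu i * Y i i)"
 define CY where "CY = (\<Sum>j\<in>H. \<Sum>k\<in>H. z j * b k * Y j k / mu j)"
 define zz where "zz = (\<Sum>j\<in>H. (z j)^2)"
 define N where "N = (\<Sum>j\<in>H. (z j)^2 / mu j)"
 define bz where "bz = (\<Sum>j\<in>H. b j * z j)"
 have Zjk: "Z j k = Y j k + (if j = k then t * mu j else 0)" for j k by (simp add: Y)
 have suppY: "Y i j = 0" if "i : H" "j : H" "mu i = 0" for i j using supp that by (cases "i = j") (auto simp: Y)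
 show tr: "(\<Sum>i\<in>H. Y i i) = 0"
  by (simp add: Y sum_subtractf tau S sum_distrib_left)
 have ZA: "(\<Sum>j\<in>H. \<Sum>k\<in>H. (Z j k)^2 / mu j) = A + t^2 * S"
 proof -
  have "(\<Sum>k\<in>H. (Z j k)^2 / mu j) = (\<Sum>k\<in>H. (Y j k)^2 / mu j) + (2 * t * Y j j + t^2 * mu j)" if j: "j : H" for j
  proof -
   have "(Z j k)^2 / mu j = (Y j k)^2 / mu j + (if j = k then 2 * t * Y j j + t^2 * mu j else 0)" if k: "k : H" for k
    using suppY[OF j k] by (cases "mu j = 0") (auto simp: Zjk sq_eq field_simps)
   then have "(\<Sum>k\<in>H. (Z j k)^2 / mu j) = (\<Sum>k\<in>H. (Y j k)^2 / mu j + (if j = k then 2 * t * Y j j + t^2 * mu j else 0))"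
    by (rule sum.cong[OF refl])
   then show ?thesis using fin j by (simp add: sum.distrib)
  qed
  then show ?thesis using tr by (simp add: A_def sum.distrib sum_distrib_left[symmetric] S cong: sum.cong)
 qed
 have ZM: "(\<Sum>j\<in>H. \<Sum>k\<in>H. mu k * (Z j k)^2 / mu j) = AM + 2 * t * g + t^2 * Q"
 proof -
  have "(\<Sum>k\<in>H. mu k * (Z j k)^2 / mu j) = (\<Sum>k\<in>H. mu k * (Y j k)^2 / mu j) + (2 * t * (mu j * Y j j) + t^2 * (mu j)^2)" if j: "j : H" for j
  proof -
   have "mu k * (Z j k)^2 / mu j = mu k * (Y j k)^2 / mu j + (if j = k then 2 * t * (mu j * Y j j) + t^2 * (mu j)^2 else 0)" if k: "k : H" for k
    using suppY[OF j k] by (cases "mu j = 0") (auto simp: Zjk sq_eq field_simps)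
   then have "(\<Sum>k\<in>H. mu k * (Z j k)^2 / mu j) = (\<Sum>k\<in>H. mu k * (Y j k)^2 / mu j + (if j = k then 2 * t * (mu j * Y j j) + t^2 * (mu j)^2 else 0))"
    by (rule sum.cong[OF refl])
   then show ?thesis using fin j by (simp add: sum.distrib)
  qed
  then show ?thesis by (simp add: AM_def g_def Q sum.distrib sum_distrib_left[symmetric] cong: sum.cong)
 qed
 have ZN: "(\<Sum>j\<in>H. \<Sum>k\<in>H. (Z j k)^2) = NY + 2 * t * g + t^2 * Q"
 proof -
  have "(\<Sum>k\<in>H. (Z j k)^2) = (\<Sum>k\<in>H. (Y j k)^2) + (2 * t * (mu j * Y j j) + t^2 * (mu j)^2)" if j: "j : H" for j
  proof -
   have "(Z j k)^2 = (Y j k)^2 + (if j = k then 2 * t * (mu j * Y j j) + t^2 * (mu j)^2 else 0)" for k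
    by (auto simp: Zjk sq_eq algebra_simps)
   then show ?thesis using fin j by (simp add: sum.distrib)
  qed
  then show ?thesis by (simp add: NY_def g_def Q sum.distrib sum_distrib_left[symmetric] cong: sum.cong)
 qed
 then show "(\<Sum>j\<in>H. \<Sum>k\<in>H. (Z j k)^2) = (\<Sum>j\<in>H. \<Sum>k\<in>H. (Y j k)^2) + 2 * t * (\<Sum>i\<in>H. mu i * Y i i) + t^2 * Q"
  by (simp add: NY_def g_def)
 have ZC: "(\<Sum>j\<in>H. \<Sum>k\<in>H. z j * b k * Z j k / mu j) = CY + t * bz"
 proof -
  have "(\<Sum>k\<in>H. z j * b k * Z j k / mu j) = (\<Sum>k\<in>H. z j * b k * Y j k / mu j) + t * (b j * z j)" if j: "j : H" for j
  proof -
   have "z j * b k * Z j k / mu j = z j * b k * Y j k / mu j + (if j = k then t * (b j * z j) else 0)" for k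
    using suppz[OF j] by (cases "mu j = 0") (auto simp: Zjk field_simps)
   then show ?thesis using fin j by (simp add: sum.distrib)
  qed
  then show ?thesis by (simp add: CY_def bz_def sum.distrib sum_distrib_left[symmetric] cong: sum.cong)
 qed
 have Zg: "(\<Sum>i\<in>H. mu i * Z i i) = g + t * Q"
  by (simp add: Zjk g_def Q sum.distrib distrib_left sum_distrib_left sq_eq mult_ac)
 have sm: "smZ = s2 * t - g / 2" unfolding smZ Zg s2 by (simp add: sq_eq field_simps)
 then show "smZ = s2 * t - (\<Sum>i\<in>H. mu i * Y i i) / 2" by (simp add: g_def)
 have YA: "(\<Sum>j\<in>H. \<Sum>k\<in>H. (Y j k)^2 * ((S - s2 / S - mu k) / mu j)) = (S - s2 / S) * A - AM"
 proof -
  have "(Y j k)^2 * ((c - mu k) / mu j) = c * ((Y j k)^2 / mu j) - mu k * (Y j k)^2 / mu j" for c j k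
   by (simp add: diff_divide_distrib right_diff_distrib mult.commute)
  then show ?thesis by (simp only: A_def AM_def sum_distrib_left sum_subtractf)
 qed
 have P1: "(\<Sum>j\<in>H. (z j)^2 * (S / mu j - 1)) = S * N - zz"
  by (simp add: N_def zz_def sum_distrib_left sum_subtractf algebra_simps)
 show "cone_form H mu b z Z a w y Z11 S s2 t smZ
  = t * d + ((\<Sum>j\<in>H. (z j)^2 * (S / mu j - 1)) - 2 * (\<Sum>j\<in>H. \<Sum>k\<in>H. z j * b k * Y j k / mu j)
    + B / S * (\<Sum>j\<in>H. \<Sum>k\<in>H. (Y j k)^2 / mu j))
   + sig / S * (\<Sum>j\<in>H. \<Sum>k\<in>H. (Y j k)^2 / mu j) + P2 t + (w - 1) * P2 (t + y) + 2 * (w - 1) * y^2 * s2"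
  unfolding ZA ZM ZN ZC P1 P2 YA sm d sig A_def[symmetric] NY_def[symmetric] g_def[symmetric] CY_def[symmetric]
   zz_def[symmetric] N_def[symmetric] bz_def[symmetric]
  unfolding s2 using S(2) by (simp add: field_simps sq_eq)
qed

lemma young:
 fixes a b e :: real assumes "e > 0" shows "2 * \<bar>a * b\<bar> <= e * a^2 + b^2 / e"
proof -
 have "0 <= (e * \<bar>a\<bar> - \<bar>b\<bar>)^2 / e" using assms by simp
 also have "... = e * a^2 + b^2 / e - 2 * \<bar>a * b\<bar>"
  using assms by (simp add: sq_eq field_simps abs_mult)
 finally show ?thesis by simp
qed

lemma sum_sum_cs:
 fixes f g :: "'a => 'a => real"
 shows "(\<Sum>i\<in>H. \<Sum>j\<in>H. f i j * g i j)^2 <= (\<Sum>i\<in>H. \<Sum>j\<in>H. (f i j)^2) * (\<Sum>i\<in>H. \<Sum>j\<in>H. (g i j)^2)"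
 unfolding sum.cartesian_product
 using sum_cs[of "%(i,j). f i j" "%(i,j). g i j" "H \<times> H"] by (simp add: case_prod_unfold)

text \<open>Nonnegativity is made quantitative. Each nonnegative piece is bounded below by
  \<open>ep\<close> times a cruder bound that contains the missing squares but costs a multiple of
  \<open>A\<close>. These costs are paid from \<open>sig / S * A\<close>, which is available because
  \<open>sig\<close> is bounded away from zero.\<close>

lemma cone_form_coercive:
 fixes L :: real
 assumes L: "L >= 1"
 obtains c C where "c > 0" "C >= 0"
  "!!(H :: 'a set) mu b z (Z :: 'a => 'a => real) a w y Z11 S Q s2 B sig t smZ d.
   [|finite H; !!i. i : H ==> mu i >= 0; !!i j. i : H ==> j : H ==> Z i j = Z j i;
   !!i j. i : H ==> j : H ==> mu i = 0 ==> Z i j = 0;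
   !!i. i : H ==> mu i = 0 ==> b i = 0; !!i. i : H ==> mu i = 0 ==> z i = 0;
   S = (\<Sum>i\<in>H. mu i); S > 0; Q = (\<Sum>i\<in>H. (mu i)^2); s2 = (S^2 - Q) / 2; B = (\<Sum>i\<in>H. (b i)^2);
   sig = a * S - B + w * s2; (\<Sum>i\<in>H. Z i i) = t * S; smZ = (S * (t * S) - (\<Sum>i\<in>H. mu i * Z i i)) / 2;
   d = S * Z11 + a * (t * S) - 2 * (\<Sum>j\<in>H. b j * z j) + 2 * w * smZ + 2 * y * (w - 1) * s2;
   S <= L; 1 / L <= s2; 1 <= w; w <= L; \<bar>a\<bar> <= L; B <= L; 1 / L <= sig|]
  ==> c * (Z11^2 + 2 * (\<Sum>j\<in>H. (z j)^2) + (\<Sum>j\<in>H. \<Sum>k\<in>H. (Z j k)^2)) + 2 * y^2 * ((w - 1) * s2) - C * d^2 <=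
  cone_form H mu b z Z a w y Z11 S s2 t smZ"
proof
 \<comment> \<open>The crude bounds cost at most \<open>5 * L ^ 5\<close> times \<open>A\<close>;
   this \<open>ep\<close> turns that into \<open>1 / (2 * L^2)\<close>, which is at most
   \<open>sig / (2 * S)\<close>.\<close>
 define ep where "ep = 1 / (10 * L ^ 7)"
 define de where "de = ep / (4 * L^2)"
 have ep: "ep > 0" "ep <= 1"
 proof -
  have "L ^ 7 >= 1" using L by (rule one_le_power)
  then have "10 * L ^ 7 >= 1" by simp
  then show "ep > 0" "ep <= 1" unfolding ep_def by (smt (verit) divide_pos_pos, smt (verit) divide_le_eq_1)
 qed
 have de: "de > 0" using ep L by (simp add: de_def)
 show "de / (50 * L ^ 6) > 0" using de L by simp
 show "L / ep + de >= 0" using L ep de by (intro add_nonneg_nonneg divide_nonneg_nonneg) auto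
 fix H :: "'a set" and mu b z and Z :: "'a => 'a => real" and a w y Z11 S Q s2 B sig t smZ d
 assume fin: "finite H" and mu: "!!i. i : H ==> mu i >= 0" and symZ: "!!i j. i : H ==> j : H ==> Z i j = Z j i"
  and supp: "!!i j. i : H ==> j : H ==> mu i = 0 ==> Z i j = 0"
  and suppb: "!!i. i : H ==> mu i = 0 ==> b i = 0"
  and suppz: "!!i. i : H ==> mu i = 0 ==> z i = 0"
  and S: "S = (\<Sum>i\<in>H. mu i)" "S > 0" and Q: "Q = (\<Sum>i\<in>H. (mu i)^2)" and s2: "s2 = (S^2 - Q) / 2"
  and B: "B = (\<Sum>i\<in>H. (b i)^2)" and sig: "sig = a * S - B + w * s2"
  and tau: "(\<Sum>i\<in>H. Z i i) = t * S"
  and smZ: "smZ = (S * (t * S) - (\<Sum>i\<in>H. mu i * Z i i)) / 2"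
  and d: "d = S * Z11 + a * (t * S) - 2 * (\<Sum>j\<in>H. b j * z j) + 2 * w * smZ + 2 * y * (w - 1) * s2"
  and bd: "S <= L" "1 / L <= s2" "1 <= w" "w <= L" "\<bar>a\<bar> <= L" "B <= L" "1 / L <= sig"
 define Y where "Y = (%j k. Z j k - (if j = k then t * mu j else 0))"
 define P2 where "P2 = (%x. (\<Sum>j\<in>H. \<Sum>k\<in>H. (Y j k)^2 * ((S - s2 / S - mu k) / mu j)) - (\<Sum>j\<in>H. \<Sum>k\<in>H. (Y j k)^2) / 2
  - 2 * x * (\<Sum>i\<in>H. mu i * Y i i) + x^2 * s2)"
 define A where "A = (\<Sum>j\<in>H. \<Sum>k\<in>H. (Y j k)^2 / mu j)"
 define NY where "NY = (\<Sum>j\<in>H. \<Sum>k\<in>H. (Y j k)^2)"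
 define g where "g = (\<Sum>i\<in>H. mu i * Y i i)"
 define CY where "CY = (\<Sum>j\<in>H. \<Sum>k\<in>H. z j * b k * Y j k / mu j)"
 define zz where "zz = (\<Sum>j\<in>H. (z j)^2)"
 define N where "N = (\<Sum>j\<in>H. (z j)^2 / mu j)"
 define bz where "bz = (\<Sum>j\<in>H. b j * z j)"
 define P1 where "P1 = (\<Sum>j\<in>H. (z j)^2 * (S / mu j - 1)) - 2 * CY + B / S * A"
 define E where "E = cone_form H mu b z Z a w y Z11 S s2 t smZ"
 note ids = cone_form_identity[OF fin supp suppb suppz S Q s2 B sig tau Y_def smZ d P2_def]
 have trY: "(\<Sum>i\<in>H. Y i i) = 0" using ids(1) .
 have sm: "smZ = s2 * t - g / 2" unfolding g_def by (rule ids(2))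
 have NN: "(\<Sum>j\<in>H. \<Sum>k\<in>H. (Z j k)^2) = NY + 2 * t * g + t^2 * Q" unfolding NY_def g_def by (rule ids(3))
 have Eid: "E = t * d + P1 + sig / S * A + P2 t + (w - 1) * P2 (t + y) + 2 * (w - 1) * y^2 * s2"
  unfolding E_def P1_def A_def CY_def by (rule ids(4))
 have symY: "Y i j = Y j i" if "i : H" "j : H" for i j using symZ that by (auto simp: Y_def)
 have suppY: "Y i j = 0" if "i : H" "j : H" "mu i = 0" for i j using supp that by (cases "i = j") (auto simp: Y_def)
 have s2pos: "s2 > 0" using bd(2) L by (smt (verit) divide_pos_pos)
 have mule: "mu j <= S" if "j : H" for j unfolding S using fin that mu by (intro member_le_sum) auto
 have muQ: "(mu j)^2 <= Q" if "j : H" for j unfolding Q using fin that by (intro member_le_sum) auto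
 have kap: "s2 / S <= S - mu j" if "j : H" for j
 proof -
  have "0 <= (S - mu j)^2" by simp
  also have "... = S^2 - 2 * (S * mu j) + (mu j)^2" by (simp add: sq_eq algebra_simps)
  finally have "0 <= S^2 - 2 * (S * mu j) + (mu j)^2" .
  moreover have "S * (S - mu j) = S^2 - S * mu j" by (simp add: sq_eq algebra_simps)
  moreover have "2 * s2 = S^2 - Q" using s2 by simp
  ultimately have "s2 <= S * (S - mu j)" using muQ[OF that] by linarith
  then show ?thesis using S(2) by (simp add: field_simps)
 qed
 have Ann: "A >= 0" unfolding A_def using mu by (intro sum_nonneg divide_nonneg_nonneg) auto
 have Nnn: "N >= 0" unfolding N_def using mu by (intro sum_nonneg divide_nonneg_nonneg) auto
 have Bnn: "B >= 0" unfolding B by (intro sum_nonneg) auto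
 have P1nn: "P1 >= 0" unfolding P1_def A_def CY_def
  by (rule cross_form_nonneg[where Y = Y and mu = mu and b = b and z = z, OF fin mu symY suppY suppz S B trY])
 have P2nn: "P2 x >= 0" for x unfolding P2_def
  by (rule trace_free_form_nonneg[where Y = Y and mu = mu and x = x, OF fin mu symY suppY S Q s2 trY])
 have CYb: "2 * \<bar>CY\<bar> <= (s2 / S) / 2 * N + 2 * B / (s2 / S) * A"
 proof -
  have "CY = (\<Sum>j\<in>H. \<Sum>k\<in>H. (z j * b k / sqrt (mu j)) * (Y j k / sqrt (mu j)))"
   unfolding CY_def by (intro sum.cong refl) (simp add: mu real_sqrt_mult[symmetric] flip: sq_eq)
  then have "CY^2 <= (\<Sum>j\<in>H. \<Sum>k\<in>H. (z j * b k / sqrt (mu j))^2) * (\<Sum>j\<in>H. \<Sum>k\<in>H. (Y j k / sqrt (mu j))^2)"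
   by (simp only: sum_sum_cs)
  also have "(\<Sum>j\<in>H. \<Sum>k\<in>H. (Y j k / sqrt (mu j))^2) = A"
   unfolding A_def by (intro sum.cong refl) (simp add: power_divide mu)
  also have "(\<Sum>j\<in>H. \<Sum>k\<in>H. (z j * b k / sqrt (mu j))^2) = N * B"
   unfolding N_def B sum_product by (intro sum.cong refl) (simp add: power_divide mu power_mult_distrib)
  finally have "\<bar>CY\<bar>^2 <= (sqrt (N * (B * A)))^2" using Ann Nnn Bnn by (simp add: mult.assoc)
  then have "\<bar>CY\<bar> <= sqrt (N * (B * A))" by (rule power2_le_imp_le) (simp add: Ann Nnn Bnn)
  then have "2 * \<bar>CY\<bar> <= 2 * \<bar>sqrt N * sqrt (B * A)\<bar>" using Ann Nnn Bnn by (simp add: real_sqrt_mult)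
  also have "... <= (s2 / S / 2) * (sqrt N)^2 + (sqrt (B * A))^2 / (s2 / S / 2)"
   using s2pos S(2) by (intro young) auto
  finally show ?thesis using Ann Nnn Bnn by (simp add: mult_ac)
 qed
 \<comment> \<open>Cruder than \<open>P1nn\<close>, but with a positive multiple of
   \<open>N\<close>, because every \<open>S - mu j\<close> is at least
   \<open>s2 / S\<close>.\<close>
 have P1b: "P1 >= (s2 / S) / 2 * N - 2 * B / (s2 / S) * A"
 proof -
  have "(s2 / S) * N <= (\<Sum>j\<in>H. (z j)^2 * (S / mu j - 1))"
   unfolding N_def sum_distrib_left
  proof (intro sum_mono)
   fix j assume j: "j : H"
   show "s2 / S * ((z j)^2 / mu j) <= (z j)^2 * (S / mu j - 1)"
   proof (cases "mu j = 0")
    case True then show ?thesis using suppz j by simp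
   next
    case False
    have "s2 / S * ((z j)^2 / mu j) <= (S - mu j) * ((z j)^2 / mu j)"
     using kap[OF j] mu[OF j] by (intro mult_right_mono) auto
    also have "... = (z j)^2 * (S / mu j - 1)" using False by (simp add: field_simps)
    finally show ?thesis .
   qed
  qed
  moreover have "B / S * A >= 0" using Bnn Ann S(2) by simp
  ultimately show ?thesis unfolding P1_def using CYb by linarith
 qed
 have NYb: "NY <= S * A" unfolding NY_def A_def sum_distrib_left
 proof (intro sum_mono)
  fix j k assume j: "j : H" and k: "k : H"
  show "(Y j k)^2 <= S * ((Y j k)^2 / mu j)"
  proof (cases "mu j = 0")
   case True then show ?thesis using suppY j k by simp
  next
   case False
   then have "(Y j k)^2 = mu j * ((Y j k)^2 / mu j)" by simp
   also have "... <= S * ((Y j k)^2 / mu j)" using mule[OF j] mu[OF j] by (intro mult_right_mono) auto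
   finally show ?thesis .
  qed
 qed
 have QS: "Q <= S^2" using s2 s2pos by simp
 have Qnn: "Q >= 0" unfolding Q by (intro sum_nonneg) auto
 have NYnn: "NY >= 0" unfolding NY_def by (intro sum_nonneg) auto
 have g2: "g^2 <= Q * NY"
 proof -
  have "g^2 <= Q * (\<Sum>i\<in>H. (Y i i)^2)" unfolding g_def Q by (rule sum_cs)
  also have "(\<Sum>i\<in>H. (Y i i)^2) <= NY" unfolding NY_def
   by (intro sum_mono member_le_sum[OF _ _ fin]) auto
  finally show ?thesis using Qnn by (simp add: mult_left_mono)
 qed
 have g2': "g^2 <= S ^ 3 * A"
 proof -
  have "Q * NY <= S^2 * (S * A)" using QS NYb Qnn NYnn S(2) by (intro mult_mono) auto
  then show ?thesis using g2 by (simp add: power3_eq_cube sq_eq)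
 qed
 have P2b: "P2 x >= x^2 * s2 / 2 - (S / 2 + 2 * S ^ 3 / s2) * A" for x
 proof -
  have "(\<Sum>j\<in>H. \<Sum>k\<in>H. (Y j k)^2 * ((S - s2 / S - mu k) / mu j)) >= 0"
   using kap mu by (intro sum_nonneg mult_nonneg_nonneg divide_nonneg_nonneg) (auto simp: algebra_simps)
  moreover have "2 * \<bar>x * g\<bar> <= (s2 / 2) * x^2 + g^2 / (s2 / 2)" using s2pos by (intro young) auto
  moreover have "g^2 / (s2 / 2) <= (S ^ 3 * A) / (s2 / 2)" using g2' s2pos by (intro divide_right_mono) auto
  moreover have "x * g <= \<bar>x * g\<bar>" by simp
  ultimately show ?thesis unfolding P2_def NY_def[symmetric] g_def[symmetric] using NYb
   by (simp add: algebra_simps)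
 qed
 have S2: "S^2 >= 2 / L" using s2 bd(2) Qnn by simp
 have S0: "S * S <= L * L" using bd(1) S(2) by (intro mult_mono) auto
 have pw: "L ^ m <= L ^ n" if "m <= n" for m n using L that by (intro power_increasing) auto
 have Lpos: "L > 0" using L by simp
 have "0 < 1 / L" using Lpos by simp
 then have sigpos: "sig > 0" using bd(7) by linarith
 have is2: "1 / s2 <= L" using bd(2) s2pos Lpos by (simp add: field_simps)
 have ikap: "1 / (s2 / S) <= L^2"
 proof -
  have "1 / (s2 / S) = S * (1 / s2)" by simp
  also have "... <= L * L" using bd(1) is2 S(2) Lpos s2pos by (intro mult_mono) auto
  finally show ?thesis by (simp add: sq_eq)
 qed
 have kapL: "s2 / S >= 1 / L^2"
 proof -
  have "s2 / S >= (1 / L) / L" using bd S(2) Lpos s2pos by (intro frac_le) auto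
  then show ?thesis by (simp add: sq_eq)
 qed
 define K where "K = S / 2 + 2 * S ^ 3 / s2"
 have Kb: "K <= 3 * L ^ 4"
 proof -
  have "S ^ 3 * (1 / s2) <= L ^ 3 * L" using bd(1) is2 S(2) Lpos s2pos by (intro mult_mono power_mono) auto
  then have "2 * S ^ 3 / s2 <= 2 * L ^ 4" by (simp add: power4_eq_xxxx power3_eq_cube)
  moreover have "S / 2 <= L ^ 4" using bd(1) S(2) pw[of 1 4] by simp
  ultimately show ?thesis unfolding K_def by linarith
 qed
 have Knn: "K >= 0" unfolding K_def using S(2) s2pos by simp
 have slack: "ep * (2 * B / (s2 / S) + w * K) <= sig / (2 * S)"
 proof -
  have "2 * B / (s2 / S) = 2 * (B * (1 / (s2 / S)))" by simp
  also have "... <= 2 * (L * L^2)" using bd(6) ikap Bnn Lpos s2pos S(2) by (intro mult_left_mono mult_mono) auto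
  also have "... <= 2 * L ^ 5" using pw[of 3 5] by (simp add: sq_eq power3_eq_cube)
  finally have 1: "2 * B / (s2 / S) <= 2 * L ^ 5" .
  have "w * K <= L * (3 * L ^ 4)" using bd(3,4) Kb Knn Lpos by (intro mult_mono) auto
  then have 2: "w * K <= 3 * L ^ 5" by (simp add: eval_nat_numeral)
  have "ep * (2 * B / (s2 / S) + w * K) <= ep * (5 * L ^ 5)" using 1 2 ep by (intro mult_left_mono) auto
  also have "... = (1 / L) / (2 * L)" using Lpos by (simp add: ep_def field_simps eval_nat_numeral)
  also have "... <= sig / (2 * S)" using bd(7) bd(1) S(2) Lpos sigpos by (intro frac_le) auto
  finally show ?thesis .
 qed
 define R where "R = A + N + t^2 + (w - 1) * (t + y)^2"
 have w1: "w - 1 >= 0" using bd by simp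
 have core: "E - 2 * y^2 * ((w - 1) * s2) >= t * d + sig / (2 * S) * A + ep * ((s2 / S) / 2 * N) + ep * (t^2 * s2 / 2)
   + ep * ((w - 1) * ((t + y)^2 * s2 / 2))"
 proof -
  have p1: "P1 >= ep * ((s2 / S) / 2 * N - 2 * B / (s2 / S) * A)"
  proof -
   have "ep * P1 <= P1" using ep P1nn by (simp add: mult_left_le_one_le)
   moreover have "ep * P1 >= ep * ((s2 / S) / 2 * N - 2 * B / (s2 / S) * A)" using P1b ep by (intro mult_left_mono) auto
   ultimately show ?thesis by linarith
  qed
  have p2: "P2 x >= ep * (x^2 * s2 / 2 - K * A)" for x
  proof -
   have "ep * P2 x <= P2 x" using ep P2nn by (simp add: mult_left_le_one_le)
   moreover have "ep * P2 x >= ep * (x^2 * s2 / 2 - K * A)" using P2b ep unfolding K_def by (intro mult_left_mono) auto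
   ultimately show ?thesis by linarith
  qed
  have p3: "(w - 1) * P2 (t + y) >= (w - 1) * (ep * ((t + y)^2 * s2 / 2 - K * A))"
   using p2 w1 by (intro mult_left_mono) auto
  have p4: "ep * (2 * B / (s2 / S) + w * K) * A <= sig / (2 * S) * A" using slack Ann by (intro mult_right_mono) auto
  have p5: "sig / S * A = sig / (2 * S) * A + sig / (2 * S) * A" using S(2) by (simp add: field_simps)
  have q1: "ep * ((s2 / S) / 2 * N - 2 * B / (s2 / S) * A) = ep * ((s2 / S) / 2 * N) - ep * (2 * B / (s2 / S)) * A"
   by (simp only: right_diff_distrib mult.assoc)
  have q2: "ep * (t^2 * s2 / 2 - K * A) = ep * (t^2 * s2 / 2) - ep * K * A" by (simp only: right_diff_distrib mult.assoc)
  have q3: "(w - 1) * (ep * ((t + y)^2 * s2 / 2 - K * A)) = ep * ((w - 1) * ((t + y)^2 * s2 / 2)) - (w * (ep * K * A) - ep * K * A)"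
   by (simp add: algebra_simps)
  have q4: "ep * (2 * B / (s2 / S) + w * K) * A = ep * (2 * B / (s2 / S)) * A + w * (ep * K * A)"
   by (simp only: distrib_left distrib_right mult_ac)
  have q5: "2 * y^2 * ((w - 1) * s2) = 2 * (w - 1) * y^2 * s2" by simp
  show ?thesis unfolding Eid p5 q5 using p1[unfolded q1] p2[of t, unfolded q2] p3[unfolded q3] p4[unfolded q4] by linarith
 qed
 \<comment> \<open>Half of the gain in \<open>t^2\<close> pays for the product \<open>t * d\<close>,
   at the price of a multiple of \<open>d^2\<close>.\<close>
 have coreR: "E - 2 * y^2 * ((w - 1) * s2) >= de * R - (L / ep) * d^2"
 proof -
  have "1 / (2 * L^2) <= sig / (2 * S)"
  proof -
   have "(1 / L) / (2 * L) <= sig / (2 * S)" using bd(7) bd(1) S(2) Lpos sigpos by (intro frac_le) auto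
   then show ?thesis by (simp add: sq_eq)
  qed
  moreover have "de <= 1 / (2 * L^2)" using ep Lpos by (simp add: de_def field_simps)
  ultimately have a1: "de * A <= sig / (2 * S) * A" using Ann by (intro mult_right_mono) auto
  have "de <= ep * ((1 / L^2) / 2)" using ep Lpos by (simp add: de_def field_simps)
  also have "... <= ep * ((s2 / S) / 2)" using kapL ep by (intro mult_left_mono) auto
  finally have "de * N <= ep * ((s2 / S) / 2) * N" using Nnn by (rule mult_right_mono)
  then have a2: "de * N <= ep * ((s2 / S) / 2 * N)" by (simp only: mult.assoc)
  have dl: "de <= ep / (4 * L)" unfolding de_def using ep L by (intro divide_left_mono) (auto simp: sq_eq)
  define x where "x = (ep / (4 * L)) * t^2"
  define e where "e = (L / ep) * d^2"
  have "ep * (t^2 * (1 / L) / 2) <= ep * (t^2 * s2 / 2)" using bd(2) ep by (intro mult_left_mono divide_right_mono) auto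
  moreover have "ep * (t^2 * (1 / L) / 2) = 2 * x" by (simp add: x_def)
  ultimately have f1: "2 * x <= ep * (t^2 * s2 / 2)" by linarith
  have "2 * \<bar>t * d\<bar> <= (ep / (2 * L)) * t^2 + d^2 / (ep / (2 * L))" using ep Lpos by (intro young) auto
  moreover have "(ep / (2 * L)) * t^2 = 2 * x" by (simp add: x_def)
  moreover have "d^2 / (ep / (2 * L)) = 2 * e" by (simp add: e_def)
  ultimately have f2: "2 * \<bar>t * d\<bar> <= 2 * x + 2 * e" by simp
  have f3: "t * d >= - \<bar>t * d\<bar>" by simp
  have f4: "de * t^2 <= x" unfolding x_def using dl by (rule mult_right_mono) simp
  have a3: "de * t^2 - (L / ep) * d^2 <= t * d + ep * (t^2 * s2 / 2)" unfolding e_def[symmetric] using f1 f2 f3 f4 by linarith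
  have "de * ((w - 1) * (t + y)^2) <= (ep / (2 * L)) * ((w - 1) * (t + y)^2)"
   using dl w1 ep Lpos by (intro mult_right_mono mult_nonneg_nonneg) (auto simp: field_simps)
  also have "... = ep * ((w - 1) * ((t + y)^2 * (1 / L) / 2))" by simp
  also have "... <= ep * ((w - 1) * ((t + y)^2 * s2 / 2))"
   using bd(2) w1 ep by (intro mult_left_mono divide_right_mono) auto
  finally have a4: "de * ((w - 1) * (t + y)^2) <= ep * ((w - 1) * ((t + y)^2 * s2 / 2))" .
  show ?thesis using core a1 a2 a3 a4 unfolding R_def by (simp add: distrib_left)
 qed
 have Rnn: "R >= 0" "A <= R" "N <= R" "t^2 <= R" "(w - 1) * (t + y)^2 <= R" unfolding R_def using Ann Nnn w1 by auto
 have zzb: "zz <= L * N"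
 proof -
  have "zz <= S * N" unfolding zz_def N_def sum_distrib_left
  proof (intro sum_mono)
   fix j assume j: "j : H"
   show "(z j)^2 <= S * ((z j)^2 / mu j)"
   proof (cases "mu j = 0")
    case True then show ?thesis using suppz j by simp
   next
    case False
    then have "(z j)^2 = mu j * ((z j)^2 / mu j)" by simp
    also have "... <= S * ((z j)^2 / mu j)" using mule[OF j] mu[OF j] by (intro mult_right_mono) auto
    finally show ?thesis .
   qed
  qed
  also have "... <= L * N" using bd(1) Nnn by (intro mult_right_mono) auto
  finally show ?thesis .
 qed
 have NNb: "(\<Sum>j\<in>H. \<Sum>k\<in>H. (Z j k)^2) <= 2 * L * A + 2 * L^2 * t^2"
 proof -
  have "\<bar>t * g\<bar> <= sqrt (t^2 * Q * NY)"
  proof (rule real_le_rsqrt)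
   have "\<bar>t * g\<bar>^2 = t^2 * g^2" by (simp add: power_mult_distrib)
   also have "... <= t^2 * (Q * NY)" using g2 by (intro mult_left_mono) auto
   finally show "\<bar>t * g\<bar>^2 <= t^2 * Q * NY" by (simp add: mult.assoc)
  qed
  also have "... <= (t^2 * Q + NY) / 2" using Qnn NYnn by (intro arith_geo_mean_sqrt) auto
  finally have tg: "2 * t * g <= t^2 * Q + NY" using abs_ge_self[of "t * g"] by (simp add: mult.assoc)
  have "(\<Sum>j\<in>H. \<Sum>k\<in>H. (Z j k)^2) <= 2 * NY + 2 * (t^2 * Q)" unfolding NN using tg by linarith
  moreover have "NY <= L * A" using NYb bd(1) Ann by (meson mult_right_mono order_trans)
  moreover have "t^2 * Q <= t^2 * L^2"
   using QS S0 by (intro mult_left_mono) (auto simp: sq_eq)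
  ultimately show ?thesis by (simp add: algebra_simps)
 qed
 \<comment> \<open>No square in the form controls \<open>Z11\<close>. It is recovered from
   \<open>d\<close>, in which its coefficient \<open>S\<close> is bounded below because
   \<open>s2\<close> is.\<close>
 have Z11b: "Z11^2 <= 3 * L * d^2 + 42 * L ^ 6 * R"
 proof -
  have sz: "S * Z11 = d + (- (a * S * t)) + 2 * bz + (- (2 * s2 * t)) + w * g + (- (2 * (w - 1) * s2 * (t + y)))"
   unfolding d sm bz_def by (simp add: algebra_simps)
  have six: "(x1 + x2 + x3 + x4 + x5 + x6)^2 <= 6 * (x1^2 + x2^2 + x3^2 + x4^2 + x5^2 + x6^2)" for x1 x2 x3 x4 x5 x6 :: real
  proof -
   have "6 * (x1^2 + x2^2 + x3^2 + x4^2 + x5^2 + x6^2) - (x1 + x2 + x3 + x4 + x5 + x6)^2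
    = (x1-x2)^2 + (x1-x3)^2 + (x1-x4)^2 + (x1-x5)^2 + (x1-x6)^2 + (x2-x3)^2 + (x2-x4)^2 + (x2-x5)^2 + (x2-x6)^2
    + (x3-x4)^2 + (x3-x5)^2 + (x3-x6)^2 + (x4-x5)^2 + (x4-x6)^2 + (x5-x6)^2"
    by (simp add: sq_eq algebra_simps)
   also have "... >= 0" by simp
   finally show ?thesis by simp
  qed
  have "2 * s2 = S * S - Q" using s2 by (simp add: sq_eq)
  then have s2L: "s2 <= L^2" unfolding sq_eq using S0 Qnn s2pos by linarith
  have b1: "(a * S * t)^2 <= L ^ 5 * R"
  proof -
   have "a^2 <= L^2" using bd(5) by (simp add: abs_le_square_iff[symmetric])
   moreover have "S^2 <= L^2" using bd(1) S(2) by (intro power_mono) auto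
   ultimately have "a^2 * S^2 * t^2 <= L^2 * L^2 * R" using Rnn by (intro mult_mono) auto
   also have "... <= L ^ 5 * R" using pw[of 4 5] Rnn by (intro mult_right_mono) (auto simp: eval_nat_numeral)
   finally show ?thesis by (simp add: power_mult_distrib)
  qed
  have b2: "(2 * bz)^2 <= 4 * L ^ 5 * R"
  proof -
   have "bz^2 <= B * zz" unfolding bz_def B zz_def by (rule sum_cs)
   also have "... <= L * (L * R)"
   proof (rule mult_mono)
    show "zz <= L * R" using zzb Rnn(3) Lpos by (smt (verit) mult_left_mono)
    show "0 <= zz" unfolding zz_def by (intro sum_nonneg) auto
   qed (use bd Bnn Lpos in auto)
   also have "... <= L ^ 5 * R" using mult_right_mono[OF pw[of 2 5] Rnn(1)] by (simp add: sq_eq mult.assoc)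
   finally show ?thesis by (simp add: power_mult_distrib)
  qed
  have b3: "(2 * s2 * t)^2 <= 4 * L ^ 5 * R"
  proof -
   have "s2^2 * t^2 <= (L^2)^2 * R" using s2L s2pos Rnn by (intro mult_mono power_mono) auto
   also have "... <= L ^ 5 * R" using pw[of 4 5] Rnn by (intro mult_right_mono) (auto simp: eval_nat_numeral)
   finally show ?thesis by (simp add: power_mult_distrib)
  qed
  have b4: "(w * g)^2 <= L ^ 5 * R"
  proof -
   have "g^2 <= L ^ 3 * R" using g2' bd(1) S(2) Ann Rnn Lpos by (smt (verit) mult_mono power_mono zero_le_power)
   then have "w^2 * g^2 <= L^2 * (L ^ 3 * R)" using bd(3,4) by (intro mult_mono power_mono) auto
   then show ?thesis by (simp add: power_mult_distrib eval_nat_numeral algebra_simps)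
  qed
  have b5: "(2 * (w - 1) * s2 * (t + y))^2 <= 4 * L ^ 5 * R"
  proof -
   have wR: "(w - 1) * ((w - 1) * (t + y)^2) <= L * R" using bd(4) w1 Rnn Lpos by (intro mult_mono) auto
   have "s2^2 * ((w - 1) * ((w - 1) * (t + y)^2)) <= (L^2)^2 * (L * R)"
    using s2L s2pos w1 by (intro mult_mono[OF _ wR] power_mono) auto
   also have "... = L ^ 5 * R" by (simp add: eval_nat_numeral)
   finally show ?thesis by (simp add: power_mult_distrib sq_eq algebra_simps)
  qed
  have lin: "x <= 6 * (e + x1 + x2 + x3 + x4 + x5) ==> x1 <= r ==> x2 <= 4 * r ==> x3 <= 4 * r ==> x4 <= r ==> x5 <= 4 * r
   ==> x <= 6 * (e + 14 * r)" for x e x1 x2 x3 x4 x5 r :: real by (simp add: distrib_left)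
  have k: "4 * L ^ 5 * R = 4 * (L ^ 5 * R)" by simp
  have "(S * Z11)^2 <= 6 * (d^2 + 14 * (L ^ 5 * R))"
   unfolding sz
   by (rule lin[OF six[of d "- (a * S * t)" "2 * bz" "- (2 * s2 * t)" "w * g" "- (2 * (w - 1) * s2 * (t + y))", unfolded power2_minus]
    b1 b2[unfolded k] b3[unfolded k] b4 b5[unfolded k]])
  moreover have "(2 / L) * Z11^2 <= S^2 * Z11^2" using S2 by (intro mult_right_mono) auto
  ultimately have "(2 / L) * Z11^2 <= 6 * (d^2 + 14 * (L ^ 5 * R))" by (simp add: power_mult_distrib)
  then have "(L / 2) * ((2 / L) * Z11^2) <= (L / 2) * (6 * (d^2 + 14 * (L ^ 5 * R)))" using Lpos by (intro mult_left_mono) auto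
  then show ?thesis using Lpos by (simp add: eval_nat_numeral algebra_simps)
 qed
 show "de / (50 * L ^ 6) * (Z11^2 + 2 * (\<Sum>j\<in>H. (z j)^2) + (\<Sum>j\<in>H. \<Sum>k\<in>H. (Z j k)^2)) + 2 * y^2 * ((w - 1) * s2) - (L / ep + de) * d^2 <=
  cone_form H mu b z Z a w y Z11 S s2 t smZ"
 proof -
  \<comment> \<open>42 from \<open>Z11b\<close>, 2 from the column and 4 from the block, rounded up
    to 50.\<close>
  have "Z11^2 + 2 * zz + (\<Sum>j\<in>H. \<Sum>k\<in>H. (Z j k)^2) <= 3 * L * d^2 + 50 * L ^ 6 * R"
  proof -
   have "L * x <= L ^ 6 * R" if "x <= R" "x >= 0" for x using pw[of 1 6] that Lpos by (intro mult_mono) auto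
   moreover have "L^2 * x <= L ^ 6 * R" if "x <= R" "x >= 0" for x using pw[of 2 6] that Lpos by (intro mult_mono) auto
   ultimately have "L * N <= L ^ 6 * R" "L * A <= L ^ 6 * R" "L^2 * t^2 <= L ^ 6 * R"
    using Rnn Nnn Ann by auto
   moreover have "2 * L * A = 2 * (L * A)" "2 * L^2 * t^2 = 2 * (L^2 * t^2)"
    "42 * L ^ 6 * R = 42 * (L ^ 6 * R)" "50 * L ^ 6 * R = 50 * (L ^ 6 * R)" by simp_all
   moreover have "L ^ 6 * R >= 0" using Rnn Lpos by simp
   ultimately show ?thesis using Z11b zzb NNb by linarith
  qed
  then have "de / (50 * L ^ 6) * (Z11^2 + 2 * zz + (\<Sum>j\<in>H. \<Sum>k\<in>H. (Z j k)^2))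
   <= de / (50 * L ^ 6) * (3 * L * d^2 + 50 * L ^ 6 * R)"
   using de Lpos by (intro mult_left_mono) auto
  also have "... = de * (3 * L / (50 * L ^ 6)) * d^2 + de * R" using Lpos by (simp add: field_simps)
  also have "... <= de * 1 * d^2 + de * R"
  proof -
   have "3 * L <= 50 * L ^ 6" using pw[of 1 6] Lpos by simp
   then have "3 * L / (50 * L ^ 6) <= 1" using Lpos by (simp add: divide_le_eq_1)
   then show ?thesis using de by (intro add_right_mono mult_right_mono mult_left_mono) auto
  qed
  finally have "de / (50 * L ^ 6) * (Z11^2 + 2 * zz + (\<Sum>j\<in>H. \<Sum>k\<in>H. (Z j k)^2)) <= de * d^2 + de * R" by simp
  then show ?thesis using coreR unfolding E_def[symmetric] unfolding zz_def[symmetric] by (simp add: distrib_right)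
 qed
qed

section \<open>The curvature equation as a polynomial equation\<close>

text \<open>The polarised second elementary symmetric function of the eigenvalues.\<close>

definition S2 :: "real^'n^'n => real^'n^'n => real" where
 "S2 U V = (trace U * trace V - U \<bullet> V) / 2"

text \<open>The polarisation, in both arguments, of \<open>p \<bullet> T\<^sub>2(U) p\<close>, where \<open>T\<^sub>2\<close> is the second Newton tensor.\<close>
definition Theta :: "real^'n => real^'n => real^'n^'n => real^'n^'n => real" where
 "Theta p r U V = ((p \<bullet> r) * (trace U * trace V - U \<bullet> V) - trace U * (p \<bullet> (V *v r)) - trace V * (p \<bullet> (U *v r))
  + (U *v p) \<bullet> (V *v r) + (U *v r) \<bullet> (V *v p)) / 2"

text \<open>The curvature equation cleared of denominators: with p = Du and A = D^2u,
  \<open>Phi p A A\<close> is (1 + |Du|^2)^2 times sigma_2 of the principal curvatures. The exponent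
  -2 in the equation is the one that makes the right side constant.\<close>

definition Phi :: "real^'n => real^'n^'n => real^'n^'n => real" where
 "Phi p U V = S2 U V + Theta p p U V"

text \<open>Tested on an eigenvector of \<open>B\<close> with eigenvalue l: \<open>C\<close> maps
  the difference \<open>r\<close> of \<open>C *v b i\<close> and l times \<open>b i\<close> to -l
  times itself, so positivity kills \<open>r\<close> if l > 0. For l = 0 the norm of
  \<open>C *v b i\<close> vanishes.\<close>

lemma pos_semidef_sqrt_unique:
 fixes B C :: "real^'n^'n"
 assumes B: "pos_semidef B" and C: "pos_semidef C" and eq: "B ** B = C ** C"
 shows "B = C"
proof -
 have tB: "transpose B = B" and tC: "transpose C = C" using B C by (auto simp: pos_semidef_def)
 obtain b l where b: "orthobasis b" and l: "!!i. B *v b i = l i *R b i" using symmetric_eigenbasis[OF tB] by blast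
 show ?thesis
 proof (rule orthobasis_ext[OF b])
  fix i
  have bi: "b i \<bullet> b i = 1" using b by (simp add: orthobasis_def)
  have li: "l i >= 0" by (rule pos_semidef_eigenvalue_nonneg[OF B l bi])
  have CC: "C *v (C *v b i) = (l i * l i) *R b i"
  proof -
   have "C *v (C *v b i) = B *v (B *v b i)" by (simp add: matrix_vector_mul_assoc eq)
   then show ?thesis by (simp add: l mv_scaleR)
  qed
  define r where "r = C *v b i - l i *R b i"
  have "C *v r = - (l i *R r)"
   by (simp add: r_def matrix_vector_mult_diff_distrib CC mv_scaleR scaleR_diff_right)
  moreover have "0 <= r \<bullet> (C *v r)" using C by (simp add: pos_semidef_def)
  ultimately have "l i * (r \<bullet> r) <= 0" by simp
  moreover have "(C *v b i) \<bullet> (C *v b i) = l i * l i" using symmetric_inner[OF tC, of "b i" "C *v b i"] CC bi by simp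
  ultimately have "r = 0"
  proof (cases "l i = 0")
   case False
   then have "r \<bullet> r <= 0" using \<open>l i * (r \<bullet> r) <= 0\<close> li by (simp add: mult_le_0_iff)
   then show ?thesis by (metis inner_eq_zero_iff inner_ge_zero order_antisym)
  qed (simp add: r_def)
  then show "B *v b i = C *v b i" by (simp add: r_def l)
 qed
qed

lemma mat_sqrt_eq: "pos_semidef B ==> mat_sqrt (B ** B) = B"
 unfolding mat_sqrt_def by (rule the_equality) (auto intro: pos_semidef_sqrt_unique)

lemma matrix_inv_eqI: "A ** C = mat 1 ==> matrix_inv A = C" for A C :: "real^'n^'n"
 unfolding matrix_inv_def
proof (rule some_equality)
 assume "A ** C = mat 1"
 then show "A ** C = mat 1 \<and> C ** A = mat 1" by (simp add: matrix_left_right_inverse)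
next
 fix D assume "A ** C = mat 1" "A ** D = mat 1 \<and> D ** A = mat 1"
 then show "D = C" by (metis matrix_mul_assoc matrix_mul_lid matrix_mul_rid)
qed

lemma mat1_outer_prod_mult:
 fixes p :: "real^'n"
 shows "(mat 1 + a *R outer_prod p p) ** (mat 1 + c *R outer_prod p p) = mat 1 + (a + c + a * c * (p \<bullet> p)) *R outer_prod p p"
proof -
 have "((mat 1 + a *R outer_prod p p) ** (mat 1 + c *R outer_prod p p)) *v x = (mat 1 + (a + c + a * c * (p \<bullet> p)) *R outer_prod p p) *v x" for x
  by (simp add: mv_assoc add_mv scaleR_mv outer_prod_mult
    mv_add mv_scaleR inner_add_right algebra_simps)
 then show ?thesis by (simp add: matrix_eq)
qed

lemma transpose_mat1_outer: "transpose (mat 1 + a *R outer_prod p p) = mat 1 + a *R outer_prod p p"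
 by (rule symmetricI) (simp add: mat_def outer_prod_def mult.commute)

text \<open>Among the matrices I + a p p^T multiplication is arithmetic in the scalar a. The square
  root has a = 1 / (w + 1), the positive solution of 2 a + a^2 |p|^2 = 1 with |p|^2 = w^2 -
  1.\<close>

lemma inverse_sqrt_metric:
 fixes p :: "real^'n"
 defines "w \<equiv> sqrt (1 + p \<bullet> p)"
 shows "matrix_inv (mat_sqrt (mat 1 + outer_prod p p)) = mat 1 + (- 1 / (w * (w + 1))) *R outer_prod p p"
proof -
 have w2: "w * w = 1 + p \<bullet> p" by (simp add: w_def add_nonneg_nonneg)
 have w1: "w >= 1" by (simp add: w_def)
 then have nz: "w ~= 0" "w + 1 ~= 0" "1 + w ~= 0" by auto
 define Q where "Q = mat 1 + (1 / (w + 1)) *R outer_prod p p"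
 have pp: "p \<bullet> p = w * w - 1" using w2 by simp
 have "pos_semidef Q"
 proof -
  have "0 <= z \<bullet> (Q *v z)" for z
   using w1 by (simp add: Q_def add_mv scaleR_mv outer_prod_mult inner_add_right
    inner_commute[of z p] flip: sq_eq)
  then show ?thesis by (simp add: pos_semidef_def Q_def transpose_mat1_outer)
 qed
 moreover have "Q ** Q = mat 1 + outer_prod p p"
 proof -
  have "1 / (w + 1) + 1 / (w + 1) + 1 / (w + 1) * (1 / (w + 1)) * (p \<bullet> p) = 1"
   unfolding pp using nz by (simp add: divide_simps) (simp add: algebra_simps)
  then show ?thesis unfolding Q_def mat1_outer_prod_mult by simp
 qed
 ultimately have "mat_sqrt (mat 1 + outer_prod p p) = Q" using mat_sqrt_eq by metis
 moreover have "Q ** (mat 1 + (- 1 / (w * (w + 1))) *R outer_prod p p) = mat 1"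
 proof -
  have "1 / (w + 1) + (- 1 / (w * (w + 1))) + 1 / (w + 1) * (- 1 / (w * (w + 1))) * (p \<bullet> p) = 0"
  proof -
   have "1 / (w + 1) * (- 1 / (w * (w + 1))) * (p \<bullet> p) = - ((w * w - 1) / (w + 1)) / (w * (w + 1))" unfolding pp by simp
   also have "(w * w - 1) / (w + 1) = w - 1" using nz by (simp add: divide_simps) (simp add: algebra_simps)
   finally have e: "1 / (w + 1) * (- 1 / (w * (w + 1))) * (p \<bullet> p) = - (w - 1) / (w * (w + 1))" by simp
   show ?thesis unfolding e using nz by (simp add: divide_simps)
  qed
  then show ?thesis unfolding Q_def mat1_outer_prod_mult by simp
 qed
 ultimately show ?thesis using matrix_inv_eqI by metis
qed

text \<open>In the traces \<open>R\<close> enters only through \<open>R ** R = G\<close>, the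
  inverse of the metric: by cyclicity the symmetric functions of \<open>K\<close> are, up to powers
  of \<open>w\<close>, those of \<open>A ** G\<close>, a rank-one perturbation of \<open>A\<close>.
  The fourth claim expresses the ellipticity form by \<open>K\<close> in the transformed direction
  \<open>R *v e\<close>.\<close>

lemma graph_curvature_identities:
 fixes p :: "real^'n" and A :: "real^'n^'n"
 assumes A: "transpose A = A"
 defines "w \<equiv> sqrt (1 + p \<bullet> p)"
 defines "R \<equiv> matrix_inv (mat_sqrt (mat 1 + outer_prod p p))"
 defines "K \<equiv> (1 / w) *R (R ** A ** R)"
 shows "transpose K = K"
  and "w * trace K = trace A - (p \<bullet> (A *v p)) / w^2"
  and "w ^ 4 * ((trace K)^2 - K \<bullet> K) / 2 = Phi p A A"
  and "!!e. Phi p A (outer_prod e e) = w ^ 3 / 2 * (trace K * ((R *v e) \<bullet> (R *v e)) - (R *v e) \<bullet> (K *v (R *v e)))"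
  and "!!e. e ~= 0 ==> R *v e ~= 0"
proof -
 have w2: "w^2 = 1 + p \<bullet> p" by (simp add: w_def add_nonneg_nonneg)
 have w1: "w >= 1" by (simp add: w_def)
 then have nz: "w ~= 0" "w + 1 ~= 0" "1 + w ~= 0" by auto
 have p2: "p \<bullet> p = w^2 - 1" using w2 by simp
 have R: "R = mat 1 + (- 1 / (w * (w + 1))) *R outer_prod p p" unfolding R_def w_def by (rule inverse_sqrt_metric)
 have tR: "transpose R = R" unfolding R by (rule transpose_mat1_outer)
 define G where "G = mat 1 + (- 1 / w^2) *R outer_prod p p"
 have RR: "R ** R = G"
 proof -
  have pp: "p \<bullet> p = (w - 1) * (w + 1)" using w2 by (simp add: sq_eq algebra_simps)
  have e: "- 1 / (w * (w + 1)) + (- 1 / (w * (w + 1))) + (- 1 / (w * (w + 1))) * (- 1 / (w * (w + 1))) * (p \<bullet> p) = - 1 / w^2"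
  proof -
   have e: "(- 1 / (w * (w + 1))) * (- 1 / (w * (w + 1))) * (p \<bullet> p) = (w - 1) / (w * w * (w + 1))"
    unfolding pp using nz by (simp add: divide_simps)
   show ?thesis unfolding e using nz by (simp add: divide_simps sq_eq)
  qed
  show ?thesis using e unfolding R mat1_outer_prod_mult G_def by simp
 qed
 have Gv: "G *v x = x - ((p \<bullet> x) / w^2) *R p" for x
  by (simp add: G_def add_mv diff_mv scaleR_mv outer_prod_mult)
 show tK: "transpose K = K"
  unfolding K_def by (simp add: transpose_scalar matrix_transpose_mul tR A matrix_mul_assoc)
 define X where "X = A ** G"
 have Xv: "X *v x = A *v x - ((p \<bullet> x) / w^2) *R (A *v p)" for x
  by (simp add: X_def mv_assoc Gv matrix_vector_mult_diff_distrib mv_scaleR)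
 have X: "X = A - (1 / w^2) *R outer_prod (A *v p) p"
 proof -
  have "X *v x = (A - (1 / w^2) *R outer_prod (A *v p) p) *v x" for x
   by (simp add: Xv diff_mv scaleR_mv outer_prod_mult)
  then show ?thesis by (simp add: matrix_eq)
 qed
 have trsc: "trace (c *R Y) = c * trace Y" for c and Y :: "real^'n^'n" by (simp add: trace_def sum_distrib_left)
 have trRAR: "trace (R ** A ** R) = trace X"
 proof -
  have "trace (R ** A ** R) = trace (R ** (R ** A))" by (rule trace_mul_sym)
  also have "... = trace (G ** A)" by (simp add: matrix_mul_assoc RR)
  also have "... = trace X" unfolding X_def by (rule trace_mul_sym)
  finally show ?thesis .
 qed
 have trX: "trace X = trace A - (p \<bullet> (A *v p)) / w^2"
  by (simp add: X trace_sub trsc trace_outer_prod inner_commute)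
 show wt: "w * trace K = trace A - (p \<bullet> (A *v p)) / w^2"
  using w1 by (simp add: K_def trsc trRAR trX)
 have trXX: "trace (X ** X) = A \<bullet> A - 2 / w^2 * ((A *v p) \<bullet> (A *v p)) + (1 / w^2)^2 * (p \<bullet> (A *v p))^2"
 proof -
  have b: "orthobasis (%i. axis i 1 :: real^'n)" by (simp add: orthobasis_def inner_axis_axis)
  have "trace (X ** X) = transpose X \<bullet> X" by (simp add: matrix_inner_columns)
  also have "transpose X = A - (1 / w^2) *R outer_prod p (A *v p)"
   by (simp add: X vec_eq_iff transpose_def outer_prod_def symmetric_component[OF A] mult.commute)
  also have "... \<bullet> X = A \<bullet> A - 1 / w^2 * (A \<bullet> outer_prod (A *v p) p) - 1 / w^2 * (A \<bullet> outer_prod p (A *v p)) + (1 / w^2)^2 * (outer_prod p (A *v p) \<bullet> outer_prod (A *v p) p)"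
   by (simp add: X inner_diff_left inner_diff_right inner_commute[of "outer_prod p (A *v p)" A] sq_eq algebra_simps)
  also have "A \<bullet> outer_prod (A *v p) p = (A *v p) \<bullet> (A *v p)" by (simp add: inner_outer_prod)
  also have "A \<bullet> outer_prod p (A *v p) = (A *v p) \<bullet> (A *v p)" by (simp add: inner_outer_prod symmetric_inner[OF A])
  also have "outer_prod p (A *v p) \<bullet> outer_prod (A *v p) p = (p \<bullet> (A *v p))^2"
   by (simp add: inner_outer_prod outer_prod_mult sq_eq inner_commute)
  finally show ?thesis by simp
 qed
 have KK: "w^2 * (K \<bullet> K) = trace (X ** X)"
 proof -
  have "K \<bullet> K = trace (K ** K)" by (simp add: matrix_inner_columns tK)
  also have "K ** K = (1 / w^2) *R ((R ** A ** R) ** (R ** A ** R))"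
   by (simp add: K_def sq_eq matrix_scalar_ac scalar_matrix_assoc[symmetric] scalar_mult_eq_scaleR vec_eq_iff matrix_matrix_mult_def sum_distrib_left mult_ac)
  also have "(R ** A ** R) ** (R ** A ** R) = R ** (A ** G ** A ** R)" by (simp add: matrix_mul_assoc[symmetric] RR[symmetric])
  also have "trace ((1 / w^2) *R (R ** (A ** G ** A ** R))) = 1 / w^2 * trace ((A ** G ** A ** R) ** R)"
   by (simp add: trsc trace_mul_sym[of R])
  also have "(A ** G ** A ** R) ** R = X ** X" by (simp add: X_def matrix_mul_assoc[symmetric] RR)
  finally show ?thesis using w1 by simp
 qed
 have Phid: "Phi p A A = (w^2 * ((trace A)^2 - A \<bullet> A) - 2 * trace A * (p \<bullet> (A *v p)) + 2 * ((A *v p) \<bullet> (A *v p))) / 2"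
  by (simp add: Phi_def S2_def Theta_def p2 sq_eq field_simps)
 show "w ^ 4 * ((trace K)^2 - K \<bullet> K) / 2 = Phi p A A"
 proof -
  have "w ^ 4 * ((trace K)^2 - K \<bullet> K) = w^2 * ((w * trace K)^2 - w^2 * (K \<bullet> K))"
   by (simp add: power_mult_distrib eval_nat_numeral algebra_simps)
  also have "... = w^2 * ((trace A - (p \<bullet> (A *v p)) / w^2)^2 - (A \<bullet> A - 2 / w^2 * ((A *v p) \<bullet> (A *v p)) + (1 / w^2)^2 * (p \<bullet> (A *v p))^2))"
   by (simp only: wt KK trXX)
  also have "... = w^2 * ((trace A)^2 - A \<bullet> A) - 2 * trace A * (p \<bullet> (A *v p)) + 2 * ((A *v p) \<bullet> (A *v p))"
   using w1 by (simp add: power2_diff power_divide right_diff_distrib distrib_left field_simps)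
  finally show ?thesis by (simp add: Phid)
 qed
 show "Phi p A (outer_prod e e) = w ^ 3 / 2 * (trace K * ((R *v e) \<bullet> (R *v e)) - (R *v e) \<bullet> (K *v (R *v e)))" for e
 proof -
  have h2: "(R *v e) \<bullet> (R *v e) = e \<bullet> e - (p \<bullet> e)^2 / w^2"
  proof -
   have "(R *v e) \<bullet> (R *v e) = e \<bullet> (G *v e)" using symmetric_inner[OF tR, of e "R *v e"] by (simp add: matrix_vector_mul_assoc RR)
   then show ?thesis by (simp add: Gv inner_diff_right inner_commute sq_eq)
  qed
  have "K *v x = (1 / w) *R (R *v (A *v (R *v x)))" for x
   by (simp add: K_def scaleR_mv mv_assoc)
  then have "w * ((R *v e) \<bullet> (K *v (R *v e))) = (R *v e) \<bullet> (R *v (A *v (R *v (R *v e))))"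
   using nz by simp
  also have "... = (R *v (R *v e)) \<bullet> (A *v (R *v (R *v e)))" by (rule symmetric_inner[OF tR])
  also have "... = (G *v e) \<bullet> (A *v (G *v e))" by (simp add: matrix_vector_mul_assoc RR)
  also have "... = e \<bullet> (A *v e) - 2 * (p \<bullet> e) / w^2 * (e \<bullet> (A *v p)) + ((p \<bullet> e) / w^2)^2 * (p \<bullet> (A *v p))"
   using symmetric_inner[OF A, of p e]
   by (simp add: Gv matrix_vector_mult_diff_distrib mv_scaleR inner_diff_left inner_diff_right sq_eq inner_commute algebra_simps)
  finally have h3: "w * ((R *v e) \<bullet> (K *v (R *v e))) = e \<bullet> (A *v e) - 2 * (p \<bullet> e) / w^2 * (e \<bullet> (A *v p)) + ((p \<bullet> e) / w^2)^2 * (p \<bullet> (A *v p))" .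
  have "w ^ 3 / 2 * (trace K * ((R *v e) \<bullet> (R *v e)) - (R *v e) \<bullet> (K *v (R *v e)))
   = w^2 / 2 * ((w * trace K) * ((R *v e) \<bullet> (R *v e)) - w * ((R *v e) \<bullet> (K *v (R *v e))))"
   by (simp add: eval_nat_numeral algebra_simps)
  also have "... = w^2 / 2 * ((trace A - (p \<bullet> (A *v p)) / w^2) * (e \<bullet> e - (p \<bullet> e)^2 / w^2) - (e \<bullet> (A *v e) - 2 * (p \<bullet> e) / w^2 * (e \<bullet> (A *v p)) + ((p \<bullet> e) / w^2)^2 * (p \<bullet> (A *v p))))"
   by (simp only: wt h2 h3)
  also have "... = (w^2 * (trace A * (e \<bullet> e) - e \<bullet> (A *v e)) - trace A * (p \<bullet> e)^2 - (e \<bullet> e) * (p \<bullet> (A *v p)) + 2 * (p \<bullet> e) * (e \<bullet> (A *v p))) / 2"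
   using w1 by (simp add: power_divide right_diff_distrib left_diff_distrib distrib_left field_simps)
  also have "... = Phi p A (outer_prod e e)"
   by (simp add: Phi_def S2_def Theta_def p2 trace_outer_prod inner_outer_prod outer_prod_mult inner_commute sq_eq field_simps)
  finally show ?thesis by simp
 qed
 show "R *v e ~= 0" if "e ~= 0" for e
 proof
  assume "R *v e = 0"
  then have "G *v e = 0" by (simp add: RR[symmetric] mv_assoc)
  then have e: "e = ((p \<bullet> e) / w^2) *R p" by (simp add: Gv)
  then have "p \<bullet> e = ((p \<bullet> e) / w^2) * (p \<bullet> p)" by (metis inner_scaleR_right)
  then have "w^2 * (p \<bullet> e) = w^2 * (((p \<bullet> e) / w^2) * (p \<bullet> p))" by (rule arg_cong)
  also have "... = (p \<bullet> e) * (w^2 - 1)" using nz by (simp add: p2)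
  finally have "p \<bullet> e = 0" by (simp add: algebra_simps)
  then show False using e that by simp
 qed
qed

text \<open>For the ellipticity: positivity of \<open>sigma1\<close> and \<open>sigma2\<close> says
  that the norm of \<open>K\<close> is less than its trace, so no eigenvalue reaches the trace and
  \<open>trace K\<close> times the identity minus \<open>K\<close> is positive definite.\<close>

lemma curvature_equation:
 fixes u :: "real^'n => real"
 assumes A: "transpose (hessian u x) = hessian u x"
  and G: "principal_curvatures u x : Gamma2"
  and eq: "sigma2 (principal_curvatures u x) = (1 + (norm (gradient u x))^2) powi (-2)"
 shows "Phi (gradient u x) (hessian u x) (hessian u x) = 1"
  and "!!e. e ~= 0 ==> Phi (gradient u x) (hessian u x) (outer_prod e e) > 0"
proof -
 define p where "p = gradient u x"
 define H where "H = hessian u x"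
 define w where "w = sqrt (1 + p \<bullet> p)"
 define R where "R = matrix_inv (mat_sqrt (mat 1 + outer_prod p p))"
 define K where "K = (1 / w) *R (R ** H ** R)"
 have H: "transpose H = H" using A by (simp add: H_def)
 note ids = graph_curvature_identities[where p = p, OF H, folded w_def R_def, folded K_def]
 have cm: "curvature_matrix u x = K"
  by (simp add: curvature_matrix_def Let_def K_def R_def w_def p_def H_def norm_sq)
 have w1: "w >= 1" by (simp add: w_def)
 have w2: "w^2 = 1 + p \<bullet> p" by (simp add: w_def add_nonneg_nonneg)
 have s1: "sigma1 (principal_curvatures u x) = trace K"
  and s2: "sigma2 (principal_curvatures u x) = ((trace K)^2 - K \<bullet> K) / 2"
  unfolding principal_curvatures_def cm using sigma1_eigenvalues[OF ids(1)] sigma2_eigenvalues[OF ids(1)] by auto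
 have pos: "trace K > 0" "K \<bullet> K < (trace K)^2" using G s1 s2 by (auto simp: Gamma2_def)
 have "(1 + (norm (gradient u x))^2) powi (-2) = 1 / w ^ 4"
  by (simp add: power_int_minus w2[symmetric] p_def[symmetric] norm_sq inverse_eq_divide flip: power_mult)
 then have "w ^ 4 * (((trace K)^2 - K \<bullet> K) / 2) = 1" using eq s2 w1 by simp
 then show "Phi (gradient u x) (hessian u x) (hessian u x) = 1" using ids(3) by (simp add: p_def H_def)
 show "Phi (gradient u x) (hessian u x) (outer_prod e e) > 0" if "e ~= 0" for e
 proof -
  define h where "h = R *v e"
  have h: "h ~= 0" using ids(5)[OF that] by (simp add: h_def)
  have "norm K < trace K"
   using pos by (simp add: norm_eq_sqrt_inner real_less_lsqrt)
  have "h \<bullet> (K *v h) <= norm h * norm (K *v h)" by (rule norm_cauchy_schwarz)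
  also have "... <= norm h * (norm K * norm h)" by (intro mult_left_mono norm_matrix_vector_le) simp
  also have "... = norm K * (h \<bullet> h)" by (simp add: power2_norm_eq_inner[symmetric] sq_eq)
  also have "... < trace K * (h \<bullet> h)" using \<open>norm K < trace K\<close> h by (intro mult_strict_right_mono) auto
  finally have "0 < w ^ 3 / 2 * (trace K * (h \<bullet> h) - h \<bullet> (K *v h))" using w1 by simp
  then show ?thesis using ids(4)[of e] by (simp add: h_def p_def H_def)
 qed
qed

lemma trace_add': "trace (A + C) = trace A + trace C" for A :: "real^'n^'n" by (rule trace_add)
lemma trace_scaleR: "trace (c *R A) = c * trace A" for A :: "real^'n^'n" by (simp add: trace_def sum_distrib_left)
lemma trace_minus: "trace (A - C) = trace A - trace C" for A :: "real^'n^'n" by (rule trace_sub)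

lemmas matrix_linear_simps = trace_add' trace_scaleR trace_minus add_mv diff_mv
 scaleR_mv inner_add_left inner_add_right inner_diff_left inner_diff_right

lemma Theta_add_left: "Theta p r (U + U') V = Theta p r U V + Theta p r U' V"
 by (simp add: Theta_def matrix_linear_simps field_simps)
lemma Theta_scale_left: "Theta p r (c *R U) V = c * Theta p r U V"
 by (simp add: Theta_def matrix_linear_simps field_simps)
lemma Theta_add_right: "Theta p r U (V + V') = Theta p r U V + Theta p r U V'"
 by (simp add: Theta_def matrix_linear_simps field_simps)
lemma Theta_scale_right: "Theta p r U (c *R V) = c * Theta p r U V"
 by (simp add: Theta_def matrix_linear_simps field_simps)
lemma Phi_add_left: "Phi p (U + U') V = Phi p U V + Phi p U' V"
 by (simp add: Phi_def S2_def Theta_add_left matrix_linear_simps field_simps)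
lemma Phi_scale_left: "Phi p (c *R U) V = c * Phi p U V"
 by (simp add: Phi_def S2_def Theta_scale_left matrix_linear_simps field_simps)
lemma Phi_add_right: "Phi p U (V + V') = Phi p U V + Phi p U V'"
 by (simp add: Phi_def S2_def Theta_add_right matrix_linear_simps field_simps)
lemma Phi_scale_right: "Phi p U (c *R V) = c * Phi p U V"
 by (simp add: Phi_def S2_def Theta_scale_right matrix_linear_simps field_simps)
lemma Theta_commute: "Theta p p U V = Theta p p V U"
 by (simp add: Theta_def inner_commute field_simps)
lemma Phi_commute: "Phi p U V = Phi p V U"
 by (simp add: Phi_def S2_def Theta_commute[of p U] inner_commute mult.commute)
lemma Phi_minus_left: "Phi p (U - U') V = Phi p U V - Phi p U' V"
 using Phi_add_left[of p "U - U'" U' V] by simp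
lemma Phi_minus_right: "Phi p U (V - V') = Phi p U V - Phi p U V'"
 using Phi_add_right[of p U "V - V'" V'] by simp
lemma Theta_minus_left: "Theta p r (U - U') V = Theta p r U V - Theta p r U' V"
 using Theta_add_left[of p r "U - U'" U' V] by simp
lemma Theta_minus_right: "Theta p r U (V - V') = Theta p r U V - Theta p r U V'"
 using Theta_add_right[of p r U "V - V'" V'] by simp
lemma Phi_0_right: "Phi p U 0 = 0" using Phi_scale_right[of p U 0 0] by simp
lemma Phi_sum_right: "Phi p U (\<Sum>i\<in>I. F i) = (\<Sum>i\<in>I. Phi p U (F i))"
 by (induction I rule: infinite_finite_induct) (simp_all add: Phi_add_right Phi_0_right)

text \<open>\<open>Theta p p\<close> sees a matrix only through its restriction to the complement of
  \<open>p\<close>. As Du is parallel to Dv, the part Dv Dv^T of \<open>M\<close> drops out of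
  it.\<close>

lemma Theta_rank_one_self: "Theta p p (outer_prod q q) V = 0" if "p = c *R q" "transpose V = V"
 using symmetric_inner[OF that(2), of q q]
 by (simp add: that(1) Theta_def trace_outer_prod inner_outer_prod outer_prod_mult inner_commute[of "outer_prod q q"] mv_scaleR
  inner_commute sq_eq algebra_simps)

lemma transpose_add': "transpose (A + C) = transpose A + transpose C" for A :: "real^'n^'n"
 by (simp add: transpose_def vec_eq_iff)
lemma transpose_minus': "transpose (A - C) = transpose A - transpose C" for A :: "real^'n^'n"
 by (simp add: transpose_def vec_eq_iff)
lemma transpose_scaleR': "transpose (c *R A) = c *R transpose A" for A :: "real^'n^'n"
 by (simp add: transpose_def vec_eq_iff)
lemma transpose_sum': "transpose (\<Sum>i\<in>I. F i) = (\<Sum>i\<in>I. transpose (F i))" for F :: "'a => real^'n^'n"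
 by (induction I rule: infinite_finite_induct) (simp_all add: transpose_add', simp_all add: transpose_def vec_eq_iff)

section \<open>Coordinates adapted to the gradient, and the structural inequality\<close>

lemma Phi_nonneg_pos_semidef:
 assumes "!!e. 0 <= Phi p U (outer_prod e e)" "pos_semidef V"
 shows "0 <= Phi p U V"
proof -
 have "transpose V = V" using assms(2) by (simp add: pos_semidef_def)
 then obtain b l where b: "orthobasis b" and l: "!!i. V *v b i = l i *R b i" by (rule symmetric_eigenbasis) blast
 have "l i >= 0" for i using pos_semidef_eigenvalue_nonneg[OF assms(2) l] b by (simp add: orthobasis_def)
 then have "0 <= (\<Sum>i\<in>UNIV. l i * Phi p U (outer_prod (b i) (b i)))" using assms(1) by (intro sum_nonneg) auto
 also have "... = Phi p U (\<Sum>i\<in>UNIV. l i *R outer_prod (b i) (b i))" by (simp add: Phi_sum_right Phi_scale_right)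
 also have "... = Phi p U V" by (simp only: eigenbasis_symmetric_matrix[OF b l, symmetric])
 finally show ?thesis .
qed

text \<open>\<open>m\<close> cannot in general be diagonalised together with the direction of
  \<open>q\<close>, but its compression to the complement can. Subtracting e e^T makes e the only
  direction with a negative eigenvalue, so every eigenbasis of \<open>N\<close> contains it up to
  sign.\<close>

lemma adapted_basis:
 fixes m :: "real^'n^'n" and q :: "real^'n"
 assumes m: "pos_semidef m"
 obtains f i0 where "orthobasis f" "q = norm q *R f i0" "!!j k. j ~= i0 ==> k ~= i0 ==> j ~= k ==> f j \<bullet> (m *v f k) = 0"
proof -
 have tm: "transpose m = m" and mpos: "!!z. 0 <= z \<bullet> (m *v z)" using m by (auto simp: pos_semidef_def)
 obtain e where e: "norm e = 1" "q = norm q *R e"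
 proof (cases "q = 0")
  case True
  show ?thesis by (rule that[of "axis undefined 1"]) (simp_all add: True norm_axis_1)
 next
  case False
  show ?thesis by (rule that[of "(1 / norm q) *R q"]) (simp_all add: False)
 qed
 have ee: "e \<bullet> e = 1" using e by (simp add: norm_eq_1)
 define P where "P = mat 1 - outer_prod e e"
 have Pv: "P *v x = x - (e \<bullet> x) *R e" for x by (simp add: P_def diff_mv outer_prod_mult)
 have tP: "transpose P = P" by (simp add: P_def transpose_minus' transpose_outer_prod transpose_mat)
 define N where "N = P ** m ** P - outer_prod e e"
 have Nv: "N *v x = P *v (m *v (P *v x)) - (e \<bullet> x) *R e" for x
  by (simp add: N_def diff_mv outer_prod_mult mv_assoc)
 have "transpose N = N" by (simp add: N_def transpose_minus' transpose_outer_prod matrix_transpose_mul tP tm matrix_mul_assoc)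
 then obtain f l where f: "orthobasis f" and l: "!!i. N *v f i = l i *R f i" by (rule symmetric_eigenbasis) blast
 have Ne: "N *v e = - e" by (simp add: Nv Pv ee)
 have "\<exists>i. f i \<bullet> e ~= 0"
 proof (rule ccontr)
  assume "\<nexists>i. f i \<bullet> e ~= 0"
  then have "e = 0" using orthobasis_expansion[OF f, of e] by simp
  then show False using ee by simp
 qed
 then obtain i0 where i0: "f i0 \<bullet> e ~= 0" by blast
 have "l i0 * (f i0 \<bullet> e) = - (f i0 \<bullet> e)"
  using symmetric_inner[OF \<open>transpose N = N\<close>, of "f i0" e] by (simp add: Ne l)
 then have l0: "l i0 = - 1" using i0 by (metis mult_cancel_right mult_minus1)
 define x where "x = f i0"
 have "x \<bullet> (N *v x) = - (x \<bullet> x)" by (simp add: x_def l l0)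
 moreover have "x \<bullet> (N *v x) = (P *v x) \<bullet> (m *v (P *v x)) - (e \<bullet> x)^2"
  using symmetric_inner[OF tP, of x "m *v (P *v x)"] by (simp add: Nv inner_diff_right sq_eq inner_commute)
 moreover have "(P *v x) \<bullet> (P *v x) = x \<bullet> x - (e \<bullet> x)^2"
  by (simp add: Pv inner_diff_left inner_diff_right ee sq_eq inner_commute)
 \<comment> \<open>The eigenvalue -1 leaves no room for a component orthogonal to \<open>e\<close>,
   where \<open>N\<close> is nonnegative.\<close>
 ultimately have "(P *v x) \<bullet> (P *v x) <= 0" using mpos[of "P *v x"] by linarith
 then have "P *v x = 0" by (metis inner_eq_zero_iff inner_ge_zero order_antisym)
 then have x: "x = (e \<bullet> x) *R e" by (simp add: Pv)
 have fe: "f j \<bullet> e = 0" if "j ~= i0" for j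
 proof -
  have "0 = f j \<bullet> x" using f that by (simp add: orthobasis_def x_def)
  also have "... = (e \<bullet> x) * (f j \<bullet> e)" by (subst x) simp
  finally show ?thesis using i0 by (simp add: x_def inner_commute)
 qed
 \<comment> \<open>\<open>f i0\<close> may be \<open>- e\<close>; the replacement makes
   \<open>q\<close> a nonnegative multiple of the basis vector.\<close>
 define g where "g = f(i0 := e)"
 have "orthobasis g" using f fe ee by (auto simp: orthobasis_def g_def inner_commute)
 moreover have "q = norm q *R g i0" using e by (simp add: g_def)
 moreover have "g j \<bullet> (m *v g k) = 0" if "j ~= i0" "k ~= i0" "j ~= k" for j k
 proof -
  have Pf: "P *v f i = f i" if "i ~= i0" for i using fe[OF that] by (simp add: Pv inner_commute)
  have "f j \<bullet> (m *v f k) = f j \<bullet> (P *v (m *v (P *v f k)))"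
   using symmetric_inner[OF tP, of "f j" "m *v f k"] that by (simp add: Pf)
  also have "... = f j \<bullet> (N *v f k)" using fe[OF that(2)] by (simp add: Nv inner_commute)
  also have "... = 0" using f that by (simp add: l orthobasis_def)
  finally show ?thesis using that by (simp add: g_def)
 qed
 ultimately show ?thesis by (rule that)
qed

lemma sum_UNIV_remove: "(\<Sum>i\<in>UNIV. g i) = g i0 + (\<Sum>i\<in>-{i0}. g i)" for g :: "'n::finite => real"
 using sum.remove[of UNIV i0 g] by (simp add: Compl_eq_Diff_UNIV)

text \<open>In an orthonormal basis whose vector \<^term>\<open>f i0\<close> is parallel to \<open>p\<close>, the form \<^const>\<open>Theta\<close> only sees
  the block orthogonal to \<open>p\<close>.\<close>
lemma Phi_adapted_coordinates:
 fixes f :: "'n => real^'n" and U V :: "real^'n^'n"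
 assumes f: "orthobasis f" and p: "p = c *R f i0" and U: "transpose U = U" and V: "transpose V = V"
 defines "u \<equiv> %j k. f j \<bullet> (U *v f k)" and "v \<equiv> %j k. f j \<bullet> (V *v f k)" and "H \<equiv> -{i0}"
 shows "Theta p p U V = c^2 * (((\<Sum>j\<in>H. u j j) * (\<Sum>j\<in>H. v j j) - (\<Sum>j\<in>H. \<Sum>k\<in>H. u j k * v j k)) / 2)"
  and "Phi p U V = (u i0 i0 * (\<Sum>j\<in>H. v j j) + v i0 i0 * (\<Sum>j\<in>H. u j j)) / 2 - (\<Sum>j\<in>H. u j i0 * v j i0)
   + (1 + c^2) * (((\<Sum>j\<in>H. u j j) * (\<Sum>j\<in>H. v j j) - (\<Sum>j\<in>H. \<Sum>k\<in>H. u j k * v j k)) / 2)"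
  and "U \<bullet> V = u i0 i0 * v i0 i0 + 2 * (\<Sum>j\<in>H. u j i0 * v j i0) + (\<Sum>j\<in>H. \<Sum>k\<in>H. u j k * v j k)"
proof -
 have us: "u j k = u k j" for j k unfolding u_def using symmetric_inner[OF U] by (simp add: inner_commute)
 have vs: "v j k = v k j" for j k unfolding v_def using symmetric_inner[OF V] by (simp add: inner_commute)
 have tU: "trace U = u i0 i0 + (\<Sum>j\<in>H. u j j)" and tV: "trace V = v i0 i0 + (\<Sum>j\<in>H. v j j)"
  unfolding orthobasis_trace[OF f] H_def u_def v_def by (rule sum_UNIV_remove)+
 show UV: "U \<bullet> V = u i0 i0 * v i0 i0 + 2 * (\<Sum>j\<in>H. u j i0 * v j i0) + (\<Sum>j\<in>H. \<Sum>k\<in>H. u j k * v j k)"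
 proof -
  have "U \<bullet> V = (\<Sum>i\<in>UNIV. \<Sum>j\<in>UNIV. u i j * v i j)" unfolding u_def v_def by (rule orthobasis_matrix_inner2[OF f])
  also have "... = (\<Sum>j\<in>UNIV. u i0 j * v i0 j) + (\<Sum>i\<in>H. \<Sum>j\<in>UNIV. u i j * v i j)" unfolding H_def by (rule sum_UNIV_remove)
  also have "(\<Sum>j\<in>UNIV. u i0 j * v i0 j) = u i0 i0 * v i0 i0 + (\<Sum>j\<in>H. u i0 j * v i0 j)" unfolding H_def by (rule sum_UNIV_remove)
  also have "(\<Sum>i\<in>H. \<Sum>j\<in>UNIV. u i j * v i j) = (\<Sum>i\<in>H. u i i0 * v i i0) + (\<Sum>j\<in>H. \<Sum>k\<in>H. u j k * v j k)"
   unfolding sum.distrib[symmetric] H_def by (rule sum.cong[OF refl]) (rule sum_UNIV_remove)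
  also have "(\<Sum>j\<in>H. u i0 j * v i0 j) = (\<Sum>j\<in>H. u j i0 * v j i0)" by (rule sum.cong[OF refl]) (metis us vs)
  finally show ?thesis by simp
 qed
 have UpV: "(U *v p) \<bullet> (V *v p) = c^2 * (u i0 i0 * v i0 i0 + (\<Sum>j\<in>H. u j i0 * v j i0))"
 proof -
  have "(U *v p) \<bullet> (V *v p) = c^2 * ((U *v f i0) \<bullet> (V *v f i0))" by (simp add: p mv_scaleR sq_eq)
  also have "(U *v f i0) \<bullet> (V *v f i0) = (\<Sum>i\<in>UNIV. u i i0 * v i i0)" unfolding u_def v_def by (simp add: orthobasis_inner[OF f])
  also have "... = u i0 i0 * v i0 i0 + (\<Sum>j\<in>H. u j i0 * v j i0)" unfolding H_def by (rule sum_UNIV_remove)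
  finally show ?thesis .
 qed
 have pp: "p \<bullet> p = c^2" "p \<bullet> (U *v p) = c^2 * u i0 i0" "p \<bullet> (V *v p) = c^2 * v i0 i0"
  using f by (simp_all add: p u_def v_def mv_scaleR sq_eq orthobasis_def)
 show Th: "Theta p p U V = c^2 * (((\<Sum>j\<in>H. u j j) * (\<Sum>j\<in>H. v j j) - (\<Sum>j\<in>H. \<Sum>k\<in>H. u j k * v j k)) / 2)"
  unfolding Theta_def pp UpV tU tV UV by (simp add: field_simps)
 show "Phi p U V = (u i0 i0 * (\<Sum>j\<in>H. v j j) + v i0 i0 * (\<Sum>j\<in>H. u j j)) / 2 - (\<Sum>j\<in>H. u j i0 * v j i0)
   + (1 + c^2) * (((\<Sum>j\<in>H. u j j) * (\<Sum>j\<in>H. v j j) - (\<Sum>j\<in>H. \<Sum>k\<in>H. u j k * v j k)) / 2)"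
  unfolding Phi_def S2_def Th unfolding tU tV UV by (simp add: field_simps)
qed

lemma pair_product_le:
 fixes a b r Q :: real
 assumes "a >= 0" "b >= 0" "r >= 0" "Q <= r^2"
 shows "a * b <= ((a + b + r)^2 - (a^2 + b^2 + Q)) / 2"
proof -
 define E where "E = (a + b + r)^2 - (a^2 + b^2 + Q)"
 have "E = 2 * (a * b) + 2 * (a * r) + 2 * (b * r) + (r^2 - Q)"
  unfolding E_def by (simp add: sq_eq algebra_simps)
 moreover have "a * r >= 0" "b * r >= 0" using assms by auto
 ultimately show ?thesis using assms(4) unfolding E_def[symmetric] by linarith
qed

text \<open>The right side is the second elementary symmetric function of the \<open>mu i\<close>, a
  sum of nonnegative products one of which stands on the left.\<close>

lemma sum_product_pair_ge:
 fixes mu :: "'a => real"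
 assumes "finite I" "j : I" "k : I" "j ~= k" "!!i. i : I ==> mu i >= 0"
 shows "mu j * mu k <= ((\<Sum>i\<in>I. mu i)^2 - (\<Sum>i\<in>I. (mu i)^2)) / 2"
proof -
 define R where "R = I - {j} - {k}"
 have fin: "finite R" using assms by (simp add: R_def)
 have nn: "mu i >= 0" if "i : R" for i using assms that by (auto simp: R_def)
 have s: "(\<Sum>i\<in>I. g i) = g j + g k + (\<Sum>i\<in>R. g i)" for g :: "'a => real"
  using assms sum.remove[of I j g] sum.remove[of "I - {j}" k g] by (simp add: R_def)
 have "(\<Sum>i\<in>R. (mu i)^2) <= (\<Sum>i\<in>R. mu i * (\<Sum>l\<in>R. mu l))"
  unfolding sq_eq using fin nn by (intro sum_mono mult_left_mono member_le_sum) auto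
 also have "... = (\<Sum>i\<in>R. mu i)^2" by (simp add: sum_distrib_right[symmetric] sq_eq)
 finally have "(\<Sum>i\<in>R. (mu i)^2) <= (\<Sum>i\<in>R. mu i)^2" .
 moreover have "(\<Sum>i\<in>R. mu i) >= 0" using nn by (rule sum_nonneg)
 ultimately show ?thesis unfolding s using assms by (intro pair_product_le) auto
qed

lemma eigenbasis_quadratic:
 fixes b :: "'n => real^'n"
 assumes b: "orthobasis b" and l: "!!i. m *v b i = l i *R b i"
 shows "x \<bullet> (m *v y) = (\<Sum>i\<in>UNIV. l i * (b i \<bullet> x) * (b i \<bullet> y))"
proof -
 have "x \<bullet> (m *v y) = x \<bullet> (m *v (\<Sum>i\<in>UNIV. (b i \<bullet> y) *R b i))" by (simp add: orthobasis_expansion[OF b])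
 also have "... = (\<Sum>i\<in>UNIV. l i * (b i \<bullet> x) * (b i \<bullet> y))"
  by (simp add: linear_sum[OF matrix_vector_mul_linear] mv_scaleR l inner_sum_right inner_commute mult_ac)
 finally show ?thesis .
qed

lemma eigenbasis_pos_semidef:
 fixes b :: "'n => real^'n"
 assumes b: "orthobasis b" and l: "!!i. m *v b i = l i *R b i" and nn: "!!i. l i >= 0"
 shows "pos_semidef m"
proof -
 have "transpose m = m"
  by (subst (1 2) eigenbasis_symmetric_matrix[OF b l]) (simp add: transpose_sum' transpose_scaleR' transpose_outer_prod)
 moreover have "0 <= z \<bullet> (m *v z)" for z
  unfolding eigenbasis_quadratic[OF b l] using nn by (intro sum_nonneg) (simp add: mult.assoc)
 ultimately show ?thesis by (simp add: pos_semidef_def)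
qed

text \<open>\<open>x\<close> minimises the quadratic form; the first-order condition is tested in
  the direction \<open>m *v x\<close>.\<close>

lemma pos_semidef_zero:
 fixes m :: "real^'n^'n"
 assumes m: "pos_semidef m" and x: "x \<bullet> (m *v x) = 0"
 shows "m *v x = 0"
proof -
 have tm: "transpose m = m" and mpos: "!!z. 0 <= z \<bullet> (m *v z)" using m by (auto simp: pos_semidef_def)
 define y where "y = m *v x"
 have "y \<bullet> y = 0"
 proof (rule quadratic_nonneg_imp_zero)
  fix t :: real
  have "0 <= (x + t *R y) \<bullet> (m *v (x + t *R y))" by (rule mpos)
  also have "... = 2 * t * (y \<bullet> y) + t^2 * (y \<bullet> (m *v y))"
   using x symmetric_inner[OF tm, of x y]
   by (simp add: mv_add mv_scaleR inner_add_left inner_add_right y_def[symmetric] sq_eq algebra_simps)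
  finally show "0 <= 2 * t * (y \<bullet> y) + t^2 * (y \<bullet> (m *v y))" .
 qed
 then show ?thesis by (simp add: y_def)
qed

text \<open>The class of configurations over which the coercivity constants are uniform.
  \<open>m\<close> stands for -v D^2v with its small eigenvalues set to zero, \<open>q\<close> for
  Dv, \<open>s\<close> for -v, and \<open>T\<close> for the indices of the remaining eigenvalues.
  The last two conditions keep \<open>m - outer_prod q q\<close> in the closed elliptic region with
  \<open>Phi\<close> bounded below.\<close>

definition structural_data :: "real => ('n => real^'n) => 'n set => ('n => real) => real^'n => real => real^'n => real^'n^'n => bool" where
 "structural_data L b T mu q s p m \<longleftrightarrow> orthobasis b \<and> (\<forall>j\<in>T. 1 / L <= mu j \<and> mu j <= L) \<and> (\<forall>j. j \<notin> T --> mu j = 0)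
  \<and> (\<forall>j. m *v b j = mu j *R b j) \<and> p = (2 * s) *R q \<and> norm q <= L \<and> 0 < s \<and> s <= L
  \<and> 1 / L <= Phi p (m - outer_prod q q) (m - outer_prod q q) \<and> (\<forall>e. 0 <= Phi p (m - outer_prod q q) (outer_prod e e))"

text \<open>\<open>Z\<close> is the derivative of -v D^2v in a null direction and \<open>y\<close>
  the logarithmic derivative of -v there. The squared term is the linearised equation, small in the
  application. Keeping \<open>2 * y^2 * Theta p p m m\<close> on the left is deliberate: it is later
  traded for the null components of the gradient.\<close>

definition structural_bound :: "real => real => ('n => real^'n) => 'n set => ('n => real) => real^'n => real^'n => real^'n^'n => real^'n^'n => real => bool" where
 "structural_bound c C b T mu q p m Z y \<longleftrightarrow>
  c * (norm Z)^2 + 2 * y^2 * Theta p p m m - C * (2 * Phi p (m - outer_prod q q) Z + 2 * y * Theta p p m m)^2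
  <= Phi p Z Z + 2 * Phi p (m - outer_prod q q) (\<Sum>j\<in>T. (1 / mu j) *R outer_prod (Z *v b j) (Z *v b j))
   + 4 * y * Theta p p m Z + 3 * y^2 * Theta p p m m"

lemma structural_dataD:
 assumes "structural_data L b T mu q s p m"
 shows "orthobasis b" "!!j. j : T ==> 1 / L <= mu j" "!!j. j : T ==> mu j <= L" "!!j. j \<notin> T ==> mu j = 0"
  "!!j. m *v b j = mu j *R b j" "p = (2 * s) *R q" "norm q <= L" "0 < s" "s <= L"
  "1 / L <= Phi p (m - outer_prod q q) (m - outer_prod q q)" "!!e. 0 <= Phi p (m - outer_prod q q) (outer_prod e e)"
 using assms by (auto simp: structural_data_def)

text \<open>With at least three nonzero eigenvalues the compression of \<open>m\<close> to the
  complement of \<open>p\<close> has rank at least two. Its second symmetric function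
  \<open>s2\<close> is then bounded below, and \<open>cone_form_coercive\<close> applies in the
  adapted basis.\<close>

lemma structural_rank_ge_3:
 fixes L :: real
 assumes L: "L >= 1"
 obtains c C where "c > 0" "C >= 0"
  "!!(b :: 'n => real^'n) T mu q s p m Z y.
   [|structural_data L b T mu q s p m; card T >= 3; transpose Z = Z; !!j. j \<notin> T ==> Z *v b j = 0|]
  ==> structural_bound c C b T mu q p m Z y"
proof -
 define N where "N = real CARD('n)"
 have N: "N >= 1" by (simp add: N_def)
 \<comment> \<open>Dominates every bound required below: the trace of \<open>m\<close> needs
   \<open>N * L\<close>, and \<open>w\<close> needs \<open>1 + 4 * L ^ 4\<close>.\<close>
 define L' where "L' = (N + 5) * L ^ 4"
 have L4: "L ^ 4 >= 1" "L <= L ^ 4" "L^2 <= L ^ 4" "L^2 >= 1"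
  using L power_increasing[of 1 4 L] power_increasing[of 2 4 L] by (auto simp: one_le_power)
 have L'a: "x <= L'" if "x <= (N + 5) * L ^ 4" for x using that by (simp add: L'_def)
 have L'1: "L' >= 1" unfolding L'_def using N L4 by (smt (verit) mult_le_cancel_left1 mult_left_mono)
 show thesis
  apply (rule cone_form_coercive[OF L'1, where 'a = 'n])
  subgoal premises main for c C
 proof (rule that[OF main(1,2)])
  fix b :: "'n => real^'n" and T mu q s p m Z y
  assume data: "structural_data L b T mu q s p m" and T: "card T >= 3" and Z: "transpose Z = Z" and ZT: "!!j. j \<notin> T ==> Z *v b j = 0"
  note b = structural_dataD(1)[OF data] and mulo = structural_dataD(2)[OF data] and muhi = structural_dataD(3)[OF data]
   and mu0 = structural_dataD(4)[OF data] and m = structural_dataD(5)[OF data] and p = structural_dataD(6)[OF data]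
   and q = structural_dataD(7)[OF data] and s = structural_dataD(8,9)[OF data] and sigma = structural_dataD(10)[OF data]
   and ell = structural_dataD(11)[OF data]
  define M where "M = m - outer_prod q q"
  have iL: "1 / L > 0" using L by simp
  have munn: "mu j >= 0" for j using mulo[of j] mu0[of j] iL by (cases "j : T") (meson less_le_trans less_imp_le, simp)
  have muL: "mu j <= L" for j using muhi[of j] mu0[of j] L by (cases "j : T") auto
  have psd: "pos_semidef m" by (rule eigenbasis_pos_semidef[OF b m munn])
  then have tm: "transpose m = m" and mpos: "!!z. 0 <= z \<bullet> (m *v z)" by (auto simp: pos_semidef_def)
  have tM: "transpose M = M" by (simp add: M_def transpose_minus' tm transpose_outer_prod)
  obtain f i0 where f: "orthobasis f" and qf: "q = norm q *R f i0"
   and diag: "!!j k. j ~= i0 ==> k ~= i0 ==> j ~= k ==> f j \<bullet> (m *v f k) = 0" using adapted_basis[OF psd] by blast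
  define H where "H = -{i0}"
  define D where "D j = f j \<bullet> (m *v f j)" for j
  define be where "be j = f j \<bullet> (m *v f i0)" for j
  define a where "a = f i0 \<bullet> (m *v f i0) - (norm q)^2"
  define cc where "cc = 2 * s * norm q"
  define w where "w = 1 + cc^2"
  define z where "z j = f j \<bullet> (Z *v f i0)" for j
  define ZZ where "ZZ j k = f j \<bullet> (Z *v f k)" for j k
  define S where "S = (\<Sum>j\<in>H. D j)"
  define Q where "Q = (\<Sum>j\<in>H. (D j)^2)"
  define s2 where "s2 = (S^2 - Q) / 2"
  define B where "B = (\<Sum>j\<in>H. (be j)^2)"
  define t where "t = (\<Sum>j\<in>H. ZZ j j) / S"
  define smZ where "smZ = (S * (t * S) - (\<Sum>i\<in>H. D i * ZZ i i)) / 2"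
  define d where "d = S * (f i0 \<bullet> (Z *v f i0)) + a * (t * S) - 2 * (\<Sum>j\<in>H. be j * z j) + 2 * w * smZ + 2 * y * (w - 1) * s2"
  have pf: "p = cc *R f i0" unfolding p by (subst qf) (simp add: cc_def)
  have fu: "f j \<bullet> f k = (if j = k then 1 else 0)" for j k using f by (simp add: orthobasis_def)
  have fq: "f j \<bullet> q = (if j = i0 then norm q else 0)" for j by (subst qf) (simp add: fu)
  have mf: "f j \<bullet> (m *v f k) = (if j = k then D j else 0)" if "j : H" "k : H" for j k
   using diag[of j k] that by (auto simp: H_def D_def)
  have Mf: "f j \<bullet> (M *v f k) = f j \<bullet> (m *v f k) - (f j \<bullet> q) * (f k \<bullet> q)" for j k
   by (simp add: M_def diff_mv outer_prod_mult inner_diff_right inner_commute)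
  have MH: "f j \<bullet> (M *v f k) = (if j = k then D j else 0)" if "j : H" "k : H" for j k
   using that mf[OF that] by (auto simp: Mf fq H_def)
  have M0: "f j \<bullet> (M *v f i0) = be j" if "j : H" for j using that by (simp add: Mf fq be_def H_def)
  have Ma: "f i0 \<bullet> (M *v f i0) = a" by (simp add: Mf fq a_def sq_eq)
  have dsum: "(\<Sum>j\<in>H. \<Sum>k\<in>H. (if j = k then D j else 0) * g j k) = (\<Sum>j\<in>H. D j * g j j)" for g :: "'n => 'n => real"
  proof (rule sum.cong[OF refl])
   fix j assume "j : H"
   have "(\<Sum>k\<in>H. (if j = k then D j else 0) * g j k) = (\<Sum>k\<in>H. if j = k then D j * g j k else 0)" by (rule sum.cong) auto
   then show "(\<Sum>k\<in>H. (if j = k then D j else 0) * g j k) = D j * g j j" using \<open>j : H\<close> by simp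
  qed
  have Dnn: "D j >= 0" for j unfolding D_def by (rule mpos)
  have Dzero: "m *v f j = 0" if "D j = 0" for j using pos_semidef_zero[OF psd] that by (simp add: D_def)
  \<comment> \<open>A diagonal zero of the compression is a null vector of \<open>m\<close>, hence
    orthogonal to all \<open>b i\<close> with \<open>i : T\<close>, and \<open>Z\<close> vanishes on
    the other basis vectors.\<close>
  have supp: "Z *v f j = 0" if "D j = 0" for j
  proof -
   have "b i \<bullet> f j = 0" if "i : T" for i
   proof -
    have "mu i * (b i \<bullet> f j) = (m *v b i) \<bullet> f j" by (simp add: m)
    also have "... = b i \<bullet> (m *v f j)" using symmetric_inner[OF tm] by simp
    also have "... = 0" using Dzero[OF \<open>D j = 0\<close>] by simp
    finally show ?thesis using mulo[OF that] iL by (metis leD mult_eq_0_iff)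
   qed
   then have zz: "(b i \<bullet> f j) *R (Z *v b i) = 0" for i using ZT by (cases "i : T") auto
   have "Z *v (\<Sum>i\<in>UNIV. (b i \<bullet> f j) *R b i) = (\<Sum>i\<in>UNIV. (b i \<bullet> f j) *R (Z *v b i))"
    by (simp add: linear_sum[OF matrix_vector_mul_linear] mv_scaleR)
   also have "... = 0" by (simp only: zz sum.neutral_const)
   finally have "Z *v (\<Sum>i\<in>UNIV. (b i \<bullet> f j) *R b i) = 0" .
   then show ?thesis by (simp add: orthobasis_expansion[OF b])
  qed
  have ZZs: "ZZ j k = ZZ k j" for j k unfolding ZZ_def using symmetric_inner[OF Z] by (simp add: inner_commute)
  have suppZ: "ZZ i j = 0" if "D i = 0" for i j using supp[OF that] ZZs[of i j] by (simp add: ZZ_def)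
  have suppz: "z i = 0" if "D i = 0" for i
   using symmetric_inner[OF Z, of "f i" "f i0"] supp[OF that] by (simp add: z_def)
  have suppb: "be i = 0" if "D i = 0" for i
   using symmetric_inner[OF tm, of "f i" "f i0"] Dzero[OF that] by (simp add: be_def)
  \<comment> \<open>\<open>s2\<close> is the average, with weights \<open>x i\<close>, of the second
    symmetric functions of the eigenvalues with the i-th one omitted. Two nonzero eigenvalues always
    remain, since \<open>T\<close> has at least three elements.\<close>
  have s2lo: "s2 >= 1 / L^2"
  proof -
   define e where "e = f i0"
   define sm where "sm = (\<Sum>i\<in>UNIV. mu i)"
   define sq where "sq = (\<Sum>i\<in>UNIV. (mu i)^2)"
   define x where "x i = (b i \<bullet> e)^2" for i
   have x1: "(\<Sum>i\<in>UNIV. x i) = 1" using orthobasis_inner[OF b, of e e] fu by (simp add: x_def sq_eq e_def)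
   have "trace m = (\<Sum>i\<in>UNIV. f i \<bullet> (m *v f i))" by (rule orthobasis_trace[OF f])
   then have tr1: "trace m = f i0 \<bullet> (m *v f i0) + S" unfolding S_def D_def H_def by (simp add: sum_UNIV_remove[of _ i0])
   have tr2: "trace m = sm" using b by (simp add: orthobasis_trace[OF b] m sm_def orthobasis_def)
   have n1: "m \<bullet> m = (f i0 \<bullet> (m *v f i0))^2 + 2 * B + Q"
    unfolding Phi_adapted_coordinates(3)[OF f pf tm tm] H_def[symmetric] B_def Q_def be_def
    by (simp add: sq_eq mf dsum cong: sum.cong)
   have n2: "m \<bullet> m = sq" using b by (simp add: orthobasis_matrix_inner[OF b] m sq_def orthobasis_def sq_eq)
   have me: "(m *v e) \<bullet> (m *v e) = (f i0 \<bullet> (m *v f i0))^2 + B"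
    using orthobasis_inner[OF f, of "m *v e" "m *v e"]
    by (simp add: sum_UNIV_remove[of _ i0] e_def B_def be_def H_def sq_eq)
   have q1: "e \<bullet> (m *v e) = (\<Sum>i\<in>UNIV. mu i * x i)"
    by (simp add: eigenbasis_quadratic[OF b m] x_def sq_eq mult.assoc)
   have q2: "(m *v e) \<bullet> (m *v e) = (\<Sum>i\<in>UNIV. (mu i)^2 * x i)"
   proof -
    have "(m *v e) \<bullet> (m *v e) = (\<Sum>i\<in>UNIV. (b i \<bullet> (m *v e)) * (b i \<bullet> (m *v e)))" by (rule orthobasis_inner[OF b, symmetric])
    also have "... = (\<Sum>i\<in>UNIV. (mu i)^2 * x i)"
     by (rule sum.cong[OF refl]) (simp add: symmetric_inner[OF tm] m x_def sq_eq)
    finally show ?thesis .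
   qed
   have "s2 = (sm^2 - sq) / 2 - sm * (e \<bullet> (m *v e)) + (m *v e) \<bullet> (m *v e)"
    unfolding s2_def me tr2[symmetric] n2[symmetric] unfolding tr1 n1 e_def by (simp add: sq_eq field_simps)
   also have "... = (\<Sum>i\<in>UNIV. ((sm^2 - sq) / 2 - sm * mu i + (mu i)^2) * x i)"
   proof -
    have "(\<Sum>i\<in>UNIV. ((sm^2 - sq) / 2 - sm * mu i + (mu i)^2) * x i)
     = (\<Sum>i\<in>UNIV. (sm^2 - sq) / 2 * x i - sm * (mu i * x i) + (mu i)^2 * x i)" by (simp add: algebra_simps)
    also have "... = (sm^2 - sq) / 2 * (\<Sum>i\<in>UNIV. x i) - sm * (\<Sum>i\<in>UNIV. mu i * x i) + (\<Sum>i\<in>UNIV. (mu i)^2 * x i)"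
     by (simp only: sum.distrib sum_subtractf sum_distrib_left)
    finally show ?thesis unfolding q1 q2 x1 by simp
   qed
   also have "... >= (\<Sum>i\<in>UNIV. 1 / L^2 * x i)"
   proof (intro sum_mono mult_right_mono)
    fix i :: 'n
    have "card (T - {i}) >= 2" using T by (cases "i : T") (simp_all add: card_Diff_singleton)
    then obtain j k where jk: "j : T - {i}" "k : T - {i}" "j ~= k"
     by (metis One_nat_def Suc_1 card_le_Suc0_iff_eq finite not_less_eq_eq)
    have "mu j * mu k <= ((\<Sum>l\<in>-{i}. mu l)^2 - (\<Sum>l\<in>-{i}. (mu l)^2)) / 2"
     using jk munn by (intro sum_product_pair_ge) auto
    also have "... = (sm^2 - sq) / 2 - sm * mu i + (mu i)^2"
     unfolding sm_def sq_def sum_UNIV_remove[of _ i] by (simp add: sq_eq field_simps)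
    finally have "mu j * mu k <= (sm^2 - sq) / 2 - sm * mu i + (mu i)^2" .
    moreover have "(1 / L) * (1 / L) <= mu j * mu k" using jk mulo munn iL by (intro mult_mono) (auto intro: less_imp_le)
    ultimately show "1 / L^2 <= (sm^2 - sq) / 2 - sm * mu i + (mu i)^2" by (simp add: sq_eq)
   qed (simp add: x_def)
   finally show ?thesis unfolding sum_distrib_left[symmetric] x1 by simp
  qed
  have Snn: "S >= 0" unfolding S_def by (intro sum_nonneg Dnn)
  have Qnn: "Q >= 0" unfolding Q_def by (intro sum_nonneg) auto
  have "1 / L^2 > 0" using L by simp
  moreover have "S^2 = 2 * s2 + Q" by (simp add: s2_def field_simps)
  ultimately have "S^2 > 0" using s2lo Qnn by linarith
  then have Spos: "S > 0" using Snn by (simp add: less_le)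
  have tS: "t * S = (\<Sum>j\<in>H. ZZ j j)" using Spos by (simp add: t_def)
  have zi: "ZZ j i0 = z j" for j by (simp add: z_def ZZ_def)
  note coords = Phi_adapted_coordinates[OF f pf, folded H_def]
  have PhiMM: "Phi p M M = a * S - B + w * s2"
   unfolding coords(2)[OF tM tM] Ma by (simp add: MH M0 dsum S_def[symmetric] B_def Q_def s2_def w_def sq_eq cong: sum.cong)
  have Thmm: "Theta p p m m = (w - 1) * s2"
   unfolding coords(1)[OF tm tm] by (simp add: mf dsum S_def[symmetric] Q_def s2_def w_def sq_eq cong: sum.cong)
  have ThmZ: "Theta p p m Z = (w - 1) * smZ"
   unfolding coords(1)[OF tm Z] by (simp add: mf dsum S_def[symmetric] tS[symmetric] ZZ_def[symmetric] smZ_def w_def cong: sum.cong)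
  have PhiMZ: "2 * Phi p M Z + 2 * y * Theta p p m m = d"
   unfolding coords(2)[OF tM Z] Thmm Ma
   by (simp add: MH M0 dsum S_def[symmetric] tS[symmetric] ZZ_def[symmetric] zi smZ_def d_def w_def cong: sum.cong)
    (simp add: field_simps)
  have PhiZZ: "Phi p Z Z = (f i0 \<bullet> (Z *v f i0)) * (t * S) - (\<Sum>j\<in>H. (z j)^2) + w * (((t * S)^2 - (\<Sum>j\<in>H. \<Sum>k\<in>H. (ZZ j k)^2)) / 2)"
   unfolding coords(2)[OF Z Z] by (simp add: ZZ_def[symmetric] tS zi w_def sq_eq)
  have normZ: "(norm Z)^2 = (f i0 \<bullet> (Z *v f i0))^2 + 2 * (\<Sum>j\<in>H. (z j)^2) + (\<Sum>j\<in>H. \<Sum>k\<in>H. (ZZ j k)^2)"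
   unfolding norm_sq coords(3)[OF Z Z] by (simp add: ZZ_def z_def sq_eq)
  define V1 where "V1 = (\<Sum>j\<in>T. (1 / mu j) *R outer_prod (Z *v b j) (Z *v b j))"
  define V2 where "V2 = (\<Sum>j\<in>H. (1 / D j) *R outer_prod (Z *v f j) (Z *v f j))"
  have tV1: "transpose V1 = V1" by (simp add: V1_def transpose_sum' transpose_scaleR' transpose_outer_prod)
  have tV2: "transpose V2 = V2" by (simp add: V2_def transpose_sum' transpose_scaleR' transpose_outer_prod)
  have V2f: "f j \<bullet> (V2 *v f k) = (\<Sum>i\<in>H. ZZ j i * ZZ i k / D i)" for j k
  proof -
   have "f j \<bullet> (V2 *v f k) = (\<Sum>i\<in>H. (f j \<bullet> (Z *v f i)) * ((Z *v f i) \<bullet> f k) / D i)"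
    by (simp add: V2_def matrix_sum_mult scaleR_mv outer_prod_mult inner_sum_right mult.commute)
   then show ?thesis by (simp add: ZZ_def symmetric_inner[OF Z])
  qed
  \<comment> \<open>The pseudo-inverse of \<open>m\<close> dominates the inverse of its compression:
    \<open>k \<bullet> v\<close> and \<open>g \<bullet> v\<close> are the two quadratic forms at
    \<open>v\<close>, and their difference is the energy of \<open>k - g\<close>.\<close>
  have V12: "pos_semidef (V1 - V2)"
  proof -
   have "0 <= x \<bullet> ((V1 - V2) *v x)" for x
   proof -
    define v where "v = Z *v x"
    have Zb: "(Z *v b j) \<bullet> x = b j \<bullet> v" "(Z *v f j) \<bullet> x = f j \<bullet> v" for j using symmetric_inner[OF Z] by (simp_all add: v_def)
    have e1: "x \<bullet> (V1 *v x) = (\<Sum>j\<in>T. (b j \<bullet> v)^2 / mu j)"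
     by (simp add: V1_def matrix_sum_mult scaleR_mv outer_prod_mult inner_sum_right Zb sq_eq inner_commute[of x])
    have e2: "x \<bullet> (V2 *v x) = (\<Sum>j\<in>H. (f j \<bullet> v)^2 / D j)"
     by (simp add: V2_def matrix_sum_mult scaleR_mv outer_prod_mult inner_sum_right Zb sq_eq inner_commute[of x])
    define k where "k = (\<Sum>j\<in>T. ((b j \<bullet> v) / mu j) *R b j)"
    define g where "g = (\<Sum>j\<in>H. ((f j \<bullet> v) / D j) *R f j)"
    have mk: "m *v k = v"
    proof -
     have "m *v k = (\<Sum>j\<in>T. (b j \<bullet> v) *R b j)"
      unfolding k_def linear_sum[OF matrix_vector_mul_linear] mv_scaleR m
     proof (rule sum.cong[OF refl])
      fix j assume "j : T"
      then have "mu j ~= 0" using mulo[of j] iL by force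
      then show "(b j \<bullet> v / mu j) *R mu j *R b j = (b j \<bullet> v) *R b j" by simp
     qed
     also have "... = (\<Sum>j\<in>UNIV. (b j \<bullet> v) *R b j)"
     proof (rule sum.mono_neutral_left)
      show "\<forall>i\<in>UNIV - T. (b i \<bullet> v) *R b i = 0" using Zb(1) ZT by (metis DiffD2 inner_zero_left scaleR_zero_left)
     qed auto
     also have "... = v" by (rule orthobasis_expansion[OF b])
     finally show ?thesis .
    qed
    have "k \<bullet> v = (\<Sum>j\<in>T. (b j \<bullet> v)^2 / mu j)" by (simp add: k_def inner_sum_left sq_eq)
    moreover have gv: "g \<bullet> v = (\<Sum>j\<in>H. (f j \<bullet> v)^2 / D j)" by (simp add: g_def inner_sum_left sq_eq)
    moreover have "g \<bullet> (m *v g) = g \<bullet> v"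
    proof -
     have "g \<bullet> (m *v g) = (\<Sum>j\<in>H. \<Sum>l\<in>H. (if j = l then D j else 0) * (((f j \<bullet> v) / D j) * ((f l \<bullet> v) / D l)))"
      unfolding g_def
      by (simp add: linear_sum[OF matrix_vector_mul_linear] mv_scaleR inner_sum_left inner_sum_right mf sum_distrib_left mult_ac cong: sum.cong)
       (subst sum.swap, intro sum.cong refl, auto simp: mf)
     also have "... = (\<Sum>j\<in>H. D j * (((f j \<bullet> v) / D j) * ((f j \<bullet> v) / D j)))" by (rule dsum)
     also have "... = g \<bullet> v" unfolding gv by (rule sum.cong) (auto simp: sq_eq)
     finally show ?thesis .
    qed
    moreover have "0 <= (k - g) \<bullet> (m *v (k - g))" by (rule mpos)
    moreover have "(k - g) \<bullet> (m *v (k - g)) = k \<bullet> v - 2 * (g \<bullet> v) + g \<bullet> (m *v g)"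
     using symmetric_inner[OF tm, of k g] by (simp add: matrix_vector_mult_diff_distrib inner_diff_left inner_diff_right mk inner_commute)
    ultimately have "0 <= (\<Sum>j\<in>T. (b j \<bullet> v)^2 / mu j) - (\<Sum>j\<in>H. (f j \<bullet> v)^2 / D j)" by linarith
    then show ?thesis by (simp add: diff_mv inner_diff_right e1 e2)
   qed
   then show ?thesis by (simp add: pos_semidef_def transpose_minus' tV1 tV2)
  qed
  have "0 <= Phi p M (V1 - V2)" by (rule Phi_nonneg_pos_semidef[OF _ V12]) (simp add: M_def ell)
  then have PhiV: "2 * Phi p M V2 <= 2 * Phi p M V1" by (simp add: Phi_minus_right)
  have PhiV2: "2 * Phi p M V2 = S * (\<Sum>j\<in>H. (z j)^2 / D j) + a * (\<Sum>j\<in>H. \<Sum>k\<in>H. (ZZ j k)^2 / D j) - 2 * (\<Sum>j\<in>H. \<Sum>k\<in>H. z j * be k * ZZ j k / D j)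
    + w * (S * (\<Sum>j\<in>H. \<Sum>k\<in>H. (ZZ j k)^2 / D j) - (\<Sum>j\<in>H. \<Sum>k\<in>H. D k * (ZZ j k)^2 / D j))"
  proof -
   have z1: "ZZ i i0 = z i" "ZZ i0 i = z i" for i by (simp_all add: z_def ZZ_def[symmetric] ZZs[of i0])
   have a1: "f i0 \<bullet> (V2 *v f i0) = (\<Sum>j\<in>H. (z j)^2 / D j)" unfolding V2f z1 by (simp add: sq_eq)
   have a2: "(\<Sum>k\<in>H. f k \<bullet> (V2 *v f k)) = (\<Sum>j\<in>H. \<Sum>k\<in>H. (ZZ j k)^2 / D j)"
    unfolding V2f by (subst sum.swap) (simp add: sq_eq ZZs)
   have a3: "(\<Sum>k\<in>H. be k * (f k \<bullet> (V2 *v f i0))) = (\<Sum>j\<in>H. \<Sum>k\<in>H. z j * be k * ZZ j k / D j)"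
    unfolding V2f z1 sum_distrib_left by (subst sum.swap) (intro sum.cong refl, simp add: ZZs mult_ac)
   have a4: "(\<Sum>k\<in>H. D k * (f k \<bullet> (V2 *v f k))) = (\<Sum>j\<in>H. \<Sum>k\<in>H. D k * (ZZ j k)^2 / D j)"
    unfolding V2f sum_distrib_left by (subst sum.swap) (intro sum.cong refl, simp add: ZZs sq_eq)
   have "Phi p M V2 = (a * (\<Sum>k\<in>H. f k \<bullet> (V2 *v f k)) + (f i0 \<bullet> (V2 *v f i0)) * S) / 2 - (\<Sum>k\<in>H. be k * (f k \<bullet> (V2 *v f i0)))
     + w * ((S * (\<Sum>k\<in>H. f k \<bullet> (V2 *v f k)) - (\<Sum>k\<in>H. D k * (f k \<bullet> (V2 *v f k)))) / 2)"
    unfolding coords(2)[OF tM tV2] Ma by (simp add: MH M0 dsum S_def w_def cong: sum.cong)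
   then show ?thesis unfolding a1 a2 a3 a4 by (simp add: field_simps)
  qed
  have bounds: "S <= L'" "1 / L' <= s2" "1 <= w" "w <= L'" "\<bar>a\<bar> <= L'" "B <= L'" "1 / L' <= Phi p M M"
  proof -
   have fi: "0 <= f i0 \<bullet> (m *v f i0)" by (rule mpos)
   have "trace m = (\<Sum>i\<in>UNIV. f i \<bullet> (m *v f i))" by (rule orthobasis_trace[OF f])
   then have tr1: "trace m = f i0 \<bullet> (m *v f i0) + S" unfolding S_def D_def H_def by (simp add: sum_UNIV_remove[of _ i0])
   have "trace m = (\<Sum>i\<in>UNIV. mu i)" using b by (simp add: orthobasis_trace[OF b] m orthobasis_def)
   also have "... <= (\<Sum>i\<in>(UNIV::'n set). L)" using muL by (intro sum_mono) auto
   finally have tr2: "trace m <= N * L" by (simp add: N_def)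
   have NL: "N * L <= N * L ^ 4" using N L4 by simp
   have NL': "N * L ^ 4 + 5 * L ^ 4 = L'" by (simp add: L'_def algebra_simps)
   show "S <= L'" using tr1 tr2 fi NL NL' L4 by linarith
   have lL: "L^2 <= L'" "L <= L'" using L4 N NL' NL L by (smt (verit) mult_nonneg_nonneg)+
   show "1 / L' <= s2" using s2lo lL L'1 L4 by (meson order_trans frac_le zero_le_one order_refl zero_less_one less_le_trans)
   show "1 / L' <= Phi p M M" using sigma lL L unfolding M_def[symmetric] by (meson order_trans frac_le zero_le_one order_refl zero_less_one less_le_trans)
   show "1 <= w" by (simp add: w_def)
   have "cc <= 2 * (L * L)" unfolding cc_def using s q L by (simp add: mult_mono mult.assoc)
   then have "cc^2 <= (2 * (L * L))^2" using s by (intro power_mono) (auto simp: cc_def)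
   then have "w <= 1 + 4 * L ^ 4" by (simp add: w_def eval_nat_numeral algebra_simps)
   then show "w <= L'" using NL' L4 N by (smt (verit) mult_nonneg_nonneg)
   have "(norm q)^2 <= L^2" using q by (intro power_mono) auto
   then show "\<bar>a\<bar> <= L'" using fi tr1 tr2 Snn NL NL' L4 unfolding a_def by (smt (verit) zero_le_power2)
   have "(m *v f i0) \<bullet> (m *v f i0) = (f i0 \<bullet> (m *v f i0))^2 + B"
    using orthobasis_inner[OF f, of "m *v f i0" "m *v f i0"]
    by (simp add: sum_UNIV_remove[of _ i0] B_def be_def H_def sq_eq)
   moreover have "(m *v f i0) \<bullet> (m *v f i0) <= L^2"
   proof -
    have "(m *v f i0) \<bullet> (m *v f i0) = (\<Sum>i\<in>UNIV. (b i \<bullet> (m *v f i0)) * (b i \<bullet> (m *v f i0)))" by (rule orthobasis_inner[OF b, symmetric])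
    also have "... = (\<Sum>i\<in>UNIV. (mu i)^2 * (b i \<bullet> f i0)^2)"
     by (rule sum.cong[OF refl]) (simp add: symmetric_inner[OF tm] m sq_eq)
    also have "... <= (\<Sum>i\<in>UNIV. L^2 * (b i \<bullet> f i0)^2)" using munn muL by (intro sum_mono mult_right_mono power_mono) auto
    also have "... = L^2" using orthobasis_inner[OF b, of "f i0" "f i0"] by (simp add: fu sum_distrib_left[symmetric] sq_eq)
    finally show ?thesis .
   qed
   ultimately show "B <= L'" using lL by (smt (verit) zero_le_power2)
  qed
  note final = main(3)[where H = H and mu = D and b = be and z = z and Z = ZZ and sig = "Phi p M M" and a = a and w = w and y = y and S = S and Q = Q and ?s2.0 = s2 and B = B and t = t and smZ = smZ and d = d, OF finite Dnn ZZs suppZ suppb suppz S_def Spos Q_def s2_def B_def PhiMM tS[symmetric] smZ_def d_def bounds]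
  have "(w - 1) * (4 * y * smZ + 3 * y^2 * s2) = 4 * y * ((w - 1) * smZ) + 3 * y^2 * ((w - 1) * s2)" by (simp add: algebra_simps)
  then show "structural_bound c C b T mu q p m Z y"
   unfolding structural_bound_def M_def[symmetric] V1_def[symmetric] PhiMZ normZ PhiZZ unfolding Thmm ThmZ using final PhiV unfolding PhiV2 by linarith
 qed
  done
qed

lemma psd2_quadratic_nonneg:
 fixes a b c :: real
 assumes "a >= 0" "c >= 0" "b^2 <= a * c"
 shows "0 <= a * x^2 + 2 * b * x * y + c * y^2"
proof (cases "a = 0")
 case True
 then have "b = 0" using assms(3) by simp
 then show ?thesis using True assms by simp
next
 case False
 have "a * (a * x^2 + 2 * b * x * y + c * y^2) = (a * x + b * y)^2 + (a * c - b^2) * y^2"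
  by (simp add: sq_eq algebra_simps)
 also have "... >= 0" using assms by simp
 finally show ?thesis using False assms(1) by (simp add: zero_le_mult_iff)
qed

text \<open>The determinant is a Lorentzian form on symmetric \<open>2 \<times> 2\<close> matrices.\<close>
lemma det2_lorentzian:
 fixes a b c :: real
 assumes "a >= 0" "c >= 0" "b^2 <= a * c"
 shows "4 * ((a * c - b^2) * (x * z - h^2)) <= (a * x + c * z + 2 * b * h)^2"
proof (cases "a = 0")
 case True
 then have "b = 0" using assms(3) by simp
 then show ?thesis using True by simp
next
 case False
 define k where "k = b / a"
 define g where "g = c - a * k^2"
 have b: "b = a * k" and c: "c = g + a * k^2" using False by (simp_all add: k_def g_def)
 have ag: "a * c - b^2 = a * g" unfolding b c by (simp add: sq_eq algebra_simps)
 then have "a * g >= 0" using assms(3) by simp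
 then have "0 <= (a * (x + 2 * k * h + k^2 * z) - g * z)^2 + 4 * (a * g * (h + k * z)^2)" by simp
 also have "... = (a * x + c * z + 2 * b * h)^2 - 4 * ((a * c - b^2) * (x * z - h^2))"
  unfolding ag unfolding b c by (simp add: sq_eq algebra_simps)
 finally show ?thesis by simp
qed

text \<open>Let G be \<open>sg\<close> times the identity plus a positive semidefinite matrix and X
  symmetric. The right side is the squared norm of G^(1/2) X G^(1/2), written through trace and
  determinant, and G is at least \<open>sg\<close> times the identity.\<close>

lemma psd2_trace_square:
 fixes a b c sg :: real
 assumes "a >= 0" "c >= 0" "b^2 <= a * c" "sg >= 0"
 shows "sg^2 * (x^2 + z^2 + 2 * h^2) <=
  ((sg + a) * x + (sg + c) * z + 2 * b * h)^2 - 2 * (((sg + a) * (sg + c) - b^2) * (x * z - h^2))"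
proof -
 define f where "f = a * x + c * z + 2 * b * h"
 define g where "g = (a * c - b^2) * (x * z - h^2)"
 define q1 where "q1 = a * x^2 + 2 * b * x * h + c * h^2"
 define q2 where "q2 = a * h^2 + 2 * b * h * z + c * z^2"
 have q: "q1 >= 0" "q2 >= 0" unfolding q1_def q2_def using assms by (auto intro: psd2_quadratic_nonneg)
 have fg: "4 * g <= f^2" unfolding f_def g_def by (rule det2_lorentzian[OF assms(1-3)])
 have id: "((sg + a) * x + (sg + c) * z + 2 * b * h)^2 - 2 * (((sg + a) * (sg + c) - b^2) * (x * z - h^2))
  = sg^2 * (x^2 + z^2 + 2 * h^2) + 2 * (sg * (q1 + q2)) + (f^2 - 2 * g)"
  by (simp add: f_def g_def q1_def q2_def sq_eq algebra_simps)
 have "sg * (q1 + q2) >= 0" using q assms by simp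
 moreover have "f^2 - 2 * g >= 0" using fg zero_le_power2[of f] by linarith
 ultimately show ?thesis unfolding id by linarith
qed

lemma planar_form_coercive:
 fixes L :: real
 assumes L: "L >= 1"
 obtains c C where "c > 0" "C >= 0"
  "!!mu1 mu2 q1 q2 a w y z11 z22 z12 sig d.
   [|1 / L <= mu1; mu1 <= L; 1 / L <= mu2; mu2 <= L; 0 <= a; 1 <= w; w <= L; 1 / L <= sig;
   sig = w * (mu1 * mu2) - (a * (mu1 + mu2) + q1^2 * mu2 + q2^2 * mu1);
   d = (w * mu2 - a - q2^2) * z11 + (w * mu1 - a - q1^2) * z22 + 2 * (q1 * q2) * z12 + 2 * y * ((w - 1) * (mu1 * mu2))|]
  ==> c * (z11^2 + z22^2 + 2 * z12^2) + 2 * (y^2 * ((w - 1) * (mu1 * mu2))) - C * d^2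
   <= (z11 / mu1 + z22 / mu2) * d - sig * ((z11 * z22 - z12^2) / (mu1 * mu2)) + 3 * (y^2 * ((w - 1) * (mu1 * mu2)))"
proof
 show "1 / (12 * L ^ 12) > 0" "2 * L ^ 3 + 6 * L ^ 10 >= 0" using L by auto
 fix mu1 mu2 q1 q2 a w y z11 z22 z12 sig d :: real
 assume mu: "1 / L <= mu1" "mu1 <= L" "1 / L <= mu2" "mu2 <= L" and a: "0 <= a" and w: "1 <= w" "w <= L" and sL: "1 / L <= sig"
  and sig: "sig = w * (mu1 * mu2) - (a * (mu1 + mu2) + q1^2 * mu2 + q2^2 * mu1)"
  and d: "d = (w * mu2 - a - q2^2) * z11 + (w * mu1 - a - q1^2) * z22 + 2 * (q1 * q2) * z12 + 2 * y * ((w - 1) * (mu1 * mu2))"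
 have iL: "1 / L > 0" using L by simp
 have mp: "mu1 > 0" "mu2 > 0" "sig > 0" using mu sL iL by linarith+
 \<comment> \<open>Normalisation: the \<open>x\<close> are the entries of m^(-1/2) Z m^(-1/2), whose
   determinant is the quotient in the claim.\<close>
 define r where "r = sqrt (mu1 * mu2)"
 have r: "r > 0" "r^2 = mu1 * mu2" using mp by (simp_all add: r_def)
 define x11 where "x11 = z11 / mu1"
 define x22 where "x22 = z22 / mu2"
 define x12 where "x12 = z12 / r"
 have z: "z11 = mu1 * x11" "z22 = mu2 * x22" "z12 = r * x12" using mp r by (simp_all add: x11_def x22_def x12_def)
 define N where "N = x11^2 + x22^2 + 2 * x12^2"
 define dla where "dla = x11 * x22 - x12^2"
 define \<Omega> where "\<Omega> = w * (mu1 * mu2)"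
 define TH where "TH = (w - 1) * (mu1 * mu2)"
 define B1 where "B1 = mu2 * (a + q1^2)"
 define B2 where "B2 = mu1 * (a + q2^2)"
 define B3 where "B3 = r * (q1 * q2)"
 define e where "e = (sig + B1) * x11 + (sig + B2) * x22 + 2 * B3 * x12"
 define D where "D = (sig + B1) * (sig + B2) - B3^2"
 have m12: "mu1 * mu2 > 0" using mp by simp
 have B: "B1 >= 0" "B2 >= 0" using mp a by (simp_all add: B1_def B2_def)
 have BB: "B1 * B2 - B3^2 = (mu1 * mu2) * (a * (a + q1^2 + q2^2))"
  unfolding B1_def B2_def B3_def power_mult_distrib r by (simp add: sq_eq algebra_simps)
 also have "... >= 0" using a mp by simp
 finally have B3: "B3^2 <= B1 * B2" by simp
 have sB: "sig + (B1 + B2) = \<Omega>" by (simp add: sig B1_def B2_def \<Omega>_def algebra_simps)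
 \<comment> \<open>\<open>D\<close> is the determinant of \<open>sig\<close> times the identity plus
   a positive semidefinite matrix with trace \<open>B1 + B2\<close>. Its first two terms already
   give \<open>\<Omega> * sig\<close>, whence \<open>sig / D <= 1 / \<Omega>\<close> below.\<close>
 have D1: "D = \<Omega> * sig + (B1 * B2 - B3^2)" unfolding sB[symmetric] D_def by (simp add: sq_eq algebra_simps)
 have DO: "D >= \<Omega> * sig" using B3 unfolding D1 by simp
 have \<Omega>: "\<Omega> > 0" using m12 w by (simp add: \<Omega>_def)
 have Dp: "D > 0" using DO mult_pos_pos[OF \<Omega> mp(3)] by linarith
 have t1: "(w * mu2 - a - q2^2) * mu1 = sig + B1" "(w * mu1 - a - q1^2) * mu2 = sig + B2"
  by (simp_all add: sig B1_def B2_def algebra_simps)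
 have de: "d = e + 2 * (y * TH)"
 proof -
  have "d = ((w * mu2 - a - q2^2) * mu1) * x11 + ((w * mu1 - a - q1^2) * mu2) * x22 + 2 * (r * (q1 * q2)) * x12 + 2 * (y * TH)"
   unfolding d TH_def z by (simp add: algebra_simps)
  then show ?thesis unfolding t1 e_def B3_def[symmetric] .
 qed
 have dla': "(z11 * z22 - z12^2) / (mu1 * mu2) = dla"
 proof -
  have "z11 * z22 - z12^2 = (mu1 * mu2) * dla" unfolding z dla_def power_mult_distrib r by (simp add: algebra_simps)
  then show ?thesis using mp by simp
 qed
 have h2: "4 * (D * dla) <= e^2"
  unfolding D_def dla_def e_def
 proof (rule det2_lorentzian)
  show "B3^2 <= (sig + B1) * (sig + B2)" using Dp by (simp add: D_def)
 qed (use mp B in auto)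
 have h3: "sig^2 * N <= e^2 - 2 * (D * dla)"
  unfolding D_def dla_def e_def N_def by (rule psd2_trace_square) (use mp B B3 in auto)
 \<comment> \<open>Chosen so that \<open>(1 + kapa)^2 <= 1 + 1 / L\<close>. This fits between
   \<open>w - 1\<close> and \<open>w\<close> because \<open>w <= L\<close>, as used in
   \<open>T1\<close>.\<close>
 define kapa where "kapa = 1 / (3 * L)"
 have kapa: "0 < kapa" "kapa <= 1" using L by (auto simp: kapa_def)
 have Np: "N >= 0" by (simp add: N_def)
 \<comment> \<open>A convex combination of the Lorentzian bound \<open>h2\<close>, which has the
   sharp constant, and \<open>h3\<close>, which has a gain in \<open>N\<close>.\<close>
 have mix: "D * dla <= (1 + kapa) * e^2 / 4 - kapa * (sig^2 * N) / 2"
 proof -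
  have "(1 - kapa) * (4 * (D * dla)) <= (1 - kapa) * e^2" using kapa h2 by (intro mult_left_mono) auto
  moreover have "kapa * (sig^2 * N) <= kapa * (e^2 - 2 * (D * dla))" using kapa h3 by (intro mult_left_mono) auto
  ultimately show ?thesis by (simp add: algebra_simps)
 qed
 have sD: "sig / D <= 1 / \<Omega>" using DO \<Omega> Dp by (simp add: field_simps)
 have O3: "\<Omega> <= L ^ 3"
 proof -
  have "mu1 * mu2 <= L * L" using mu mp L by (intro mult_mono) auto
  then have "w * (mu1 * mu2) <= L * (L * L)" using w L m12 by (intro mult_mono[of w]) auto
  then show ?thesis by (simp add: \<Omega>_def power3_eq_cube mult.assoc)
 qed
 have "D <= \<Omega> * \<Omega>"
 proof -
  have "D <= (sig + B1) * (sig + B2)" by (simp add: D_def)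
  also have "... <= \<Omega> * \<Omega>" using sB B mp \<Omega> by (intro mult_mono) auto
  finally show ?thesis .
 qed
 also have "... <= L ^ 3 * L ^ 3" using O3 \<Omega> L by (intro mult_mono) auto
 finally have D6: "D <= L ^ 6" by (simp add: power_add[symmetric])
 have c0: "1 / (6 * L ^ 10) <= sig / D * (kapa * sig^2 / 2)"
 proof -
  have "(1 / L) ^ 3 <= sig ^ 3" using sL iL by (intro power_mono) auto
  then have "(1 / L) ^ 3 / L ^ 6 <= sig ^ 3 / D" using D6 Dp mp by (intro frac_le) auto
  then have "kapa / 2 * ((1 / L) ^ 3 / L ^ 6) <= kapa / 2 * (sig ^ 3 / D)" using kapa by (intro mult_left_mono) auto
  moreover have "kapa / 2 * ((1 / L) ^ 3 / L ^ 6) = 1 / (6 * L ^ 10)" using L by (simp add: kapa_def eval_nat_numeral field_simps)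
  moreover have "kapa / 2 * (sig ^ 3 / D) = sig / D * (kapa * sig^2 / 2)" by (simp add: eval_nat_numeral mult_ac)
  ultimately show ?thesis by simp
 qed
 define c0 where "c0 = 1 / (6 * L ^ 10)"
 have c0p: "c0 > 0" using L by (simp add: c0_def)
 have s1: "sig * dla <= (1 + kapa) * e^2 / (4 * \<Omega>) - c0 * N"
 proof -
  have "sig * dla = sig / D * (D * dla)" using Dp by simp
  also have "... <= sig / D * ((1 + kapa) * e^2 / 4 - kapa * (sig^2 * N) / 2)" using mix mp Dp by (intro mult_left_mono) auto
  also have "... = sig / D * ((1 + kapa) * e^2 / 4) - sig / D * (kapa * sig^2 / 2) * N" by (simp add: algebra_simps)
  also have "... <= 1 / \<Omega> * ((1 + kapa) * e^2 / 4) - c0 * N"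
   using sD c0 kapa Np unfolding c0_def by (intro diff_mono mult_right_mono) auto
  finally show ?thesis by simp
 qed
 have e2: "e^2 <= (1 + kapa) * (4 * (y * TH)^2) + (1 + 1 / kapa) * d^2"
 proof -
  have "0 <= kapa * (2 * (y * TH) + d / kapa)^2" using kapa by simp
  also have "... = kapa * (4 * (y * TH)^2) + 4 * (y * TH) * d + 1 / kapa * d^2"
   using kapa by (simp add: sq_eq field_simps)
  finally have "0 <= kapa * (4 * (y * TH)^2) + 4 * (y * TH) * d + 1 / kapa * d^2" .
  moreover have "e^2 = 4 * (y * TH)^2 - 4 * (y * TH) * d + d^2" using de by (simp add: sq_eq algebra_simps)
  ultimately show ?thesis by (simp add: algebra_simps)
 qed
 have TH: "0 <= TH" using w m12 by (simp add: TH_def)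
 have T1: "(1 + kapa)^2 * TH <= \<Omega>"
 proof -
  have k2: "(1 + kapa)^2 <= 1 + 1 / L"
  proof -
   have "kapa * kapa <= kapa * 1" using kapa by (intro mult_left_mono) auto
   then have "(1 + kapa)^2 <= 1 + 3 * kapa" by (simp add: sq_eq algebra_simps)
   then show ?thesis by (simp add: kapa_def)
  qed
  have "(1 + kapa)^2 * (w - 1) <= (1 + 1 / L) * (w - 1)" using k2 w by (intro mult_right_mono) auto
  also have "... <= w"
  proof -
   have "(w - 1) / L <= 1" using w L by simp
   then show ?thesis by (simp add: algebra_simps)
  qed
  finally have "(1 + kapa)^2 * (w - 1) * (mu1 * mu2) <= w * (mu1 * mu2)" using m12 by (intro mult_right_mono) auto
  then show ?thesis by (simp add: TH_def \<Omega>_def mult.assoc)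
 qed
 have y2: "(1 + kapa) * ((1 + kapa) * (4 * (y * TH)^2)) / (4 * \<Omega>) <= y^2 * TH"
 proof -
  have "(1 + kapa) * ((1 + kapa) * (4 * (y * TH)^2)) / (4 * \<Omega>) = (y^2 * TH) * ((1 + kapa)^2 * TH) / \<Omega>"
   using \<Omega> by (simp add: sq_eq field_simps)
  also have "... <= (y^2 * TH) * \<Omega> / \<Omega>" using T1 TH \<Omega> by (intro divide_right_mono mult_left_mono) auto
  finally show ?thesis using \<Omega> by simp
 qed
 have O2: "1 / \<Omega> <= L^2"
 proof -
  have "(1 / L) * (1 / L) <= mu1 * mu2" using mu mp(1,2) iL by (intro mult_mono) linarith+
  also have "... <= \<Omega>" using w m12 unfolding \<Omega>_def by (simp add: mult_le_cancel_right1)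
  finally have "1 / L^2 <= \<Omega>" by (simp add: sq_eq)
  then show ?thesis using \<Omega> L by (simp add: field_simps)
 qed
 have d2: "(1 + kapa) * ((1 + 1 / kapa) * d^2) / (4 * \<Omega>) <= 2 * L ^ 3 * d^2"
 proof -
  have "(1 + kapa) * (1 + 1 / kapa) <= 2 * (4 * L)" using kapa L by (intro mult_mono) (auto simp: kapa_def)
  then have "((1 + kapa) * (1 + 1 / kapa)) * (1 / \<Omega>) <= (2 * (4 * L)) * L^2" using O2 \<Omega> L kapa by (intro mult_mono[of "(1 + kapa) * (1 + 1 / kapa)"]) auto
  then have "((1 + kapa) * (1 + 1 / kapa)) * (1 / \<Omega>) * (d^2 / 4) <= (2 * (4 * L)) * L^2 * (d^2 / 4)" by (intro mult_right_mono) auto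
  moreover have "((1 + kapa) * (1 + 1 / kapa)) * (1 / \<Omega>) * (d^2 / 4) = (1 + kapa) * ((1 + 1 / kapa) * d^2) / (4 * \<Omega>)" by (simp add: mult_ac)
  moreover have "(2 * (4 * L)) * L^2 * (d^2 / 4) = 2 * L ^ 3 * d^2" by (simp add: eval_nat_numeral)
  ultimately show ?thesis by linarith
 qed
 have s2: "sig * dla <= y^2 * TH + 2 * L ^ 3 * d^2 - c0 * N"
 proof -
  have "(1 + kapa) * e^2 / (4 * \<Omega>) <= (1 + kapa) * ((1 + kapa) * (4 * (y * TH)^2) + (1 + 1 / kapa) * d^2) / (4 * \<Omega>)"
   using e2 kapa \<Omega> by (intro divide_right_mono mult_left_mono) auto
  also have "... = (1 + kapa) * ((1 + kapa) * (4 * (y * TH)^2)) / (4 * \<Omega>) + (1 + kapa) * ((1 + 1 / kapa) * d^2) / (4 * \<Omega>)"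
   by (simp only: distrib_left add_divide_distrib)
  finally show ?thesis using s1 y2 d2 by linarith
 qed
 have s3: "(x11 + x22) * d >= - (c0 / 2 * N) - 6 * L ^ 10 * d^2"
 proof -
  have "(x11 + x22)^2 <= 2 * N"
   proof -
   have "2 * N - (x11 + x22)^2 = (x11 - x22)^2 + 4 * x12^2" by (simp add: N_def sq_eq algebra_simps)
   then show ?thesis using zero_le_power2[of "x11 - x22"] zero_le_power2[of x12] by linarith
  qed
  then have "c0 / 4 * (x11 + x22)^2 <= c0 / 4 * (2 * N)" using c0p by (intro mult_left_mono) auto
  moreover have "0 <= (c0 / 4) * ((x11 + x22) + 2 / c0 * d)^2" using c0p by simp
  moreover have "(c0 / 4) * ((x11 + x22) + 2 / c0 * d)^2 = c0 / 4 * (x11 + x22)^2 + (x11 + x22) * d + 1 / c0 * d^2"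
   using c0p by (simp add: sq_eq field_simps)
  moreover have "1 / c0 * d^2 = 6 * L ^ 10 * d^2" by (simp add: c0_def)
  moreover have "c0 / 4 * (2 * N) = c0 / 2 * N" by simp
  ultimately show ?thesis by linarith
 qed
 have ZN: "1 / (12 * L ^ 12) * (z11^2 + z22^2 + 2 * z12^2) <= c0 / 2 * N"
 proof -
  have "mu1^2 <= L^2" "mu2^2 <= L^2" using mu mp by (auto intro: power_mono)
  moreover have "r^2 <= L^2" unfolding r unfolding sq_eq using mu mp L by (intro mult_mono) auto
  ultimately have "mu1^2 * x11^2 <= L^2 * x11^2" "mu2^2 * x22^2 <= L^2 * x22^2" "r^2 * x12^2 <= L^2 * x12^2" by (auto intro: mult_right_mono)
  then have "z11^2 + z22^2 + 2 * z12^2 <= L^2 * N" unfolding z power_mult_distrib N_def by (simp add: algebra_simps)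
  then have "1 / (12 * L ^ 12) * (z11^2 + z22^2 + 2 * z12^2) <= 1 / (12 * L ^ 12) * (L^2 * N)" using L by (intro mult_left_mono) auto
  also have "... = c0 / 2 * N" using L by (simp add: c0_def eval_nat_numeral)
  finally show ?thesis .
 qed
 have "1 / (12 * L ^ 12) * (z11^2 + z22^2 + 2 * z12^2) + 2 * (y^2 * TH) - (2 * L ^ 3 + 6 * L ^ 10) * d^2
  <= (x11 + x22) * d - sig * dla + 3 * (y^2 * TH)"
  using s2 s3 ZN unfolding distrib_right by linarith
 then show "1 / (12 * L ^ 12) * (z11^2 + z22^2 + 2 * z12^2) + 2 * (y^2 * ((w - 1) * (mu1 * mu2))) - (2 * L ^ 3 + 6 * L ^ 10) * d^2
   <= (z11 / mu1 + z22 / mu2) * d - sig * ((z11 * z22 - z12^2) / (mu1 * mu2)) + 3 * (y^2 * ((w - 1) * (mu1 * mu2)))"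
  by (simp only: dla' TH_def x11_def x22_def)
qed

lemma rank_two_coordinates:
 fixes b :: "'n => real^'n" and U V :: "real^'n^'n"
 assumes b: "orthobasis b" and ij: "i ~= j" and U: "transpose U = U" and V: "transpose V = V"
  and "\<forall>k. k \<notin> {i, j} --> U *v b k = 0" and "\<forall>k. k \<notin> {i, j} --> V *v b k = 0"
 defines "u \<equiv> %k l. b k \<bullet> (U *v b l)" and "v \<equiv> %k l. b k \<bullet> (V *v b l)"
 shows "trace U = u i i + u j j"
  and "U \<bullet> V = u i i * v i i + u j j * v j j + 2 * (u i j * v i j)"
  and "x \<bullet> (U *v x) = u i i * (b i \<bullet> x)^2 + u j j * (b j \<bullet> x)^2 + 2 * (u i j * ((b i \<bullet> x) * (b j \<bullet> x)))"
  and "(U *v x) \<bullet> (V *v x) = (u i i * (b i \<bullet> x) + u i j * (b j \<bullet> x)) * (v i i * (b i \<bullet> x) + v i j * (b j \<bullet> x))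
    + (u i j * (b i \<bullet> x) + u j j * (b j \<bullet> x)) * (v i j * (b i \<bullet> x) + v j j * (b j \<bullet> x))"
proof -
 have U0: "U *v b k = 0" and V0: "V *v b k = 0" if "k \<notin> {i, j}" for k using assms(5,6) that by auto
 have us: "u k l = u l k" for k l unfolding u_def using symmetric_inner[OF U] by (simp add: inner_commute)
 have vs: "v k l = v l k" for k l unfolding v_def using symmetric_inner[OF V] by (simp add: inner_commute)
 have restr: "(\<Sum>k\<in>UNIV. g k) = g i + g j" if "!!k. k \<notin> {i, j} ==> g k = 0" for g :: "'n => real"
  using sum.mono_neutral_right[of UNIV "{i, j}" g] that ij by simp
 have bU: "b k \<bullet> (U *v x) = (U *v b k) \<bullet> x" and bV: "b k \<bullet> (V *v x) = (V *v b k) \<bullet> x" for k x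
  using symmetric_inner[OF U] symmetric_inner[OF V] by simp_all
 show "trace U = u i i + u j j" unfolding orthobasis_trace[OF b] u_def by (rule restr) (simp add: U0)
 have "U \<bullet> V = (\<Sum>k\<in>UNIV. \<Sum>l\<in>UNIV. u k l * v k l)" unfolding u_def v_def by (rule orthobasis_matrix_inner2[OF b])
 also have "... = (\<Sum>l\<in>UNIV. u i l * v i l) + (\<Sum>l\<in>UNIV. u j l * v j l)"
  by (rule restr) (simp add: u_def bU U0)
 also have "(\<Sum>l\<in>UNIV. u i l * v i l) = u i i * v i i + u i j * v i j" by (rule restr) (simp add: u_def U0)
 also have "(\<Sum>l\<in>UNIV. u j l * v j l) = u j i * v j i + u j j * v j j" by (rule restr) (simp add: u_def U0)
 finally show "U \<bullet> V = u i i * v i i + u j j * v j j + 2 * (u i j * v i j)" by (simp add: us[of j i] vs[of j i])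
 have Ub: "(U *v b k) \<bullet> x = u i k * (b i \<bullet> x) + u j k * (b j \<bullet> x)" for k
 proof -
  have "(U *v b k) \<bullet> x = (\<Sum>l\<in>UNIV. (b l \<bullet> (U *v b k)) * (b l \<bullet> x))" by (rule orthobasis_inner[OF b, symmetric])
  also have "... = u i k * (b i \<bullet> x) + u j k * (b j \<bullet> x)" unfolding u_def by (rule restr) (simp add: bU U0)
  finally show ?thesis .
 qed
 have Vb: "(V *v b k) \<bullet> x = v i k * (b i \<bullet> x) + v j k * (b j \<bullet> x)" for k
 proof -
  have "(V *v b k) \<bullet> x = (\<Sum>l\<in>UNIV. (b l \<bullet> (V *v b k)) * (b l \<bullet> x))" by (rule orthobasis_inner[OF b, symmetric])
  also have "... = v i k * (b i \<bullet> x) + v j k * (b j \<bullet> x)" unfolding v_def by (rule restr) (simp add: bV V0)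
  finally show ?thesis .
 qed
 have "x \<bullet> (U *v x) = (\<Sum>k\<in>UNIV. (b k \<bullet> x) * (b k \<bullet> (U *v x)))" by (rule orthobasis_inner[OF b, symmetric])
 also have "... = (b i \<bullet> x) * (b i \<bullet> (U *v x)) + (b j \<bullet> x) * (b j \<bullet> (U *v x))" by (rule restr) (simp add: bU U0)
 finally show "x \<bullet> (U *v x) = u i i * (b i \<bullet> x)^2 + u j j * (b j \<bullet> x)^2 + 2 * (u i j * ((b i \<bullet> x) * (b j \<bullet> x)))"
  unfolding bU Ub us[of j i] by (simp add: sq_eq algebra_simps)
 have "(U *v x) \<bullet> (V *v x) = (\<Sum>k\<in>UNIV. (b k \<bullet> (U *v x)) * (b k \<bullet> (V *v x)))" by (rule orthobasis_inner[OF b, symmetric])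
 also have "... = (b i \<bullet> (U *v x)) * (b i \<bullet> (V *v x)) + (b j \<bullet> (U *v x)) * (b j \<bullet> (V *v x))" by (rule restr) (simp add: bU U0)
 finally show "(U *v x) \<bullet> (V *v x) = (u i i * (b i \<bullet> x) + u i j * (b j \<bullet> x)) * (v i i * (b i \<bullet> x) + v i j * (b j \<bullet> x))
    + (u i j * (b i \<bullet> x) + u j j * (b j \<bullet> x)) * (v i j * (b i \<bullet> x) + v j j * (b j \<bullet> x))"
  unfolding bU bV Ub Vb us[of j i] vs[of j i] by (simp add: algebra_simps)
qed

text \<open>In the eigenbasis of \<open>m\<close> all matrices that occur, apart from q q^T, live in
  one plane. The part of \<open>q\<close> off the plane enters only through its squared length
  \<open>a\<close>, and \<open>Theta p p\<close> becomes \<open>4 * s^2 * a\<close> times the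
  polarised determinant.\<close>

lemma structural_rank_2:
 fixes L :: real
 assumes L: "L >= 1"
 obtains c C where "c > 0" "C >= 0"
  "!!(b :: 'n => real^'n) T mu q s p m Z y.
   [|structural_data L b T mu q s p m; card T = 2; transpose Z = Z; !!j. j \<notin> T ==> Z *v b j = 0|]
  ==> structural_bound c C b T mu q p m Z y"
proof -
 define L' where "L' = 1 + 4 * L ^ 4"
 have L4: "L <= L ^ 4" using L power_increasing[of 1 4 L] by auto
 have L'1: "L' >= 1" "L <= L'" unfolding L'_def using L L4 by auto
 show thesis
  apply (rule planar_form_coercive[OF L'1(1)])
  subgoal premises main for c C
 proof (rule that[OF main(1,2)])
  fix b :: "'n => real^'n" and T mu q s p m Z y
  assume data: "structural_data L b T mu q s p m" and T: "card T = 2" and Z: "transpose Z = Z" and ZT: "!!j. j \<notin> T ==> Z *v b j = 0"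
  note b = structural_dataD(1)[OF data] and mulo = structural_dataD(2)[OF data] and muhi = structural_dataD(3)[OF data]
   and mu0 = structural_dataD(4)[OF data] and m = structural_dataD(5)[OF data] and p = structural_dataD(6)[OF data]
   and q = structural_dataD(7)[OF data] and s = structural_dataD(8,9)[OF data] and sigma = structural_dataD(10)[OF data]
  obtain i j where Tij: "T = {i, j}" "i ~= j" using T by (meson card_2_iff)
  have iL: "1 / L > 0" using L by simp
  have mp: "mu i > 0" "mu j > 0" using mulo[of i] mulo[of j] Tij iL by (meson insertI1 insertI2 less_le_trans)+
  have tm: "transpose m = m"
   by (subst (1 2) eigenbasis_symmetric_matrix[OF b m]) (simp add: transpose_sum' transpose_scaleR' transpose_outer_prod)
  have bb: "b k \<bullet> b l = (if k = l then 1 else 0)" for k l using b by (simp add: orthobasis_def)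
  define q1 where "q1 = b i \<bullet> q"
  define q2 where "q2 = b j \<bullet> q"
  define a where "a = q \<bullet> q - (q1^2 + q2^2)"
  define w where "w = 1 + 4 * s^2 * a"
  define z where "z k l = b k \<bullet> (Z *v b l)" for k l
  have zs: "z j i = z i j" unfolding z_def using symmetric_inner[OF Z] by (simp add: inner_commute)
  define M where "M = m - outer_prod q q"
  have a0: "a >= 0"
  proof -
   have "(\<Sum>k\<in>{i, j}. (b k \<bullet> q) * (b k \<bullet> q)) <= (\<Sum>k\<in>UNIV. (b k \<bullet> q) * (b k \<bullet> q))" by (intro sum_mono2) auto
   then show ?thesis using Tij by (simp add: orthobasis_inner[OF b] a_def q1_def q2_def sq_eq)
  qed
  have m0: "\<forall>k. k \<notin> {i, j} --> m *v b k = 0" using m mu0 Tij by simp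
  have Z0: "\<forall>k. k \<notin> {i, j} --> Z *v b k = 0" using ZT Tij by simp
  have mu_ij: "b i \<bullet> (m *v b i) = mu i" "b j \<bullet> (m *v b j) = mu j" "b i \<bullet> (m *v b j) = 0" using Tij by (simp_all add: m bb)
  note cU = rank_two_coordinates[OF b Tij(2)]
  \<comment> \<open>For matrices supported in the plane the second Newton tensor vanishes on the
    plane by Cayley-Hamilton, so only the component of \<open>p\<close> off the plane
    counts.\<close>
  have Th: "Theta p p U V = (w - 1) * (((b i \<bullet> (U *v b i)) * (b j \<bullet> (V *v b j)) + (b j \<bullet> (U *v b j)) * (b i \<bullet> (V *v b i))
    - 2 * ((b i \<bullet> (U *v b j)) * (b i \<bullet> (V *v b j)))) / 2)"
   if U: "transpose U = U" "\<forall>k. k \<notin> {i, j} --> U *v b k = 0" and V: "transpose V = V" "\<forall>k. k \<notin> {i, j} --> V *v b k = 0" for U V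
  proof -
   have pq: "p \<bullet> p = 4 * s^2 * (q \<bullet> q)" "p \<bullet> (U *v p) = 4 * s^2 * (q \<bullet> (U *v q))" "p \<bullet> (V *v p) = 4 * s^2 * (q \<bullet> (V *v q))"
    "(U *v p) \<bullet> (V *v p) = 4 * s^2 * ((U *v q) \<bullet> (V *v q))"
    by (simp_all add: p mv_scaleR sq_eq)
   have qq: "q \<bullet> q = a + (q1^2 + q2^2)" by (simp add: a_def)
   show ?thesis
    unfolding Theta_def pq cU(1)[OF U(1) U(1) U(2) U(2)] cU(1)[OF V(1) V(1) V(2) V(2)] cU(2)[OF U(1) V(1) U(2) V(2)]
     cU(3)[OF U(1) U(1) U(2) U(2), where x = q] cU(3)[OF V(1) V(1) V(2) V(2), where x = q] cU(4)[OF U(1) V(1) U(2) V(2), where x = q] q1_def[symmetric] q2_def[symmetric] qq w_def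
    by (simp add: sq_eq field_simps)
  qed
  have PhiM: "2 * Phi p M V = (w * mu j - a - q2^2) * (b i \<bullet> (V *v b i)) + (w * mu i - a - q1^2) * (b j \<bullet> (V *v b j)) + 2 * (q1 * q2) * (b i \<bullet> (V *v b j))"
   if V: "transpose V = V" "\<forall>k. k \<notin> {i, j} --> V *v b k = 0" for V
  proof -
   have "2 * Phi p M V = 2 * S2 m V - 2 * S2 (outer_prod q q) V + 2 * Theta p p m V"
    by (simp add: M_def Phi_def S2_def Theta_minus_left Theta_rank_one_self[OF p V(1)] trace_minus inner_diff_left field_simps)
   also have "2 * S2 (outer_prod q q) V = (q \<bullet> q) * trace V - q \<bullet> (V *v q)"
    by (simp add: S2_def trace_outer_prod inner_outer_prod inner_commute[of "outer_prod q q"])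
   also have "2 * S2 m V = trace m * trace V - m \<bullet> V" by (simp add: S2_def)
   also have qq: "q \<bullet> q = a + (q1^2 + q2^2)" by (simp add: a_def)
   finally show ?thesis
    unfolding Th[OF tm m0 V] cU(1)[OF V(1) V(1) V(2) V(2)] cU(1)[OF tm tm m0 m0] cU(2)[OF tm V(1) m0 V(2)]
     cU(3)[OF V(1) V(1) V(2) V(2), where x = q] mu_ij q1_def[symmetric] q2_def[symmetric]
    by (simp add: sq_eq field_simps)
  qed
  define TH where "TH = (w - 1) * (mu i * mu j)"
  have Thmm: "Theta p p m m = TH" unfolding Th[OF tm m0 tm m0] mu_ij by (simp add: TH_def)
  have ThmZ: "Theta p p m Z = (w - 1) * ((mu i * z j j + mu j * z i i) / 2)" unfolding Th[OF tm m0 Z Z0] mu_ij by (simp add: z_def)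
  define sig where "sig = w * (mu i * mu j) - (a * (mu i + mu j) + q1^2 * mu j + q2^2 * mu i)"
  have PhiMM: "Phi p M M = sig"
  proof -
   have "Phi p M M = 2 * Phi p M m - Phi p M m - Phi p M (outer_prod q q)" by (simp add: M_def Phi_minus_right)
   moreover have "Phi p M (outer_prod q q) = Phi p m (outer_prod q q) - Phi p (outer_prod q q) (outer_prod q q)"
    by (simp add: M_def Phi_minus_left)
   moreover have "Phi p (outer_prod q q) (outer_prod q q) = 0"
    by (simp add: Phi_def S2_def Theta_rank_one_self[OF p transpose_outer_prod] trace_outer_prod inner_outer_prod outer_prod_mult sq_eq)
   moreover have "Phi p M m = Phi p m m - Phi p m (outer_prod q q)" by (simp add: M_def Phi_minus_left Phi_commute[of p "outer_prod q q" m])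
   moreover have "Phi p m m = w * (mu i * mu j)"
    unfolding Phi_def Thmm S2_def cU(1)[OF tm tm m0 m0] cU(2)[OF tm tm m0 m0] mu_ij by (simp add: TH_def field_simps)
   moreover have "2 * Phi p M m = (w * mu j - a - q2^2) * mu i + (w * mu i - a - q1^2) * mu j"
    unfolding PhiM[OF tm m0] mu_ij by simp
   ultimately show ?thesis unfolding sig_def by (simp add: algebra_simps)
  qed
  define d where "d = (w * mu j - a - q2^2) * z i i + (w * mu i - a - q1^2) * z j j + 2 * (q1 * q2) * z i j + 2 * y * ((w - 1) * (mu i * mu j))"
  have PhiMZ: "2 * Phi p M Z + 2 * y * Theta p p m m = d"
   unfolding PhiM[OF Z Z0] Thmm by (simp add: d_def z_def TH_def)
  define V where "V = (\<Sum>j\<in>T. (1 / mu j) *R outer_prod (Z *v b j) (Z *v b j))"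
  have tV: "transpose V = V" by (simp add: V_def transpose_sum' transpose_scaleR' transpose_outer_prod)
  have Vb: "V *v x = (1 / mu i) *R ((Z *v b i) \<bullet> x) *R (Z *v b i) + (1 / mu j) *R ((Z *v b j) \<bullet> x) *R (Z *v b j)" for x
   using Tij by (simp add: V_def add_mv scaleR_mv outer_prod_mult)
  have Zx: "(Z *v b k) \<bullet> b l = z l k" for k l by (simp add: z_def inner_commute)
  have V0: "\<forall>k. k \<notin> {i, j} --> V *v b k = 0"
  proof (intro allI impI)
   fix k assume "k \<notin> {i, j}"
   then have "z k l = 0" for l using symmetric_inner[OF Z, of "b k" "b l"] Z0 by (simp add: z_def)
   then show "V *v b k = 0" by (simp add: Vb Zx)
  qed
  have Vij: "b k \<bullet> (V *v b l) = z k i * z l i / mu i + z k j * z l j / mu j" for k l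
   by (simp add: Vb Zx inner_add_right z_def mult.commute)
  define dla where "dla = (z i i * z j j - (z i j)^2) / (mu i * mu j)"
  define ta where "ta = z i i / mu i + z j j / mu j"
  have PhiZZ: "Phi p Z Z = w * (dla * (mu i * mu j))"
   unfolding Phi_def S2_def cU(1)[OF Z Z Z0 Z0] cU(2)[OF Z Z Z0 Z0] Th[OF Z Z0 Z Z0] z_def[symmetric] dla_def
   using mp by (simp add: sq_eq field_simps)
  have LHS: "Phi p Z Z + 2 * Phi p M V + 4 * y * Theta p p m Z + 3 * y^2 * Theta p p m m = ta * d - sig * dla + 3 * (y^2 * TH)"
  proof -
   \<comment> \<open>Cayley-Hamilton for m^(-1) Z in the plane: Z m^(-1) Z = ta Z - dla m, entry by
     entry.\<close>
   have v1: "z i i * z i i / mu i + z i j * z i j / mu j = ta * z i i - dla * mu i"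
    and v2: "z j i * z j i / mu i + z j j * z j j / mu j = ta * z j j - dla * mu j"
    and v3: "z i i * z j i / mu i + z i j * z j j / mu j = ta * z i j"
    using mp by (simp_all add: ta_def dla_def zs sq_eq field_simps)
   have "mu i * z j j + mu j * z i i = ta * (mu i * mu j)" using mp by (simp add: ta_def field_simps)
   then have t: "4 * y * Theta p p m Z = 2 * y * ((w - 1) * (ta * (mu i * mu j)))" unfolding ThmZ by simp
   show ?thesis
    unfolding PhiZZ PhiM[OF tV V0] Vij v1 v2 v3 t Thmm d_def sig_def TH_def by (simp add: sq_eq algebra_simps)
  qed
  have nZ: "(norm Z)^2 = (z i i)^2 + (z j j)^2 + 2 * (z i j)^2"
   unfolding norm_sq cU(2)[OF Z Z Z0 Z0] by (simp add: z_def sq_eq)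
  have iL': "1 / L' <= 1 / L" using L L'1 by (simp add: frac_le)
  have w1: "1 <= w" "w <= L'"
  proof -
   show "1 <= w" using a0 by (simp add: w_def)
   have "a <= q \<bullet> q" by (simp add: a_def)
   also have "... = (norm q)^2" by (simp add: norm_sq)
   also have "... <= L^2" using q by (intro power_mono) auto
   finally have "s^2 * a <= L^2 * L^2" using s a0 by (intro mult_mono power_mono) auto
   then show "w <= L'" by (simp add: w_def L'_def power_add[symmetric])
  qed
  have "c * ((z i i)^2 + (z j j)^2 + 2 * (z i j)^2) + 2 * (y^2 * TH) - C * d^2 <= ta * d - sig * dla + 3 * (y^2 * TH)"
   unfolding ta_def dla_def TH_def
  proof (rule main(3))
   show "1 / L' <= mu i" "mu i <= L'" "1 / L' <= mu j" "mu j <= L'"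
    using mulo[of i] mulo[of j] muhi[of i] muhi[of j] Tij iL' L'1 by auto
   show "1 / L' <= sig" using sigma iL' unfolding M_def[symmetric] PhiMM by linarith
  qed (fact a0 w1 sig_def d_def)+
  then show "structural_bound c C b T mu q p m Z y"
   unfolding structural_bound_def M_def[symmetric] V_def[symmetric] PhiMZ nZ LHS unfolding Thmm by (simp add: mult.assoc)
 qed
  done
qed

lemma sum_squares_le_square_sum:
 fixes mu :: "'a => real"
 assumes "finite I" "!!i. i : I ==> mu i >= 0"
 shows "(\<Sum>i\<in>I. (mu i)^2) <= (\<Sum>i\<in>I. mu i)^2"
proof -
 have "(\<Sum>i\<in>I. (mu i)^2) <= (\<Sum>i\<in>I. mu i * (\<Sum>l\<in>I. mu l))"
  unfolding sq_eq using assms by (intro sum_mono mult_left_mono member_le_sum) auto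
 also have "... = (\<Sum>i\<in>I. mu i)^2" by (simp add: sum_distrib_right[symmetric] sq_eq)
 finally show ?thesis .
qed

text \<open>In the eigenbasis \<open>Theta p p m m\<close> is diagonal, the coefficient of the
  square of \<open>b i \<bullet> p\<close> being the second symmetric function of the other
  eigenvalues. For an index off \<open>T\<close> no nonzero eigenvalue is omitted, and at least two
  are present.\<close>

lemma Theta_kernel_lower_bound:
 fixes b :: "'n => real^'n"
 assumes b: "orthobasis b" and T: "card T >= 2" and L: "L >= 1" and mulo: "!!j. j : T ==> 1 / L <= mu j"
  and mu0: "!!j. j \<notin> T ==> mu j = 0" and m: "!!j. m *v b j = mu j *R b j"
 shows "1 / L^2 * (\<Sum>i\<in>-T. (b i \<bullet> p)^2) <= Theta p p m m"
proof -
 have iL: "1 / L > 0" using L by simp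
 have munn: "mu j >= 0" for j using mulo[of j] mu0[of j] iL by (cases "j : T") (meson less_le_trans less_imp_le, simp)
 have tm: "transpose m = m"
  by (subst (1 2) eigenbasis_symmetric_matrix[OF b m]) (simp add: transpose_sum' transpose_scaleR' transpose_outer_prod)
 define s1 where "s1 = (\<Sum>i\<in>UNIV. mu i)"
 define sq where "sq = (\<Sum>i\<in>UNIV. (mu i)^2)"
 define x where "x i = (b i \<bullet> p)^2" for i
 have tr: "trace m = s1" using b by (simp add: orthobasis_trace[OF b] m s1_def orthobasis_def)
 have mm: "m \<bullet> m = sq" using b by (simp add: orthobasis_matrix_inner[OF b] m sq_def orthobasis_def sq_eq)
 have pp: "p \<bullet> p = (\<Sum>i\<in>UNIV. x i)" using orthobasis_inner[OF b, of p p] by (simp add: x_def sq_eq)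
 have pmp: "p \<bullet> (m *v p) = (\<Sum>i\<in>UNIV. mu i * x i)"
  by (simp add: eigenbasis_quadratic[OF b m] x_def sq_eq mult.assoc)
 have mpmp: "(m *v p) \<bullet> (m *v p) = (\<Sum>i\<in>UNIV. (mu i)^2 * x i)"
 proof -
  have "(m *v p) \<bullet> (m *v p) = (\<Sum>i\<in>UNIV. (b i \<bullet> (m *v p)) * (b i \<bullet> (m *v p)))" by (rule orthobasis_inner[OF b, symmetric])
  also have "... = (\<Sum>i\<in>UNIV. (mu i)^2 * x i)"
   by (rule sum.cong[OF refl]) (simp add: symmetric_inner[OF tm] m x_def sq_eq)
  finally show ?thesis .
 qed
 define c where "c i = (s1^2 - sq) / 2 - s1 * mu i + (mu i)^2" for i
 have "Theta p p m m = (s1^2 - sq) / 2 * (p \<bullet> p) - s1 * (p \<bullet> (m *v p)) + (m *v p) \<bullet> (m *v p)"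
  unfolding Theta_def tr mm by (simp add: sq_eq field_simps)
 also have "... = (\<Sum>i\<in>UNIV. (s1^2 - sq) / 2 * x i - s1 * (mu i * x i) + (mu i)^2 * x i)"
  unfolding pp pmp mpmp by (simp only: sum.distrib sum_subtractf sum_distrib_left)
 also have "... = (\<Sum>i\<in>UNIV. c i * x i)" by (simp add: c_def algebra_simps)
 finally have Th: "Theta p p m m = (\<Sum>i\<in>UNIV. c i * x i)" .
 have c: "c i = ((\<Sum>l\<in>-{i}. mu l)^2 - (\<Sum>l\<in>-{i}. (mu l)^2)) / 2" for i
  unfolding c_def s1_def sq_def sum_UNIV_remove[of _ i] by (simp add: sq_eq field_simps)
 have cnn: "c i >= 0" for i unfolding c using sum_squares_le_square_sum[of "-{i}" mu] munn by simp
 have clo: "c i >= 1 / L^2" if i: "i \<notin> T" for i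
 proof -
  obtain j k where jk: "j : T" "k : T" "j ~= k"
   using T by (metis One_nat_def Suc_1 card_le_Suc0_iff_eq finite not_less_eq_eq)
  have "mu j * mu k <= c i" unfolding c using jk i munn by (intro sum_product_pair_ge) auto
  moreover have "(1 / L) * (1 / L) <= mu j * mu k" using jk mulo munn iL by (intro mult_mono) (auto intro: less_imp_le)
  ultimately show ?thesis by (simp add: sq_eq)
 qed
 have "1 / L^2 * (\<Sum>i\<in>-T. x i) = (\<Sum>i\<in>-T. 1 / L^2 * x i)" by (rule sum_distrib_left)
 also have "... <= (\<Sum>i\<in>-T. c i * x i)" using clo by (intro sum_mono mult_right_mono) (auto simp: x_def)
 also have "... <= (\<Sum>i\<in>UNIV. c i * x i)" using cnn by (intro sum_mono2) (auto simp: x_def)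
 finally show ?thesis unfolding Th x_def .
qed

lemma structural_bound_mono:
 assumes "structural_bound c C b T mu q p m Z y" "c' <= c" "C <= C'"
 shows "structural_bound c' C' b T mu q p m Z y"
proof -
 have "c' * (norm Z)^2 <= c * (norm Z)^2" "C * x^2 <= C' * x^2" for x using assms(2,3) by (auto intro!: mult_right_mono)
 then show ?thesis using assms(1) unfolding structural_bound_def by (smt (verit))
qed

lemma structural_coercive:
 fixes L :: real
 assumes L: "L >= 1"
 obtains c C where "c > 0" "C >= 0"
  "!!(b :: 'n => real^'n) T mu q s p m Z y.
   [|structural_data L b T mu q s p m; card T >= 2; transpose Z = Z; !!j. j \<notin> T ==> Z *v b j = 0|]
  ==> structural_bound c C b T mu q p m Z y"
proof (rule structural_rank_ge_3[OF L, where 'n = 'n], rule structural_rank_2[OF L, where 'n = 'n])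
 fix c C c' C' :: real
 assume c: "c > 0" "C >= 0" and c': "c' > 0" "C' >= 0"
  and h3: "!!(b :: 'n => real^'n) T mu q s p m Z y.
   [|structural_data L b T mu q s p m; card T >= 3; transpose Z = Z; !!j. j \<notin> T ==> Z *v b j = 0|]
  ==> structural_bound c C b T mu q p m Z y"
  and h2: "!!(b :: 'n => real^'n) T mu q s p m Z y.
   [|structural_data L b T mu q s p m; card T = 2; transpose Z = Z; !!j. j \<notin> T ==> Z *v b j = 0|]
  ==> structural_bound c' C' b T mu q p m Z y"
 show thesis
 proof (rule that[of "min c c'" "max C C'"])
  show "min c c' > 0" "max C C' >= 0" using c c' by auto
  fix b :: "'n => real^'n" and T mu q s p m Z y
  assume h: "structural_data L b T mu q s p m" "transpose Z = Z" "!!j. j \<notin> T ==> Z *v b j = 0" and T: "card T >= 2"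
  show "structural_bound (min c c') (max C C') b T mu q p m Z y"
  proof (cases "card T = 2")
   case True
   show ?thesis by (rule structural_bound_mono[OF h2[OF h(1) True h(2,3)]]) auto
  next
   case False
   then have "card T >= 3" using T by linarith
   then show ?thesis by (intro structural_bound_mono[OF h3[OF h(1) _ h(2,3)]]) auto
  qed
 qed
qed

section \<open>Orders of magnitude, uniform over a family of configurations\<close>

lemma norm_outer_prod: "norm (outer_prod x y) = norm x * norm y"
proof -
 have "(norm (outer_prod x y))^2 = (norm x * norm y)^2"
  unfolding norm_sq power_mult_distrib
  by (simp add: inner_outer_prod outer_prod_mult)
 then show ?thesis by (simp add: power2_eq_iff_nonneg)
qed

lemma abs_trace_le: "\<bar>trace U\<bar> <= real CARD('n) * norm U" for U :: "real^'n^'n"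
proof -
 have "\<bar>trace U\<bar> <= (\<Sum>i\<in>UNIV. \<bar>U $ i $ i\<bar>)" unfolding trace_def by (rule sum_abs)
 also have "... <= (\<Sum>i\<in>(UNIV::'n set). norm U)"
  by (intro sum_mono) (metis Finite_Cartesian_Product.norm_nth_le order_trans real_norm_def)
 finally show ?thesis by simp
qed

lemma abs_S2_Theta_le:
 fixes U V :: "real^'n^'n"
 defines "N \<equiv> (real CARD('n))^2"
 shows "\<bar>S2 U V\<bar> <= N * (norm U * norm V)" and "\<bar>Theta p r U V\<bar> <= 3 * N * (norm p * norm r) * (norm U * norm V)"
proof -
 define n where "n = real CARD('n)"
 have n1: "n >= 1" by (simp add: n_def)
 have N: "N = n * n" by (simp add: N_def n_def sq_eq)
 define w where "w = norm U * norm V"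
 define z where "z = norm p * norm r"
 have w0: "w >= 0" "z >= 0" by (simp_all add: w_def z_def)
 have tU: "\<bar>trace U\<bar> <= n * norm U" and tV: "\<bar>trace V\<bar> <= n * norm V" unfolding n_def by (rule abs_trace_le)+
 have tt: "\<bar>trace U * trace V\<bar> <= n * n * w"
 proof -
  have "\<bar>trace U * trace V\<bar> <= (n * norm U) * (n * norm V)" unfolding abs_mult using tU tV n1 by (intro mult_mono) auto
  then show ?thesis by (simp add: w_def mult_ac)
 qed
 have UV: "\<bar>U \<bullet> V\<bar> <= w" unfolding w_def by (rule Cauchy_Schwarz_ineq2)
 have nn: "w <= n * n * w" "n * w <= n * n * w"
  using n1 w0 mult_mono[of 1 n 1 n] by (auto simp: mult_le_cancel_right1 mult_le_cancel_right)
 have d: "\<bar>trace U * trace V - U \<bullet> V\<bar> <= 2 * (n * n * w)" using tt UV nn by linarith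
 show S2: "\<bar>S2 U V\<bar> <= N * (norm U * norm V)" unfolding S2_def N w_def[symmetric] abs_divide using d by simp
 have e1: "\<bar>(p \<bullet> r) * (trace U * trace V - U \<bullet> V)\<bar> <= z * (2 * (n * n * w))"
  unfolding abs_mult using d w0 n1 by (intro mult_mono) (auto simp: z_def Cauchy_Schwarz_ineq2)
 have q: "\<bar>x \<bullet> (A *v y)\<bar> <= norm A * (norm x * norm y)" for A :: "real^'n^'n" and x y
 proof -
  have "\<bar>x \<bullet> (A *v y)\<bar> <= norm x * norm (A *v y)" by (rule Cauchy_Schwarz_ineq2)
  also have "... <= norm x * (norm A * norm y)" by (intro mult_left_mono norm_matrix_vector_le) auto
  finally show ?thesis by (simp add: mult_ac)
 qed
 have t2: "\<bar>trace A * (p \<bullet> (D *v r))\<bar> <= z * (n * (norm A * norm D))" for A D :: "real^'n^'n"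
 proof -
  have "\<bar>trace A * (p \<bullet> (D *v r))\<bar> <= (n * norm A) * (norm D * (norm p * norm r))"
   unfolding abs_mult using abs_trace_le[of A] q[of p D r] n1 by (intro mult_mono) (auto simp: n_def)
  then show ?thesis by (simp add: z_def mult_ac)
 qed
 have t3: "\<bar>(U *v x) \<bullet> (V *v y)\<bar> <= (norm x * norm y) * w" for x y
 proof -
  have "\<bar>(U *v x) \<bullet> (V *v y)\<bar> <= norm (U *v x) * norm (V *v y)" by (rule Cauchy_Schwarz_ineq2)
  also have "... <= (norm U * norm x) * (norm V * norm y)" by (intro mult_mono norm_matrix_vector_le) auto
  finally show ?thesis by (simp add: w_def mult_ac)
 qed
 have zz: "z * w <= z * (n * n * w)" "z * (n * w) <= z * (n * n * w)" using nn w0 by (auto intro: mult_left_mono)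
 have "\<bar>trace U * (p \<bullet> (V *v r))\<bar> <= z * (n * w)" "\<bar>trace V * (p \<bullet> (U *v r))\<bar> <= z * (n * w)"
  "\<bar>(U *v p) \<bullet> (V *v r)\<bar> <= z * w" "\<bar>(U *v r) \<bullet> (V *v p)\<bar> <= z * w"
  using t2[of U V] t2[of V U] t3[of p r] t3[of r p] by (simp_all add: w_def z_def mult_ac)
 then show "\<bar>Theta p r U V\<bar> <= 3 * N * (norm p * norm r) * (norm U * norm V)"
  unfolding Theta_def N w_def[symmetric] z_def[symmetric] using e1 zz by (simp add: mult_ac)
qed

lemma abs_Phi_le:
 fixes U V :: "real^'n^'n"
 shows "\<bar>Phi p U V\<bar> <= ((real CARD('n))^2 + 3 * (real CARD('n))^2 * (norm p)^2) * (norm U * norm V)"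
 using abs_S2_Theta_le(1)[of U V] abs_S2_Theta_le(2)[of p p U V] unfolding Phi_def by (simp add: sq_eq algebra_simps)

text \<open>Landau's O with a constant uniform over the index set \<open>S\<close>. Hiding the
  constant allows the many error terms of the second differentiation to be estimated by closure
  rules alone.\<close>

definition of_order :: "'i set => ('i => real) => ('i => 'a::real_normed_vector) => bool" where
 "of_order S g f \<longleftrightarrow> (\<exists>C\<ge>0. \<forall>i\<in>S. norm (f i) <= C * g i)"

abbreviation bdd_family :: "'i set => ('i => 'a::real_normed_vector) => bool" where
 "bdd_family S f \<equiv> of_order S (%_. 1) f"

lemma of_orderI: "of_order S g f" if "!!i. i : S ==> norm (f i) <= C * g i" "!!i. i : S ==> 0 <= g i"
proof -
 have "norm (f i) <= \<bar>C\<bar> * g i" if "i : S" for i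
  using \<open>!!i. i : S ==> norm (f i) <= C * g i\<close>[OF that] mult_right_mono[of C "\<bar>C\<bar>" "g i"] \<open>!!i. i : S ==> 0 <= g i\<close>[OF that] by linarith
 then show ?thesis unfolding of_order_def by (intro exI[of _ "\<bar>C\<bar>"]) auto
qed

lemma of_orderE:
 assumes "of_order S g f"
 obtains C where "C >= 0" "!!i. i : S ==> norm (f i) <= C * g i"
 using assms unfolding of_order_def by blast

lemma of_order_const: "bdd_family S (%i. c)" by (rule of_orderI[of S _ "norm c"]) auto

lemma of_order_cong: "of_order S g f ==> (!!i. i : S ==> f i = f' i) ==> of_order S g f'"
 unfolding of_order_def by auto

lemma of_order_add: "of_order S g f ==> of_order S g h ==> of_order S g (%i. f i + h i)"
proof (elim of_orderE)
 fix C D assume C: "C >= 0" "!!i. i : S ==> norm (f i) <= C * g i" and D: "D >= 0" "!!i. i : S ==> norm (h i) <= D * g i"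
 have "norm (f i + h i) <= (C + D) * g i" if "i : S" for i
  using norm_triangle_ineq[of "f i" "h i"] C(2)[OF that] D(2)[OF that] by (simp add: distrib_right)
 then show ?thesis unfolding of_order_def using C D by (intro exI[of _ "C + D"]) auto
qed

lemma of_order_minus: "of_order S g f ==> of_order S g (%i. - f i)" by (simp add: of_order_def)

lemma of_order_diff: "of_order S g f ==> of_order S g h ==> of_order S g (%i. f i - h i)"
 using of_order_add[OF _ of_order_minus, of S g f h] by simp

lemma of_order_trans: "of_order S g f ==> of_order S h g ==> of_order S h f"
proof (elim of_orderE)
 fix C D assume C: "C >= 0" "!!i. i : S ==> norm (f i) <= C * g i" and D: "D >= 0" "!!i. i : S ==> norm (g i) <= D * h i"
 have "norm (f i) <= (C * D) * h i" if "i : S" for i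
 proof -
  have "norm (f i) <= C * \<bar>g i\<bar>" using C(2)[OF that] mult_left_mono[OF abs_ge_self[of "g i"] C(1)] by linarith
  also have "... <= C * (D * h i)" using C(1) D(2)[OF that] by (intro mult_left_mono) auto
  finally show ?thesis by (simp add: mult.assoc)
 qed
 then show ?thesis unfolding of_order_def using C D by (intro exI[of _ "C * D"]) auto
qed

text \<open>The common source of the product rules below. Most of them come in three versions, since
  a factor that is merely bounded should leave the order function of the other one
  unchanged.\<close>

lemma of_order_bilinear:
 assumes "!!i. i : S ==> norm (F i) <= N * (norm (f i) * norm (h i))" "N >= 0" "of_order S g1 f" "of_order S g2 h"
 shows "of_order S (%i. g1 i * g2 i) F"
 using assms(3,4)
proof (elim of_orderE)
 fix C D assume C: "C >= 0" "!!i. i : S ==> norm (f i) <= C * g1 i" and D: "D >= 0" "!!i. i : S ==> norm (h i) <= D * g2 i"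
 have "norm (F i) <= (N * C * D) * (g1 i * g2 i)" if "i : S" for i
 proof -
  have "norm (f i) * norm (h i) <= (C * g1 i) * (D * g2 i)"
   using C(2)[OF that] D(2)[OF that] by (intro mult_mono) (auto intro: order_trans[OF norm_ge_zero])
  then have "N * (norm (f i) * norm (h i)) <= N * ((C * g1 i) * (D * g2 i))" using assms(2) by (rule mult_left_mono)
  then show ?thesis using assms(1)[OF that] by (simp add: mult_ac)
 qed
 then show ?thesis unfolding of_order_def using C D assms(2) by (intro exI[of _ "N * C * D"]) auto
qed

lemma of_order_bilinear1:
 assumes "!!i. i : S ==> norm (F i) <= N * (norm (f i) * norm (h i))" "N >= 0" "of_order S g f" "bdd_family S h"
 shows "of_order S g F"
 using of_order_bilinear[OF assms] by simp

lemma of_order_bilinear2: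
 assumes "!!i. i : S ==> norm (F i) <= N * (norm (f i) * norm (h i))" "N >= 0" "bdd_family S f" "of_order S g h"
 shows "of_order S g F"
 using of_order_bilinear[OF assms] by simp

lemma of_order_mult:
 fixes f h :: "'i => real"
 shows "of_order S g1 f ==> of_order S g2 h ==> of_order S (%i. g1 i * g2 i) (%i. f i * h i)"
  "of_order S g f ==> bdd_family S h ==> of_order S g (%i. f i * h i)"
  "bdd_family S f ==> of_order S g h ==> of_order S g (%i. f i * h i)"
 by (rule of_order_bilinear[where N = 1 and f = f and h = h] of_order_bilinear1[where N = 1 and f = f and h = h]
   of_order_bilinear2[where N = 1 and f = f and h = h]; simp add: abs_mult)+

lemma of_order_scaleR:
 fixes f :: "'i => real" and h :: "'i => 'a::real_normed_vector"
 shows "of_order S g1 f ==> of_order S g2 h ==> of_order S (%i. g1 i * g2 i) (%i. f i *R h i)"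
  "of_order S g f ==> bdd_family S h ==> of_order S g (%i. f i *R h i)"
  "bdd_family S f ==> of_order S g h ==> of_order S g (%i. f i *R h i)"
 by (rule of_order_bilinear[where N = 1 and f = f and h = h] of_order_bilinear1[where N = 1 and f = f and h = h]
   of_order_bilinear2[where N = 1 and f = f and h = h]; simp)+

lemma of_order_inner:
 fixes f h :: "'i => 'a::real_inner"
 shows "of_order S g1 f ==> of_order S g2 h ==> of_order S (%i. g1 i * g2 i) (%i. f i \<bullet> h i)"
  "of_order S g f ==> bdd_family S h ==> of_order S g (%i. f i \<bullet> h i)"
  "bdd_family S f ==> of_order S g h ==> of_order S g (%i. f i \<bullet> h i)"
 by (rule of_order_bilinear[where N = 1 and f = f and h = h] of_order_bilinear1[where N = 1 and f = f and h = h]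
   of_order_bilinear2[where N = 1 and f = f and h = h]; simp add: Cauchy_Schwarz_ineq2)+

lemma of_order_matrix_vector:
 fixes f :: "'i => real^'n^'n" and h :: "'i => real^'n"
 shows "of_order S g f ==> bdd_family S h ==> of_order S g (%i. f i *v h i)"
  "bdd_family S f ==> of_order S g h ==> of_order S g (%i. f i *v h i)"
  "of_order S g1 f ==> of_order S g2 h ==> of_order S (%i. g1 i * g2 i) (%i. f i *v h i)"
 by (rule of_order_bilinear1[where N = 1 and f = f and h = h] of_order_bilinear2[where N = 1 and f = f and h = h]
   of_order_bilinear[where N = 1 and f = f and h = h]; simp add: norm_matrix_vector_le)+

lemma of_order_outer_prod:
 fixes f h :: "'i => real^'n"
 shows "of_order S g1 f ==> of_order S g2 h ==> of_order S (%i. g1 i * g2 i) (%i. outer_prod (f i) (h i))"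
  "of_order S g f ==> bdd_family S h ==> of_order S g (%i. outer_prod (f i) (h i))"
  "bdd_family S f ==> of_order S g h ==> of_order S g (%i. outer_prod (f i) (h i))"
 by (rule of_order_bilinear[where N = 1 and f = f and h = h] of_order_bilinear1[where N = 1 and f = f and h = h]
   of_order_bilinear2[where N = 1 and f = f and h = h]; simp add: norm_outer_prod)+

lemma of_order_trace: "of_order S g f ==> of_order S g (%i. trace (f i))" for f :: "'i => real^'n^'n"
 by (rule of_order_bilinear1[where N = "real CARD('n)" and f = f and h = "%_. 1::real"])
  (simp_all add: abs_trace_le of_order_const)

lemma of_order_Theta:
 fixes U V :: "'i => real^'n^'n"
 assumes "bdd_family S p" "bdd_family S r"
 shows "of_order S g1 U ==> of_order S g2 V ==> of_order S (%i. g1 i * g2 i) (%i. Theta (p i) (r i) (U i) (V i))"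
  "of_order S g U ==> bdd_family S V ==> of_order S g (%i. Theta (p i) (r i) (U i) (V i))"
  "bdd_family S U ==> of_order S g V ==> of_order S g (%i. Theta (p i) (r i) (U i) (V i))"
proof -
 obtain C D where C: "C >= 0" "!!i. i : S ==> norm (p i) <= C" and D: "D >= 0" "!!i. i : S ==> norm (r i) <= D"
  using assms by (auto elim!: of_orderE)
 have b: "norm (Theta (p i) (r i) (U i) (V i)) <= (3 * (real CARD('n))^2 * (C * D)) * (norm (U i) * norm (V i))" if "i : S" for i
 proof -
  have "3 * (real CARD('n))^2 * (norm (p i) * norm (r i)) * (norm (U i) * norm (V i)) <= (3 * (real CARD('n))^2 * (C * D)) * (norm (U i) * norm (V i))"
   using C D that by (intro mult_right_mono mult_left_mono mult_mono) auto
  then show ?thesis using abs_S2_Theta_le(2)[of "p i" "r i" "U i" "V i"] unfolding real_norm_def by (rule order_trans[rotated])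
 qed
 have N: "3 * (real CARD('n))^2 * (C * D) >= 0" using C D by simp
 show "of_order S g1 U ==> of_order S g2 V ==> of_order S (%i. g1 i * g2 i) (%i. Theta (p i) (r i) (U i) (V i))"
  by (rule of_order_bilinear[OF b N])
 show "of_order S g U ==> bdd_family S V ==> of_order S g (%i. Theta (p i) (r i) (U i) (V i))"
  by (rule of_order_bilinear1[OF b N])
 show "bdd_family S U ==> of_order S g V ==> of_order S g (%i. Theta (p i) (r i) (U i) (V i))"
  by (rule of_order_bilinear2[OF b N])
qed

lemma of_order_Phi:
 fixes U V :: "'i => real^'n^'n"
 assumes "bdd_family S p"
 shows "of_order S g1 U ==> of_order S g2 V ==> of_order S (%i. g1 i * g2 i) (%i. Phi (p i) (U i) (V i))"
  "of_order S g U ==> bdd_family S V ==> of_order S g (%i. Phi (p i) (U i) (V i))"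
  "bdd_family S U ==> of_order S g V ==> of_order S g (%i. Phi (p i) (U i) (V i))"
proof -
 obtain C where C: "C >= 0" "!!i. i : S ==> norm (p i) <= C" using assms by (auto elim!: of_orderE)
 define n where "n = (real CARD('n))^2"
 have n: "n >= 0" by (simp add: n_def)
 have b: "norm (Phi (p i) (U i) (V i)) <= (n + 3 * n * C^2) * (norm (U i) * norm (V i))" if "i : S" for i
 proof -
  have "(n + 3 * n * (norm (p i))^2) * (norm (U i) * norm (V i)) <= (n + 3 * n * C^2) * (norm (U i) * norm (V i))"
   using C that n by (intro mult_right_mono add_left_mono mult_left_mono power_mono) auto
  then show ?thesis using abs_Phi_le[of "p i" "U i" "V i"] by (simp add: n_def)
 qed
 have N: "n + 3 * n * C^2 >= 0" using n by simp
 show "of_order S g1 U ==> of_order S g2 V ==> of_order S (%i. g1 i * g2 i) (%i. Phi (p i) (U i) (V i))"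
  by (rule of_order_bilinear[OF b N])
 show "of_order S g U ==> bdd_family S V ==> of_order S g (%i. Phi (p i) (U i) (V i))"
  by (rule of_order_bilinear1[OF b N])
 show "bdd_family S U ==> of_order S g V ==> of_order S g (%i. Phi (p i) (U i) (V i))"
  by (rule of_order_bilinear2[OF b N])
qed

text \<open>The range of summation varies with \<open>i\<close>, so the summands form a family over
  the disjoint union of the ranges; their number is bounded by the size of the finite index
  type.\<close>

lemma of_order_sum:
 fixes f :: "'i => 'j::finite => 'a::real_normed_vector"
 assumes "of_order (Sigma S T) (%x. g (fst x)) (%x. f (fst x) (snd x))" "!!i. i : S ==> 0 <= g i"
 shows "of_order S g (%i. \<Sum>j\<in>T i. f i j)"
proof -
 obtain C where C: "C >= 0" "!!i j. i : S ==> j : T i ==> norm (f i j) <= C * g i"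
  using assms(1) by (elim of_orderE) auto
 have "norm (\<Sum>j\<in>T i. f i j) <= (real CARD('j) * C) * g i" if "i : S" for i
 proof -
  have "norm (\<Sum>j\<in>T i. f i j) <= (\<Sum>j\<in>T i. C * g i)" using C(2)[OF that] by (rule sum_norm_le)
  also have "... <= real CARD('j) * (C * g i)" using C(1) assms(2)[OF that] by (simp add: card_mono mult_right_mono)
  finally show ?thesis by (simp add: mult.assoc)
 qed
 then show ?thesis using assms(2) by (rule of_orderI)
qed

lemma of_order_fst: "of_order S g f ==> of_order (Sigma S T) (%x. g (fst x)) (%x. f (fst x))"
 unfolding of_order_def by auto

lemmas bdd_family_intros = of_order_const of_order_add[where g = "%_. 1"] of_order_diff[where g = "%_. 1"] of_order_minus[where g = "%_. 1"]
 of_order_mult(2)[where g = "%_. 1"] of_order_scaleR(2)[where g = "%_. 1"] of_order_inner(2)[where g = "%_. 1"]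
 of_order_matrix_vector(1)[where g = "%_. 1"] of_order_outer_prod(2)[where g = "%_. 1"] of_order_trace[where g = "%_. 1"]
 of_order_Theta(2)[where g = "%_. 1"] of_order_Phi(2)[where g = "%_. 1"]

section \<open>The equation differentiated twice in a null direction\<close>

lemma Theta_vector_linear:
 shows "Theta (p + p') r U V = Theta p r U V + Theta p' r U V" "Theta (c *R p) r U V = c * Theta p r U V"
  "Theta p (r + r') U V = Theta p r U V + Theta p r' U V" "Theta p (c *R r) U V = c * Theta p r U V"
 by (simp_all add: Theta_def inner_add_left inner_add_right mv_add mv_scaleR field_simps)

lemma Theta_vector_commute: "transpose U = U ==> transpose V = V ==> Theta p r U V = Theta r p U V"
 using symmetric_inner[of U p r] symmetric_inner[of V p r] by (simp add: Theta_def inner_commute)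

lemma Theta_swap: "Theta p r U V = Theta p r V U"
 by (simp add: Theta_def inner_commute field_simps)

text \<open>The first two derivatives of the equation \<^term>\<open>Phi p M M = const\<close> along a line in the direction of an
  eigenvector \<open>e\<close> of the Hessian \<open>B\<close> with eigenvalue \<open>la\<close>, where \<open>p = 2 s q\<close>, \<open>M = s B - q q\<^sup>T\<close> and \<open>s\<close>, \<open>q\<close>, \<open>B\<close>
  have first derivatives \<open>Y\<close>, \<open>la e\<close>, \<open>X\<close> and second derivatives \<open>-la\<close>, \<open>X e\<close>, \<open>W\<close>.\<close>
definition jet_equations :: "real => real^'n => real^'n^'n => real^'n^'n => real^'n^'n => real^'n => real => bool" where
 "jet_equations s q B X W e la \<longleftrightarrow> (let
  Y = - (q \<bullet> e); p = (2 * s) *R q; M = s *R B - outer_prod q q;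
  p' = (2 * Y) *R q + (2 * s * la) *R e;
  M' = s *R X + Y *R B - la *R (outer_prod q e + outer_prod e q);
  p'' = (- 2 * la) *R q + (4 * Y * la) *R e + (2 * s) *R (X *v e);
  M'' = s *R W + (2 * Y) *R X - la *R B - (outer_prod (X *v e) q + outer_prod q (X *v e)) - (2 * la^2) *R outer_prod e e
 in 2 * Phi p M M' + 2 * Theta p p' M M = 0 \<and>
  2 * Phi p M' M' + 2 * Phi p M M'' + 8 * Theta p p' M M' + 2 * Theta p' p' M M + 2 * Theta p p'' M M = 0)"

text \<open>With \<open>Z\<close>, the derivative of \<open>m\<close>, and \<open>y\<close>, the
  logarithmic derivative of \<open>s\<close>, the eigenvalue \<open>la\<close> splits off: p' is
  \<open>y\<close> times \<open>p\<close> up to a multiple of \<open>la\<close>, and M' is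
  \<open>Z - la *R N\<close>. Terms with a factor \<open>la\<close> are collected because they are
  negligible, those linear in \<open>X *v e\<close> because they will add up to a gradient.\<close>

lemma differentiated_equation:
 fixes X W B :: "real^'n^'n" and q e :: "real^'n" and s la :: real
 assumes tB: "transpose B = B" and tX: "transpose X = X" and s: "s > 0" and jets: "jet_equations s q B X W e la"
 defines "p \<equiv> (2 * s) *R q" and "M \<equiv> s *R B - outer_prod q q" and "N \<equiv> outer_prod q e + outer_prod e q" and "Y \<equiv> - (q \<bullet> e)"
 defines "Z \<equiv> s *R X + Y *R B" and "m \<equiv> s *R B" and "y \<equiv> Y / s"
 shows "2 * Phi p M Z + 2 * y * Theta p p m m = la * (2 * Phi p M N - 4 * s * Theta p e M M)"
  and "2 * s * Phi p M W = - (2 * Phi p Z Z + 4 * y * Phi p M Z - 4 * y^2 * Phi p M m + 8 * y * Theta p p m Z + 2 * y^2 * Theta p p m m)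
   + (2 * Phi p M (outer_prod (X *v e) q + outer_prod q (X *v e)) - 4 * s * Theta p (X *v e) M M)
   + la * (4 * Phi p Z N - 2 * la * Phi p N N + 2 * Phi p M B + 4 * la * Phi p M (outer_prod e e) + 8 * y * Theta p p M N
    - 16 * s * Theta p e M Z + 16 * s * la * Theta p e M N - 8 * y * s * Theta p e M M - 8 * s^2 * la * Theta e e M M
    + 4 * Theta p q M M - 8 * Y * Theta p e M M)"
proof -
 define p' where "p' = (2 * Y) *R q + (2 * s * la) *R e"
 define M' where "M' = s *R X + Y *R B - la *R N"
 define p'' where "p'' = (- 2 * la) *R q + (4 * Y * la) *R e + (2 * s) *R (X *v e)"
 define M'' where "M'' = s *R W + (2 * Y) *R X - la *R B - (outer_prod (X *v e) q + outer_prod q (X *v e)) - (2 * la^2) *R outer_prod e e"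
 have first: "2 * Phi p M M' + 2 * Theta p p' M M = 0"
  and second: "2 * Phi p M' M' + 2 * Phi p M M'' + 8 * Theta p p' M M' + 2 * Theta p' p' M M + 2 * Theta p p'' M M = 0"
  using jets unfolding jet_equations_def Let_def p_def M_def N_def Y_def p'_def M'_def p''_def M''_def by blast+
 have Y: "Y = y * s" using s by (simp add: y_def)
 have tm: "transpose m = m" by (simp add: m_def transpose_scaleR' tB)
 have Mm: "M = m - outer_prod q q" by (simp add: M_def m_def)
 have tM: "transpose M = M" by (simp add: Mm transpose_minus' tm transpose_outer_prod)
 have tZ: "transpose Z = Z" by (simp add: Z_def transpose_add' transpose_scaleR' tB tX)
 have ThM: "Theta p p M V = Theta p p m V" if "transpose V = V" for V
  by (simp add: Mm Theta_minus_left Theta_rank_one_self[OF p_def[THEN meta_eq_to_obj_eq] that])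
 have Thmm: "Theta p p M M = Theta p p m m" using ThM[OF tM] ThM[OF tm] by (simp add: Theta_commute[of p m M])
 have pp': "p' = y *R p + (2 * s * la) *R e" by (simp add: p'_def p_def Y)
 have M'Z: "M' = Z - la *R N" by (simp add: M'_def Z_def)
 have Tep: "Theta e p M M = Theta p e M M" by (rule Theta_vector_commute[OF tM tM])
 have PMZ: "Phi p M Z = s * Phi p M X + y * Phi p M m"
  by (simp add: Z_def m_def Phi_add_right Phi_scale_right Y)
 have PMB: "Phi p M m = s * Phi p M B" by (simp add: m_def Phi_scale_right)
 have "2 * Phi p M M' + 2 * Theta p p' M M = 2 * Phi p M Z + 2 * y * Theta p p m m - la * (2 * Phi p M N - 4 * s * Theta p e M M)"
  unfolding M'Z pp' by (simp add: Phi_minus_right Phi_scale_right Theta_vector_linear Thmm algebra_simps)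
 then show "2 * Phi p M Z + 2 * y * Theta p p m m = la * (2 * Phi p M N - 4 * s * Theta p e M M)" using first by simp
 have e1: "Phi p M' M' = Phi p Z Z - 2 * la * Phi p Z N + la * la * Phi p N N"
  unfolding M'Z by (simp add: Phi_minus_right Phi_minus_left Phi_scale_right Phi_scale_left Phi_commute[of p N Z] algebra_simps)
 have e2: "2 * Phi p M M'' = 2 * s * Phi p M W + 4 * y * (s * Phi p M X) - 2 * la * Phi p M B
   - 2 * Phi p M (outer_prod (X *v e) q + outer_prod q (X *v e)) - 4 * (la * la) * Phi p M (outer_prod e e)"
  unfolding M''_def by (simp add: Phi_minus_right Phi_scale_right Phi_add_right Y sq_eq algebra_simps)
 have e3: "Theta p p' M M' = y * Theta p p m Z - y * la * Theta p p M N + 2 * s * la * Theta p e M Z - 2 * s * (la * la) * Theta p e M N"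
  unfolding pp' M'Z by (simp add: Theta_vector_linear Theta_minus_right Theta_scale_right ThM[OF tZ] algebra_simps)
 have e4: "Theta p' p' M M = y * y * Theta p p m m + 4 * y * s * la * Theta p e M M + 4 * (s * s) * (la * la) * Theta e e M M"
  unfolding pp' by (simp add: Theta_vector_linear Thmm Tep algebra_simps)
 have e5: "Theta p p'' M M = - 2 * la * Theta p q M M + 4 * y * s * la * Theta p e M M + 2 * s * Theta p (X *v e) M M"
  unfolding p''_def Theta_vector_linear Y by simp
 show "2 * s * Phi p M W = - (2 * Phi p Z Z + 4 * y * Phi p M Z - 4 * y^2 * Phi p M m + 8 * y * Theta p p m Z + 2 * y^2 * Theta p p m m)
   + (2 * Phi p M (outer_prod (X *v e) q + outer_prod q (X *v e)) - 4 * s * Theta p (X *v e) M M)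
   + la * (4 * Phi p Z N - 2 * la * Phi p N N + 2 * Phi p M B + 4 * la * Phi p M (outer_prod e e) + 8 * y * Theta p p M N
    - 16 * s * Theta p e M Z + 16 * s * la * Theta p e M N - 8 * y * s * Theta p e M M - 8 * s^2 * la * Theta e e M M
    + 4 * Theta p q M M - 8 * Y * Theta p e M M)"
  using second unfolding e1 e2 e3 e4 e5 PMZ PMB Y by (simp add: sq_eq algebra_simps)
qed

lemma outer_prod_linear:
 "outer_prod (x + x') z = outer_prod x z + outer_prod x' z" "outer_prod x (z + z') = outer_prod x z + outer_prod x z'"
 "outer_prod (c *R x) z = c *R outer_prod x z" "outer_prod x (c *R z) = c *R outer_prod x z"
 "outer_prod (x - x') z = outer_prod x z - outer_prod x' z" "outer_prod x (z - z') = outer_prod x z - outer_prod x z'"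
 by (simp_all add: vec_eq_iff outer_prod_def algebra_simps)

lemma orthobasis_sum_outer:
 fixes Z :: "real^'n^'n"
 assumes "orthobasis b"
 shows "(\<Sum>j\<in>UNIV. outer_prod (Z *v b j) (b j)) = Z"
proof (rule orthobasis_ext[OF assms])
 fix k
 have "(\<Sum>j\<in>UNIV. outer_prod (Z *v b j) (b j)) *v b k = (\<Sum>j\<in>UNIV. if j = k then Z *v b j else 0)"
  unfolding matrix_sum_mult outer_prod_mult using assms by (intro sum.cong) (auto simp: orthobasis_def)
 then show "(\<Sum>j\<in>UNIV. outer_prod (Z *v b j) (b j)) *v b k = Z *v b k" by simp
qed

lemma sum_split_Compl: "(\<Sum>j\<in>UNIV. f j) = (\<Sum>j\<in>T. f j) + (\<Sum>j\<in>-T. f j)"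
 for f :: "'n::finite => 'a::comm_monoid_add"
 using sum.union_disjoint[of T "-T" f] by (simp add: Compl_partition)

text \<open>On an eigenvector \<open>X *v b j\<close> is \<open>Z *v b j\<close> divided by
  \<open>s\<close>, minus \<open>y * lam j\<close> times \<open>b j\<close>. In the squares this
  creates cross terms; over the whole basis they add up to twice \<open>Z\<close>, so the sum over
  \<open>T\<close> misses only the remainder \<open>R\<close> from the other indices.\<close>

lemma pseudo_inverse_identity:
 fixes X B :: "real^'n^'n" and s y :: real
 assumes b: "orthobasis b" and lam: "!!j. B *v b j = lam j *R b j" and lamT: "!!j. j : T ==> lam j ~= 0"
  and s: "s > 0" and tX: "transpose X = X" and tB: "transpose B = B"
 defines "Z \<equiv> s *R X + (y * s) *R B"
 defines "R \<equiv> (\<Sum>j\<in>-T. outer_prod (Z *v b j) (b j) + outer_prod (b j) (Z *v b j))"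
 shows "s *R (\<Sum>j\<in>T. (1 / lam j) *R outer_prod (X *v b j) (X *v b j))
  = (\<Sum>j\<in>T. (1 / (s * lam j)) *R outer_prod (Z *v b j) (Z *v b j)) - (2 * y) *R Z + y *R R
   + y^2 *R (\<Sum>j\<in>T. (s * lam j) *R outer_prod (b j) (b j))"
proof -
 have tZ: "transpose Z = Z" by (simp add: Z_def transpose_add' transpose_scaleR' tB tX)
 have X: "X *v b j = (1 / s) *R (Z *v b j) - (y * lam j) *R b j" for j
  using s by (simp add: Z_def add_mv scaleR_mv lam scaleR_add_right)
 have termj: "s *R ((1 / lam j) *R outer_prod (X *v b j) (X *v b j)) = (1 / (s * lam j)) *R outer_prod (Z *v b j) (Z *v b j)
   - y *R (outer_prod (Z *v b j) (b j) + outer_prod (b j) (Z *v b j)) + y^2 *R ((s * lam j) *R outer_prod (b j) (b j))"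
  if "j : T" for j
  using s lamT[OF that] unfolding X outer_prod_linear by (simp add: vec_eq_iff sq_eq field_simps)
 have U: "(\<Sum>j\<in>UNIV. outer_prod (Z *v b j) (b j) + outer_prod (b j) (Z *v b j)) = 2 *R Z"
 proof -
  have "(\<Sum>j\<in>UNIV. outer_prod (b j) (Z *v b j)) = transpose (\<Sum>j\<in>UNIV. outer_prod (Z *v b j) (b j))"
   by (simp add: transpose_sum' transpose_outer_prod)
  then show ?thesis by (simp add: sum.distrib orthobasis_sum_outer[OF b] tZ scaleR_2)
 qed
 have "s *R (\<Sum>j\<in>T. (1 / lam j) *R outer_prod (X *v b j) (X *v b j))
  = (\<Sum>j\<in>T. (1 / (s * lam j)) *R outer_prod (Z *v b j) (Z *v b j))
   - y *R (\<Sum>j\<in>T. outer_prod (Z *v b j) (b j) + outer_prod (b j) (Z *v b j)) + y^2 *R (\<Sum>j\<in>T. (s * lam j) *R outer_prod (b j) (b j))"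
  unfolding scaleR_sum_right sum_subtractf[symmetric] sum.distrib[symmetric]
  by (rule sum.cong[OF refl]) (simp only: termj scaleR_sum_right)
 also have "(\<Sum>j\<in>T. outer_prod (Z *v b j) (b j) + outer_prod (b j) (Z *v b j)) = 2 *R Z - R"
  using U unfolding sum_split_Compl[of _ T] R_def by (simp add: eq_diff_eq)
 finally show ?thesis by (simp add: scaleR_diff_right)
qed

lemma matrix_mult_left_linear:
 fixes A A' C :: "real^'n^'n"
 shows "(A + A') ** C = A ** C + A' ** C" "(c *R A) ** C = c *R (A ** C)" "0 ** C = 0" "trace (0 :: real^'n^'n) = 0"
 by (simp_all add: vec_eq_iff matrix_matrix_mult_def trace_def sum.distrib distrib_right sum_distrib_left mult.assoc)

text \<open>All data are indexed by \<open>i\<close>, so that one constant serves all points,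
  eigenbases and null directions. Small eigenvalues are at most \<open>r i * r i\<close>, third
  derivatives with two null indices of order \<open>r i\<close>. The bound keeps exactly the
  negative \<open>Theta\<close> term and the terms linear in \<open>X i *v e i\<close>; among the
  errors the last one is in general only of order \<open>r i\<close> and has to be displayed with
  its factors.\<close>

lemma differentiated_equation_estimate:
 fixes b :: "'i => 'n => real^'n" and T :: "'i => 'n set" and X W B :: "'i => real^'n^'n" and q :: "'i => real^'n"
  and s r :: "'i => real" and a :: "'i => 'n" and lam :: "'i => 'n => real" and K :: real
 assumes K: "K >= 1" and b: "!!i. i : S ==> orthobasis (b i)" and T: "!!i. i : S ==> card (T i) >= 2"
  and a: "!!i. i : S ==> a i \<notin> T i"
  and lam: "!!i j. i : S ==> B i *v b i j = lam i j *R b i j"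
  and lamT: "!!i j. i : S ==> j : T i ==> 1 / K <= lam i j" "!!i j. i : S ==> j : T i ==> lam i j <= K"
  and lamI: "!!i j. i : S ==> j \<notin> T i ==> 0 <= lam i j" "!!i j. i : S ==> j \<notin> T i ==> lam i j <= r i * r i"
  and bnd: "!!i. i : S ==> norm (q i) <= K" "!!i. i : S ==> s i <= K" "!!i. i : S ==> 1 / K <= s i"
   "!!i. i : S ==> norm (X i) <= K" "!!i. i : S ==> norm (B i) <= K" "!!i. i : S ==> 0 <= r i" "!!i. i : S ==> r i <= K"
  and tX: "!!i. i : S ==> transpose (X i) = X i"
  and Xb: "!!i j. i : S ==> j \<notin> T i ==> norm (X i *v b i j) <= K * r i"
 defines "p \<equiv> %i. (2 * s i) *R q i" and "M \<equiv> %i. s i *R B i - outer_prod (q i) (q i)"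
  and "e \<equiv> %i. b i (a i)" and "la \<equiv> %i. lam i (a i)" and "Y \<equiv> %i. - (q i \<bullet> b i (a i))"
 assumes jets: "!!i. i : S ==> jet_equations (s i) (q i) (B i) (X i) (W i) (b i (a i)) (lam i (a i))"
 defines "m0 \<equiv> %i. \<Sum>j\<in>T i. (s i * lam i j) *R outer_prod (b i j) (b i j)"
 assumes M0: "!!i. i : S ==> 1 / K <= Phi (p i) (m0 i - outer_prod (q i) (q i)) (m0 i - outer_prod (q i) (q i))"
   "!!i xi. i : S ==> 0 <= Phi (p i) (m0 i - outer_prod (q i) (q i)) (outer_prod xi xi)"
 defines "P \<equiv> %i. \<Sum>j\<in>-T i. outer_prod (b i j) (b i j)"
 obtains C where "C >= 0"
  "!!i. i : S ==> s i * (2 * Phi (p i) (M i) (W i) - 4 * Phi (p i) (M i) (\<Sum>j\<in>T i. (1 / lam i j) *R outer_prod (X i *v b i j) (X i *v b i j)))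
   <= - (4 * (Y i / s i)^2 * Theta (p i) (p i) (m0 i) (m0 i))
   + (2 * Phi (p i) (M i) (outer_prod (X i *v e i) (q i) + outer_prod (q i) (X i *v e i)) - 4 * s i * Theta (p i) (X i *v e i) (M i) (M i))
   + C * (r i * r i + \<bar>trace (X i ** P i)\<bar> + \<bar>Y i\<bar> * (norm (P i *v q i) * r i))"
proof -
 have spos: "s i > 0" if "i : S" for i using bnd(3)[OF that] K by (smt (verit) divide_pos_pos)
 have bb: "b i j \<bullet> b i k = (if j = k then 1 else 0)" if "i : S" for i j k using b[OF that] by (simp add: orthobasis_def)
 have nb: "norm (b i j) = 1" if "i : S" for i j using bb[OF that, of j j] by (simp add: norm_eq_1)
 have tB: "transpose (B i) = B i" if "i : S" for i
  by (subst (1 2) eigenbasis_symmetric_matrix[OF b[OF that] lam[OF that]]) (simp add: transpose_sum' transpose_scaleR' transpose_outer_prod)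
 define y where "y i = Y i / s i" for i
 define m where "m i = s i *R B i" for i
 define Z where "Z i = s i *R X i + Y i *R B i" for i
 define N where "N i = outer_prod (q i) (e i) + outer_prod (e i) (q i)" for i
 define mP where "mP i = (\<Sum>j\<in>-T i. (s i * lam i j) *R outer_prod (b i j) (b i j))" for i
 \<comment> \<open>\<open>M\<close> with the small eigenvalues of the Hessian set to zero; the
   structural inequality is applied to this truncation.\<close>
 define M0 where "M0 i = m0 i - outer_prod (q i) (q i)" for i
 define V where "V i = (\<Sum>j\<in>T i. (1 / (s i * lam i j)) *R outer_prod (Z i *v b i j) (Z i *v b i j))" for i
 define ZP where "ZP i = Z i ** P i" for i
 define PZ where "PZ i = P i ** Z i" for i
 define R where "R i = ZP i + PZ i" for i
 define PZP where "PZP i = P i ** ZP i" for i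
 \<comment> \<open>Inclusion-exclusion: \<open>Ze\<close> is the part of \<open>Z\<close> with a
   null row or a null column, so that \<open>Z0\<close> is supported on the other directions, as the
   structural inequality requires.\<close>
 define Ze where "Ze i = R i - PZP i" for i
 define Z0 where "Z0 i = Z i - Ze i" for i
 define V0 where "V0 i = (\<Sum>j\<in>T i. (1 / (s i * lam i j)) *R outer_prod (Z0 i *v b i j) (Z0 i *v b i j))" for i
 define Vc where "Vc i = (\<Sum>j\<in>T i. (1 / (s i * lam i j)) *R (outer_prod (Z0 i *v b i j) (Ze i *v b i j) + outer_prod (Ze i *v b i j) (Z0 i *v b i j)))" for i
 define Vee where "Vee i = (\<Sum>j\<in>T i. (1 / (s i * lam i j)) *R outer_prod (Ze i *v b i j) (Ze i *v b i j))" for i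
 define ta where "ta i = trace (ZP i)" for i
 define kapa where "kapa i = norm (P i *v q i)" for i
 \<comment> \<open>The order required of the errors that are multiplied by \<open>y\<close>. A mere
   O(r) would be too large there.\<close>
 define h where "h i = \<bar>ta i\<bar> + r i * r i + kapa i * r i" for i

 have tm: "transpose (m i) = m i" if "i : S" for i using tB[OF that] by (simp add: m_def transpose_scaleR')
 have tZ: "transpose (Z i) = Z i" if "i : S" for i using tB[OF that] tX[OF that] by (simp add: Z_def transpose_add' transpose_scaleR')
 have tm0: "transpose (m0 i) = m0 i" and tP: "transpose (P i) = P i" and tmP: "transpose (mP i) = mP i" for i
  by (simp_all add: m0_def P_def mP_def transpose_sum' transpose_scaleR' transpose_outer_prod)
 have m_split: "m i = m0 i + mP i" if "i : S" for i
 proof -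
  have "m i = (\<Sum>j\<in>UNIV. (s i * lam i j) *R outer_prod (b i j) (b i j))"
   by (rule eigenbasis_symmetric_matrix[OF b[OF that]]) (simp add: m_def scaleR_mv lam[OF that])
  then show ?thesis unfolding sum_split_Compl[of _ "T i"] m0_def mP_def .
 qed
 have M_split: "M i = M0 i + mP i" if "i : S" for i using m_split[OF that] by (simp add: M_def M0_def m_def[symmetric])
 have Mm: "M i = m i - outer_prod (q i) (q i)" for i by (simp add: M_def m_def)
 have Pb: "P i *v b i k = (if k : T i then 0 else b i k)" if "i : S" for i k
 proof -
  have "P i *v b i k = (\<Sum>j\<in>-T i. if j = k then b i j else 0)"
   unfolding P_def matrix_sum_mult outer_prod_mult using bb[OF that] by (intro sum.cong) auto
  then show ?thesis by simp
 qed
 have m0b: "m0 i *v b i k = (if k : T i then (s i * lam i k) *R b i k else 0)" if "i : S" for i k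
 proof -
  have "m0 i *v b i k = (\<Sum>j\<in>T i. if j = k then (s i * lam i k) *R b i k else 0)"
   unfolding m0_def matrix_sum_mult scaleR_mv outer_prod_mult using bb[OF that] by (intro sum.cong) auto
  then show ?thesis by simp
 qed
 have PP: "P i ** P i = P i" if "i : S" for i
  by (rule orthobasis_ext[OF b[OF that]]) (simp add: mv_assoc Pb[OF that])
 have m0P: "m0 i ** P i = 0" if "i : S" for i
  by (rule orthobasis_ext[OF b[OF that]]) (simp add: mv_assoc Pb[OF that] m0b[OF that])
 have Pm0: "P i ** m0 i = 0" if "i : S" for i
  by (rule orthobasis_ext[OF b[OF that]]) (simp add: mv_assoc Pb[OF that] m0b[OF that] mv_scaleR)
 have tPZ: "transpose (ZP i) = PZ i" if "i : S" for i by (simp add: ZP_def PZ_def matrix_transpose_mul tP tZ[OF that])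
 have tPZP: "transpose (PZP i) = PZP i" if "i : S" for i
  by (simp add: PZP_def ZP_def matrix_transpose_mul tP tZ[OF that] matrix_mul_assoc)
 have tR: "transpose (R i) = R i" if "i : S" for i
  using tPZ[OF that] transpose_transpose[of "ZP i"] by (simp add: R_def transpose_add')
 have tZ0: "transpose (Z0 i) = Z0 i" if "i : S" for i
  by (simp add: Z0_def Ze_def transpose_minus' tZ[OF that] tR[OF that] tPZP[OF that])
 have Z0T: "Z0 i *v b i k = 0" if "i : S" "k \<notin> T i" for i k
  using Pb[OF that(1), of k] that(2)
  by (simp add: Z0_def Ze_def R_def PZP_def ZP_def PZ_def diff_mv add_mv mv_assoc)
 have ZP_sum: "ZP i = (\<Sum>j\<in>-T i. outer_prod (Z i *v b i j) (b i j))" if "i : S" for i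
 proof (rule orthobasis_ext[OF b[OF that]])
  fix k
  have "(\<Sum>j\<in>-T i. outer_prod (Z i *v b i j) (b i j)) *v b i k = (\<Sum>j\<in>-T i. if j = k then Z i *v b i k else 0)"
   unfolding matrix_sum_mult outer_prod_mult using bb[OF that] by (intro sum.cong) auto
  then show "ZP i *v b i k = (\<Sum>j\<in>-T i. outer_prod (Z i *v b i j) (b i j)) *v b i k"
   by (simp add: ZP_def mv_assoc Pb[OF that])
 qed
 have R_sum: "R i = (\<Sum>j\<in>-T i. outer_prod (Z i *v b i j) (b i j) + outer_prod (b i j) (Z i *v b i j))" if "i : S" for i
  unfolding R_def tPZ[OF that, symmetric] ZP_sum[OF that] by (simp add: transpose_sum' transpose_outer_prod sum.distrib)

 have b_q: "bdd_family S q" by (rule of_orderI[of S _ K]) (use bnd K in auto)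
 have b_s: "bdd_family S s" by (rule of_orderI[of S _ K]) (use bnd K spos in \<open>auto simp: less_imp_le\<close>)
 have b_X: "bdd_family S X" by (rule of_orderI[of S _ K]) (use bnd K in auto)
 have b_B: "bdd_family S B" by (rule of_orderI[of S _ K]) (use bnd K in auto)
 have b_r: "bdd_family S r" by (rule of_orderI[of S _ K]) (use bnd K in auto)
 have b_e: "bdd_family S e" by (rule of_orderI[of S _ 1]) (auto simp: e_def nb)
 have b_is: "bdd_family S (%i. 1 / s i)"
 proof (rule of_orderI[of S _ K])
  fix i assume "i : S"
  then have "1 / s i <= K" using bnd(3)[of i] spos[of i] K by (simp add: field_simps)
  then show "norm (1 / s i) <= K * 1" using spos[OF \<open>i : S\<close>] by simp
 qed auto
 have ei: "b i (a i) = e i" for i by (simp add: e_def)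
 have b_Y: "bdd_family S Y" unfolding Y_def ei by (intro bdd_family_intros b_q b_e)
 have b_y: "bdd_family S y"
  by (rule of_order_cong[OF of_order_mult(2)[OF b_Y b_is]]) (simp add: y_def)
 have b_p: "bdd_family S p" unfolding p_def by (intro bdd_family_intros b_q b_s)
 have b_M: "bdd_family S M" unfolding M_def by (intro bdd_family_intros b_q b_s b_B)
 have b_m: "bdd_family S m" unfolding m_def by (intro bdd_family_intros b_s b_B)
 have b_Z: "bdd_family S Z" unfolding Z_def by (intro bdd_family_intros b_s b_X b_Y b_B)
 have b_N: "bdd_family S N" unfolding N_def by (intro bdd_family_intros b_q b_e)
 have rnn: "0 <= r i" "0 <= r i * r i" if "i : S" for i using bnd(6)[OF that] by auto
 have r_r: "of_order S r r" by (rule of_orderI[of S _ 1]) (use rnn in auto)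
 have rr_r: "of_order S r (%i. r i * r i)" by (rule of_order_mult(2)[OF r_r b_r])
 have rr1: "bdd_family S (%i. r i * r i)" by (rule of_order_mult(2)[OF b_r b_r])
 have la_rr: "of_order S (%i. r i * r i) la"
  by (rule of_orderI[of S _ 1]) (use lamI a rnn in \<open>auto simp: la_def\<close>)
 have b_la: "bdd_family S la" by (rule of_order_trans[OF la_rr rr1])

 define SI where "SI = Sigma S (%i. - T i)"
 define ST where "ST = Sigma S T"
 have bI: "bdd_family SI (%x. b (fst x) (snd x))" by (rule of_orderI[of SI _ 1]) (auto simp: SI_def nb)
 have bT: "bdd_family ST (%x. b (fst x) (snd x))" by (rule of_orderI[of ST _ 1]) (auto simp: ST_def nb)
 have lI: "of_order SI (%x. r (fst x) * r (fst x)) (%x. lam (fst x) (snd x))"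
  by (rule of_orderI[of SI _ 1]) (use lamI rnn in \<open>auto simp: SI_def\<close>)
 have XI: "of_order SI (%x. r (fst x)) (%x. X (fst x) *v b (fst x) (snd x))"
  by (rule of_orderI[of SI _ K]) (use Xb rnn in \<open>auto simp: SI_def\<close>)
 have sI: "bdd_family SI (%x. s (fst x))" unfolding SI_def by (rule of_order_fst[OF b_s])
 have YI: "bdd_family SI (%x. Y (fst x))" unfolding SI_def by (rule of_order_fst[OF b_Y])
 have rrI: "of_order SI (%x. r (fst x)) (%x. r (fst x) * r (fst x))"
  unfolding SI_def by (rule of_order_fst[OF rr_r])
 have ilT: "bdd_family ST (%x. 1 / (s (fst x) * lam (fst x) (snd x)))"
 proof (rule of_orderI[of ST _ "K * K"])
  fix x assume "x : ST"
  then obtain i j where x: "x = (i, j)" "i : S" "j : T i" by (auto simp: ST_def)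
  have l: "lam i j > 0" using lamT(1)[OF x(2,3)] K by (smt (verit) divide_pos_pos)
  have "1 / s i <= K" using bnd(3)[OF x(2)] spos[OF x(2)] K by (simp add: field_simps)
  moreover have "1 / lam i j <= K" using lamT(1)[OF x(2,3)] l K by (simp add: field_simps)
  ultimately have "(1 / s i) * (1 / lam i j) <= K * K" using spos[OF x(2)] l K by (intro mult_mono) auto
  then show "norm (1 / (s (fst x) * lam (fst x) (snd x))) <= K * K * 1" using spos[OF x(2)] l by (simp add: x)
 qed auto
 have mP_rr: "of_order S (%i. r i * r i) mP"
  unfolding mP_def
  by (rule of_order_sum, fold SI_def, rule of_order_scaleR(2)[OF of_order_mult(3)[OF sI lI]], rule of_order_outer_prod(2)[OF bI bI])
   (rule rnn)
 have b_mP: "bdd_family S mP" by (rule of_order_trans[OF mP_rr rr1])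
 have b_m0: "bdd_family S m0"
  by (rule of_order_cong[OF of_order_diff[OF b_m b_mP]]) (simp add: m_split)
 have b_M0: "bdd_family S M0" unfolding M0_def by (intro bdd_family_intros b_m0 b_q)
 have b_P: "bdd_family S P"
  unfolding P_def by (rule of_order_sum, fold SI_def, rule of_order_outer_prod(2)[OF bI bI]) simp
 have ZI: "of_order SI (%x. r (fst x)) (%x. Z (fst x) *v b (fst x) (snd x))"
 proof (rule of_order_cong)
  show "of_order SI (%x. r (fst x)) (%x. s (fst x) *R (X (fst x) *v b (fst x) (snd x)) + (Y (fst x) * lam (fst x) (snd x)) *R b (fst x) (snd x))"
   by (rule of_order_add[OF of_order_scaleR(3)[OF sI XI] of_order_scaleR(2)[OF of_order_mult(3)[OF YI of_order_trans[OF lI rrI]] bI]])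
  fix x assume "x : SI"
  then have "fst x : S" by (auto simp: SI_def)
  then show "s (fst x) *R (X (fst x) *v b (fst x) (snd x)) + (Y (fst x) * lam (fst x) (snd x)) *R b (fst x) (snd x) = Z (fst x) *v b (fst x) (snd x)"
   by (simp add: Z_def add_mv scaleR_mv lam)
 qed
 have ZP_r: "of_order S r ZP"
 proof (rule of_order_cong)
  show "of_order S r (%i. \<Sum>j\<in>-T i. outer_prod (Z i *v b i j) (b i j))"
   by (rule of_order_sum, fold SI_def, rule of_order_outer_prod(2)[OF ZI bI]) (rule rnn)
 qed (simp add: ZP_sum)
 have PZ_r: "of_order S r PZ"
 proof (rule of_order_cong)
  show "of_order S r (%i. \<Sum>j\<in>-T i. outer_prod (b i j) (Z i *v b i j))"
   by (rule of_order_sum, fold SI_def, rule of_order_outer_prod(3)[OF bI ZI]) (rule rnn)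
 next
  fix i assume "i : S"
  then show "(\<Sum>j\<in>-T i. outer_prod (b i j) (Z i *v b i j)) = PZ i"
   by (simp add: tPZ[symmetric] ZP_sum transpose_sum' transpose_outer_prod)
 qed
 have R_r: "of_order S r R" unfolding R_def by (rule of_order_add[OF ZP_r PZ_r])
 have PZP_r: "of_order S r PZP"
 proof (rule of_order_cong)
  have "of_order SI (%x. r (fst x)) (%x. P (fst x) *v (Z (fst x) *v b (fst x) (snd x)))"
   using b_P by (intro of_order_matrix_vector(2) ZI) (simp add: SI_def of_order_fst[where g = "%_. 1"])
  then show "of_order S r (%i. \<Sum>j\<in>-T i. outer_prod (P i *v (Z i *v b i j)) (b i j))"
   by (intro of_order_sum, fold SI_def, intro of_order_outer_prod(2) bI) (auto intro: rnn)
 next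
  fix i assume i: "i : S"
  show "(\<Sum>j\<in>-T i. outer_prod (P i *v (Z i *v b i j)) (b i j)) = PZP i"
  proof (rule orthobasis_ext[OF b[OF i]])
   fix k
   have "(\<Sum>j\<in>-T i. outer_prod (P i *v (Z i *v b i j)) (b i j)) *v b i k = (\<Sum>j\<in>-T i. if j = k then P i *v (Z i *v b i k) else 0)"
    unfolding matrix_sum_mult outer_prod_mult using bb[OF i] by (intro sum.cong) auto
   then show "(\<Sum>j\<in>-T i. outer_prod (P i *v (Z i *v b i j)) (b i j)) *v b i k = PZP i *v b i k"
    by (simp add: PZP_def ZP_def mv_assoc Pb[OF i])
  qed
 qed
 have Ze_r: "of_order S r Ze" unfolding Ze_def by (rule of_order_diff[OF R_r PZP_r])
 have b_Ze: "bdd_family S Ze" by (rule of_order_trans[OF Ze_r b_r])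
 have b_Z0: "bdd_family S Z0" unfolding Z0_def by (rule of_order_diff[OF b_Z b_Ze])
 have ZT: "bdd_family ST (%x. Z (fst x) *v b (fst x) (snd x))"
  by (intro of_order_matrix_vector(1) bT) (simp add: ST_def of_order_fst[OF b_Z])
 have b_V: "bdd_family S V"
  unfolding V_def by (rule of_order_sum, fold ST_def, intro of_order_scaleR(2) ilT of_order_outer_prod(2) ZT) simp
 have ZeT: "of_order ST (%x. r (fst x)) (%x. Ze (fst x) *v b (fst x) (snd x))"
  by (intro of_order_matrix_vector(1) bT) (simp add: ST_def of_order_fst[OF Ze_r])
 have Z0n: "of_order S (%i. norm (Z0 i)) Z0" by (rule of_orderI[of S _ 1]) auto
 have Z0Tn: "of_order ST (%x. norm (Z0 (fst x))) (%x. Z0 (fst x) *v b (fst x) (snd x))"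
  by (intro of_order_matrix_vector(1) bT) (simp add: ST_def of_order_fst[OF Z0n])
 have Vc_w: "of_order S (%i. norm (Z0 i) * r i) Vc"
  unfolding Vc_def
 proof (rule of_order_sum, fold ST_def, rule of_order_scaleR(3)[OF ilT], rule of_order_add)
  show "of_order ST (%x. norm (Z0 (fst x)) * r (fst x)) (%x. outer_prod (Z0 (fst x) *v b (fst x) (snd x)) (Ze (fst x) *v b (fst x) (snd x)))"
   by (rule of_order_outer_prod(1)[OF Z0Tn ZeT])
  show "of_order ST (%x. norm (Z0 (fst x)) * r (fst x)) (%x. outer_prod (Ze (fst x) *v b (fst x) (snd x)) (Z0 (fst x) *v b (fst x) (snd x)))"
   using of_order_outer_prod(1)[OF ZeT Z0Tn] by (simp add: mult.commute)
 qed (use rnn in auto)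
 have Vee_rr: "of_order S (%i. r i * r i) Vee"
  unfolding Vee_def by (rule of_order_sum, fold ST_def, rule of_order_scaleR(3)[OF ilT], rule of_order_outer_prod(1)[OF ZeT ZeT]) (rule rnn)
 have V_split: "V i = V0 i + Vc i + Vee i" for i
 proof -
  have Zs: "Z i = Z0 i + Ze i" by (simp add: Z0_def)
  show ?thesis
   unfolding V_def V0_def Vc_def Vee_def sum.distrib[symmetric]
   by (rule sum.cong[OF refl]) (simp add: Zs add_mv outer_prod_linear scaleR_add_right)
 qed

 have knn: "kapa i >= 0" for i by (simp add: kapa_def)
 have hnn: "h i >= 0" if "i : S" for i using rnn[OF that] knn by (simp add: h_def)
 have ta_h: "of_order S h ta" by (rule of_orderI[of S _ 1]) (use rnn knn hnn in \<open>auto simp: h_def\<close>)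
 have rr_h: "of_order S h (%i. r i * r i)" by (rule of_orderI[of S _ 1]) (use rnn knn hnn in \<open>auto simp: h_def\<close>)
 have kr_h: "of_order S h (%i. kapa i * r i)" by (rule of_orderI[of S _ 1]) (use rnn knn hnn in \<open>auto simp: h_def\<close>)
 have Pq: "of_order S kapa (%i. P i *v q i)" by (rule of_orderI[of S _ 1]) (auto simp: kapa_def)
 have Pp: "of_order S kapa (%i. P i *v p i)"
  by (rule of_order_cong[OF of_order_scaleR(3)[OF of_order_mult(3)[OF of_order_const[of S "2::real"] b_s] Pq]])
   (simp add: p_def mv_scaleR)
 \<comment> \<open>As matrices \<open>R\<close> and \<open>PZP\<close> are only O(r). In a quadratic
   form at \<open>x\<close> the projection falls on \<open>x\<close> itself, next to
   \<open>Z ** P\<close>, and this gains the factor \<open>kapa\<close>.\<close>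
 have form_h: "of_order S h (%i. x i \<bullet> (R i *v x i))" "of_order S h (%i. x i \<bullet> (PZP i *v x i))"
  "of_order S h (%i. (m0 i *v x i) \<bullet> (R i *v x i))" "of_order S h (%i. (m0 i *v x i) \<bullet> (PZP i *v x i))"
  if x: "bdd_family S x" and Px: "of_order S kapa (%i. P i *v x i)" for x
 proof -
  define z where "z i = ZP i *v (P i *v x i)" for i
  have z_w: "of_order S (%i. kapa i * r i) z"
   unfolding z_def using of_order_matrix_vector(3)[OF ZP_r Px] by (simp add: mult.commute)
  have z_h: "of_order S h z" by (rule of_order_trans[OF z_w kr_h])
  have zz: "z i = Z i *v (P i *v x i)" if "i : S" for i
   using arg_cong[OF PP[OF that], of "%A. A *v x i"] by (simp add: z_def ZP_def mv_assoc)
  have m0P0: "(m0 i *v u) \<bullet> (P i *v w) = 0" if "i : S" for i u w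
   using arg_cong[OF Pm0[OF that], of "%A. A *v u"] symmetric_inner[OF tP[of i], of "m0 i *v u" w]
   by (simp add: mv_assoc)
  have "x i \<bullet> (R i *v x i) = x i \<bullet> z i + x i \<bullet> z i" if "i : S" for i
   using symmetric_inner[OF tP[of i], of "x i" "Z i *v x i"] symmetric_inner[OF tZ[OF that], of "P i *v x i" "x i"]
   by (simp add: R_def ZP_def PZ_def zz[OF that] add_mv mv_assoc inner_add_right inner_commute)
  then show "of_order S h (%i. x i \<bullet> (R i *v x i))"
   using of_order_cong[OF of_order_add[OF of_order_inner(3)[OF x z_h] of_order_inner(3)[OF x z_h]]] by simp
  have "x i \<bullet> (PZP i *v x i) = x i \<bullet> (P i *v z i)" if "i : S" for i
   by (simp add: PZP_def ZP_def zz[OF that] mv_assoc)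
  then show "of_order S h (%i. x i \<bullet> (PZP i *v x i))"
   using of_order_cong[OF of_order_inner(3)[OF x of_order_matrix_vector(2)[OF b_P z_h]]] by simp
  have "(m0 i *v x i) \<bullet> (R i *v x i) = (m0 i *v x i) \<bullet> z i" if "i : S" for i
   by (simp add: R_def ZP_def PZ_def zz[OF that] add_mv mv_assoc inner_add_right m0P0[OF that])
  then show "of_order S h (%i. (m0 i *v x i) \<bullet> (R i *v x i))"
   using of_order_cong[OF of_order_inner(3)[OF of_order_matrix_vector(1)[OF b_m0 x] z_h]] by simp
  have "(m0 i *v x i) \<bullet> (PZP i *v x i) = 0" if "i : S" for i
   by (simp add: PZP_def mv_assoc m0P0[OF that])
  then show "of_order S h (%i. (m0 i *v x i) \<bullet> (PZP i *v x i))"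
   by (intro of_orderI[of S _ 0]) (auto simp: hnn)
 qed
 have trR: "trace (R i) = 2 * ta i" for i
  by (simp add: R_def trace_add' ta_def ZP_def PZ_def trace_mul_sym[of "P i" "Z i"])
 have trPZP: "trace (PZP i) = ta i" if "i : S" for i
  by (simp add: PZP_def ta_def ZP_def trace_mul_sym[of "P i"] matrix_mul_assoc[symmetric] PP[OF that])
 have m0R: "m0 i \<bullet> R i = 0" if "i : S" for i
  by (simp add: matrix_inner_columns tm0 R_def ZP_def PZ_def matrix_add_ldistrib trace_add' matrix_mul_assoc m0P[OF that]
    trace_mul_sym[of "m0 i ** Z i"] Pm0[OF that] matrix_mult_left_linear)
 have m0PZP: "m0 i \<bullet> PZP i = 0" if "i : S" for i
  by (simp add: matrix_inner_columns tm0 PZP_def matrix_mul_assoc m0P[OF that] matrix_mult_left_linear)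
 have Theta_m0: "Theta (p i) (p i) (m0 i) U = ((p i \<bullet> p i) * (trace (m0 i) * trace U - m0 i \<bullet> U) - trace (m0 i) * (p i \<bullet> (U *v p i))
   - trace U * (p i \<bullet> (m0 i *v p i))) / 2 + (m0 i *v p i) \<bullet> (U *v p i)" for i U
  by (simp add: Theta_def field_simps)
 \<comment> \<open>A matrix orthogonal to \<open>m0\<close> enters \<open>Theta\<close> only through
   its trace and through contractions with \<open>p\<close>; each of these is required to be O(h),
   which is better than its norm.\<close>
 have Theta_h: "of_order S h (%i. Theta (p i) (p i) (m0 i) (U i))"
  if U: "!!i. i : S ==> m0 i \<bullet> U i = 0" "of_order S h (%i. trace (U i))" "of_order S h (%i. p i \<bullet> (U i *v p i))"
   "of_order S h (%i. (m0 i *v p i) \<bullet> (U i *v p i))" for U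
 proof (rule of_order_cong)
  show "of_order S h (%i. (1 / 2) * (((p i \<bullet> p i) * trace (m0 i)) * trace (U i) - trace (m0 i) * (p i \<bullet> (U i *v p i))
   - (p i \<bullet> (m0 i *v p i)) * trace (U i)) + (m0 i *v p i) \<bullet> (U i *v p i))"
   by (intro of_order_add U(4) of_order_mult(3) of_order_const of_order_diff U(2,3); intro bdd_family_intros b_p b_m0)
 qed (simp add: Theta_m0 U(1) mult_ac)
 have tau2: "of_order S h (%i. 2 * ta i)" by (rule of_order_mult(3)[OF of_order_const ta_h])
 have ThR: "of_order S h (%i. Theta (p i) (p i) (m0 i) (R i))"
  by (rule Theta_h[OF m0R _ form_h(1,3)[OF b_p Pp]]) (simp_all add: trR tau2)
 have ThPZP: "of_order S h (%i. Theta (p i) (p i) (m0 i) (PZP i))"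
  by (rule Theta_h[OF m0PZP of_order_cong[OF ta_h] form_h(2,4)[OF b_p Pp]]) (simp_all add: trPZP)
 have ThZe: "of_order S h (%i. Theta (p i) (p i) (m0 i) (Ze i))"
  unfolding Ze_def Theta_minus_right by (rule of_order_diff[OF ThR ThPZP])
 have b_R: "bdd_family S R" by (rule of_order_trans[OF R_r b_r])
 have mP_h: "of_order S h mP" by (rule of_order_trans[OF mP_rr rr_h])
 have PhiMR: "of_order S h (%i. Phi (p i) (M i) (R i))"
 proof (rule of_order_cong)
  show "of_order S h (%i. (1 / 2) * (trace (M i) * (2 * ta i) - mP i \<bullet> R i + q i \<bullet> (R i *v q i))
    + (Theta (p i) (p i) (m0 i) (R i) + Theta (p i) (p i) (mP i) (R i)))"
   by (intro of_order_add of_order_mult(3) of_order_const of_order_diff tau2 ThR form_h(1)[OF b_q Pq] of_order_inner(2)[OF mP_h b_R]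
     of_order_Theta(2)[OF b_p b_p mP_h b_R] bdd_family_intros b_M)
  fix i assume i: "i : S"
  have "Theta (p i) (p i) (M i) (R i) = Theta (p i) (p i) (m i) (R i)"
   unfolding Mm Theta_minus_left by (subst Theta_rank_one_self[of "p i" "2 * s i" "q i" "R i"]) (simp_all add: p_def tR[OF i])
  also have "... = Theta (p i) (p i) (m0 i) (R i) + Theta (p i) (p i) (mP i) (R i)" unfolding m_split[OF i] by (rule Theta_add_left)
  finally have T: "Theta (p i) (p i) (M i) (R i) = Theta (p i) (p i) (m0 i) (R i) + Theta (p i) (p i) (mP i) (R i)" .
  have "M i \<bullet> R i = mP i \<bullet> R i - q i \<bullet> (R i *v q i)"
   unfolding Mm m_split[OF i] by (simp add: inner_diff_left inner_add_left m0R[OF i] inner_commute[of "outer_prod (q i) (q i)"] inner_outer_prod)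
  then show "(1 / 2) * (trace (M i) * (2 * ta i) - mP i \<bullet> R i + q i \<bullet> (R i *v q i))
    + (Theta (p i) (p i) (m0 i) (R i) + Theta (p i) (p i) (mP i) (R i)) = Phi (p i) (M i) (R i)"
   unfolding Phi_def S2_def T trR by simp
 qed

 \<comment> \<open>The error between \<open>E\<close> and its truncated version \<open>E0\<close> is
   sorted by the way it will be absorbed: \<open>y * D\<close> through the order \<open>h\<close>,
   \<open>A1\<close> by the coercive multiple of the square of \<open>norm (Z0 i)\<close>, and
   \<open>A2\<close> directly as O(r^2).\<close>
 define D where "D i = 4 * Theta (p i) (p i) (m0 i) (Ze i) + 2 * Phi (p i) (M i) (R i)" for i
 have D_h: "of_order S h D" unfolding D_def by (intro of_order_add of_order_mult(3) of_order_const ThZe PhiMR)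
 define A1 where "A1 i = 2 * Phi (p i) (Z0 i) (Ze i) + 2 * Phi (p i) (M0 i) (Vc i)" for i
 have A1_w: "of_order S (%i. norm (Z0 i) * r i) A1"
  unfolding A1_def by (intro of_order_add of_order_mult(3) of_order_const of_order_Phi(1)[OF b_p Z0n Ze_r] of_order_Phi(3)[OF b_p b_M0 Vc_w])
 define dT where "dT i = Theta (p i) (p i) (mP i) (m i) + Theta (p i) (p i) (m0 i) (mP i)" for i
 have dT_rr: "of_order S (%i. r i * r i) dT"
  unfolding dT_def by (rule of_order_add[OF of_order_Theta(2)[OF b_p b_p mP_rr b_m] of_order_Theta(3)[OF b_p b_p b_m0 mP_rr]])
 have Tmm: "Theta (p i) (p i) (m i) (m i) = Theta (p i) (p i) (m0 i) (m0 i) + dT i" if "i : S" for i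
  unfolding dT_def m_split[OF that] by (simp add: Theta_add_left Theta_add_right)
 define A2 where "A2 i = Phi (p i) (Ze i) (Ze i) + 2 * Phi (p i) (mP i) (V i) + 2 * Phi (p i) (M0 i) (Vee i)
   + (4 * y i) * Theta (p i) (p i) (mP i) (Z i) + (3 * (y i)^2) * dT i" for i
 have A2_rr: "of_order S (%i. r i * r i) A2"
  unfolding A2_def sq_eq
  by (intro of_order_add of_order_Phi(1)[OF b_p Ze_r Ze_r] of_order_mult(3)[OF of_order_const] of_order_Phi(2)[OF b_p mP_rr b_V]
    of_order_Phi(3)[OF b_p b_M0 Vee_rr] of_order_mult(3)[OF _ of_order_Theta(2)[OF b_p b_p mP_rr b_Z]] of_order_mult(3)[OF _ dT_rr]
    bdd_family_intros b_y)
 define dla where "dla i = 2 * Phi (p i) (M i) (N i) - 4 * s i * Theta (p i) (e i) (M i) (M i)" for i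
 have b_dla: "bdd_family S dla" unfolding dla_def by (intro bdd_family_intros b_p b_M b_N b_s b_e)
 define rh where "rh i = 4 * Phi (p i) (Z i) (N i) - 2 * la i * Phi (p i) (N i) (N i) + 2 * Phi (p i) (M i) (B i) + 4 * la i * Phi (p i) (M i) (outer_prod (e i) (e i)) + 8 * y i * Theta (p i) (p i) (M i) (N i)
    - 16 * s i * Theta (p i) (e i) (M i) (Z i) + 16 * s i * la i * Theta (p i) (e i) (M i) (N i) - 8 * y i * s i * Theta (p i) (e i) (M i) (M i) - 8 * (s i)^2 * la i * Theta (e i) (e i) (M i) (M i)
    + 4 * Theta (p i) (q i) (M i) (M i) - 8 * Y i * Theta (p i) (e i) (M i) (M i)" for i
 have b_rh: "bdd_family S rh" unfolding rh_def sq_eq by (intro bdd_family_intros b_p b_M b_N b_s b_e b_Z b_la b_B b_y b_q b_Y)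
 define d0 where "d0 i = 2 * Phi (p i) (M0 i) (Z0 i) + 2 * y i * Theta (p i) (p i) (m0 i) (m0 i)" for i
 define A3 where "A3 i = (4 * (y i)^2) * Phi (p i) (M i) (mP i) + la i * (rh i + 2 * y i * dla i)" for i
 have A3_rr: "of_order S (%i. r i * r i) A3"
  unfolding A3_def sq_eq
  by (intro of_order_add of_order_mult(3)[OF _ of_order_Phi(3)[OF b_p b_M mP_rr]] of_order_mult(2)[OF la_rr] bdd_family_intros b_y b_rh b_dla)
 define l where "l i = 2 * Phi (p i) (M i) (outer_prod (X i *v e i) (q i) + outer_prod (q i) (X i *v e i)) - 4 * s i * Theta (p i) (X i *v e i) (M i) (M i)" for i
 define E where "E i = Phi (p i) (Z i) (Z i) + 2 * Phi (p i) (M i) (V i) + 4 * y i * Theta (p i) (p i) (m i) (Z i)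
   + 3 * (y i)^2 * Theta (p i) (p i) (m i) (m i) + 2 * y i * Phi (p i) (M i) (R i)" for i
 define E0 where "E0 i = Phi (p i) (Z0 i) (Z0 i) + 2 * Phi (p i) (M0 i) (V0 i) + 4 * y i * Theta (p i) (p i) (m0 i) (Z0 i)
   + 3 * (y i)^2 * Theta (p i) (p i) (m0 i) (m0 i)" for i
 note eqs = differentiated_equation[OF tB tX spos jets]
 have dA: "2 * Phi (p i) (M i) (Z i) + 2 * y i * Theta (p i) (p i) (m i) (m i) = la i * dla i" if "i : S" for i
  unfolding dla_def p_def M_def N_def m_def Z_def y_def Y_def e_def la_def by (rule eqs(1)[OF that that that that])
 \<comment> \<open>The truncated linearised equation holds only up to O(r). That is enough, because
   it enters the structural inequality squared.\<close>
 have d0_r: "of_order S r d0"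
 proof (rule of_order_cong)
  have mP_r: "of_order S r mP" and la_r: "of_order S r la" and dT_r: "of_order S r dT"
   by (rule of_order_trans[OF mP_rr rr_r] of_order_trans[OF la_rr rr_r] of_order_trans[OF dT_rr rr_r])+
  show "of_order S r (%i. la i * dla i - 2 * Phi (p i) (M0 i) (Ze i) - 2 * Phi (p i) (mP i) (Z i) - (2 * y i) * dT i)"
   by (intro of_order_diff of_order_mult(2)[OF la_r b_dla] of_order_mult(3)[OF of_order_const] of_order_Phi(3)[OF b_p b_M0 Ze_r]
     of_order_Phi(2)[OF b_p mP_r b_Z] of_order_mult(3)[OF _ dT_r] bdd_family_intros b_y)
  fix i assume i: "i : S"
  have Zs: "Z i = Z0 i + Ze i" by (simp add: Z0_def)
  have "Phi (p i) (M i) (Z i) = Phi (p i) (M0 i) (Z0 i) + Phi (p i) (M0 i) (Ze i) + Phi (p i) (mP i) (Z i)"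
   unfolding M_split[OF i] Phi_add_left by (simp add: Zs Phi_add_right)
  then show "la i * dla i - 2 * Phi (p i) (M0 i) (Ze i) - 2 * Phi (p i) (mP i) (Z i) - (2 * y i) * dT i = d0 i"
   unfolding dA[OF i, symmetric] Tmm[OF i] d0_def by (simp add: algebra_simps)
 qed
 \<comment> \<open>\<open>yd\<close> expresses \<open>y\<close> times \<open>Phi\<close> of
   \<open>M\<close> and \<open>Z\<close> by the linearised equation; thereafter the terms in
   \<open>y\<close> from the second derivative and those from the pseudo-inverse sum combine into
   the form \<open>E\<close>.\<close>
 have main_id: "s i * (2 * Phi (p i) (M i) (W i) - 4 * Phi (p i) (M i) (\<Sum>j\<in>T i. (1 / lam i j) *R outer_prod (X i *v b i j) (X i *v b i j)))
   = - (2 * E i) + l i + A3 i" if i: "i : S" for i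
 proof -
  define G where "G = (\<Sum>j\<in>T i. (1 / lam i j) *R outer_prod (X i *v b i j) (X i *v b i j))"
  have Ys: "Y i = y i * s i" using spos[OF i] by (simp add: y_def)
  have l0: "lam i j ~= 0" if "j : T i" for j using lamT(1)[OF i that] K by (smt (verit) divide_pos_pos)
  have sG: "s i *R G = V i - (2 * y i) *R Z i + y i *R R i + (y i)^2 *R m0 i"
   using pseudo_inverse_identity[OF b[OF i] lam[OF i] l0 spos[OF i] tX[OF i] tB[OF i], where y = "y i"]
   by (simp add: G_def V_def m0_def R_sum[OF i] Z_def Ys)
  have "s i * Phi (p i) (M i) G = Phi (p i) (M i) (s i *R G)" by (simp add: Phi_scale_right)
  also have "... = Phi (p i) (M i) (V i) - 2 * y i * Phi (p i) (M i) (Z i) + y i * Phi (p i) (M i) (R i) + (y i)^2 * Phi (p i) (M i) (m0 i)"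
   unfolding sG by (simp add: Phi_add_right Phi_minus_right Phi_scale_right)
  finally have PG: "s i * Phi (p i) (M i) G = ..." .
  have Pm: "Phi (p i) (M i) (m i) = Phi (p i) (M i) (m0 i) + Phi (p i) (M i) (mP i)" unfolding m_split[OF i] by (rule Phi_add_right)
  have PW: "2 * s i * Phi (p i) (M i) (W i) = - (2 * Phi (p i) (Z i) (Z i) + 4 * y i * Phi (p i) (M i) (Z i) - 4 * (y i)^2 * Phi (p i) (M i) (m i)
    + 8 * y i * Theta (p i) (p i) (m i) (Z i) + 2 * (y i)^2 * Theta (p i) (p i) (m i) (m i)) + l i + la i * rh i"
   unfolding l_def rh_def p_def M_def N_def m_def Z_def y_def Y_def e_def la_def by (rule eqs(2)[OF i i i i])
  have "y i * (2 * Phi (p i) (M i) (Z i) + 2 * y i * Theta (p i) (p i) (m i) (m i)) = y i * (la i * dla i)" unfolding dA[OF i] ..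
  then have yd: "y i * Phi (p i) (M i) (Z i) = y i * (la i * dla i) / 2 - (y i)^2 * Theta (p i) (p i) (m i) (m i)"
   by (simp add: sq_eq algebra_simps)
  have "s i * (2 * Phi (p i) (M i) (W i) - 4 * Phi (p i) (M i) G) = 2 * s i * Phi (p i) (M i) (W i) - 4 * (s i * Phi (p i) (M i) G)"
   by (simp add: algebra_simps)
  also have "... = - (2 * E i) + l i + A3 i"
   unfolding PW PG Pm E_def A3_def using yd by (simp add: algebra_simps)
  finally show ?thesis unfolding G_def .
 qed
 have E_split: "E i = E0 i + A1 i + A2 i + y i * D i" if i: "i : S" for i
 proof -
  have Zs: "Z i = Z0 i + Ze i" by (simp add: Z0_def)
  have "Phi (p i) (Z i) (Z i) = Phi (p i) (Z0 i) (Z0 i) + 2 * Phi (p i) (Z0 i) (Ze i) + Phi (p i) (Ze i) (Ze i)"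
   unfolding Zs by (simp add: Phi_add_left Phi_add_right Phi_commute[of "p i" "Ze i" "Z0 i"])
  moreover have "Phi (p i) (M i) (V i) = Phi (p i) (M0 i) (V0 i) + Phi (p i) (M0 i) (Vc i) + Phi (p i) (M0 i) (Vee i) + Phi (p i) (mP i) (V i)"
   unfolding M_split[OF i] Phi_add_left by (simp add: V_split Phi_add_right)
  moreover have "Theta (p i) (p i) (m i) (Z i) = Theta (p i) (p i) (m0 i) (Z0 i) + Theta (p i) (p i) (m0 i) (Ze i) + Theta (p i) (p i) (mP i) (Z i)"
   unfolding m_split[OF i] Theta_add_left by (simp add: Zs Theta_add_right)
  ultimately show ?thesis unfolding E_def E0_def A1_def A2_def D_def Tmm[OF i] by (simp add: algebra_simps)
 qed
 \<comment> \<open>The nonzero eigenvalues of \<open>m0\<close> are the products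
   \<open>s i * lam i j\<close>, which lie between the reciprocal of \<open>K * K\<close> and
   \<open>K * K\<close>.\<close>
 define L where "L = K * K"
 have L1: "L >= 1" "K <= L" using K by (simp_all add: L_def mult_le_cancel_left1 mult_ge1_I)
 obtain c C where c: "c > 0" "C >= 0" and struct: "!!i. i : S ==>
   c * (norm (Z0 i))^2 + 2 * (y i)^2 * Theta (p i) (p i) (m0 i) (m0 i) - C * (d0 i)^2 <= E0 i"
 proof (rule structural_coercive[OF L1(1), where 'n = 'n])
  fix c C :: real
  assume cC: "c > 0" "C >= 0"
  assume main: "!!(b :: 'n => real^'n) T mu q s p m Z y.
   [|structural_data L b T mu q s p m; card T >= 2; transpose Z = Z; !!j. j \<notin> T ==> Z *v b j = 0|]
  ==> structural_bound c C b T mu q p m Z y"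
  show thesis
  proof (rule that[OF cC])
   fix i assume i: "i : S"
   define mu where "mu j = (if j : T i then s i * lam i j else 0)" for j
   have V0': "V0 i = (\<Sum>j\<in>T i. (1 / mu j) *R outer_prod (Z0 i *v b i j) (Z0 i *v b i j))"
    unfolding V0_def by (rule sum.cong) (simp_all add: mu_def)
   have iK: "1 / K > 0" using K by simp
   show "c * (norm (Z0 i))^2 + 2 * (y i)^2 * Theta (p i) (p i) (m0 i) (m0 i) - C * (d0 i)^2 <= E0 i"
    unfolding d0_def E0_def M0_def V0'
   proof (rule main[unfolded structural_bound_def, OF _ T[OF i] tZ0[OF i] Z0T[OF i]], unfold structural_data_def, intro conjI ballI allI impI)
    fix j assume j: "j : T i"
    have "1 / K * (1 / K) <= s i * lam i j" using bnd(3)[OF i] lamT(1)[OF i j] iK spos[OF i] by (intro mult_mono) auto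
    then show "1 / L <= mu j" using j by (simp add: mu_def L_def)
    have "0 <= lam i j" using lamT(1)[OF i j] iK by linarith
    then have "s i * lam i j <= K * K" using bnd(2)[OF i] lamT(2)[OF i j] spos[OF i] K by (intro mult_mono) auto
    then show "mu j <= L" using j by (simp add: mu_def L_def)
   next
    show "m0 i *v b i j = mu j *R b i j" for j using m0b[OF i, of j] by (simp add: mu_def)
    show "p i = (2 * s i) *R q i" by (simp add: p_def)
    show "norm (q i) <= L" "0 < s i" "s i <= L" using bnd(1,2)[OF i] L1 spos[OF i] by linarith+
    have "1 / L <= 1 / K" using K L1 by (intro divide_left_mono) auto
    then show "1 / L <= Phi (p i) (m0 i - outer_prod (q i) (q i)) (m0 i - outer_prod (q i) (q i))" using M0(1)[OF i] by linarith
    show "0 <= Phi (p i) (m0 i - outer_prod (q i) (q i)) (outer_prod xi xi)" for xi by (rule M0(2)[OF i])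
   qed (simp_all add: mu_def b[OF i])
  qed
 qed
 obtain C1 where C1: "C1 >= 0" "!!i. i : S ==> norm (A1 i) <= C1 * (norm (Z0 i) * r i)" using A1_w by (rule of_orderE) blast
 obtain C2 where C2: "C2 >= 0" "!!i. i : S ==> norm (A2 i) <= C2 * (r i * r i)" using A2_rr by (rule of_orderE) blast
 obtain C3 where C3: "C3 >= 0" "!!i. i : S ==> norm (A3 i) <= C3 * (r i * r i)" using A3_rr by (rule of_orderE) blast
 obtain C4 where C4: "C4 >= 0" "!!i. i : S ==> norm (D i) <= C4 * h i" using D_h by (rule of_orderE) blast
 obtain C5 where C5: "C5 >= 0" "!!i. i : S ==> norm (d0 i) <= C5 * r i" using d0_r by (rule of_orderE) blast
 obtain C6 where C6: "C6 >= 0" "!!i. i : S ==> norm (y i) <= C6" using b_y by (rule of_orderE) simp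
 \<comment> \<open>The null trace of \<open>Z\<close> differs from that of \<open>s *R X\<close> by
   a bounded multiple of the sum of the small eigenvalues.\<close>
 have ta_X: "of_order S (%i. r i * r i + \<bar>trace (X i ** P i)\<bar>) ta"
 proof (rule of_order_cong)
  have x: "of_order S (%i. r i * r i + \<bar>trace (X i ** P i)\<bar>) (%i. trace (X i ** P i))"
   "of_order S (%i. r i * r i + \<bar>trace (X i ** P i)\<bar>) (%i. r i * r i)"
   by (rule of_orderI[of S _ 1], use rnn in \<open>auto simp: add_nonneg_nonneg\<close>)+
  have BP: "of_order S (%i. r i * r i) (%i. \<Sum>j\<in>-T i. lam i j)"
   by (rule of_order_sum, fold SI_def, rule lI) (rule rnn)
  show "of_order S (%i. r i * r i + \<bar>trace (X i ** P i)\<bar>) (%i. s i * trace (X i ** P i) + Y i * (\<Sum>j\<in>-T i. lam i j))"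
   by (intro of_order_add of_order_mult(3)[OF b_s x(1)] of_order_mult(3)[OF b_Y] of_order_trans[OF BP x(2)])
  fix i assume i: "i : S"
  have "trace (B i ** P i) = (\<Sum>j\<in>UNIV. b i j \<bullet> ((B i ** P i) *v b i j))" by (rule orthobasis_trace[OF b[OF i]])
  also have "... = (\<Sum>j\<in>UNIV. if j : - T i then lam i j else 0)"
   by (rule sum.cong[OF refl]) (simp add: mv_assoc Pb[OF i] lam[OF i] bb[OF i])
  also have "... = (\<Sum>j\<in>-T i. lam i j)" by (subst sum.inter_filter[symmetric]) (simp_all add: Compl_eq)
  finally show "s i * trace (X i ** P i) + Y i * (\<Sum>j\<in>-T i. lam i j) = ta i"
   by (simp add: ta_def ZP_def Z_def matrix_mult_left_linear trace_add' trace_scaleR)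
 qed
 obtain C7 where C7: "C7 >= 0" "!!i. i : S ==> norm (ta i) <= C7 * (r i * r i + \<bar>trace (X i ** P i)\<bar>)" using ta_X by (rule of_orderE) blast
 define CC where "CC = C1^2 / (2 * c) + 2 * C * C5^2 + 2 * C2 + C3 + 2 * (C4 * C6) * (C7 + 1) + 2 * C4 * K"
 have CC0: "CC >= 0" unfolding CC_def using c C1 C2 C3 C4 C6 C7 K by (intro add_nonneg_nonneg mult_nonneg_nonneg divide_nonneg_nonneg) auto
 show thesis
 proof (rule that[OF CC0])
  fix i assume i: "i : S"
  define t where "t = \<bar>trace (X i ** P i)\<bar>"
  define R2 where "R2 = r i * r i"
  define z where "z = norm (Z0 i)"
  have R2: "R2 >= 0" "t >= 0" using rnn[OF i] by (simp_all add: R2_def t_def)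
  \<comment> \<open>Completing the square: the coercive term \<open>c * z^2\<close> of the
    structural inequality pays for the whole cross term.\<close>
  have a1: "A1 i >= - (c * z^2) - C1^2 / (4 * c) * R2"
  proof -
   have "0 <= c * (z - C1 * r i / (2 * c))^2" using c by simp
   also have "... = c * z^2 - C1 * (z * r i) + C1^2 / (4 * c) * R2" using c by (simp add: R2_def sq_eq field_simps)
   finally show ?thesis using C1(2)[OF i] unfolding z_def[symmetric] by (simp add: abs_le_iff)
  qed
  have a2: "A2 i >= - (C2 * R2)" "A3 i <= C3 * R2" using C2(2)[OF i] C3(2)[OF i] by (simp_all add: R2_def abs_le_iff)
  have a4: "y i * D i >= - ((C4 * C6) * (C7 + 1) * (R2 + t)) - C4 * (K * (\<bar>Y i\<bar> * (kapa i * r i)))"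
  proof -
   have "\<bar>y i * D i\<bar> <= \<bar>y i\<bar> * (C4 * h i)" unfolding abs_mult using C4(2)[OF i] by (intro mult_left_mono) auto
   also have "... = C4 * (\<bar>y i\<bar> * (\<bar>ta i\<bar> + R2)) + C4 * (\<bar>y i\<bar> * (kapa i * r i))" by (simp add: h_def R2_def algebra_simps)
   also have "C4 * (\<bar>y i\<bar> * (\<bar>ta i\<bar> + R2)) <= C4 * (C6 * ((C7 + 1) * (R2 + t)))"
   proof (intro mult_left_mono mult_mono)
    show "\<bar>y i\<bar> <= C6" using C6(2)[OF i] by simp
    have "\<bar>ta i\<bar> <= C7 * (R2 + t)" using C7(2)[OF i] by (simp add: R2_def t_def)
    then show "\<bar>ta i\<bar> + R2 <= (C7 + 1) * (R2 + t)" using R2 by (simp add: algebra_simps)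
   qed (use C4 C6 R2 in auto)
   also have "C4 * (\<bar>y i\<bar> * (kapa i * r i)) <= C4 * (K * (\<bar>Y i\<bar> * (kapa i * r i)))"
   proof -
    have "1 / s i <= K" using bnd(3)[OF i] spos[OF i] K by (simp add: field_simps)
    then have "\<bar>Y i\<bar> * (1 / s i) <= \<bar>Y i\<bar> * K" by (intro mult_left_mono) auto
    then have "\<bar>y i\<bar> <= K * \<bar>Y i\<bar>" using spos[OF i] by (simp add: y_def mult.commute)
    then have "\<bar>y i\<bar> * (kapa i * r i) <= (K * \<bar>Y i\<bar>) * (kapa i * r i)" using knn[of i] rnn[OF i] by (intro mult_right_mono) auto
    then show ?thesis using C4(1) by (intro mult_left_mono) (simp_all add: mult.assoc)
   qed
   finally have "\<bar>y i * D i\<bar> <= C4 * (C6 * ((C7 + 1) * (R2 + t))) + C4 * (K * (\<bar>Y i\<bar> * (kapa i * r i)))" by simp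
   moreover have "C4 * (C6 * ((C7 + 1) * (R2 + t))) = (C4 * C6) * (C7 + 1) * (R2 + t)" by simp
   ultimately show ?thesis by linarith
  qed
  have a5: "C * (d0 i)^2 <= C * C5^2 * R2"
  proof -
   have "(d0 i)^2 <= (C5 * r i)^2" using C5(2)[OF i] by (intro abs_le_square_iff[THEN iffD1]) (use C5(1) rnn[OF i] in auto)
   then have "C * (d0 i)^2 <= C * (C5 * r i)^2" using c by (intro mult_left_mono) auto
   then show ?thesis by (simp add: R2_def sq_eq mult_ac)
  qed
  have E: "E i >= 2 * (y i)^2 * Theta (p i) (p i) (m0 i) (m0 i) - C * C5^2 * R2 - C1^2 / (4 * c) * R2 - C2 * R2
    - (C4 * C6) * (C7 + 1) * (R2 + t) - C4 * (K * (\<bar>Y i\<bar> * (kapa i * r i)))"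
   using struct[OF i] a1 a2(1) a4 a5 unfolding E_split[OF i] z_def by linarith
  have "CC * (R2 + t + \<bar>Y i\<bar> * (kapa i * r i)) >= 2 * (C * C5^2 * R2) + 2 * (C1^2 / (4 * c) * R2) + 2 * (C2 * R2)
    + 2 * ((C4 * C6) * (C7 + 1) * (R2 + t)) + 2 * (C4 * (K * (\<bar>Y i\<bar> * (kapa i * r i)))) + C3 * R2"
  proof -
   define w where "w = \<bar>Y i\<bar> * (kapa i * r i)"
   have w: "w >= 0" using knn[of i] rnn[OF i] by (simp add: w_def)
   define k1 where "k1 = C1^2 / (2 * c) + 2 * C * C5^2 + 2 * C2 + C3"
   define k2 where "k2 = 2 * (C4 * C6) * (C7 + 1)"
   define k3 where "k3 = 2 * C4 * K"
   have k: "k1 >= 0" "k2 >= 0" "k3 >= 0" unfolding k1_def k2_def k3_def using c C1 C2 C3 C4 C6 C7 K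
    by (auto intro!: add_nonneg_nonneg mult_nonneg_nonneg divide_nonneg_nonneg)
   have "k1 * R2 + k2 * (R2 + t) + k3 * w <= (k1 + k2 + k3) * (R2 + t + w)"
   proof -
    have "0 <= k1 * t" "0 <= k1 * w" "0 <= k2 * w" "0 <= k3 * R2" "0 <= k3 * t" using k R2 w by auto
    then show ?thesis by (simp add: algebra_simps)
   qed
   moreover have "k1 + k2 + k3 = CC" by (simp add: CC_def k1_def k2_def k3_def)
   then have "(k1 + k2 + k3) * (R2 + t + w) = CC * (R2 + t + w)" by simp
   moreover have "k1 * R2 = 2 * (C * C5^2 * R2) + 2 * (C1^2 / (4 * c) * R2) + 2 * (C2 * R2) + C3 * R2"
    by (simp add: k1_def algebra_simps)
   moreover have "k2 * (R2 + t) = 2 * ((C4 * C6) * (C7 + 1) * (R2 + t))" "k3 * w = 2 * (C4 * (K * w))"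
    by (simp_all add: k2_def k3_def)
   ultimately show ?thesis unfolding w_def[symmetric] by linarith
  qed
  then show "s i * (2 * Phi (p i) (M i) (W i) - 4 * Phi (p i) (M i) (\<Sum>j\<in>T i. (1 / lam i j) *R outer_prod (X i *v b i j) (X i *v b i j)))
   <= - (4 * (Y i / s i)^2 * Theta (p i) (p i) (m0 i) (m0 i))
   + (2 * Phi (p i) (M i) (outer_prod (X i *v e i) (q i) + outer_prod (q i) (X i *v e i)) - 4 * s i * Theta (p i) (X i *v e i) (M i) (M i))
   + CC * (r i * r i + \<bar>trace (X i ** P i)\<bar> + \<bar>Y i\<bar> * (norm (P i *v q i) * r i))"
   using E a2(2) unfolding main_id[OF i] l_def[symmetric] y_def[symmetric] t_def[symmetric] R2_def[symmetric] kapa_def[symmetric] by linarith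
 qed
qed

section \<open>Third and fourth derivatives of v and their symmetries\<close>

context
 fixes v :: "real^'n => real" and S :: "(real^'n) set"
 assumes S: "open S" and v: "Ck_on 4 v S"
begin

lemma hessian_entry: "x : S ==> hessian v x $ i $ j = gradient (%x. gradient v x $ i) x $ j"
proof (rule hessian_component)
 fix i assume "x : S"
 have "Ck_on 3 (%x. gradient v x $ i) S" using v by (simp add: eval_nat_numeral)
 then show "(%x. gradient v x $ i) differentiable (at x)" by (rule Ck_on_differentiable[OF S]) (use \<open>x : S\<close> in auto)
qed

lemma gradient_entry_Ck: "Ck_on 3 (%x. gradient v x $ i) S"
 using v by (simp add: eval_nat_numeral)

lemma hessian_entry_Ck: "Ck_on 2 (%x. hessian v x $ i $ j) S"
proof (rule Ck_on_cong[OF S])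
 show "Ck_on 2 (%x. gradient (%x. gradient v x $ i) x $ j) S"
  using gradient_entry_Ck[of i] by (simp add: eval_nat_numeral)
qed (simp add: hessian_entry)

lemma third_entry_Ck: "Ck_on 1 (%x. gradient (%x. hessian v x $ i $ j) x $ k) S"
 using hessian_entry_Ck[of i j] by (simp add: eval_nat_numeral)

lemma fourth_entry_continuous: "continuous_on S (%x. gradient (%x. gradient (%x. hessian v x $ i $ j) x $ k) x $ l)"
 using third_entry_Ck[of i j k] by (simp add: eval_nat_numeral)

lemma hessian_sym: "x : S ==> hessian v x $ i $ j = hessian v x $ j $ i"
 using mixed_partials_commute[OF S Ck_on_mono[OF v]] by (simp add: hessian_entry)

lemma hessian_transpose: "x : S ==> transpose (hessian v x) = hessian v x"
 by (rule symmetricI) (rule hessian_sym)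

lemma gradient_cong_on:
 assumes "!!y. y : S ==> f y = g y" "Ck_on 1 f S" "x : S"
 shows "gradient g x = gradient f x"
proof -
 have "f differentiable (at x)" by (rule Ck_on_differentiable[OF S assms(2) _ assms(3)]) simp
 with assms(1) show ?thesis by (intro differentiable_cong_open(2)[OF S assms(3)]) auto
qed

lemma third_sym:
 assumes x: "x : S"
 shows "gradient (%x. hessian v x $ i $ j) x $ k = gradient (%x. hessian v x $ j $ i) x $ k"
  and "gradient (%x. hessian v x $ i $ j) x $ k = gradient (%x. hessian v x $ i $ k) x $ j"
proof -
 have C1: "Ck_on 1 (%x. hessian v x $ i $ j) S" for i j by (rule Ck_on_mono[OF hessian_entry_Ck]) simp
 have C1': "Ck_on 1 (%x. gradient (%x. gradient v x $ i) x $ j) S" for i j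
  by (rule Ck_on_cong[OF S C1]) (simp add: hessian_entry)
 show "gradient (%x. hessian v x $ i $ j) x $ k = gradient (%x. hessian v x $ j $ i) x $ k"
  by (rule arg_cong[where f = "%g. g $ k"], rule gradient_cong_on[OF _ C1 x], rule hessian_sym)
 have g: "gradient (%x. hessian v x $ i $ j) x = gradient (%x. gradient (%x. gradient v x $ i) x $ j) x" for i j
  by (rule gradient_cong_on[OF _ C1' x]) (simp add: hessian_entry)
 have "Ck_on 2 (%x. gradient v x $ i) S" by (rule Ck_on_mono[OF gradient_entry_Ck]) simp
 from mixed_partials_commute[OF S this x]
 show "gradient (%x. hessian v x $ i $ j) x $ k = gradient (%x. hessian v x $ i $ k) x $ j"
  unfolding g by simp
qed

text \<open>The first two are symmetries of third derivatives, differentiated, and the third is the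
  symmetry of mixed partials. The exchange of pairs is a word in these transpositions.\<close>

lemma fourth_sym:
 assumes x: "x : S"
 defines "T \<equiv> %i j k l. gradient (%x. gradient (%x. hessian v x $ i $ j) x $ k) x $ l"
 shows "T i j k l = T j i k l" "T i j k l = T i k j l" "T i j k l = T i j l k" "T i j k l = T k l i j"
proof -
 show a: "T i j k l = T j i k l" for i j k l
  unfolding T_def by (subst gradient_cong_on[OF third_sym(1) third_entry_Ck x]) simp_all
 show b: "T i j k l = T i k j l" for i j k l
  unfolding T_def by (subst gradient_cong_on[OF third_sym(2) third_entry_Ck x]) simp_all
 show c: "T i j k l = T i j l k" for i j k l
  unfolding T_def by (rule mixed_partials_commute[OF S hessian_entry_Ck x])
 have "T i j k l = T i j l k" by (rule c)
 also have "... = T i l j k" by (rule b)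
 also have "... = T l i j k" by (rule a)
 also have "... = T l i k j" by (rule c)
 also have "... = T l k i j" by (rule b)
 also have "... = T k l i j" by (rule a)
 finally show "T i j k l = T k l i j" .
qed

lemma third_transpose: "x : S ==> transpose (mdir (hessian v) x e) = mdir (hessian v) x e"
 by (rule symmetricI) (simp add: mdir_def inner_vec_def third_sym(1))

text \<open>Together with the symmetry of each matrix \<open>mdir (hessian v) x e\<close> this makes
  the trilinear form of third derivatives totally symmetric.\<close>

lemma third_swap: "x : S ==> mdir (hessian v) x e *v f = mdir (hessian v) x f *v e"
proof -
 assume x: "x : S"
 define T where "T i j k = gradient (%x. hessian v x $ i $ j) x $ k" for i j k
 have T: "T i j k = T i k j" for i j k unfolding T_def by (rule third_sym(2)[OF x])
 have "(mdir (hessian v) x e *v f) $ i = (mdir (hessian v) x f *v e) $ i" for i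
 proof -
  have "(mdir (hessian v) x e *v f) $ i = (\<Sum>j\<in>UNIV. \<Sum>k\<in>UNIV. T i j k * e $ k * f $ j)"
   by (simp add: mdir_def matrix_vector_mult_def inner_vec_def T_def sum_distrib_right sum_distrib_left mult_ac)
  also have "... = (\<Sum>k\<in>UNIV. \<Sum>j\<in>UNIV. T i k j * f $ j * e $ k)"
   by (subst sum.swap) (simp add: T[of i] mult_ac)
  also have "... = (mdir (hessian v) x f *v e) $ i"
   by (simp add: mdir_def matrix_vector_mult_def inner_vec_def T_def sum_distrib_right sum_distrib_left mult_ac)
  finally show ?thesis .
 qed
 then show ?thesis by (simp add: vec_eq_iff)
qed

lemma mdir_entry_Ck: "Ck_on 1 (%x. mdir (hessian v) x e $ i $ j) S"
proof -
 have fin: "Ck_on 1 (%x. \<Sum>k\<in>I. gradient (%x. hessian v x $ i $ j) x $ k * e $ k) S" if "finite I" for I :: "'n set"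
  using that
 proof (induction I rule: finite_induct)
  case empty show ?case using Ck_on_const[of 1 0 S] by simp
 next
  case (insert k I)
  have "Ck_on 1 (%x. gradient (%x. hessian v x $ i $ j) x $ k * e $ k) S"
   by (rule Ck_on_mult[OF S third_entry_Ck Ck_on_const])
  from Ck_on_add[OF S this insert.IH] show ?case using insert by simp
 qed
 show ?thesis using fin[of UNIV] by (simp add: mdir_def inner_vec_def)
qed

lemma fourth_entry:
 assumes x: "x : S"
 shows "mdir (%x. mdir (hessian v) x e) x f $ i $ j
  = (\<Sum>k\<in>UNIV. \<Sum>l\<in>UNIV. gradient (%x. gradient (%x. hessian v x $ i $ j) x $ k) x $ l * e $ k * f $ l)"
proof -
 define g where "g k x = gradient (%x. hessian v x $ i $ j) x $ k" for k x
 have d: "(g k has_derivative (%h. gradient (g k) x \<bullet> h)) (at x)" for k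
  unfolding g_def by (rule has_derivative_gradient[OF Ck_on_differentiable[OF S third_entry_Ck _ x]]) simp
 have "(%x. mdir (hessian v) x e $ i $ j) = (%x. \<Sum>k\<in>UNIV. g k x * e $ k)"
  by (simp add: mdir_def inner_vec_def g_def fun_eq_iff)
 then have "((%x. mdir (hessian v) x e $ i $ j) has_derivative (%h. \<Sum>k\<in>UNIV. (gradient (g k) x \<bullet> h) * e $ k)) (at x)"
  by (auto intro!: derivative_eq_intros d)
 then have "((%x. mdir (hessian v) x e $ i $ j) has_derivative (%h. (\<Sum>k\<in>UNIV. e $ k *R gradient (g k) x) \<bullet> h)) (at x)"
  by (simp add: inner_sum_left mult.commute)
 then have "gradient (%x. mdir (hessian v) x e $ i $ j) x = (\<Sum>k\<in>UNIV. e $ k *R gradient (g k) x)" by (rule gradient_unique)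
 then have "mdir (%x. mdir (hessian v) x e) x f $ i $ j = (\<Sum>k\<in>UNIV. e $ k * (gradient (g k) x \<bullet> f))"
  by (simp add: mdir_def[of "%x. mdir (hessian v) x e"] inner_sum_left)
 also have "... = (\<Sum>k\<in>UNIV. \<Sum>l\<in>UNIV. gradient (g k) x $ l * e $ k * f $ l)"
  by (simp add: inner_vec_def sum_distrib_left mult_ac)
 finally show ?thesis unfolding g_def .
qed

lemma fourth_transpose: "x : S ==> transpose (mdir (%x. mdir (hessian v) x e) x e) = mdir (%x. mdir (hessian v) x e) x e"
proof (rule symmetricI)
 fix i j assume x: "x : S"
 show "mdir (%x. mdir (hessian v) x e) x e $ i $ j = mdir (%x. mdir (hessian v) x e) x e $ j $ i"
  unfolding fourth_entry[OF x] by (intro sum.cong refl) (simp add: fourth_sym(1)[OF x])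
qed

text \<open>The exchange of pairs in coordinate-free form. It turns the second derivative of the
  Hessian in a direction \<open>f\<close>, tested on a null vector \<open>e\<close>, into the second
  derivative along \<open>e\<close>, tested on \<open>f\<close>. The former comes from varying
  eigenvalues, the latter from differentiating the equation.\<close>

lemma fourth_swap:
 assumes x: "x : S"
 shows "f \<bullet> (mdir (%x. mdir (hessian v) x e) x e *v f) = e \<bullet> (mdir (%x. mdir (hessian v) x f) x f *v e)"
proof -
 define T where "T i j k l = gradient (%x. gradient (%x. hessian v x $ i $ j) x $ k) x $ l" for i j k l
 have T: "T i j k l = T k l i j" for i j k l unfolding T_def by (rule fourth_sym(4)[OF x])
 have q: "f \<bullet> (mdir (%x. mdir (hessian v) x e) x e *v f)
  = (\<Sum>(i, j)\<in>UNIV. \<Sum>(k, l)\<in>UNIV. T i j k l * e $ k * e $ l * f $ i * f $ j)" for e f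
  by (simp add: matrix_vector_mult_def inner_vec_def fourth_entry[OF x] T_def[symmetric] sum_distrib_left sum_distrib_right
    UNIV_Times_UNIV[symmetric] sum.cartesian_product[symmetric] mult_ac del: UNIV_Times_UNIV)
 have q': "f \<bullet> (mdir (%x. mdir (hessian v) x e) x e *v f)
  = (\<Sum>a\<in>UNIV. \<Sum>b\<in>UNIV. T (fst a) (snd a) (fst b) (snd b) * e $ fst b * e $ snd b * f $ fst a * f $ snd a)" for e f
  unfolding q by (simp add: split_beta)
 have sw: "T (fst a) (snd a) (fst b) (snd b) * e $ fst b * e $ snd b * f $ fst a * f $ snd a
  = T (fst b) (snd b) (fst a) (snd a) * f $ fst a * f $ snd a * e $ fst b * e $ snd b" for a b
  by (subst T) (simp add: mult_ac)
 show ?thesis unfolding q' by (subst sum.swap) (intro sum.cong refl sw)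
qed

lemma third_fourth_bound:
 assumes K: "compact K" "K \<subseteq> S"
 obtains C where "C > 0" "!!x e. x : K ==> norm (mdir (hessian v) x e) <= C * norm e"
  "!!x e. x : K ==> norm (mdir (%x. mdir (hessian v) x e) x e) <= C * (norm e)^2"
proof -
 define N where "N = real CARD('n)"
 have bound: "\<exists>C. \<forall>x\<in>K. \<bar>f x\<bar> <= C" if "continuous_on S f" for f :: "real^'n => real"
  using compact_imp_bounded[OF compact_continuous_image[OF continuous_on_subset[OF that K(2)] K(1)]] by (auto simp: bounded_iff)
 have "\<exists>C. \<forall>x\<in>K. \<bar>gradient (%x. hessian v x $ i $ j) x $ k\<bar> <= C" for i j k
  by (rule bound[OF Ck_on_continuous[OF third_entry_Ck]])
 then obtain C3 where C3: "!!i j k x. x : K ==> \<bar>gradient (%x. hessian v x $ i $ j) x $ k\<bar> <= C3 i j k" by metis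
 have "\<exists>C. \<forall>x\<in>K. \<bar>gradient (%x. gradient (%x. hessian v x $ i $ j) x $ k) x $ l\<bar> <= C" for i j k l
  by (rule bound[OF fourth_entry_continuous])
 then obtain C4 where C4: "!!i j k l x. x : K ==> \<bar>gradient (%x. gradient (%x. hessian v x $ i $ j) x $ k) x $ l\<bar> <= C4 i j k l" by metis
 define D3 where "D3 = (\<Sum>i\<in>UNIV. \<Sum>j\<in>UNIV. \<Sum>k\<in>UNIV. \<bar>C3 i j k\<bar>)"
 define D4 where "D4 = (\<Sum>i\<in>UNIV. \<Sum>j\<in>UNIV. \<Sum>k\<in>UNIV. \<Sum>l\<in>UNIV. \<bar>C4 i j k l\<bar>)"
 have D: "D3 >= 0" "D4 >= 0" by (auto simp: D3_def D4_def intro!: sum_nonneg)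
 have normm: "norm A <= (\<Sum>i\<in>UNIV. \<Sum>j\<in>UNIV. \<bar>A $ i $ j\<bar>)" for A :: "real^'n^'n"
 proof -
  have "norm A <= (\<Sum>i\<in>UNIV. norm (A $ i))" unfolding norm_vec_def[of A] by (rule L2_set_le_sum) simp
  also have "... <= (\<Sum>i\<in>UNIV. \<Sum>j\<in>UNIV. \<bar>A $ i $ j\<bar>)" by (intro sum_mono norm_le_l1_cart)
  finally show ?thesis .
 qed
 show thesis
 proof (rule that[of "D3 + D4 + 1"])
  show "D3 + D4 + 1 > 0" using D by linarith
  fix x and e :: "real^'n" assume x: "x : K"
  then have xS: "x : S" using K by auto
  have ek: "\<bar>e $ k\<bar> <= norm e" for k by (rule component_le_norm_cart)
  have "norm (mdir (hessian v) x e) <= (\<Sum>i\<in>UNIV. \<Sum>j\<in>UNIV. \<bar>mdir (hessian v) x e $ i $ j\<bar>)" by (rule normm)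
  also have "... <= (\<Sum>i\<in>UNIV. \<Sum>j\<in>UNIV. \<Sum>k\<in>UNIV. \<bar>C3 i j k\<bar> * norm e)"
  proof (intro sum_mono)
   fix i j
   have "\<bar>mdir (hessian v) x e $ i $ j\<bar> <= (\<Sum>k\<in>UNIV. \<bar>gradient (%x. hessian v x $ i $ j) x $ k * e $ k\<bar>)"
    by (simp add: mdir_def inner_vec_def sum_abs)
   also have "... <= (\<Sum>k\<in>UNIV. \<bar>C3 i j k\<bar> * norm e)"
    unfolding abs_mult using order_trans[OF C3[OF x] abs_ge_self] ek by (intro sum_mono mult_mono) auto
   finally show "\<bar>mdir (hessian v) x e $ i $ j\<bar> <= (\<Sum>k\<in>UNIV. \<bar>C3 i j k\<bar> * norm e)" .
  qed
  also have "... = D3 * norm e" by (simp add: D3_def sum_distrib_right)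
  also have "... <= (D3 + D4 + 1) * norm e" using D by (intro mult_right_mono) auto
  finally show "norm (mdir (hessian v) x e) <= (D3 + D4 + 1) * norm e" .
  have "norm (mdir (%x. mdir (hessian v) x e) x e) <= (\<Sum>i\<in>UNIV. \<Sum>j\<in>UNIV. \<bar>mdir (%x. mdir (hessian v) x e) x e $ i $ j\<bar>)" by (rule normm)
  also have "... <= (\<Sum>i\<in>UNIV. \<Sum>j\<in>UNIV. \<Sum>k\<in>UNIV. \<Sum>l\<in>UNIV. \<bar>C4 i j k l\<bar> * (norm e)^2)"
  proof (intro sum_mono)
   fix i j
   have "\<bar>mdir (%x. mdir (hessian v) x e) x e $ i $ j\<bar>
    <= (\<Sum>k\<in>UNIV. \<Sum>l\<in>UNIV. \<bar>gradient (%x. gradient (%x. hessian v x $ i $ j) x $ k) x $ l * e $ k * e $ l\<bar>)"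
    unfolding fourth_entry[OF xS] by (rule order_trans[OF sum_abs sum_mono[OF sum_abs]])
   also have "... <= (\<Sum>k\<in>UNIV. \<Sum>l\<in>UNIV. \<bar>C4 i j k l\<bar> * (norm e)^2)"
   proof (intro sum_mono)
    fix k l
    have "\<bar>e $ k\<bar> * \<bar>e $ l\<bar> <= norm e * norm e" using ek by (intro mult_mono) auto
    then have "\<bar>gradient (%x. gradient (%x. hessian v x $ i $ j) x $ k) x $ l\<bar> * (\<bar>e $ k\<bar> * \<bar>e $ l\<bar>) <= \<bar>C4 i j k l\<bar> * (norm e * norm e)"
     by (rule mult_mono[OF order_trans[OF C4[OF x, of i j k l] abs_ge_self]]) auto
    then show "\<bar>gradient (%x. gradient (%x. hessian v x $ i $ j) x $ k) x $ l * e $ k * e $ l\<bar> <= \<bar>C4 i j k l\<bar> * (norm e)^2"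
     by (simp add: abs_mult sq_eq mult.assoc)
   qed
   finally show "\<bar>mdir (%x. mdir (hessian v) x e) x e $ i $ j\<bar> <= (\<Sum>k\<in>UNIV. \<Sum>l\<in>UNIV. \<bar>C4 i j k l\<bar> * (norm e)^2)" .
  qed
  also have "... = D4 * (norm e)^2" by (simp add: D4_def sum_distrib_right)
  also have "... <= (D3 + D4 + 1) * (norm e)^2" using D by (intro mult_right_mono) auto
  finally show "norm (mdir (%x. mdir (hessian v) x e) x e) <= (D3 + D4 + 1) * (norm e)^2" .
 qed
qed

lemma hessian_continuous: "continuous_on S (hessian v)"
proof -
 have "continuous_on S (%x. hessian v x $ i $ j)" for i j by (rule Ck_on_continuous[OF hessian_entry_Ck])
 then have "continuous_on S (%x. \<chi> i j. hessian v x $ i $ j)" by (intro continuous_on_vec_lambda)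
 then show ?thesis by simp
qed

lemma gradient_continuous: "continuous_on S (gradient v)"
proof -
 have "continuous_on S (%x. gradient v x $ i)" for i by (rule Ck_on_continuous[OF gradient_entry_Ck])
 then have "continuous_on S (%x. \<chi> i. gradient v x $ i)" by (intro continuous_on_vec_lambda)
 then show ?thesis by simp
qed

lemma jet_lines:
 assumes "x + t *R e : S"
 shows "((%t. v (x + t *R e)) has_real_derivative gradient v (x + t *R e) \<bullet> e) (at t)"
  and "((%t. gradient v (x + t *R e)) has_vector_derivative hessian v (x + t *R e) *v e) (at t)"
  and "((%t. hessian v (x + t *R e)) has_vector_derivative mdir (hessian v) (x + t *R e) e) (at t)"
  and "((%t. mdir (hessian v) (x + t *R e) f) has_vector_derivative mdir (%x. mdir (hessian v) x f) (x + t *R e) e) (at t)"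
proof -
 show "((%t. v (x + t *R e)) has_real_derivative gradient v (x + t *R e) \<bullet> e) (at t)"
  by (rule line_has_derivative[OF Ck_on_differentiable[OF S v _ assms]]) simp
 show "((%t. hessian v (x + t *R e)) has_vector_derivative mdir (hessian v) (x + t *R e) e) (at t)"
  by (rule mdir_line[OF Ck_on_differentiable[OF S hessian_entry_Ck _ assms]]) simp
 show "((%t. mdir (hessian v) (x + t *R e) f) has_vector_derivative mdir (%x. mdir (hessian v) x f) (x + t *R e) e) (at t)"
  by (rule mdir_line[OF Ck_on_differentiable[OF S mdir_entry_Ck _ assms]]) simp
 have "((%t. gradient v (x + t *R e) $ i) has_real_derivative (hessian v (x + t *R e) *v e) $ i) (at t)" for i
 proof -
  have "(%x. gradient v x $ i) differentiable (at (x + t *R e))"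
   by (rule Ck_on_differentiable[OF S gradient_entry_Ck _ assms]) simp
  from line_has_derivative[OF this] show ?thesis
   by (simp add: matrix_vector_mult_def inner_vec_def hessian_entry[OF assms])
 qed
 then have "((%t. gradient v (x + t *R e) $ i) has_derivative (%h. h * (hessian v (x + t *R e) *v e) $ i)) (at t)" for i
  by (simp add: has_field_derivative_def mult_commute_abs)
 then show "((%t. gradient v (x + t *R e)) has_vector_derivative hessian v (x + t *R e) *v e) (at t)"
  unfolding has_vector_derivative_def by (subst has_derivative_componentwise_within) (auto simp: Basis_vec_def inner_axis)
qed

end

lemma bounded_bilinear_matrix_vector: "bounded_bilinear ((*v) :: real^'n^'n => real^'n => real^'n)"
 by (rule bounded_bilinear.intro)
  (auto simp: add_mv mv_add scaleR_mv mv_scaleR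
   intro!: exI[of _ 1] norm_matrix_vector_le)

lemma bounded_bilinear_outer_prod: "bounded_bilinear (outer_prod :: real^'n => real^'n => real^'n^'n)"
 by (rule bounded_bilinear.intro) (auto simp: outer_prod_linear norm_outer_prod intro!: exI[of _ 1])

lemma bounded_linear_trace: "bounded_linear (trace :: real^'n^'n => real)"
 by (rule bounded_linear_intro[where K = "real CARD('n)"]) (simp_all add: trace_add' trace_scaleR, metis abs_trace_le mult.commute)

lemma inner_has_real_derivative:
 fixes f g :: "real => 'a::real_inner"
 assumes "(f has_vector_derivative f') (at t)" "(g has_vector_derivative g') (at t)"
 shows "((%t. f t \<bullet> g t) has_real_derivative f t \<bullet> g' + f' \<bullet> g t) (at t)"
 using bounded_bilinear.has_vector_derivative[OF bounded_bilinear_inner assms]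
 by (simp add: has_real_derivative_iff_has_vector_derivative)

lemma trace_has_real_derivative:
 fixes A :: "real => real^'n^'n"
 assumes "(A has_vector_derivative A') (at t)"
 shows "((%t. trace (A t)) has_real_derivative trace A') (at t)"
 using bounded_linear.has_vector_derivative[OF bounded_linear_trace assms]
 by (simp add: has_real_derivative_iff_has_vector_derivative)

lemmas matrix_vector_has_vector_derivative = bounded_bilinear.has_vector_derivative[OF bounded_bilinear_matrix_vector]
lemmas outer_prod_has_vector_derivative = bounded_bilinear.has_vector_derivative[OF bounded_bilinear_outer_prod]

lemma Theta_has_derivative:
 fixes p r :: "real => real^'n" and U V :: "real => real^'n^'n"
 assumes p: "(p has_vector_derivative p') (at t)" and r: "(r has_vector_derivative r') (at t)"
  and U: "(U has_vector_derivative U') (at t)" and V: "(V has_vector_derivative V') (at t)"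
 shows "((%t. Theta (p t) (r t) (U t) (V t)) has_real_derivative
  Theta p' (r t) (U t) (V t) + Theta (p t) r' (U t) (V t) + Theta (p t) (r t) U' (V t) + Theta (p t) (r t) (U t) V') (at t)"
proof -
 note mv = matrix_vector_has_vector_derivative
 note d = inner_has_real_derivative[OF p r] inner_has_real_derivative[OF U V] inner_has_real_derivative[OF p mv[OF V r]]
  inner_has_real_derivative[OF p mv[OF U r]] inner_has_real_derivative[OF mv[OF U p] mv[OF V r]] inner_has_real_derivative[OF mv[OF U r] mv[OF V p]]
  trace_has_real_derivative[OF U] trace_has_real_derivative[OF V]
 show ?thesis
  unfolding Theta_def
  by (rule DERIV_cong, (rule DERIV_cdivide DERIV_add DERIV_diff DERIV_mult' d)+) (simp add: field_simps inner_add_left inner_add_right)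
qed

lemma Phi_has_derivative:
 fixes p :: "real => real^'n" and U V :: "real => real^'n^'n"
 assumes p: "(p has_vector_derivative p') (at t)"
  and U: "(U has_vector_derivative U') (at t)" and V: "(V has_vector_derivative V') (at t)"
 shows "((%t. Phi (p t) (U t) (V t)) has_real_derivative
  Phi (p t) U' (V t) + Phi (p t) (U t) V' + Theta p' (p t) (U t) (V t) + Theta (p t) p' (U t) (V t)) (at t)"
proof -
 note d = inner_has_real_derivative[OF U V] trace_has_real_derivative[OF U] trace_has_real_derivative[OF V]
 have "((%t. S2 (U t) (V t)) has_real_derivative S2 U' (V t) + S2 (U t) V') (at t)"
  unfolding S2_def by (rule DERIV_cong, (rule DERIV_cdivide DERIV_diff DERIV_mult' d)+) (simp add: field_simps)
 from DERIV_add[OF this Theta_has_derivative[OF p p U V]] show ?thesis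
  unfolding Phi_def by (rule DERIV_cong) simp
qed

text \<open>The line has the fixed direction \<open>e\<close>, which is known to be an eigenvector
  only at \<open>x\<close>. The derivatives are therefore taken with the product of Hessian and
  \<open>e\<close> unevaluated, and the eigenvalue is inserted at \<open>t = 0\<close>
  alone.\<close>

lemma equation_jets:
 fixes v :: "real^'n => real"
 assumes S: "open S" and v: "Ck_on 4 v S"
  and eq: "!!x. x : S ==> Phi ((2 * (- v x)) *R gradient v x) ((- v x) *R hessian v x - outer_prod (gradient v x) (gradient v x))
    ((- v x) *R hessian v x - outer_prod (gradient v x) (gradient v x)) = 1 / 4"
  and x: "x : S" and e: "hessian v x *v e = la *R e" "e \<bullet> e = 1"
 shows "jet_equations (- v x) (gradient v x) (hessian v x) (mdir (hessian v) x e) (mdir (%x. mdir (hessian v) x e) x e) e la"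
proof -
 define I where "I = {t. x + t *R e : S}"
 have "open ((%t. x + t *R e) -` S)" by (rule open_vimage[OF S]) (intro continuous_intros)
 then have I: "open I" by (simp add: I_def vimage_def)
 have I0: "0 : I" using x by (simp add: I_def)
 define qf where "qf t = gradient v (x + t *R e)" for t
 define sf where "sf t = - v (x + t *R e)" for t
 define Bf where "Bf t = hessian v (x + t *R e)" for t
 define Xf where "Xf t = mdir (hessian v) (x + t *R e) e" for t
 define Wf where "Wf t = mdir (%x. mdir (hessian v) x e) (x + t *R e) e" for t
 define Yf where "Yf t = - (qf t \<bullet> e)" for t
 define pf where "pf t = (2 * sf t) *R qf t" for t
 define Mf where "Mf t = sf t *R Bf t - outer_prod (qf t) (qf t)" for t
 define p1 where "p1 t = (2 * Yf t) *R qf t + (2 * sf t) *R (Bf t *v e)" for t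
 define M1 where "M1 t = sf t *R Xf t + Yf t *R Bf t - (outer_prod (qf t) (Bf t *v e) + outer_prod (Bf t *v e) (qf t))" for t
 define p2 where "p2 t = (2 * - ((Bf t *v e) \<bullet> e)) *R qf t + (4 * Yf t) *R (Bf t *v e) + (2 * sf t) *R (Xf t *v e)" for t
 define M2 where "M2 t = sf t *R Wf t + (2 * Yf t) *R Xf t - ((Bf t *v e) \<bullet> e) *R Bf t
  - (outer_prod (Xf t *v e) (qf t) + outer_prod (qf t) (Xf t *v e)) - 2 *R outer_prod (Bf t *v e) (Bf t *v e)" for t
 note jl = jet_lines[OF S v]
 note vd = bounded_bilinear.has_vector_derivative[OF bounded_bilinear_scaleR, folded has_real_derivative_iff_has_vector_derivative]
 have dq: "(qf has_vector_derivative Bf t *v e) (at t)" and dB: "(Bf has_vector_derivative Xf t) (at t)"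
  and dX: "(Xf has_vector_derivative Wf t) (at t)" and ds: "(sf has_real_derivative Yf t) (at t)" if "t : I" for t
  using jl(2,3,4)[of x t e] DERIV_minus[OF jl(1)[of x t e]] that
  unfolding I_def qf_def Bf_def Xf_def Wf_def sf_def Yf_def by simp_all
 have dBe: "((%t. Bf t *v e) has_vector_derivative Xf t *v e) (at t)" if "t : I" for t
  using matrix_vector_has_vector_derivative[OF dB[OF that] has_vector_derivative_const[of e]] by simp
 have dXe: "((%t. Xf t *v e) has_vector_derivative Wf t *v e) (at t)" if "t : I" for t
  using matrix_vector_has_vector_derivative[OF dX[OF that] has_vector_derivative_const[of e]] by simp
 have dY: "(Yf has_real_derivative - ((Bf t *v e) \<bullet> e)) (at t)" if "t : I" for t
  unfolding Yf_def using DERIV_minus[OF inner_has_real_derivative[OF dq[OF that] has_vector_derivative_const[of e]]] by simp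
 have dp: "(pf has_vector_derivative p1 t) (at t)" if "t : I" for t
  unfolding pf_def p1_def using vd[OF DERIV_cmult[OF ds[OF that], of 2] dq[OF that]] by (simp add: add.commute)
 have dM: "(Mf has_vector_derivative M1 t) (at t)" if "t : I" for t
  unfolding Mf_def M1_def
  using has_vector_derivative_diff[OF vd[OF ds[OF that] dB[OF that]] outer_prod_has_vector_derivative[OF dq[OF that] dq[OF that]]] by simp
 have dp1: "(p1 has_vector_derivative p2 t) (at t)" if "t : I" for t
  unfolding p1_def p2_def
  using has_vector_derivative_add[OF vd[OF DERIV_cmult[OF dY[OF that], of 2] dq[OF that]] vd[OF DERIV_cmult[OF ds[OF that], of 2] dBe[OF that]]]
  by (rule has_vector_derivative_eq_rhs) (simp add: vec_eq_iff algebra_simps)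
 have dM1: "(M1 has_vector_derivative M2 t) (at t)" if "t : I" for t
  unfolding M1_def M2_def
  using has_vector_derivative_diff[OF has_vector_derivative_add[OF vd[OF ds[OF that] dX[OF that]] vd[OF dY[OF that] dB[OF that]]]
   has_vector_derivative_add[OF outer_prod_has_vector_derivative[OF dq[OF that] dBe[OF that]] outer_prod_has_vector_derivative[OF dBe[OF that] dq[OF that]]]]
  by (rule has_vector_derivative_eq_rhs) (simp add: vec_eq_iff algebra_simps)
 have sym: "transpose (Bf t) = Bf t" "transpose (Xf t) = Xf t" if "t : I" for t
  using that hessian_transpose[OF S v] third_transpose[OF S v] by (auto simp: I_def Bf_def Xf_def)
 have tM: "transpose (Mf t) = Mf t" "transpose (M1 t) = M1 t" if "t : I" for t
  by (simp_all add: Mf_def M1_def transpose_minus' transpose_add' transpose_scaleR' transpose_outer_prod sym[OF that] add.commute)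
 have phi: "Phi (pf t) (Mf t) (Mf t) = 1 / 4" if "t : I" for t
  using eq[of "x + t *R e"] that by (simp add: I_def pf_def Mf_def sf_def qf_def Bf_def)
 have zero: "D = 0" if "t : I" "(f has_real_derivative D) (at t)" "!!t. t : I ==> f t = c" for f D t c
 proof -
  have "((%t. c) has_real_derivative D) (at t)"
   using has_field_derivative_transform_within_open[OF that(2) I that(1)] that(3) by simp
  then show ?thesis using DERIV_unique[OF DERIV_const] by blast
 qed
 have phi1: "2 * Phi (pf t) (Mf t) (M1 t) + 2 * Theta (pf t) (p1 t) (Mf t) (Mf t) = 0" if t: "t : I" for t
  using zero[OF t Phi_has_derivative[OF dp[OF t] dM[OF t] dM[OF t]] phi]
  by (simp add: Phi_commute[of "pf t" "M1 t"] Theta_vector_commute[OF tM(1)[OF t] tM(1)[OF t], of "p1 t"])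
 have phi2: "2 * (Phi (pf t) (M1 t) (M1 t) + Phi (pf t) (Mf t) (M2 t) + Theta (p1 t) (pf t) (Mf t) (M1 t) + Theta (pf t) (p1 t) (Mf t) (M1 t))
   + 2 * (Theta (p1 t) (p1 t) (Mf t) (Mf t) + Theta (pf t) (p2 t) (Mf t) (Mf t) + Theta (pf t) (p1 t) (M1 t) (Mf t) + Theta (pf t) (p1 t) (Mf t) (M1 t)) = 0"
  if t: "t : I" for t
  by (rule zero[OF t DERIV_add[OF DERIV_cmult[OF Phi_has_derivative[OF dp[OF t] dM[OF t] dM1[OF t]]]
     DERIV_cmult[OF Theta_has_derivative[OF dp[OF t] dp1[OF t] dM[OF t] dM[OF t]]]] phi1])
 have Be: "Bf 0 *v e = la *R e" by (simp add: Bf_def e)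
 show ?thesis
  using phi1[OF I0] phi2[OF I0] Theta_vector_commute[OF tM[OF I0], of "p1 0" "pf 0"] Theta_swap[of "pf 0" "p1 0" "M1 0" "Mf 0"]
  unfolding jet_equations_def Let_def pf_def Mf_def p1_def M1_def p2_def M2_def Be
  by (simp add: sf_def qf_def Yf_def Bf_def Xf_def Wf_def e outer_prod_linear scaleR_add_right sq_eq mult.commute)
qed

section \<open>Third derivatives in null directions and the differential inequality\<close>

lemma nonneg_C2_derivative_bound:
 fixes f f1 f2 :: "real => real"
 assumes d: "dla > 0" and D: "D >= 0" and E: "E > 0"
  and f: "!!t. \<bar>t\<bar> <= dla ==> (f has_real_derivative f1 t) (at t)" "!!t. \<bar>t\<bar> <= dla ==> (f1 has_real_derivative f2 t) (at t)"
  and nn: "!!t. \<bar>t\<bar> <= dla ==> 0 <= f t" and f2: "!!t. \<bar>t\<bar> <= dla ==> \<bar>f2 t\<bar> <= D" and f0: "f 0 <= E"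
 shows "\<bar>f1 0\<bar> <= (sqrt E / dla + D * dla / sqrt E) * sqrt (f 0)"
proof (cases "f 0 = 0")
 case True
 have "f1 0 = 0"
  by (rule DERIV_local_min[OF f(1) d]) (use d nn True in auto)
 then show ?thesis using True by simp
next
 case False
 then have f0p: "f 0 > 0" using nn[of 0] d by (simp add: less_le)
 \<comment> \<open>Glaeser's argument: a nonnegative function with bounded second derivative cannot
   have a large slope at a small value. The step is proportional to \<open>sqrt (f 0)\<close>, which
   gives both Taylor contributions this order, and it stays within \<open>dla\<close> because
   \<open>f 0 <= E\<close>.\<close>
 define t where "t = dla * sqrt (f 0) / sqrt E"
 have t: "0 < t" "t <= dla"
 proof -
  show "0 < t" using d f0p E by (simp add: t_def)
  have "sqrt (f 0) / sqrt E <= 1" using f0 E by simp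
  then have "dla * (sqrt (f 0) / sqrt E) <= dla * 1" using d by (intro mult_left_mono) auto
  then show "t <= dla" by (simp add: t_def)
 qed
 define x where "x = - sgn (f1 0) * t"
 have xt: "\<bar>x\<bar> <= t" "x * f1 0 = - (\<bar>f1 0\<bar> * t)" using t by (auto simp: x_def abs_mult sgn_if)
 have x2: "x^2 <= t^2" using xt(1) t by (metis abs_le_square_iff abs_of_pos)
 have taylor: "f x <= f 0 + x * f1 0 + D * t^2"
 proof (cases "x = 0")
  case True
  then show ?thesis using D by simp
 next
  case False
  define diff where "diff k = (if k = 0 then f else if k = 1 then f1 else f2)" for k :: nat
  have "\<exists>s. (if x < 0 then x < s \<and> s < 0 else 0 < s \<and> s < x) \<and>
    f x = (\<Sum>m<2. diff m 0 / fact m * (x - 0) ^ m) + diff 2 s / fact 2 * (x - 0) ^ 2"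
  proof (rule Taylor[of 2 diff f "-dla" dla 0 x])
   show "\<forall>m s. m < 2 \<and> - dla <= s \<and> s <= dla --> (diff m has_real_derivative diff (Suc m) s) (at s)"
    using f by (auto simp: diff_def less_2_cases_iff)
  qed (use d xt t False in \<open>auto simp: diff_def\<close>)
  then obtain s where s': "if x < 0 then x < s \<and> s < 0 else 0 < s \<and> s < x"
   and s2: "f x = (\<Sum>m<2. diff m 0 / fact m * (x - 0) ^ m) + diff 2 s / fact 2 * (x - 0) ^ 2" by blast
  have s: "\<bar>s\<bar> <= \<bar>x\<bar>" "f x = f 0 + f1 0 * x + f2 s / 2 * x^2"
   using s' s2 by (auto simp: diff_def eval_nat_numeral split: if_splits)
  have "f2 s / 2 * x^2 <= D * t^2"
  proof (rule mult_mono[OF _ x2 D])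
   have "\<bar>s\<bar> <= dla" using s(1) xt t by linarith
   from f2[OF this] show "f2 s / 2 <= D" using D by linarith
  qed simp
  then show ?thesis using s(2) by (simp add: mult.commute)
 qed
 have "\<bar>x\<bar> <= dla" using xt t by linarith
 from nn[OF this] taylor have "\<bar>f1 0\<bar> * t <= f 0 + D * t^2" unfolding xt(2) by linarith
 then have "\<bar>f1 0\<bar> <= (f 0 + D * t^2) / t" using t by (simp add: pos_le_divide_eq)
 also have "... = f 0 / t + D * t" using t by (simp add: sq_eq add_divide_distrib)
 also have "f 0 / t = sqrt E / dla * sqrt (f 0)"
 proof -
  have "f 0 = sqrt (f 0) * sqrt (f 0)" using f0p by simp
  moreover have "sqrt (f 0) * sqrt (f 0) / t = sqrt E / dla * sqrt (f 0)" using f0p d E by (simp add: t_def field_simps)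
  ultimately show ?thesis by simp
 qed
 also have "D * t = D * dla / sqrt E * sqrt (f 0)" by (simp add: t_def)
 finally show ?thesis by (simp add: distrib_right)
qed

text \<open>Along a line, the Hessian tested twice on a fixed vector z is a nonnegative C^2
  function, so its slope is at most of the order of its square root. For z the sum and the
  difference of \<open>b j\<close> and \<open>b k\<close> this is \<open>sqrt ps\<close>.
  Polarisation and the symmetry of third derivatives give the bound for the vector.\<close>

lemma pos_semidef_third_bound:
 fixes v :: "real^'n => real"
 assumes S: "open S" and v: "Ck_on 4 v S" and psd: "!!x. x : S ==> pos_semidef (hessian v x)"
  and d: "dla > 0" "cball x0 (2 * dla) \<subseteq> S"
 obtains C where "C >= 0" "!!x b lam j k ps. [|x : cball x0 dla; orthobasis b; !!j. hessian v x *v b j = lam j *R b j;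
   0 <= lam j; 0 <= lam k; lam j <= ps; lam k <= ps; ps <= 1|]
  ==> norm (mdir (hessian v) x (b j) *v b k) <= C * sqrt ps"
proof -
 obtain C4 where C4: "C4 > 0" "!!x e. x : cball x0 (2 * dla) ==> norm (mdir (%x. mdir (hessian v) x e) x e) <= C4 * (norm e)^2"
  using third_fourth_bound[OF S v compact_cball d(2)] by metis
 define C where "C = sqrt 4 / dla + 4 * C4 * dla / sqrt 4"
 have C: "C >= 0" using d C4 by (simp add: C_def)
 show thesis
 proof (rule that[of "C"])
  show "C >= 0" by (rule C)
  fix x b lam j k ps assume x: "x : cball x0 dla" and b: "orthobasis b" and lam: "!!j. hessian v x *v b j = lam j *R b j"
   and l: "0 <= lam j" "0 <= lam k" "lam j <= ps" "lam k <= ps" "ps <= 1"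
  have bb: "b i \<bullet> b l = (if i = l then 1 else 0)" for i l using b by (simp add: orthobasis_def)
  have xS: "x : S" using x d by (auto simp: subset_eq)
  \<comment> \<open>The constant 4 includes the case of equal indices, where \<open>z\<close> is
    twice a basis vector.\<close>
  have quad: "\<bar>z \<bullet> (mdir (hessian v) x e *v z)\<bar> <= C * (2 * sqrt ps)"
   if z: "z \<bullet> z <= 4" "z \<bullet> (hessian v x *v z) <= 4 * ps" and e: "norm e = 1" for z e
  proof -
   define f where "f t = z \<bullet> (hessian v (x + t *R e) *v z)" for t
   define f1 where "f1 t = z \<bullet> (mdir (hessian v) (x + t *R e) e *v z)" for t
   define f2 where "f2 t = z \<bullet> (mdir (%x. mdir (hessian v) x e) (x + t *R e) e *v z)" for t
   have in2: "x + t *R e : cball x0 (2 * dla)" if "\<bar>t\<bar> <= dla" for t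
   proof -
    have "dist x0 (x + t *R e) <= dist x0 x + norm (t *R e)" using norm_triangle_ineq4[of "x0 - x" "t *R e"] by (simp add: dist_norm algebra_simps)
    also have "... <= dla + dla" using x that e by (intro add_mono) auto
    finally show ?thesis by simp
   qed
   have inS: "x + t *R e : S" if "\<bar>t\<bar> <= dla" for t using in2[OF that] d by auto
   have mvz: "((%t. z \<bullet> (A t *v z)) has_real_derivative z \<bullet> (A' *v z)) (at t)"
    if "(A has_vector_derivative A') (at t)" for A :: "real => real^'n^'n" and A' t
    using inner_has_real_derivative[OF has_vector_derivative_const[of z] matrix_vector_has_vector_derivative[OF that has_vector_derivative_const[of z]]] by simp
   have "\<bar>f1 0\<bar> <= C * sqrt (f 0)"
    unfolding C_def
   proof (rule nonneg_C2_derivative_bound[where f = f and ?f1.0 = f1 and ?f2.0 = f2])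
    fix t assume t: "\<bar>t\<bar> <= dla"
    show "(f has_real_derivative f1 t) (at t)" "(f1 has_real_derivative f2 t) (at t)"
     unfolding f_def f1_def f2_def by (rule mvz[OF jet_lines(3)[OF S v inS[OF t]]] mvz[OF jet_lines(4)[OF S v inS[OF t]]])+
    show "0 <= f t" using psd[OF inS[OF t]] by (simp add: f_def pos_semidef_def)
    have "\<bar>f2 t\<bar> <= norm z * norm (mdir (%x. mdir (hessian v) x e) (x + t *R e) e *v z)" unfolding f2_def by (rule Cauchy_Schwarz_ineq2)
    also have "... <= norm z * (norm (mdir (%x. mdir (hessian v) x e) (x + t *R e) e) * norm z)"
     by (intro mult_left_mono norm_matrix_vector_le) auto
    also have "... <= norm z * (C4 * norm z)"
     using C4(2)[OF in2[OF t], of e] e by (intro mult_left_mono mult_right_mono) auto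
    also have "... = C4 * (z \<bullet> z)" by (simp add: power2_norm_eq_inner[symmetric] sq_eq)
    also have "... <= C4 * 4" using z C4 by (intro mult_left_mono) auto
    finally show "\<bar>f2 t\<bar> <= 4 * C4" by simp
   qed (use d C4 z l in \<open>auto simp: f_def\<close>)
   also have "... <= C * sqrt (4 * ps)" using z C by (intro mult_left_mono real_sqrt_le_mono) (auto simp: f_def)
   also have "sqrt (4 * ps) = 2 * sqrt ps" by (simp add: real_sqrt_mult)
   finally show ?thesis by (simp add: f1_def)
  qed
  have off: "\<bar>b j \<bullet> (mdir (hessian v) x e *v b k)\<bar> <= C * sqrt ps" if e: "norm e = 1" for e
  proof -
   define X where "X = mdir (hessian v) x e"
   have tX: "transpose X = X" unfolding X_def by (rule third_transpose[OF S v xS])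
   have "\<bar>(b j + b k) \<bullet> (X *v (b j + b k))\<bar> <= C * (2 * sqrt ps)"
    unfolding X_def using l by (intro quad e) (auto simp: mv_add lam inner_add_left inner_add_right bb)
   moreover have "\<bar>(b j - b k) \<bullet> (X *v (b j - b k))\<bar> <= C * (2 * sqrt ps)"
    unfolding X_def using l by (intro quad e) (auto simp: matrix_vector_mult_diff_distrib lam inner_diff_left inner_diff_right bb)
   moreover have "(b j + b k) \<bullet> (X *v (b j + b k)) - (b j - b k) \<bullet> (X *v (b j - b k)) = 4 * (b j \<bullet> (X *v b k))"
    using symmetric_inner[OF tX, of "b j" "b k"]
    by (simp add: mv_add matrix_vector_mult_diff_distrib inner_add_left inner_add_right inner_diff_left inner_diff_right inner_commute)
   ultimately show ?thesis unfolding X_def[symmetric] by linarith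
  qed
  define z where "z = mdir (hessian v) x (b j) *v b k"
  show "norm z <= C * sqrt ps"
  proof (cases "z = 0")
   case True
   then show ?thesis using C l by simp
  next
   case False
   define e where "e = (1 / norm z) *R z"
   have e: "norm e = 1" "z = norm z *R e" using False by (simp_all add: e_def)
   have "norm z = e \<bullet> z"
    using False by (simp add: e_def power2_norm_eq_inner[symmetric] sq_eq)
   also have "... = b k \<bullet> (mdir (hessian v) x (b j) *v e)"
    unfolding z_def using symmetric_inner[OF third_transpose[OF S v xS], of e] by (simp add: inner_commute)
   also have "... = b k \<bullet> (mdir (hessian v) x e *v b j)" using third_swap[OF S v xS] by metis
   also have "... = b j \<bullet> (mdir (hessian v) x e *v b k)"
    using symmetric_inner[OF third_transpose[OF S v xS], of "b k"] by (simp add: inner_commute)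
   also have "... <= C * sqrt ps" using off[OF e(1)] by linarith
   finally show ?thesis .
  qed
 qed
qed

lemma continuous_on_Phi:
 fixes p :: "'a::topological_space => real^'n"
 assumes "continuous_on S p" "continuous_on S U" "continuous_on S V"
 shows "continuous_on S (%x. Phi (p x) (U x) (V x))"
proof -
 note mv = bounded_bilinear.continuous_on[OF bounded_bilinear_matrix_vector]
 note tr = bounded_linear.continuous_on[OF bounded_linear_trace]
 show ?thesis unfolding Phi_def S2_def Theta_def
  by (intro continuous_intros mv tr assms) auto
qed

text \<open>Compactness of the domain times the unit sphere turns pointwise ellipticity into
  two-sided bounds.\<close>

lemma uniform_ellipticity:
 fixes p :: "real^'n => real^'n" and M :: "real^'n => real^'n^'n"
 assumes D: "compact D" "D ~= {}" and p: "continuous_on D p" and M: "continuous_on D M"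
  and ell: "!!x e. x : D ==> e ~= 0 ==> 0 < Phi (p x) (M x) (outer_prod e e)"
 obtains th La where "th > 0" "!!x e. x : D ==> norm (e :: real^'n) = 1 ==> th <= Phi (p x) (M x) (outer_prod e e)"
  "!!x e. x : D ==> norm (e :: real^'n) = 1 ==> Phi (p x) (M x) (outer_prod e e) <= La"
proof -
 define Q where "Q = D \<times> sphere (0 :: real^'n) 1"
 define f where "f z = Phi (p (fst z)) (M (fst z)) (outer_prod (snd z) (snd z))" for z :: "(real^'n) \<times> (real^'n)"
 have Q: "compact Q" unfolding Q_def by (intro compact_Times D compact_sphere)
 have cQ: "continuous_on Q f"
  unfolding f_def
 proof (rule continuous_on_Phi)
  show "continuous_on Q (%z. p (fst z))" "continuous_on Q (%z. M (fst z))"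
   by (rule continuous_on_compose2[OF p] continuous_on_compose2[OF M]; auto simp: Q_def intro!: continuous_intros)+
  show "continuous_on Q (%z. outer_prod (snd z) (snd z))"
   by (intro bounded_bilinear.continuous_on[OF bounded_bilinear_outer_prod] continuous_intros)
 qed
 have ne: "Q ~= {}"
 proof -
  obtain x where "x : D" using D by blast
  then have "(x, axis undefined 1) : Q" by (simp add: Q_def norm_axis_1)
  then show ?thesis by auto
 qed
 obtain z0 where z0: "z0 : Q" "!!z. z : Q ==> f z0 <= f z" using continuous_attains_inf[OF Q ne cQ] by blast
 obtain z1 where z1: "z1 : Q" "!!z. z : Q ==> f z <= f z1" using continuous_attains_sup[OF Q ne cQ] by blast
 show thesis
 proof (rule that)
  show "0 < f z0" unfolding f_def using z0(1) by (intro ell) (auto simp: Q_def)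
  show "f z0 <= Phi (p x) (M x) (outer_prod e e)" if "x : D" "norm e = 1" for x e
   using z0(2)[of "(x, e)"] that by (simp add: Q_def f_def)
  show "Phi (p x) (M x) (outer_prod e e) <= f z1" if "x : D" "norm e = 1" for x e
   using z1(2)[of "(x, e)"] that by (simp add: Q_def f_def)
 qed
qed

lemma bounded_on_compact:
 fixes f :: "'a::topological_space => 'b::real_normed_vector"
 assumes "compact K" "continuous_on K f"
 obtains C where "C > 0" "!!x. x : K ==> norm (f x) <= C"
 using compact_imp_bounded[OF compact_continuous_image[OF assms(2,1)]] unfolding bounded_pos by auto

text \<open>Formally the left side is the linearised operator applied to the sum of the small
  eigenvalues, by the second-order perturbation formula with \<open>lam a\<close> neglected against
  \<open>lam j\<close>, and the vector in the norm is the gradient of that sum. Stated through an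
  eigenbasis, the inequality presupposes no smoothness of eigenvalues.\<close>

lemma main_estimate:
 fixes v :: "real^'n => real"
 assumes S: "open S" and v: "Ck_on 4 v S" and vneg: "!!x. x : S ==> v x < 0" and psd: "!!x. x : S ==> pos_semidef (hessian v x)"
  and d: "dla > 0" "cball x0 (2 * dla) \<subseteq> S" and c0: "c0 > 0"
 defines "p \<equiv> %x. (2 * (- v x)) *R gradient v x" and "M \<equiv> %x. (- v x) *R hessian v x - outer_prod (gradient v x) (gradient v x)"
 assumes eq: "!!x. x : S ==> Phi (p x) (M x) (M x) = 1 / 4"
  and ell: "!!x e. x : S ==> e ~= 0 ==> 0 < Phi (p x) (M x) (outer_prod e e)"
 obtains C et where "C >= 0" "et > 0"
  "!!x b lam T. [|x : cball x0 dla; orthobasis b; !!j. hessian v x *v b j = lam j *R b j; card T >= 2;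
    !!j. j : T ==> c0 <= lam j; (\<Sum>j\<in>-T. lam j) <= et|] ==>
   (\<Sum>a\<in>-T. 2 * Phi (p x) (M x) (mdir (%x. mdir (hessian v) x (b a)) x (b a))
    - 4 * Phi (p x) (M x) (\<Sum>j\<in>T. (1 / lam j) *R outer_prod (mdir (hessian v) x (b a) *v b j) (mdir (hessian v) x (b a) *v b j)))
   <= C * ((\<Sum>j\<in>-T. lam j) + norm (\<Sum>a\<in>-T. mdir (hessian v) x (b a) *v b a))"
proof -
 define n where "n = real CARD('n)"
 have n1: "n >= 1" by (simp add: n_def)
 define D where "D = cball x0 dla"
 have D: "compact D" "D \<subseteq> S" using d by (auto simp: D_def subset_eq)
 have cont: "continuous_on S v" "continuous_on S (gradient v)" "continuous_on S (hessian v)"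
  using Ck_on_continuous[OF v] gradient_continuous[OF S v] hessian_continuous[OF S v] by auto
 note contD = continuous_on_subset[OF cont(1) D(2)] continuous_on_subset[OF cont(2) D(2)] continuous_on_subset[OF cont(3) D(2)]
 have contis: "continuous_on D (%x. 1 / v x)" using vneg D(2) by (intro continuous_intros contD) (auto simp: subset_eq dest!: vneg)
 obtain K1 where K1: "K1 > 0" "!!x. x : D ==> norm (gradient v x) <= K1" using bounded_on_compact[OF D(1) contD(2)] by metis
 obtain K2 where K2: "K2 > 0" "!!x. x : D ==> norm (v x) <= K2" using bounded_on_compact[OF D(1) contD(1)] by metis
 obtain K3 where K3: "K3 > 0" "!!x. x : D ==> norm (1 / v x) <= K3" using bounded_on_compact[OF D(1) contis] by metis
 obtain K4 where K4: "K4 > 0" "!!x. x : D ==> norm (hessian v x) <= K4" using bounded_on_compact[OF D(1) contD(3)] by metis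
 obtain K5 where K5: "K5 > 0" "!!x e. x : D ==> norm (mdir (hessian v) x e) <= K5 * norm e"
  using third_fourth_bound[OF S v D] by metis
 obtain K6 where K6: "K6 >= 0" "!!x b lam j k ps. [|x : D; orthobasis b; !!j. hessian v x *v b j = lam j *R b j;
   0 <= lam j; 0 <= lam k; lam j <= ps; lam k <= ps; ps <= 1|] ==> norm (mdir (hessian v) x (b j) *v b k) <= K6 * sqrt ps"
  unfolding D_def by (rule pos_semidef_third_bound[OF S v psd d]) blast+
 \<comment> \<open>The summand 8 makes \<open>1 / K\<close> at most the 1 / 8 that remains of the
   value 1 / 4 of the equation after truncation.\<close>
 define K where "K = 8 + K1 + K2 + K3 + K4 + K5 + K6 + 1 / c0"
 have Kge: "K >= 8" "K >= 1" "K1 <= K" "K2 <= K" "K3 <= K" "K4 <= K" "K5 <= K" "K6 <= K" "1 / c0 <= K"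
  using K1 K2 K3 K4 K5 K6 c0 by (simp_all add: K_def)
 have Kp: "K > 0" using Kge by linarith
 have contp: "continuous_on D p" unfolding p_def by (intro continuous_intros contD)
 have contM: "continuous_on D M"
  unfolding M_def by (intro continuous_intros contD bounded_bilinear.continuous_on[OF bounded_bilinear_outer_prod])
 obtain N1 where N1: "N1 > 0" "!!x. x : D ==> norm (p x) <= N1" using bounded_on_compact[OF D(1) contp] by metis
 obtain N2 where N2: "N2 > 0" "!!x. x : D ==> norm (M x) <= N2" using bounded_on_compact[OF D(1) contM] by metis
 define N where "N = n^2 + 3 * n^2 * N1^2"
 have Nnn: "N > 0" using n1 by (simp add: N_def add_pos_nonneg)
 have PhiN: "\<bar>Phi (p x) U V\<bar> <= N * (norm U * norm V)" if "x : D" for x U V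
 proof -
  have "(n^2 + 3 * n^2 * (norm (p x))^2) * (norm U * norm V) <= N * (norm U * norm V)"
   unfolding N_def using N1 that n1 by (intro mult_right_mono add_left_mono mult_left_mono power_mono) auto
  then show ?thesis using abs_Phi_le[of "p x" U V] unfolding n_def by linarith
 qed
 obtain th where th: "th > 0" "!!x e. x : D ==> norm e = 1 ==> th <= Phi (p x) (M x) (outer_prod e e)"
 proof (rule uniform_ellipticity[OF D(1) _ contp contM])
  show "D ~= {}" using d by (simp add: D_def)
 qed (use ell D(2) in blast)+
 define c1 where "c1 = n * K"
 have c1: "c1 > 0" using n1 Kp by (simp add: c1_def)
 \<comment> \<open>Small enough that setting the small eigenvalues to zero costs at most half of the
   value 1 / 4 and does not destroy ellipticity; the bound 1 keeps the square root \<open>rr\<close>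
   at most 1.\<close>
 define et where "et = min 1 (min (1 / (8 * (N * c1 * (2 * N2 + c1)))) (th / (N * c1)))"
 have et: "et > 0" "et <= 1" "N * c1 * (2 * N2 + c1) * et <= 1 / 8" "N * c1 * et <= th"
 proof -
  have pos: "N * c1 * (2 * N2 + c1) > 0" "N * c1 > 0" using Nnn c1 N2 by (simp_all add: add_pos_pos)
  show "et > 0" using pos th by (simp add: et_def)
  show "et <= 1" by (simp add: et_def)
  have le: "X * et <= y" if "et <= y / X" "X > 0" for X y using that by (simp add: field_simps)
  show "N * c1 * (2 * N2 + c1) * et <= 1 / 8" "N * c1 * et <= th"
   by (rule le[OF _ pos(1)], simp add: et_def, rule le[OF _ pos(2)], simp add: et_def)
 qed
 \<comment> \<open>The index set of the family: a point, an eigenbasis with its eigenvalues, the set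
   of large indices and one null index. The constant has to be uniform over all of them.\<close>
 define data where "data = {i :: (real^'n) \<times> ('n => real^'n) \<times> ('n => real) \<times> 'n set \<times> 'n.
  case i of (x, b, lam, T, a) => x : D \<and> orthobasis b \<and> (\<forall>j. hessian v x *v b j = lam j *R b j) \<and> card T >= 2
   \<and> (\<forall>j\<in>T. c0 <= lam j) \<and> (\<Sum>j\<in>-T. lam j) <= et \<and> a \<notin> T}"
 define xx where "xx i = fst i" for i :: "(real^'n) \<times> ('n => real^'n) \<times> ('n => real) \<times> 'n set \<times> 'n"
 define bb where "bb i = fst (snd i)" for i :: "(real^'n) \<times> ('n => real^'n) \<times> ('n => real) \<times> 'n set \<times> 'n"
 define ll where "ll i = fst (snd (snd i))" for i :: "(real^'n) \<times> ('n => real^'n) \<times> ('n => real) \<times> 'n set \<times> 'n"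
 define TT where "TT i = fst (snd (snd (snd i)))" for i :: "(real^'n) \<times> ('n => real^'n) \<times> ('n => real) \<times> 'n set \<times> 'n"
 define aa where "aa i = snd (snd (snd (snd i)))" for i :: "(real^'n) \<times> ('n => real^'n) \<times> ('n => real) \<times> 'n set \<times> 'n"
 define rr where "rr i = sqrt (\<Sum>j\<in>-TT i. ll i j)" for i
 have dat: "xx i : D" "orthobasis (bb i)" "!!j. hessian v (xx i) *v bb i j = ll i j *R bb i j" "card (TT i) >= 2"
   "!!j. j : TT i ==> c0 <= ll i j" "(\<Sum>j\<in>-TT i. ll i j) <= et" "aa i \<notin> TT i" if "i : data" for i
  using that by (auto simp: data_def xx_def bb_def ll_def TT_def aa_def)
 have xS: "xx i : S" if "i : data" for i using dat(1)[OF that] D by auto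
 have obb: "bb i j \<bullet> bb i k = (if j = k then 1 else 0)" if "i : data" for i j k using dat(2)[OF that] by (simp add: orthobasis_def)
 have nbb: "norm (bb i j) = 1" if "i : data" for i j using obb[OF that, of j j] by (simp add: norm_eq_1)
 have lnn: "0 <= ll i j" if "i : data" for i j
  using pos_semidef_eigenvalue_nonneg[OF psd[OF xS[OF that]] dat(3)[OF that]] obb[OF that] by simp
 have lK: "ll i j <= K" if "i : data" for i j
 proof -
  have "ll i j = norm (hessian v (xx i) *v bb i j)" using dat(3)[OF that] nbb[OF that] lnn[OF that] by simp
  also have "... <= norm (hessian v (xx i)) * norm (bb i j)" by (rule norm_matrix_vector_le)
  also have "... <= K" using K4(2)[OF dat(1)[OF that]] Kge by (simp add: nbb[OF that])
  finally show ?thesis .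
 qed
 have psi: "0 <= (\<Sum>j\<in>-TT i. ll i j)" if "i : data" for i using lnn[OF that] by (intro sum_nonneg) auto
 have rr2: "rr i * rr i = (\<Sum>j\<in>-TT i. ll i j)" if "i : data" for i using psi[OF that] by (simp add: rr_def)
 have lpsi: "ll i j <= (\<Sum>j\<in>-TT i. ll i j)" if "i : data" "j \<notin> TT i" for i j
  using lnn[OF that(1)] that(2) by (intro member_le_sum) auto
 have spos: "- v (xx i) > 0" if "i : data" for i using vneg[OF xS[OF that]] by simp
 define m0 where "m0 i = (\<Sum>j\<in>TT i. (- v (xx i) * ll i j) *R outer_prod (bb i j) (bb i j))" for i
 define M0 where "M0 i = m0 i - outer_prod (gradient v (xx i)) (gradient v (xx i))" for i
 define mP where "mP i = (\<Sum>j\<in>-TT i. (- v (xx i) * ll i j) *R outer_prod (bb i j) (bb i j))" for i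
 have M_split: "M (xx i) = M0 i + mP i" if "i : data" for i
 proof -
  have "(- v (xx i)) *R hessian v (xx i) = (\<Sum>j\<in>UNIV. (- v (xx i) * ll i j) *R outer_prod (bb i j) (bb i j))"
  proof (rule eigenbasis_symmetric_matrix[OF dat(2)[OF that]])
   show "((- v (xx i)) *R hessian v (xx i)) *v bb i j = (- v (xx i) * ll i j) *R bb i j" for j
    using scaleR_matrix_vector_assoc[of "- v (xx i)" "hessian v (xx i)" "bb i j"] by (simp add: dat(3)[OF that])
  qed
  then have "(- v (xx i)) *R hessian v (xx i) = m0 i + mP i" unfolding sum_split_Compl[of _ "TT i"] m0_def mP_def .
  then show ?thesis unfolding M_def M0_def by simp
 qed
 have mPn: "norm (mP i) <= c1 * (\<Sum>j\<in>-TT i. ll i j)" if "i : data" for i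
 proof -
  have s: "\<bar>v (xx i)\<bar> <= K" using K2(2)[OF dat(1)[OF that]] Kge by simp
  have "norm (mP i) <= (\<Sum>j\<in>-TT i. K * (\<Sum>j\<in>-TT i. ll i j))"
   unfolding mP_def
  proof (rule sum_norm_le)
   fix j assume j: "j : - TT i"
   have "\<bar>v (xx i)\<bar> * ll i j <= K * (\<Sum>j\<in>-TT i. ll i j)" using s lpsi[OF that, of j] lnn[OF that, of j] j Kp by (intro mult_mono) auto
   then show "norm ((- v (xx i) * ll i j) *R outer_prod (bb i j) (bb i j)) <= K * (\<Sum>j\<in>-TT i. ll i j)"
    using lnn[OF that, of j] by (simp add: norm_outer_prod nbb[OF that] abs_mult)
  qed
  also have "... = real (card (-TT i)) * (K * (\<Sum>j\<in>-TT i. ll i j))" by simp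
  also have "... <= n * (K * (\<Sum>j\<in>-TT i. ll i j))" unfolding n_def using psi[OF that] Kp by (intro mult_right_mono) (auto simp: card_mono)
  finally show ?thesis by (simp add: c1_def mult.assoc)
 qed
 have mPet: "norm (mP i) <= c1 * et" if "i : data" for i
  using mPn[OF that] mult_left_mono[OF dat(6)[OF that], of c1] c1 by linarith
 \<comment> \<open>The form is quadratic in \<open>xi\<close>, so unit vectors suffice; on these the
   truncation costs at most \<open>N * c1 * et\<close>, which is at most the ellipticity constant
   \<open>th\<close>.\<close>
 have ellM0: "0 <= Phi (p (xx i)) (M0 i) (outer_prod xi xi)" if "i : data" for i xi
 proof (cases "xi = 0")
  case True
  then have "outer_prod xi xi = 0" by (simp add: outer_prod_def vec_eq_iff)
  then show ?thesis by (simp add: Phi_0_right)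
 next
  case False
  define e where "e = (1 / norm xi) *R xi"
  have e: "norm e = 1" "xi = norm xi *R e" using False by (simp_all add: e_def)
  have "Phi (p (xx i)) (mP i) (outer_prod e e) <= N * (c1 * et)"
  proof -
   have "\<bar>Phi (p (xx i)) (mP i) (outer_prod e e)\<bar> <= N * (norm (mP i) * norm (outer_prod e e))" by (rule PhiN[OF dat(1)[OF that]])
   also have "... <= N * (c1 * et)" using mPet[OF that] Nnn e(1) by (simp add: norm_outer_prod)
   finally show ?thesis by linarith
  qed
  also have "... <= th" using et(4) by (simp add: mult.assoc)
  also have "th <= Phi (p (xx i)) (M (xx i)) (outer_prod e e)" by (rule th(2)[OF dat(1)[OF that] e(1)])
  finally have "0 <= Phi (p (xx i)) (M0 i) (outer_prod e e)" unfolding M_split[OF that] Phi_add_left by linarith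
  then have "0 <= (norm xi * norm xi) * Phi (p (xx i)) (M0 i) (outer_prod e e)" by simp
  also have "... = Phi (p (xx i)) (M0 i) (outer_prod (norm xi *R e) (norm xi *R e))"
   by (simp add: outer_prod_linear Phi_scale_right)
  finally show ?thesis using e(2) by metis
 qed
 have sigM0: "1 / K <= Phi (p (xx i)) (M0 i) (M0 i)" if "i : data" for i
 proof -
  define P where "P = p (xx i)"
  have M0': "M0 i = M (xx i) - mP i" using M_split[OF that] by simp
  have "Phi P (M0 i) (M0 i) = 1 / 4 - 2 * Phi P (M (xx i)) (mP i) + Phi P (mP i) (mP i)"
   unfolding M0' Phi_minus_left Phi_minus_right using eq[OF xS[OF that]] by (simp add: P_def Phi_commute[of _ "mP i" "M (xx i)"])
  moreover have "\<bar>Phi P (M (xx i)) (mP i)\<bar> <= N * (N2 * (c1 * et))"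
  proof -
   have "\<bar>Phi P (M (xx i)) (mP i)\<bar> <= N * (norm (M (xx i)) * norm (mP i))" unfolding P_def by (rule PhiN[OF dat(1)[OF that]])
   also have "... <= N * (N2 * (c1 * et))" using Nnn N2 dat(1)[OF that] mPet[OF that] by (intro mult_left_mono mult_mono) auto
   finally show ?thesis .
  qed
  moreover have "\<bar>Phi P (mP i) (mP i)\<bar> <= N * (c1 * (c1 * et))"
  proof -
   have c: "norm (mP i) <= c1" using mPet[OF that] mult_left_mono[OF et(2), of c1] c1 by linarith
   have "\<bar>Phi P (mP i) (mP i)\<bar> <= N * (norm (mP i) * norm (mP i))" unfolding P_def by (rule PhiN[OF dat(1)[OF that]])
   also have "... <= N * (c1 * (c1 * et))" using Nnn c1 c mPet[OF that] by (intro mult_left_mono mult_mono) auto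
   finally show ?thesis .
  qed
  moreover have "2 * (N * (N2 * (c1 * et))) + N * (c1 * (c1 * et)) <= 1 / 8"
   using et(3) by (simp add: algebra_simps)
  ultimately have "1 / 8 <= Phi P (M0 i) (M0 i)" by linarith
  moreover have "1 / K <= 1 / 8" using Kge Kp by (simp add: field_simps)
  ultimately show ?thesis unfolding P_def by linarith
 qed
 define P where "P i = (\<Sum>j\<in>-TT i. outer_prod (bb i j) (bb i j))" for i
 define q where "q i = gradient v (xx i)" for i
 define s where "s i = - v (xx i)" for i
 define B where "B i = hessian v (xx i)" for i
 define X where "X i = mdir (hessian v) (xx i) (bb i (aa i))" for i
 define W where "W i = mdir (%x. mdir (hessian v) x (bb i (aa i))) (xx i) (bb i (aa i))" for i
 obtain C where C: "C >= 0" and est: "!!i. i : data ==>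
   s i * (2 * Phi (p (xx i)) (M (xx i)) (W i) - 4 * Phi (p (xx i)) (M (xx i)) (\<Sum>j\<in>TT i. (1 / ll i j) *R outer_prod (X i *v bb i j) (X i *v bb i j)))
   <= - (4 * (- (q i \<bullet> bb i (aa i)) / s i)^2 * Theta (p (xx i)) (p (xx i)) (m0 i) (m0 i))
   + (2 * Phi (p (xx i)) (M (xx i)) (outer_prod (X i *v bb i (aa i)) (q i) + outer_prod (q i) (X i *v bb i (aa i)))
     - 4 * s i * Theta (p (xx i)) (X i *v bb i (aa i)) (M (xx i)) (M (xx i)))
   + C * (rr i * rr i + \<bar>trace (X i ** P i)\<bar> + \<bar>- (q i \<bullet> bb i (aa i))\<bar> * (norm (P i *v q i) * rr i))"
 proof (rule differentiated_equation_estimate[where S = data and K = K and b = bb and T = TT and a = aa and lam = ll and B = B and s = s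
    and q = q and X = X and W = W and r = rr])
  show "1 <= K" using Kge by simp
  fix i assume i: "i : data"
  show "orthobasis (bb i)" "2 <= card (TT i)" "aa i \<notin> TT i" using dat[OF i] by auto
  show "B i *v bb i j = ll i j *R bb i j" for j unfolding B_def by (rule dat(3)[OF i])
  show "1 / K <= ll i j" if "j : TT i" for j
  proof -
   have "1 / K <= c0" using Kge(9) Kp c0 by (simp add: field_simps)
   then show ?thesis using dat(5)[OF i that] by linarith
  qed
  show "ll i j <= K" for j by (rule lK[OF i])
  show "0 <= ll i j" for j by (rule lnn[OF i])
  show "ll i j <= rr i * rr i" if "j \<notin> TT i" for j unfolding rr2[OF i] by (rule lpsi[OF i that])
  show "norm (q i) <= K" using K1(2)[OF dat(1)[OF i]] Kge by (simp add: q_def)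
  show "s i <= K" using K2(2)[OF dat(1)[OF i]] Kge by (simp add: s_def)
  show "1 / K <= s i"
  proof -
   have "1 / s i <= K" using K3(2)[OF dat(1)[OF i]] Kge spos[OF i] by (simp add: s_def)
   then show ?thesis using spos[OF i] Kp by (simp add: s_def field_simps)
  qed
  show "norm (X i) <= K" using K5(2)[OF dat(1)[OF i], of "bb i (aa i)"] Kge by (simp add: X_def nbb[OF i])
  show "norm (B i) <= K" using K4(2)[OF dat(1)[OF i]] Kge by (simp add: B_def)
  show "0 <= rr i" using psi[OF i] by (simp add: rr_def)
  have "rr i <= sqrt 1" unfolding rr_def using dat(6)[OF i] et by (intro real_sqrt_le_mono) auto
  then show "rr i <= K" using Kge by simp
  show "transpose (X i) = X i" unfolding X_def by (rule third_transpose[OF S v xS[OF i]])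
  show "norm (X i *v bb i j) <= K * rr i" if "j \<notin> TT i" for j
  proof -
   have "norm (X i *v bb i j) <= K6 * rr i"
    unfolding X_def rr_def
    by (rule K6(2)[OF dat(1)[OF i] dat(2)[OF i] dat(3)[OF i] lnn[OF i] lnn[OF i] lpsi[OF i dat(7)[OF i]] lpsi[OF i that]])
     (use dat(6)[OF i] et in linarith)
   also have "... <= K * rr i" using Kge psi[OF i] by (intro mult_right_mono) (auto simp: rr_def)
   finally show ?thesis .
  qed
  have be: "hessian v (xx i) *v bb i (aa i) = ll i (aa i) *R bb i (aa i)" by (rule dat(3)[OF i])
  have bb1: "bb i (aa i) \<bullet> bb i (aa i) = 1" using obb[OF i] by simp
  show "jet_equations (s i) (q i) (B i) (X i) (W i) (bb i (aa i)) (ll i (aa i))"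
   unfolding s_def q_def B_def X_def W_def by (rule equation_jets[OF S v eq[unfolded p_def M_def] xS[OF i] be bb1])
  show "1 / K <= Phi ((2 * s i) *R q i) ((\<Sum>j\<in>TT i. (s i * ll i j) *R outer_prod (bb i j) (bb i j)) - outer_prod (q i) (q i))
     ((\<Sum>j\<in>TT i. (s i * ll i j) *R outer_prod (bb i j) (bb i j)) - outer_prod (q i) (q i))"
   using sigM0[OF i] unfolding M0_def m0_def p_def s_def q_def .
  show "0 <= Phi ((2 * s i) *R q i) ((\<Sum>j\<in>TT i. (s i * ll i j) *R outer_prod (bb i j) (bb i j)) - outer_prod (q i) (q i)) (outer_prod xi xi)" for xi
   using ellM0[OF i] unfolding M0_def m0_def p_def s_def q_def .
 qed (rule that, assumption, simp add: P_def m0_def p_def M_def s_def q_def B_def)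
 define L where "L = K * K"
 have L: "L >= 1" using Kge by (simp add: L_def mult_ge1_I)
 define C2 where "C2 = 4 * N * N2 * K1 + 12 * K * n^2 * N1 * N2^2"
 have C2: "C2 >= 0" unfolding C2_def using Nnn N1 N2 K1 Kp n1 by (auto intro!: add_nonneg_nonneg mult_nonneg_nonneg)
 define C3 where "C3 = n * C + C^2 * n^2 * L^2 + C2 + n * C"
 have C3: "C3 >= 0" using C C2 n1 by (simp add: C3_def)
 show thesis
 proof (rule that[of "K * C3" et])
  show "K * C3 >= 0" "et > 0" using C3 Kp et by auto
  fix x b lam T
  assume x: "x : cball x0 dla" and b: "orthobasis b" and lam: "!!j. hessian v x *v b j = lam j *R b j" and T: "card T >= 2"
   and lamT: "!!j. j : T ==> c0 <= lam j" and small: "(\<Sum>j\<in>-T. lam j) <= et"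
  define ps where "ps = (\<Sum>j\<in>-T. lam j)"
  define g where "g = (\<Sum>a\<in>-T. mdir (hessian v) x (b a) *v b a)"
  define sx where "sx = - v x"
  define qx where "qx = gradient v x"
  define Xa where "Xa a = mdir (hessian v) x (b a)" for a
  define Px where "Px = (\<Sum>j\<in>-T. outer_prod (b j) (b j))"
  define r where "r = sqrt ps"
  define kapa where "kapa = norm (Px *v qx)"
  define ma where "ma = (\<Sum>j\<in>T. (sx * lam j) *R outer_prod (b j) (b j))"
  define TH where "TH = Theta (p x) (p x) ma ma"
  define Z where "Z a = 2 * Phi (p x) (M x) (mdir (%x. mdir (hessian v) x (b a)) x (b a))
    - 4 * Phi (p x) (M x) (\<Sum>j\<in>T. (1 / lam j) *R outer_prod (Xa a *v b j) (Xa a *v b j))" for a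
  define l where "l xi = 2 * Phi (p x) (M x) (outer_prod xi qx + outer_prod qx xi) - 4 * sx * Theta (p x) xi (M x) (M x)" for xi
  have xD: "x : D" using x by (simp add: D_def)
  have xS': "x : S" using xD D by auto
  have ob: "b j \<bullet> b k = (if j = k then 1 else 0)" for j k using b by (simp add: orthobasis_def)
  have nb: "norm (b j) = 1" for j using ob[of j j] by (simp add: norm_eq_1)
  have sx: "sx > 0" using vneg[OF xS'] by (simp add: sx_def)
  have isx: "1 / sx <= K" using K3(2)[OF xD] Kge sx by (simp add: sx_def)
  have sxK: "sx <= K" using K2(2)[OF xD] Kge by (simp add: sx_def)
  have lnn': "0 <= lam j" for j using pos_semidef_eigenvalue_nonneg[OF psd[OF xS'] lam] ob by simp
  have ps0: "ps >= 0" using lnn' by (simp add: ps_def sum_nonneg)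
  have r: "r >= 0" "r * r = ps" using ps0 by (simp_all add: r_def)
  have est': "sx * Z a <= - (4 * (- (qx \<bullet> b a) / sx)^2 * TH) + l (Xa a *v b a) + C * (ps + \<bar>trace (Xa a ** Px)\<bar> + \<bar>qx \<bullet> b a\<bar> * (kapa * r))"
   if a: "a \<notin> T" for a
  proof -
   have "(x, b, lam, T, a) : data" using xD b lam T lamT small a by (simp add: data_def)
   from est[OF this] show ?thesis
    unfolding s_def q_def X_def W_def P_def m0_def rr_def xx_def bb_def ll_def TT_def aa_def fst_conv snd_conv
     sx_def[symmetric] qx_def[symmetric] Xa_def[symmetric] Px_def[symmetric] ps_def[symmetric] r_def[symmetric] kapa_def[symmetric]
     ma_def[symmetric] TH_def[symmetric] Z_def[symmetric] l_def[symmetric] r(2) abs_minus_cancel .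
  qed
  have kapa2: "(\<Sum>a\<in>-T. (qx \<bullet> b a)^2) = kapa^2"
  proof -
   have Pq: "Px *v qx = (\<Sum>a\<in>-T. (b a \<bullet> qx) *R b a)" unfolding Px_def matrix_sum_mult outer_prod_mult ..
   have "kapa^2 = (\<Sum>a\<in>-T. \<Sum>c\<in>-T. if a = c then (b a \<bullet> qx)^2 else 0)"
    unfolding kapa_def norm_sq Pq inner_sum_left inner_sum_right
    by (intro sum.cong refl) (auto simp: ob sq_eq)
   then show ?thesis by (simp add: inner_commute)
  qed
  have qb: "\<bar>qx \<bullet> b a\<bar> <= kapa" if "a \<notin> T" for a
  proof -
   have "(qx \<bullet> b a)^2 <= (\<Sum>a\<in>-T. (qx \<bullet> b a)^2)" using that by (intro member_le_sum) auto
   then have "\<bar>qx \<bullet> b a\<bar>^2 <= kapa^2" unfolding kapa2 by simp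
   then show ?thesis by (rule power2_le_imp_le) (simp add: kapa_def)
  qed
  \<comment> \<open>Consequently the negative terms, which carry \<open>TH\<close> times the squares
    of the null components of \<open>qx\<close>, add up to at least a multiple of
    \<open>kapa^4\<close>.\<close>
  have THlo: "1 / L^2 * (4 * sx^2 * kapa^2) <= TH"
  proof -
   have px: "p x = (2 * sx) *R qx" by (simp add: p_def sx_def qx_def)
   have "1 / L^2 * (\<Sum>i\<in>-T. (b i \<bullet> p x)^2) <= TH"
    unfolding TH_def
   proof (rule Theta_kernel_lower_bound[OF b T L, where mu = "%j. if j : T then sx * lam j else 0"])
    fix j assume j: "j : T"
    have "1 / K <= sx" using isx sx Kp by (simp add: field_simps)
    moreover have "1 / K <= lam j"
    proof -
     have "1 / K <= c0" using Kge(9) Kp c0 by (simp add: field_simps)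
     then show ?thesis using lamT[OF j] by linarith
    qed
    ultimately have "(1 / K) * (1 / K) <= sx * lam j" using Kp sx by (intro mult_mono) auto
    then show "1 / L <= (if j : T then sx * lam j else 0)" using j by (simp add: L_def)
   next
    fix j
    have "ma *v b j = (\<Sum>k\<in>T. if k = j then (sx * lam j) *R b j else 0)"
     unfolding ma_def matrix_sum_mult scaleR_mv outer_prod_mult by (intro sum.cong refl) (auto simp: ob)
    then show "ma *v b j = (if j : T then sx * lam j else 0) *R b j" by simp
   qed simp
   moreover have "(\<Sum>i\<in>-T. (b i \<bullet> p x)^2) = 4 * sx^2 * kapa^2"
    unfolding kapa2[symmetric] sum_distrib_left px by (intro sum.cong refl) (simp add: sq_eq inner_commute)
   ultimately show ?thesis by simp
  qed
  \<comment> \<open>By total symmetry of the third derivatives the null trace of \<open>Xa a\<close>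
    is the component of \<open>g\<close> along \<open>b a\<close>.\<close>
  have trg: "\<bar>trace (Xa a ** Px)\<bar> <= norm g" for a
  proof -
   have "trace (Xa a ** Px) = (\<Sum>j\<in>UNIV. b j \<bullet> ((Xa a ** Px) *v b j))" by (rule orthobasis_trace[OF b])
   also have "... = (\<Sum>j\<in>UNIV. if j : -T then b j \<bullet> (Xa a *v b j) else 0)"
   proof (rule sum.cong[OF refl])
    fix j
    have "Px *v b j = (\<Sum>k\<in>-T. if k = j then b j else 0)"
     unfolding Px_def matrix_sum_mult outer_prod_mult by (intro sum.cong refl) (auto simp: ob)
    then show "b j \<bullet> ((Xa a ** Px) *v b j) = (if j : -T then b j \<bullet> (Xa a *v b j) else 0)"
     by (simp add: mv_assoc)
   qed
   also have "... = (\<Sum>j\<in>-T. b j \<bullet> (Xa a *v b j))" by (subst sum.inter_filter[symmetric]) (simp_all add: Compl_eq)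
   also have "... = (\<Sum>j\<in>-T. b a \<bullet> (Xa j *v b j))"
   proof (rule sum.cong[OF refl])
    fix j
    have "Xa a *v b j = Xa j *v b a" unfolding Xa_def by (rule third_swap[OF S v xS'])
    then have "b j \<bullet> (Xa a *v b j) = b j \<bullet> (Xa j *v b a)" by simp
    also have "... = b a \<bullet> (Xa j *v b j)"
     using symmetric_inner[OF third_transpose[OF S v xS'], of "b j"] by (simp add: Xa_def inner_commute)
    finally show "b j \<bullet> (Xa a *v b j) = b a \<bullet> (Xa j *v b j)" .
   qed
   also have "... = b a \<bullet> g" by (simp add: g_def Xa_def inner_sum_right)
   finally show ?thesis using Cauchy_Schwarz_ineq2[of "b a" g] by (simp add: nb)
  qed
  \<comment> \<open>A single \<open>Xa a *v b a\<close> is only of order \<open>r\<close>; by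
    linearity the sum over the null indices depends on \<open>g\<close> alone.\<close>
  have lsum: "(\<Sum>a\<in>-T. l (Xa a *v b a)) = l g"
  proof -
   have l_add: "l (xi + \<zeta>) = l xi + l \<zeta>" for xi \<zeta>
    by (simp add: l_def outer_prod_linear Phi_add_right Theta_vector_linear algebra_simps)
   have l_0: "l 0 = 0" using l_add[of 0 0] by simp
   have "(\<Sum>a\<in>A. l (Xa a *v b a)) = l (\<Sum>a\<in>A. Xa a *v b a)" for A
    by (induction A rule: infinite_finite_induct) (simp_all add: l_add l_0)
   then show ?thesis by (simp add: g_def Xa_def)
  qed
  have lg: "l g <= C2 * norm g"
  proof -
   have n: "norm (outer_prod g qx + outer_prod qx g) <= 2 * K1 * norm g"
   proof -
    have "norm (outer_prod g qx + outer_prod qx g) <= norm g * norm qx + norm qx * norm g"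
     using norm_triangle_ineq[of "outer_prod g qx" "outer_prod qx g"] by (simp add: norm_outer_prod)
    also have "... <= 2 * (K1 * norm g)" using mult_right_mono[OF K1(2)[OF xD], of "norm g"] by (simp add: qx_def mult.commute)
    finally show ?thesis by simp
   qed
   have "\<bar>Phi (p x) (M x) (outer_prod g qx + outer_prod qx g)\<bar> <= N * (norm (M x) * norm (outer_prod g qx + outer_prod qx g))" by (rule PhiN[OF xD])
   also have "... <= N * (N2 * (2 * K1 * norm g))" using Nnn N2 xD n by (intro mult_left_mono mult_mono) auto
   finally have a: "\<bar>Phi (p x) (M x) (outer_prod g qx + outer_prod qx g)\<bar> <= N * (N2 * (2 * K1 * norm g))" .
   have "\<bar>Theta (p x) g (M x) (M x)\<bar> <= 3 * n^2 * (norm (p x) * norm g) * (norm (M x) * norm (M x))"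
    unfolding n_def by (rule abs_S2_Theta_le(2))
   also have "... <= 3 * n^2 * (N1 * norm g) * (N2 * N2)"
    using N1 N2 xD n1 by (intro mult_mono mult_nonneg_nonneg) auto
   finally have t: "\<bar>Theta (p x) g (M x) (M x)\<bar> <= 3 * n^2 * (N1 * norm g) * (N2 * N2)" .
   have "sx * \<bar>Theta (p x) g (M x) (M x)\<bar> <= K * (3 * n^2 * (N1 * norm g) * (N2 * N2))"
    using t sx sxK by (intro mult_mono) auto
   moreover have "l g <= 2 * \<bar>Phi (p x) (M x) (outer_prod g qx + outer_prod qx g)\<bar> + 4 * (sx * \<bar>Theta (p x) g (M x) (M x)\<bar>)"
   proof -
    have "- (sx * Theta (p x) g (M x) (M x)) <= sx * \<bar>Theta (p x) g (M x) (M x)\<bar>"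
     using sx mult_left_mono[of "- Theta (p x) g (M x) (M x)" "\<bar>Theta (p x) g (M x) (M x)\<bar>" sx] by simp
    then show ?thesis unfolding l_def mult.assoc by linarith
   qed
   moreover have "2 * (N * (N2 * (2 * K1 * norm g))) + 4 * (K * (3 * n^2 * (N1 * norm g) * (N2 * N2))) = C2 * norm g"
    by (simp add: C2_def sq_eq algebra_simps)
   ultimately show ?thesis using a by linarith
  qed
  have "sx * (\<Sum>a\<in>-T. Z a) = (\<Sum>a\<in>-T. sx * Z a)" by (rule sum_distrib_left)
  also have "... <= (\<Sum>a\<in>-T. - (4 * TH / sx^2) * (qx \<bullet> b a)^2 + l (Xa a *v b a) + (C * ps + C * norm g + C * (kapa * (kapa * r))))"
  proof (rule sum_mono)
   fix a assume a: "a : -T"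
   have k: "kapa * r >= 0" using r by (simp add: kapa_def)
   have "\<bar>qx \<bullet> b a\<bar> * (kapa * r) <= kapa * (kapa * r)" using a qb k by (intro mult_right_mono) auto
   then have "C * (ps + \<bar>trace (Xa a ** Px)\<bar> + \<bar>qx \<bullet> b a\<bar> * (kapa * r)) <= C * (ps + norm g + kapa * (kapa * r))"
    using trg[of a] C by (intro mult_left_mono) auto
   moreover have "4 * (- (qx \<bullet> b a) / sx)^2 * TH = (4 * TH / sx^2) * (qx \<bullet> b a)^2"
    by (simp add: sq_eq)
   ultimately show "sx * Z a <= - (4 * TH / sx^2) * (qx \<bullet> b a)^2 + l (Xa a *v b a) + (C * ps + C * norm g + C * (kapa * (kapa * r)))"
    using est'[of a] a by (simp add: distrib_left)
  qed
  also have "... = - (4 * TH / sx^2) * kapa^2 + l g + real (card (-T)) * (C * ps + C * norm g + C * (kapa * (kapa * r)))"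
   by (simp add: sum.distrib lsum sum_distrib_left[symmetric] kapa2 sum_subtractf sum_negf sum_divide_distrib[symmetric])
  also have "... <= - (4 * TH / sx^2) * kapa^2 + C2 * norm g + n * (C * ps + C * norm g + C * (kapa * (kapa * r)))"
  proof -
   have "0 <= C * ps + C * norm g + C * (kapa * (kapa * r))" using C ps0 r by (simp add: kapa_def)
   moreover have "real (card (-T)) <= n" by (simp add: n_def card_mono)
   ultimately have "real (card (-T)) * (C * ps + C * norm g + C * (kapa * (kapa * r))) <= n * (C * ps + C * norm g + C * (kapa * (kapa * r)))"
    by (rule mult_right_mono[rotated])
   then show ?thesis using lg by linarith
  qed
  also have "... <= C3 * (ps + norm g)"
  proof -
   have t1: "16 / L^2 * (kapa^2 * kapa^2) <= (4 * TH / sx^2) * kapa^2"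
   proof -
    have "1 / L^2 * (4 * sx^2 * kapa^2) * (4 * kapa^2 / sx^2) <= TH * (4 * kapa^2 / sx^2)" using THlo by (intro mult_right_mono) auto
    moreover have "1 / L^2 * (4 * sx^2 * kapa^2) * (4 * kapa^2 / sx^2) = 16 / L^2 * (kapa^2 * kapa^2)" using sx by simp
    moreover have "TH * (4 * kapa^2 / sx^2) = (4 * TH / sx^2) * kapa^2" by simp
    ultimately show ?thesis by linarith
   qed
   \<comment> \<open>The one error that is not O(ps): \<open>kapa^2 * r\<close> is split into
     \<open>kapa^4\<close>, which \<open>t1\<close> absorbs, and \<open>r^2 = ps\<close>. This is
     what the surplus in \<open>structural_bound\<close> is for.\<close>
   have t2: "n * (C * (kapa * (kapa * r))) <= 16 / L^2 * (kapa^2 * kapa^2) + C^2 * n^2 * L^2 * ps"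
   proof -
    define A where "A = kapa^2 / L"
    define E where "E = C * n * L * r"
    have AE: "n * (C * (kapa * (kapa * r))) = A * E" "16 / L^2 * (kapa^2 * kapa^2) = 16 * A^2" "C^2 * n^2 * L^2 * ps = E^2"
     using L r(2) by (simp_all add: A_def E_def sq_eq mult_ac)
    have "0 <= (4 * A - E)^2 + 7 * (A * E)" using L C n1 r by (simp add: A_def E_def)
    then have "A * E <= 16 * A^2 + E^2" by (simp add: sq_eq algebra_simps)
    then show ?thesis unfolding AE .
   qed
   have t3: "(n * C + C^2 * n^2 * L^2) * ps + (C2 + n * C) * norm g <= C3 * (ps + norm g)"
   proof -
    have "0 <= (C2 + n * C) * ps" "0 <= (n * C + C^2 * n^2 * L^2) * norm g" using C2 C n1 ps0 by auto
    then show ?thesis by (simp add: C3_def algebra_simps)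
   qed
   have t4: "- (4 * TH / sx^2) * kapa^2 = - ((4 * TH / sx^2) * kapa^2)" by simp
   show ?thesis unfolding t4 using t1 t2 t3 unfolding distrib_left distrib_right by linarith
  qed
  finally have fin: "sx * (\<Sum>a\<in>-T. Z a) <= C3 * (ps + norm g)" .
  have R: "C3 * (ps + norm g) >= 0" using C3 ps0 by simp
  have "(\<Sum>a\<in>-T. Z a) <= (1 / sx) * (C3 * (ps + norm g))" using fin sx by (simp add: field_simps)
  also have "... <= K * (C3 * (ps + norm g))" using isx R by (rule mult_right_mono)
  finally show "(\<Sum>a\<in>-T. 2 * Phi (p x) (M x) (mdir (%x. mdir (hessian v) x (b a)) x (b a))
    - 4 * Phi (p x) (M x) (\<Sum>j\<in>T. (1 / lam j) *R outer_prod (mdir (hessian v) x (b a) *v b j) (mdir (hessian v) x (b a) *v b j)))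
   <= K * C3 * ((\<Sum>j\<in>-T. lam j) + norm (\<Sum>a\<in>-T. mdir (hessian v) x (b a) *v b a))"
   unfolding Z_def Xa_def ps_def[symmetric] g_def[symmetric] by (simp add: mult.assoc)
 qed
qed

section \<open>Ky Fan's principle and orthonormal frames\<close>

definition orthonormal_on :: "'n set => ('n => real^'n) => bool" where
 "orthonormal_on I w \<longleftrightarrow> (\<forall>i\<in>I. \<forall>j\<in>I. w i \<bullet> w j = (if i = j then 1 else 0))"

lemma bessel_inequality:
 fixes w :: "'n => real^'n"
 assumes "orthonormal_on I w"
 shows "(\<Sum>i\<in>I. (w i \<bullet> e)^2) <= e \<bullet> e"
proof -
 define z where "z = (\<Sum>i\<in>I. (w i \<bullet> e) *R w i)"
 have ze: "z \<bullet> e = (\<Sum>i\<in>I. (w i \<bullet> e)^2)" by (simp add: z_def inner_sum_left sq_eq)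
 have "z \<bullet> z = (\<Sum>i\<in>I. \<Sum>j\<in>I. if i = j then (w i \<bullet> e)^2 else 0)"
  unfolding z_def inner_sum_left inner_sum_right
  by (intro sum.cong refl) (use assms in \<open>auto simp: orthonormal_on_def sq_eq\<close>)
 then have zz: "z \<bullet> z = (\<Sum>i\<in>I. (w i \<bullet> e)^2)" by simp
 have "0 <= (e - z) \<bullet> (e - z)" by simp
 also have "... = e \<bullet> e - 2 * (z \<bullet> e) + z \<bullet> z" by (simp add: inner_diff_left inner_diff_right inner_commute)
 finally show ?thesis using ze zz by simp
qed

lemma frame_weights:
 fixes b w :: "'n => real^'n"
 assumes b: "orthobasis b" and w: "orthonormal_on I w"
 shows "(\<Sum>i\<in>I. (b j \<bullet> w i)^2) <= 1" and "(\<Sum>j\<in>UNIV. \<Sum>i\<in>I. (b j \<bullet> w i)^2) = real (card I)"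
proof -
 show "(\<Sum>i\<in>I. (b j \<bullet> w i)^2) <= 1"
  using bessel_inequality[OF w, of "b j"] b by (simp add: orthobasis_def inner_commute)
 have "(\<Sum>j\<in>UNIV. \<Sum>i\<in>I. (b j \<bullet> w i)^2) = (\<Sum>i\<in>I. \<Sum>j\<in>UNIV. (b j \<bullet> w i) * (b j \<bullet> w i))"
  by (subst sum.swap) (simp add: sq_eq)
 also have "... = (\<Sum>i\<in>I. 1)" using w by (intro sum.cong refl) (simp add: orthobasis_inner[OF b] orthonormal_on_def)
 finally show "(\<Sum>j\<in>UNIV. \<Sum>i\<in>I. (b j \<bullet> w i)^2) = real (card I)" by simp
qed

lemma frame_trace_eigenbasis:
 fixes b w :: "'n => real^'n"
 assumes b: "orthobasis b" and l: "!!j. A *v b j = lam j *R b j"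
 shows "(\<Sum>i\<in>I. w i \<bullet> (A *v w i)) = (\<Sum>j\<in>UNIV. lam j * (\<Sum>i\<in>I. (b j \<bullet> w i)^2))"
 unfolding eigenbasis_quadratic[OF b l] by (subst sum.swap) (simp add: sum_distrib_left sq_eq mult.assoc)

text \<open>The trace over a frame is a weighted sum of the eigenvalues, with weights in [0, 1] of
  total \<open>card I\<close>. With a threshold between the two groups of eigenvalues the excess
  over the left side becomes a sum of nonnegative products.\<close>

lemma ky_fan_minimum:
 fixes b w :: "'n => real^'n"
 assumes b: "orthobasis b" and l: "!!j. A *v b j = lam j *R b j" and w: "orthonormal_on I w"
  and ord: "!!a j. a : I ==> j \<notin> I ==> lam a <= lam j"
 shows "(\<Sum>a\<in>I. lam a) <= (\<Sum>i\<in>I. w i \<bullet> (A *v w i))"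
proof -
 define c where "c j = (\<Sum>i\<in>I. (b j \<bullet> w i)^2)" for j
 have c: "0 <= c j" "c j <= 1" "(\<Sum>j\<in>UNIV. c j) = real (card I)" for j
  using frame_weights[OF b w] by (auto simp: c_def intro: sum_nonneg)
 obtain \<mu> where \<mu>: "!!a. a : I ==> lam a <= \<mu>" "!!j. j \<notin> I ==> \<mu> <= lam j"
 proof (cases "I = {}")
  case True
  \<comment> \<open>Without small eigenvalues any lower bound of all the others serves as
    threshold.\<close>
  show ?thesis by (rule that[of "Min (range lam)"]) (use True in auto)
 next
  case False
  show ?thesis by (rule that[of "Max (lam ` I)"]) (use False ord in auto)
 qed
 have "(\<Sum>j\<in>UNIV. lam j * c j) - (\<Sum>a\<in>I. lam a) = (\<Sum>a\<in>I. (\<mu> - lam a) * (1 - c a)) + (\<Sum>j\<in>-I. (lam j - \<mu>) * c j)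
   + \<mu> * ((\<Sum>j\<in>UNIV. c j) - real (card I))"
  unfolding sum_split_Compl[of _ I]
  by (simp add: algebra_simps sum.distrib sum_subtractf sum_distrib_left)
 also have "... >= 0"
 proof -
  have "0 <= (\<Sum>a\<in>I. (\<mu> - lam a) * (1 - c a))" "0 <= (\<Sum>j\<in>-I. (lam j - \<mu>) * c j)"
   using \<mu> c(1,2) by (auto intro!: sum_nonneg mult_nonneg_nonneg)
  then show ?thesis unfolding c(3) by simp
 qed
 finally show ?thesis unfolding frame_trace_eigenbasis[OF b l] c_def by simp
qed

lemma k_smallest_exists:
 fixes f :: "'n::finite => real"
 assumes "k <= CARD('n)"
 obtains J where "card J = k" "!!a j. a : J ==> j \<notin> J ==> f a <= f j"
proof -
 have "\<exists>J. card J = k \<and> (\<forall>a\<in>J. \<forall>j\<in>-J. f a <= f j)" using assms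
 proof (induction k)
  case 0
  show ?case by (rule exI[of _ "{}"]) auto
 next
  case (Suc k)
  then obtain J where J: "card J = k" "\<forall>a\<in>J. \<forall>j\<in>-J. f a <= f j" by auto
  have "J ~= UNIV" using J(1) Suc.prems by auto
  then have "-J ~= {}" by auto
  then obtain m where m: "m : -J" "\<forall>j\<in>-J. f m <= f j"
   using ex_is_arg_min_if_finite[of "-J" f] by (auto simp: is_arg_min_linorder)
  have "card (insert m J) = Suc k" using m J by simp
  moreover have "\<forall>a\<in>insert m J. \<forall>j\<in>- insert m J. f a <= f j" using m J by auto
  ultimately show ?case by blast
 qed
 then show ?thesis using that by auto
qed

text \<open>\<open>I\<close> stays fixed while the point moves; instead the eigenbasis is relabelled
  so that the smallest eigenvalues sit on \<open>I\<close>. Frames at different points thus share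
  one index set.\<close>

lemma ordered_eigenbasis:
 fixes A :: "real^'n^'n"
 assumes "transpose A = A"
 obtains b lam where "orthobasis b" "!!j. A *v b j = lam j *R b j" "!!a j. a : I ==> j \<notin> I ==> lam a <= lam j"
proof -
 obtain b l where b: "orthobasis b" and l: "!!i. A *v b i = l i *R b i" using symmetric_eigenbasis[OF assms] by blast
 obtain J where J: "card J = card I" "!!a j. a : J ==> j \<notin> J ==> l a <= l j"
  using k_smallest_exists[of "card I" l] card_mono[of UNIV I] by auto
 have "card (-I) = card (-J)" using J(1) by (simp add: Compl_eq_Diff_UNIV card_Diff_subset)
 then obtain f g where f: "bij_betw f I J" and g: "bij_betw g (-I) (-J)"
  using J(1) finite_same_card_bij[of I J] finite_same_card_bij[of "-I" "-J"] by auto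
 define \<pi> where "\<pi> i = (if i : I then f i else g i)" for i
 have f': "\<pi> i : J" if "i : I" for i using f that by (auto simp: \<pi>_def bij_betw_def)
 have g': "\<pi> i \<notin> J" if "i \<notin> I" for i using g that by (auto simp: \<pi>_def bij_betw_def)
 have inj: "\<pi> i = \<pi> j \<longleftrightarrow> i = j" for i j
 proof (cases "i : I \<longleftrightarrow> j : I")
  case True
  then show ?thesis using f g unfolding bij_betw_def inj_on_def \<pi>_def by auto
 next
  case False
  then show ?thesis using f' g' by metis
 qed
 show ?thesis
 proof (rule that[of "b \<circ> \<pi>" "l \<circ> \<pi>"])
  show "orthobasis (b \<circ> \<pi>)" using b inj by (simp add: orthobasis_def)
 qed (use l J(2) f' g' in auto)
qed

text \<open>A frame whose Gram matrix dominates the identity can be replaced by an orthonormal one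
  without increasing the trace of any positive semidefinite matrix. Frames may therefore be varied
  along straight lines instead of curves of orthonormal frames.\<close>

lemma frame_shrink:
 fixes c :: "'n => real^'n"
 assumes gram: "!!y. (\<Sum>a\<in>I. (y a)^2) <= (norm (\<Sum>a\<in>I. y a *R c a))^2"
 obtains w where "orthonormal_on I w" "!!A. pos_semidef A ==> (\<Sum>a\<in>I. w a \<bullet> (A *v w a)) <= (\<Sum>a\<in>I. c a \<bullet> (A *v c a))"
proof -
 have zero: "y a = 0" if "(\<Sum>a\<in>I. y a *R c a) = 0" "a : I" for y a
 proof -
  have "(\<Sum>a\<in>I. (y a)^2) <= 0" using gram[of y] that(1) by simp
  then have "(\<Sum>a\<in>I. (y a)^2) = 0" by (simp add: order_antisym sum_nonneg)
  then show ?thesis using that(2) by (simp add: sum_nonneg_eq_0_iff)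
 qed
 have inj: "inj_on c I"
 proof (rule inj_onI, rule ccontr)
  fix a a' assume a: "a : I" "a' : I" "c a = c a'" "a ~= a'"
  define y where "y i = (if i = a then 1 else 0) - (if i = a' then 1 else (0::real))" for i
  have "(\<Sum>i\<in>I. y i *R c i) = (\<Sum>i\<in>I. (if i = a then c a else 0)) - (\<Sum>i\<in>I. if i = a' then c a' else 0)"
   unfolding sum_subtractf[symmetric] by (rule sum.cong) (auto simp: y_def)
  also have "... = 0" using a by simp
  finally have "y a = 0" using zero a(1) by blast
  then show False using a(4) by (simp add: y_def)
 qed
 have indep: "independent (c ` I)"
 proof (rule independent_if_scalars_zero)
  fix f x assume s: "(\<Sum>x\<in>c ` I. f x *R x) = 0" and x: "x : c ` I"
  then obtain a where a: "a : I" "x = c a" by auto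
  have "(\<Sum>a\<in>I. f (c a) *R c a) = 0" using s by (simp add: sum.reindex[OF inj])
  then show "f x = 0" using zero[of "%a. f (c a)"] a by simp
 qed simp
 obtain O' where O': "O' \<subseteq> span (c ` I)" "pairwise orthogonal O'" "!!x. x : O' ==> norm x = 1" "card O' = dim (span (c ` I))" "independent O'"
  using orthonormal_basis_subspace[OF subspace_span, of "c ` I"] by metis
 have cO: "card O' = card I" using O'(4) indep by (simp add: dim_eq_card_independent card_image[OF inj])
 have "finite O'" using O'(5) independent_imp_finite by blast
 then obtain w where w: "bij_betw w I O'" using finite_same_card_bij[of I O'] cO by auto
 have won: "orthonormal_on I w"
  unfolding orthonormal_on_def
 proof (intro ballI)
  fix i j assume ij: "i : I" "j : I"
  then have wO: "w i : O'" "w j : O'" "w i = w j \<longleftrightarrow> i = j" using w by (auto simp: bij_betw_def inj_on_def)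
  show "w i \<bullet> w j = (if i = j then 1 else 0)"
   using O'(2,3) wO by (auto simp: pairwise_def orthogonal_def norm_eq_1)
 qed
 \<comment> \<open>In matrix terms: the projection onto the span of \<open>c\<close> is at most the
   sum of the matrices c c^T. \<open>z\<close> is the projection of \<open>e\<close>, expanded in
   the frame \<open>c\<close>; Cauchy-Schwarz together with \<open>gram\<close> bounds its
   square.\<close>
 have key: "(\<Sum>a\<in>I. (e \<bullet> w a)^2) <= (\<Sum>a\<in>I. (e \<bullet> c a)^2)" for e
 proof -
  define z where "z = (\<Sum>a\<in>I. (w a \<bullet> e) *R w a)"
  have zz: "z \<bullet> z = (\<Sum>i\<in>I. (w i \<bullet> e)^2)"
  proof -
   have "z \<bullet> z = (\<Sum>i\<in>I. \<Sum>j\<in>I. if i = j then (w i \<bullet> e)^2 else 0)"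
    unfolding z_def inner_sum_left inner_sum_right
    by (intro sum.cong refl) (use won in \<open>auto simp: orthonormal_on_def sq_eq\<close>)
   then show ?thesis by simp
  qed
  have perp: "w i \<bullet> (e - z) = 0" if "i : I" for i
  proof -
   have "w i \<bullet> z = (\<Sum>j\<in>I. if i = j then w i \<bullet> e else 0)"
    unfolding z_def inner_sum_right by (intro sum.cong refl) (use won that in \<open>auto simp: orthonormal_on_def\<close>)
   then show ?thesis using that by (simp add: inner_diff_right)
  qed
  have spanO: "span O' = span (c ` I)"
  proof (rule subset_antisym)
   show "span O' \<subseteq> span (c ` I)" using O'(1) by (simp add: span_minimal subspace_span)
   show "span (c ` I) \<subseteq> span O'"
    using card_ge_dim_independent[OF O'(1,5)] O'(4) by (simp add: subset_trans[OF span_minimal] subspace_span)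
  qed
  have cspan: "c a \<bullet> (e - z) = 0" if "a : I" for a
  proof -
   have "c a : span O'" unfolding spanO using that by (intro span_base) auto
   moreover have "orthogonal (e - z) x" if xO: "x : O'" for x
   proof -
    obtain i where "i : I" "x = w i" using w xO by (auto simp: bij_betw_def)
    then show ?thesis using perp by (simp add: orthogonal_def inner_commute)
   qed
   ultimately have "orthogonal (e - z) (c a)" using orthogonal_to_span by blast
   then show ?thesis by (simp add: orthogonal_def inner_commute)
  qed
  have "z : span (c ` I)" unfolding z_def using O'(1) w by (intro span_sum span_scale) (auto simp: bij_betw_def)
  then obtain u where u: "z = (\<Sum>x\<in>c ` I. u x *R x)" using span_finite[of "c ` I"] by auto
  define y where "y a = u (c a)" for a
  have zy: "z = (\<Sum>a\<in>I. y a *R c a)" unfolding u y_def by (simp add: sum.reindex[OF inj])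
  define C where "C = (\<Sum>a\<in>I. (e \<bullet> c a)^2)"
  have "z \<bullet> z = (\<Sum>a\<in>I. y a * (e \<bullet> c a))"
  proof -
   have "z \<bullet> z = z \<bullet> (\<Sum>a\<in>I. y a *R c a)" using zy by simp
   also have "... = (\<Sum>a\<in>I. y a * (z \<bullet> c a))" by (simp add: inner_sum_right)
   also have "... = (\<Sum>a\<in>I. y a * (e \<bullet> c a))"
    using cspan by (intro sum.cong refl) (simp add: inner_diff_right inner_commute)
   finally show ?thesis .
  qed
  then have "(z \<bullet> z)^2 = (\<Sum>a\<in>I. y a * (e \<bullet> c a))^2" by simp
  also have "... <= (\<Sum>a\<in>I. (y a)^2) * C" unfolding C_def by (rule sum_cs)
  also have "... <= (z \<bullet> z) * C"
   using gram[of y] unfolding zy[symmetric] norm_sq by (intro mult_right_mono) (auto simp: C_def sum_nonneg)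
  finally have "(z \<bullet> z) * (z \<bullet> z) <= (z \<bullet> z) * C" by (simp add: sq_eq)
  then have "z \<bullet> z <= C"
   by (cases "z = 0") (auto simp: C_def sum_nonneg)
  then show ?thesis unfolding zz C_def by (simp add: inner_commute)
 qed
 show ?thesis
 proof (rule that[OF won])
  fix A :: "real^'n^'n" assume A: "pos_semidef A"
  then have "transpose A = A" by (simp add: pos_semidef_def)
  then obtain b l where b: "orthobasis b" and l: "!!i. A *v b i = l i *R b i" using symmetric_eigenbasis by blast
  have "l i >= 0" for i using pos_semidef_eigenvalue_nonneg[OF A l] b by (simp add: orthobasis_def)
  then show "(\<Sum>a\<in>I. w a \<bullet> (A *v w a)) <= (\<Sum>a\<in>I. c a \<bullet> (A *v c a))"
   unfolding frame_trace_eigenbasis[OF b l] using key by (intro sum_mono) (rule mult_left_mono)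
 qed
qed

text \<open>Every product \<open>l j * c j\<close> vanishes, so the weights live on the kernel. Each
  is at most 1 and their total is \<open>card I\<close>, hence the kernel has at least this
  dimension.\<close>

lemma frame_zero_imp_rank_le:
 fixes A :: "real^'n^'n"
 assumes A: "pos_semidef A" and w: "orthonormal_on I w" and z: "(\<Sum>i\<in>I. w i \<bullet> (A *v w i)) = 0"
 shows "rank A + card I <= CARD('n)"
proof -
 have "transpose A = A" using A by (simp add: pos_semidef_def)
 then obtain b l where b: "orthobasis b" and l: "!!i. A *v b i = l i *R b i" using symmetric_eigenbasis by blast
 have lnn: "l i >= 0" for i using pos_semidef_eigenvalue_nonneg[OF A l] b by (simp add: orthobasis_def)
 define c where "c j = (\<Sum>i\<in>I. (b j \<bullet> w i)^2)" for j
 have c: "0 <= c j" "c j <= 1" "(\<Sum>j\<in>UNIV. c j) = real (card I)" for j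
  using frame_weights[OF b w] by (auto simp: c_def intro: sum_nonneg)
 have "(\<Sum>j\<in>UNIV. l j * c j) = 0" using z unfolding frame_trace_eigenbasis[OF b l] c_def .
 then have lc: "l j * c j = 0" for j using lnn c(1) by (subst (asm) sum_nonneg_eq_0_iff) auto
 have "real (card I) = (\<Sum>j\<in>{j. l j = 0}. c j)"
  unfolding c(3)[symmetric] by (rule sum.mono_neutral_right) (use lc in auto)
 also have "... <= (\<Sum>j\<in>{j. l j = 0}. 1)" using c(2) by (intro sum_mono)
 finally have "card I <= card {j. l j = 0}" by simp
 moreover have "card {j. l j = 0} + card {j. l j ~= 0} = CARD('n)"
  using card_Un_disjoint[of "{j. l j = 0}" "{j. l j ~= 0}"] by (simp add: Un_def Int_def)
 ultimately show ?thesis unfolding rank_eigenbasis[OF b l] by linarith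
qed

text \<open>The ordering makes the zero set and \<open>I\<close> nested, and the rank gives them the
  same size.\<close>

lemma ordered_eigenvalues_vanish:
 fixes b :: "'n => real^'n"
 assumes b: "orthobasis b" and l: "!!j. A *v b j = lam j *R b j" and nn: "!!j. 0 <= lam j"
  and ord: "!!a j. a : I ==> j \<notin> I ==> lam a <= lam j" and rk: "rank A + card I = CARD('n)"
 shows "lam j = 0 \<longleftrightarrow> j : I"
proof -
 define Z where "Z = {j. lam j = 0}"
 have "card Z + card {j. lam j ~= 0} = CARD('n)"
  using card_Un_disjoint[of Z "{j. lam j ~= 0}"] by (simp add: Z_def Un_def Int_def)
 then have cZ: "card Z = card I" using rk unfolding rank_eigenbasis[OF b l] by linarith
 have "Z \<subseteq> I \<or> I \<subseteq> Z"
 proof (rule ccontr)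
  assume "\<not> (Z \<subseteq> I \<or> I \<subseteq> Z)"
  then obtain j a where "j : Z" "j \<notin> I" "a : I" "a \<notin> Z" by blast
  then show False using ord[of a j] nn[of a] by (simp add: Z_def)
 qed
 then have "Z = I" using cZ card_subset_eq[of I Z] card_subset_eq[of Z I] by auto
 then show ?thesis by (auto simp: Z_def)
qed

lemma second_derivative_test:
 fixes F F1 :: "real => real"
 assumes d: "dla > 0" and F: "!!t. \<bar>t\<bar> < dla ==> (F has_real_derivative F1 t) (at t)" and F1: "(F1 has_real_derivative F2) (at 0)"
  and min: "!!t. \<bar>t\<bar> < dla ==> F 0 <= F t"
 shows "F1 0 = 0" and "0 <= F2"
proof -
 show F10: "F1 0 = 0" by (rule DERIV_local_min[OF F d]) (use d min in auto)
 show "0 <= F2"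
 proof (rule ccontr)
  assume "\<not> 0 <= F2"
  then obtain e where e: "e > 0" "!!h. 0 < h ==> h < e ==> F1 (0 + h) < F1 0"
   using DERIV_neg_dec_right[OF F1] by auto
  define h where "h = min e dla / 2"
  have h: "0 < h" "h < e" "h < dla" using e d by (auto simp: h_def)
  obtain z where z: "0 < z" "z < h" "F h - F 0 = (h - 0) * F1 z"
   using MVT2[OF h(1), of F F1] F h by force
  have "F1 z < 0" using e(2)[of z] z h F10 by simp
  then have "F h < F 0" using z h by (simp add: mult_pos_neg) (smt (verit) mult_pos_neg)
  then show False using min[of h] h by simp
 qed
qed

text \<open>On symmetric matrices the linear form is the pairing with a symmetric matrix. Its
  eigenbasis reduces the linearised operator to pure second derivatives in finitely many directions,
  each of which can be given its own variation of the frame.\<close>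

lemma Phi_eigen_directions:
 fixes M :: "real^'n^'n"
 obtains ob ta where "orthobasis ob" "!!i. ta i = 2 * Phi p M (outer_prod (ob i) (ob i))"
  "!!V. transpose V = V ==> 2 * Phi p M V = (\<Sum>i\<in>UNIV. ta i * (ob i \<bullet> (V *v ob i)))"
proof -
 define E where "E i j = outer_prod (axis i 1) (axis j (1::real))" for i j :: 'n
 define T where "T = (\<chi> i j. Phi p M (E i j) + Phi p M (E j i))"
 have expand: "V = (\<Sum>i\<in>UNIV. \<Sum>j\<in>UNIV. V $ i $ j *R E i j)" for V :: "real^'n^'n"
  by (simp add: vec_eq_iff E_def outer_prod_def axis_def if_distrib[of "%x. _ * x"] cong: if_cong)
 have TV: "T \<bullet> V = 2 * Phi p M V" if "transpose V = V" for V
 proof -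
  have Vs: "V $ i $ j = V $ j $ i" for i j using symmetric_component[OF that] .
  have P: "Phi p M V = (\<Sum>i\<in>UNIV. \<Sum>j\<in>UNIV. V $ i $ j * Phi p M (E i j))"
   by (subst expand) (simp add: Phi_sum_right Phi_scale_right)
  have "T \<bullet> V = (\<Sum>i\<in>UNIV. \<Sum>j\<in>UNIV. V $ i $ j * Phi p M (E i j)) + (\<Sum>i\<in>UNIV. \<Sum>j\<in>UNIV. V $ i $ j * Phi p M (E j i))"
   by (simp add: T_def inner_vec_def distrib_left sum.distrib mult.commute)
  also have "(\<Sum>i\<in>UNIV. \<Sum>j\<in>UNIV. V $ i $ j * Phi p M (E j i)) = (\<Sum>i\<in>UNIV. \<Sum>j\<in>UNIV. V $ i $ j * Phi p M (E i j))"
   by (subst sum.swap) (intro sum.cong refl, metis Vs)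
  finally show ?thesis unfolding P by simp
 qed
 have "transpose T = T" by (rule symmetricI) (simp add: T_def)
 then obtain ob ta where ob: "orthobasis ob" and ta: "!!i. T *v ob i = ta i *R ob i" using symmetric_eigenbasis by blast
 show ?thesis
 proof (rule that[OF ob])
  fix i
  have "2 * Phi p M (outer_prod (ob i) (ob i)) = T \<bullet> outer_prod (ob i) (ob i)" by (rule TV[symmetric]) (rule transpose_outer_prod)
  also have "... = ta i" using ob by (simp add: inner_outer_prod ta orthobasis_def)
  finally show "ta i = 2 * Phi p M (outer_prod (ob i) (ob i))" by simp
 next
  fix V :: "real^'n^'n" assume "transpose V = V"
  from TV[OF this] show "2 * Phi p M V = (\<Sum>i\<in>UNIV. ta i * (ob i \<bullet> (V *v ob i)))"
   by (simp add: orthobasis_matrix_inner[OF ob] ta)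
 qed
qed

section \<open>The barrier comparison at a touching ball\<close>

lemma barrier_derivatives:
 fixes x y e :: "real^'n" and al :: real
 defines "ph \<equiv> %t. exp (- al * (norm (x + t *R e - y))^2)"
 shows "(ph has_real_derivative - 2 * al * ((x + t *R e - y) \<bullet> e) * ph t) (at t)"
  and "((%t. - 2 * al * ((x + t *R e - y) \<bullet> e) * ph t) has_real_derivative
   (4 * al^2 * ((x + t *R e - y) \<bullet> e)^2 - 2 * al * (e \<bullet> e)) * ph t) (at t)"
proof -
 have n: "(norm (x + t *R e - y))^2 = (x - y) \<bullet> (x - y) + 2 * t * ((x - y) \<bullet> e) + t^2 * (e \<bullet> e)" for t
  unfolding norm_sq
  by (simp add: inner_add_left inner_add_right inner_diff_left inner_diff_right inner_commute sq_eq algebra_simps)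
 have i: "(x + t *R e - y) \<bullet> e = (x - y) \<bullet> e + t * (e \<bullet> e)" for t
  by (simp add: inner_add_left inner_diff_left)
 show a: "(ph has_real_derivative - 2 * al * ((x + t *R e - y) \<bullet> e) * ph t) (at t)" for t
  unfolding ph_def n i by (auto intro!: derivative_eq_intros simp: algebra_simps)
 have b: "((%t. - 2 * al * ((x + t *R e - y) \<bullet> e)) has_real_derivative - 2 * al * (e \<bullet> e)) (at t)"
  unfolding i by (auto intro!: derivative_eq_intros)
 show "((%t. - 2 * al * ((x + t *R e - y) \<bullet> e) * ph t) has_real_derivative
   (4 * al^2 * ((x + t *R e - y) \<bullet> e)^2 - 2 * al * (e \<bullet> e)) * ph t) (at t)"
  by (rule DERIV_cong[OF DERIV_mult[OF b a]]) (simp add: sq_eq algebra_simps)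
qed

text \<open>Expansion of the difference: both diagonal terms vanish because the matrices have rank
  at most one, and the mixed term is nonnegative and enters with a minus sign.\<close>

lemma Phi_rank_le_1_nonpos:
 fixes B :: "real^'n^'n"
 assumes B: "pos_semidef B" and rk: "rank B <= 1" and s: "s > 0" and p: "p = (2 * s) *R q"
 shows "Phi p (s *R B - outer_prod q q) (s *R B - outer_prod q q) <= 0"
proof -
 have tB: "transpose B = B" using B by (simp add: pos_semidef_def)
 obtain b l where b: "orthobasis b" and l: "!!i. B *v b i = l i *R b i" using symmetric_eigenbasis[OF tB] by blast
 have lnn: "l i >= 0" for i using pos_semidef_eigenvalue_nonneg[OF B l] b by (simp add: orthobasis_def)
 have "card {i. l i ~= 0} <= 1" using rk unfolding rank_eigenbasis[OF b l] .
 then obtain k where k: "{i. l i ~= 0} \<subseteq> {k}"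
  by (metis card_le_Suc0_iff_eq finite One_nat_def insertCI subsetI)
 have Bk: "B = l k *R outer_prod (b k) (b k)"
 proof -
  have "B = (\<Sum>i\<in>UNIV. l i *R outer_prod (b i) (b i))" by (rule eigenbasis_symmetric_matrix[OF b l])
  also have "... = (\<Sum>i\<in>{k}. l i *R outer_prod (b i) (b i))" by (rule sum.mono_neutral_right) (use k in auto)
  finally show ?thesis by simp
 qed
 define m where "m = s *R B"
 have m: "m = (s * l k) *R outer_prod (b k) (b k)" unfolding m_def by (subst Bk) simp
 have bk: "b k \<bullet> b k = 1" using b by (simp add: orthobasis_def)
 have tm: "transpose m = m" by (simp add: m_def transpose_scaleR' tB)
 define E where "E = outer_prod (b k) (b k)"
 have EE: "Phi p E E = 0"
  by (simp add: E_def Phi_def S2_def Theta_def trace_outer_prod inner_outer_prod outer_prod_mult bk inner_commute sq_eq)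
 have mm: "Phi p m m = 0" unfolding m E_def[symmetric] by (simp add: Phi_scale_left Phi_scale_right EE)
 have qq: "Phi p (outer_prod q q) (outer_prod q q) = 0"
  by (simp add: Phi_def Theta_rank_one_self[OF p transpose_outer_prod] S2_def trace_outer_prod inner_outer_prod outer_prod_mult)
 have "Phi p m (outer_prod q q) = (s * l k) * ((q \<bullet> q - (q \<bullet> b k)^2) / 2)"
 proof -
  have "Phi p m (outer_prod q q) = S2 m (outer_prod q q)"
   by (simp add: Phi_def Theta_commute[of p m] Theta_rank_one_self[OF p tm])
  then show ?thesis
   by (simp add: m S2_def trace_scaleR trace_outer_prod inner_outer_prod outer_prod_mult bk scaleR_mv inner_commute sq_eq field_simps)
 qed
 moreover have "(q \<bullet> b k)^2 <= q \<bullet> q"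
  using Cauchy_Schwarz_ineq[of q "b k"] bk by simp
 moreover have "0 <= (s * l k) * ((q \<bullet> q - (q \<bullet> b k)^2) / 2)"
  using calculation s lnn[of k] by (intro mult_nonneg_nonneg) auto
 ultimately have "0 <= Phi p m (outer_prod q q)" by simp
 then show ?thesis
  unfolding m_def[symmetric] by (simp add: Phi_minus_left Phi_minus_right mm qq Phi_commute[of p "outer_prod q q" m])
qed

text \<open>If \<open>lam j\<close> were small for some \<open>j\<close> off \<open>I\<close>, the
  frame on \<open>I\<close> and \<open>j\<close> would have small trace for \<open>B0\<close>. But
  it has one vector more than the kernel of \<open>B0\<close> has dimensions, so that trace is at
  least the smallest nonzero eigenvalue. Continuity of individual eigenvalues is thereby
  avoided.\<close>

lemma eigenvalue_gap:
 fixes B0 :: "real^'n^'n"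
 assumes B0: "pos_semidef B0" and rk: "rank B0 + card I = CARD('n)" and I: "I ~= UNIV"
 obtains c0 rh where "c0 > 0" "rh > 0"
  "!!B b lam j. [|norm (B - B0) <= rh; orthobasis b; !!j. B *v b j = lam j *R b j; !!a j. a : I ==> j \<notin> I ==> lam a <= lam j; j \<notin> I|]
   ==> c0 <= lam j"
proof -
 define n where "n = real CARD('n)"
 have n1: "n >= 1" by (simp add: n_def)
 have tB0: "transpose B0 = B0" using B0 by (simp add: pos_semidef_def)
 obtain b0 l0 where b0: "orthobasis b0" and l0: "!!j. B0 *v b0 j = l0 j *R b0 j" and ord0: "!!a j. a : I ==> j \<notin> I ==> l0 a <= l0 j"
  using ordered_eigenbasis[OF tB0, of I] by blast
 have l0nn: "0 <= l0 j" for j using pos_semidef_eigenvalue_nonneg[OF B0 l0] b0 by (simp add: orthobasis_def)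
 have van: "l0 j = 0 \<longleftrightarrow> j : I" for j by (rule ordered_eigenvalues_vanish[OF b0 l0 l0nn ord0 rk])
 define c where "c = Min (l0 ` (-I))"
 have neI: "-I ~= {}" using I by auto
 have c: "c > 0" "!!j. j \<notin> I ==> c <= l0 j"
 proof -
  have "c : l0 ` (-I)" unfolding c_def using neI by (intro Min_in) auto
  then obtain j where "j \<notin> I" "c = l0 j" by auto
  then show "c > 0" using van[of j] l0nn[of j] by (simp add: less_le)
  show "!!j. j \<notin> I ==> c <= l0 j" unfolding c_def by (intro Min_le) auto
 qed
 show thesis
 proof (rule that[of "c / (2 * n)" "c / (2 * n)"])
  show "c / (2 * n) > 0" "c / (2 * n) > 0" using c n1 by auto
  fix B b lam j
  assume B: "norm (B - B0) <= c / (2 * n)" and b: "orthobasis b" and lam: "!!j. B *v b j = lam j *R b j"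
   and ord: "!!a j. a : I ==> j \<notin> I ==> lam a <= lam j" and j: "j \<notin> I"
  have bb: "b i \<bullet> b k = (if i = k then 1 else 0)" for i k using b by (simp add: orthobasis_def)
  have nb: "norm (b k) = 1" for k using bb[of k k] by (simp add: norm_eq_1)
  define J where "J = insert j I"
  have J: "orthonormal_on J b" by (simp add: orthonormal_on_def bb)
  have cJ: "real (card J) = real (card I) + 1" using j by (simp add: J_def)
  have cn: "real (card J) <= n" by (simp add: n_def card_mono)
  define w where "w k = (\<Sum>i\<in>J. (b0 k \<bullet> b i)^2)" for k
  have w: "0 <= w k" "w k <= 1" "(\<Sum>k\<in>UNIV. w k) = real (card J)" for k
   using frame_weights[OF b0 J] by (auto simp: w_def intro: sum_nonneg)
  \<comment> \<open>The total weight is \<open>card I + 1\<close>, and the indices in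
    \<open>I\<close> carry at most \<open>card I\<close> of it.\<close>
  have "1 <= (\<Sum>k\<in>-I. w k)"
  proof -
   have "(\<Sum>k\<in>I. w k) <= (\<Sum>k\<in>I. 1)" using w(2) by (intro sum_mono)
   then show ?thesis using w(3) unfolding sum_split_Compl[of _ I] cJ by simp
  qed
  then have "c * 1 <= c * (\<Sum>k\<in>-I. w k)" using c by (intro mult_left_mono) auto
  also have "... <= (\<Sum>k\<in>-I. l0 k * w k)" unfolding sum_distrib_left using c(2) w(1) by (intro sum_mono mult_right_mono) auto
  also have "... <= (\<Sum>k\<in>UNIV. l0 k * w k)" using l0nn w(1) by (intro sum_mono2) auto
  also have "... = (\<Sum>i\<in>J. b i \<bullet> (B0 *v b i))" unfolding w_def by (rule frame_trace_eigenbasis[OF b0 l0, symmetric])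
  also have "... <= (\<Sum>i\<in>J. lam j + c / (2 * n))"
  proof (rule sum_mono)
   fix i assume i: "i : J"
   have "b i \<bullet> (B0 *v b i) = lam i - b i \<bullet> ((B - B0) *v b i)"
    by (simp add: diff_mv inner_diff_right lam bb)
   moreover have "\<bar>b i \<bullet> ((B - B0) *v b i)\<bar> <= c / (2 * n)"
   proof -
    have "\<bar>b i \<bullet> ((B - B0) *v b i)\<bar> <= norm (b i) * norm ((B - B0) *v b i)" by (rule Cauchy_Schwarz_ineq2)
    also have "... <= c / (2 * n)" using norm_matrix_vector_le[of "B - B0" "b i"] B by (simp add: nb)
    finally show ?thesis .
   qed
   moreover have "lam i <= lam j" using i ord[of i j] j by (auto simp: J_def)
   ultimately show "b i \<bullet> (B0 *v b i) <= lam j + c / (2 * n)" by linarith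
  qed
  also have "... = real (card J) * (lam j + c / (2 * n))" by simp
  finally have le: "c <= real (card J) * (lam j + c / (2 * n))" by simp
  show "c / (2 * n) <= lam j"
  proof (rule ccontr)
   assume "\<not> c / (2 * n) <= lam j"
   then have "lam j + c / (2 * n) < c / n" by (simp add: field_simps)
   moreover have "real (card J) > 0" using cJ by simp
   ultimately have "real (card J) * (lam j + c / (2 * n)) < real (card J) * (c / n)" by (rule mult_strict_left_mono)
   also have "... <= n * (c / n)" using cn c n1 by (intro mult_right_mono) auto
   also have "... = c" using n1 by simp
   finally show False using le by simp
  qed
 qed
qed

lemma pos_semidef_frame_nonneg: "pos_semidef A ==> 0 <= (\<Sum>i\<in>I. w i \<bullet> (A *v w i))"
 by (intro sum_nonneg) (simp add: pos_semidef_def)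

text \<open>A frame is encoded as a full matrix; the rows off \<open>I\<close> are set to zero to
  keep the set bounded.\<close>

lemma compact_frames: "compact {w :: real^'n^'n. orthonormal_on I (%i. w $ i) \<and> (\<forall>i\<in>-I. w $ i = 0)}" (is "compact ?F")
proof (rule compact_eq_bounded_closed[THEN iffD2], intro conjI)
 have "norm w <= real CARD('n)" if w: "w : ?F" for w
 proof -
  have "norm w <= (\<Sum>i\<in>UNIV. norm (w $ i))" unfolding norm_vec_def[of w] by (rule L2_set_le_sum) simp
  also have "... <= (\<Sum>i\<in>(UNIV::'n set). 1)"
  proof (rule sum_mono)
   fix i
   show "norm (w $ i) <= 1"
    using w by (cases "i : I") (auto simp: orthonormal_on_def norm_eq_1[THEN iffD2])
  qed
  finally show ?thesis by simp
 qed
 then show "bounded ?F" unfolding bounded_iff by blast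
 have "?F = (\<Inter>i\<in>I. \<Inter>j\<in>I. {w. w $ i \<bullet> w $ j = (if i = j then 1 else 0)}) \<inter> (\<Inter>i\<in>-I. {w. w $ i = 0})"
  by (auto simp: orthonormal_on_def)
 also have "closed ..."
  by (intro closed_Int closed_INT ballI closed_Collect_eq continuous_intros)
 finally show "closed ?F" .
qed

text \<open>The minimum is taken jointly over points and frames. This makes the minimised function
  twice differentiable along lines of points and frames, while the sum of the smallest eigenvalues
  itself may fail to be.\<close>

lemma touching_ball_impossible:
 fixes v :: "real^'n => real" and I :: "'n set"
 assumes S: "open S" and v: "Ck_on 4 v S" and vneg: "!!x. x : S ==> v x < 0" and psd: "!!x. x : S ==> pos_semidef (hessian v x)"
 defines "p \<equiv> %x. (2 * (- v x)) *R gradient v x" and "M \<equiv> %x. (- v x) *R hessian v x - outer_prod (gradient v x) (gradient v x)"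
 assumes eq: "!!x. x : S ==> Phi (p x) (M x) (M x) = 1 / 4"
  and ell: "!!x e. x : S ==> e ~= 0 ==> 0 < Phi (p x) (M x) (outer_prod e e)"
  and x0: "x0 : S" "rank (hessian v x0) + card I = CARD('n)" and I: "card (-I) >= 2"
  and R: "R > 0" "dist x0 y = R"
  and touch: "!!x. x : S ==> x : cball y R ==> rank (hessian v x) + card I <= CARD('n) ==> x = x0"
 shows False
proof -
 define B where "B = hessian v"
 define n where "n = real CARD('n)"
 have n1: "n >= 1" by (simp add: n_def)
 have contB: "continuous_on S B" unfolding B_def by (rule hessian_continuous[OF S v])
 have contq: "continuous_on S (gradient v)" by (rule gradient_continuous[OF S v])
 have contv: "continuous_on S v" by (rule Ck_on_continuous[OF v])
 have "I ~= UNIV" using I by auto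
 from eigenvalue_gap[OF psd[OF x0(1)] x0(2) this]
 obtain c0 rh where c0: "c0 > 0" and rh: "rh > 0"
  and gap: "!!A b lam j. [|norm (A - hessian v x0) <= rh; orthobasis b; !!j. A *v b j = lam j *R b j; !!a j. a : I ==> j \<notin> I ==> lam a <= lam j; j \<notin> I|] ==> c0 <= lam j"
  by blast
 \<comment> \<open>At most half of \<open>R\<close> keeps the neighbourhood away from the centre
   \<open>y\<close>, where the barrier has no slope. Twice the radius stays in \<open>S\<close> for
   the sake of the third-derivative bound.\<close>
 obtain dla where dla: "dla > 0" "cball x0 (2 * dla) \<subseteq> S" "dla <= R / 2" "!!x. x : cball x0 dla ==> norm (B x - B x0) <= rh"
 proof -
  obtain e1 where e1: "e1 > 0" "cball x0 e1 \<subseteq> S" using open_contains_cball[of S] S x0 by blast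
  obtain e2 where e2: "e2 > 0" "!!x. x : S ==> dist x x0 < e2 ==> dist (B x) (B x0) < rh"
   using contB x0(1) rh unfolding continuous_on_iff by blast
  define d where "d = min (e1 / 2) (min (e2 / 2) (R / 2))"
  have d: "d > 0" "2 * d <= e1" "d < e2" "d <= R / 2" using e1 e2 R by (auto simp: d_def)
  show thesis
  proof (rule that[OF d(1) _ d(4)])
   show sub: "cball x0 (2 * d) \<subseteq> S" using d e1 by (auto simp: subset_eq)
   fix x assume "x : cball x0 d"
   then have "x : S" "dist x x0 < e2" using sub d by (auto simp: subset_eq dist_commute)
   then show "norm (B x - B x0) <= rh" using e2(2) by (simp add: dist_norm less_imp_le)
  qed
 qed
 define D where "D = cball x0 dla"
 have DS: "D \<subseteq> S" using dla by (auto simp: D_def subset_eq)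
 have contM: "continuous_on D M" and contp: "continuous_on D p"
  unfolding M_def p_def B_def[symmetric]
  by (intro continuous_intros bounded_bilinear.continuous_on[OF bounded_bilinear_outer_prod]
    continuous_on_subset[OF contB DS] continuous_on_subset[OF contq DS] continuous_on_subset[OF contv DS])+
 obtain th La where th: "th > 0" "!!x e. x : D ==> norm e = 1 ==> th <= Phi (p x) (M x) (outer_prod e e)"
  and La: "!!x e. x : D ==> norm e = 1 ==> Phi (p x) (M x) (outer_prod e e) <= La"
 proof (rule uniform_ellipticity[OF _ _ contp contM])
  show "compact D" "D ~= {}" using dla by (auto simp: D_def)
  show "0 < Phi (p x) (M x) (outer_prod e e)" if "x : D" "e ~= 0" for x e using that DS by (intro ell) auto
 qed blast
 have Lap: "La > 0" using th(1) th(2)[of x0 "axis undefined 1"] La[of x0 "axis undefined 1"] dla by (simp add: D_def norm_axis_1)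
 obtain C et where C: "C >= 0" and et: "et > 0" and main: "!!x b lam T. [|x : cball x0 dla; orthobasis b; !!j. hessian v x *v b j = lam j *R b j; card T >= 2;
    !!j. j : T ==> c0 <= lam j; (\<Sum>j\<in>-T. lam j) <= et|] ==>
   (\<Sum>a\<in>-T. 2 * Phi (p x) (M x) (mdir (%x. mdir (hessian v) x (b a)) x (b a))
    - 4 * Phi (p x) (M x) (\<Sum>j\<in>T. (1 / lam j) *R outer_prod (mdir (hessian v) x (b a) *v b j) (mdir (hessian v) x (b a) *v b j)))
   <= C * ((\<Sum>j\<in>-T. lam j) + norm (\<Sum>a\<in>-T. mdir (hessian v) x (b a) *v b a))"
  using main_estimate[OF S v vneg psd dla(1,2) c0 eq[unfolded p_def M_def] ell[unfolded p_def M_def]] unfolding p_def M_def by blast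
 \<comment> \<open>Collects what the barrier has to beat at the end: \<open>4 * n * La\<close> from
   its own second derivatives, \<open>4 * C * R\<close> from its gradient, and \<open>C + 1\<close>
   for the constant with a strict margin. The barrier yields \<open>2 * th * al^2 * R^2\<close>,
   which decides the choice of \<open>al\<close>.\<close>
 define k where "k = 4 * n * La + 4 * C * R + C + 1"
 have k: "k > 0" unfolding k_def using n1 Lap C R by (intro add_nonneg_pos add_nonneg_nonneg mult_nonneg_nonneg) auto
 define al where "al = max 1 (k / (2 * th * R^2))"
 have al: "al >= 1" "k <= 2 * th * R^2 * al"
 proof -
  show "al >= 1" by (simp add: al_def)
  have "k / (2 * th * R^2) <= al" by (simp add: al_def)
  moreover have "2 * th * R^2 > 0" using th R by simp
  ultimately show "k <= 2 * th * R^2 * al" by (simp add: pos_divide_le_eq mult.commute)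
 qed
 define ph where "ph x = exp (- al * (norm (x - y))^2)" for x
 define h where "h x = ph x - exp (- al * R^2)" for x
 have h1: "h x <= 1" "h x <= ph x" for x
 proof -
  have "ph x <= 1" using al by (simp add: ph_def)
  moreover have "0 < exp (- al * R^2)" by simp
  ultimately show "h x <= 1" "h x <= ph x" unfolding h_def by linarith+
 qed
 have hneg: "h x < 0" if "x \<notin> cball y R" for x
 proof -
  have "R < norm (x - y)" using that by (simp add: dist_norm norm_minus_commute)
  then have "R^2 < (norm (x - y))^2" using R by (intro power_strict_mono) auto
  then have "- al * (norm (x - y))^2 < - al * R^2" using al by simp
  then show ?thesis by (simp add: h_def ph_def)
 qed
 have hx0: "h x0 = 0" using R by (simp add: h_def ph_def dist_norm)
 define Fr where "Fr = {w :: real^'n^'n. orthonormal_on I (%i. w $ i) \<and> (\<forall>i\<in>-I. w $ i = 0)}"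
 have cFr: "compact Fr" unfolding Fr_def by (rule compact_frames)
 define Ps where "Ps z = (\<Sum>i\<in>I. snd z $ i \<bullet> (B (fst z) *v (snd z $ i)))" for z :: "(real^'n) \<times> (real^'n^'n)"
 have contPs: "continuous_on (D' \<times> Fr) Ps" if "D' \<subseteq> S" for D'
  unfolding Ps_def
  by (intro continuous_intros bounded_bilinear.continuous_on[OF bounded_bilinear_matrix_vector] continuous_on_compose2[OF contB])
   (use that in auto)
 have Psnn: "0 <= Ps (x, w)" if "x : S" for x w
  unfolding Ps_def fst_conv snd_conv B_def by (rule pos_semidef_frame_nonneg[OF psd[OF that]])
 \<comment> \<open>On the part of the small sphere inside the ball the touching hypothesis excludes
   a vanishing trace, so compactness gives a positive lower bound. Outside the ball the barrier is
   negative and no bound is required.\<close>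
 obtain kapa where kapa: "kapa > 0" "!!x w. x : sphere x0 dla ==> x : cball y R ==> w : Fr ==> kapa <= Ps (x, w)"
 proof (cases "(sphere x0 dla \<inter> cball y R) \<times> Fr = {}")
  case True
  show ?thesis by (rule that[of 1]) (use True in auto)
 next
  case False
  have sub: "sphere x0 dla \<inter> cball y R \<subseteq> S" using DS by (auto simp: D_def subset_eq)
  have "compact ((sphere x0 dla \<inter> cball y R) \<times> Fr)" by (intro compact_Times cFr compact_Int compact_sphere compact_cball)
  from continuous_attains_inf[OF this False contPs[OF sub]]
  obtain x w where z: "x : sphere x0 dla" "x : cball y R" "w : Fr"
   and zmin: "!!x' w'. x' : sphere x0 dla ==> x' : cball y R ==> w' : Fr ==> Ps (x, w) <= Ps (x', w')" by auto
  have xS: "x : S" using sub z by auto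
  have "Ps (x, w) ~= 0"
  proof
   assume "Ps (x, w) = 0"
   then have "(\<Sum>i\<in>I. w $ i \<bullet> (hessian v x *v (w $ i))) = 0" by (simp add: Ps_def B_def)
   then have "rank (hessian v x) + card I <= CARD('n)"
    using frame_zero_imp_rank_le[OF psd[OF xS], of I "%i. w $ i"] z(3) by (simp add: Fr_def)
   then have "x = x0" by (rule touch[OF xS z(2)])
   then show False using z(1) dla(1) by simp
  qed
  then have "Ps (x, w) > 0" using Psnn[OF xS] by (simp add: less_le)
  then show ?thesis using that zmin by blast
 qed
 \<comment> \<open>Less than \<open>kapa\<close>, so that \<open>G\<close> is positive on the
   sphere, and at most \<open>et\<close>, so that the sum of the small eigenvalues at the minimum is
   in the range of \<open>main\<close>.\<close>
 define eps where "eps = min kapa et / 2"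
 have eps: "eps > 0" "eps < kapa" "eps <= et" using kapa et by (auto simp: eps_def)
 define G where "G z = Ps z - eps * h (fst z)" for z
 have contG: "continuous_on (D \<times> Fr) G"
  unfolding G_def h_def ph_def by (intro continuous_intros contPs[OF DS])
 have frame_of: "(\<chi> i. if i : I then w i else 0) : Fr" "Ps (x, \<chi> i. if i : I then w i else 0) = (\<Sum>i\<in>I. w i \<bullet> (B x *v w i))"
  if "orthonormal_on I w" for w x
  using that by (simp_all add: Fr_def orthonormal_on_def Ps_def)
 have on_basis: "orthonormal_on I b" if "orthobasis b" for b using that by (simp add: orthonormal_on_def orthobasis_def)
 have tB: "transpose (B x) = B x" if "x : S" for x unfolding B_def by (rule hessian_transpose[OF S v that])
 \<comment> \<open>The null vectors of the Hessian at \<open>x0\<close> form a frame of trace zero;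
   as the barrier vanishes there, the minimum of \<open>G\<close> is nonpositive.\<close>
 obtain w0 where w0: "w0 : Fr" "Ps (x0, w0) = 0"
 proof -
  obtain b lam where b: "orthobasis b" and lam: "!!j. B x0 *v b j = lam j *R b j" and ord: "!!a j. a : I ==> j \<notin> I ==> lam a <= lam j"
   using ordered_eigenbasis[OF tB[OF x0(1)], of I] by blast
  have lnn: "0 <= lam j" for j using pos_semidef_eigenvalue_nonneg[OF psd[OF x0(1)] lam[unfolded B_def]] b by (simp add: orthobasis_def)
  have "lam j = 0 \<longleftrightarrow> j : I" for j by (rule ordered_eigenvalues_vanish[OF b lam[unfolded B_def] lnn ord x0(2)])
  then have "(\<Sum>i\<in>I. b i \<bullet> (B x0 *v b i)) = 0" by (intro sum.neutral) (auto simp: lam)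
  then show ?thesis by (intro that[of "\<chi> i. if i : I then b i else 0"]) (simp_all only: frame_of[OF on_basis[OF b]])
 qed
 have "(x0, w0) : D \<times> Fr" using w0 dla by (simp add: D_def)
 then have neDF: "D \<times> Fr ~= {}" by blast
 have cDF: "compact (D \<times> Fr)" by (intro compact_Times cFr) (simp add: D_def)
 obtain z1 where z1: "z1 : D \<times> Fr" "!!z. z : D \<times> Fr ==> G z1 <= G z" using continuous_attains_inf[OF cDF neDF contG] by blast
 obtain x1 w1 where zx: "z1 = (x1, w1)" by (cases z1)
 have x1: "x1 : D" "w1 : Fr" and Gmin: "!!x w. x : D ==> w : Fr ==> G (x1, w1) <= G (x, w)"
  using z1 unfolding zx by auto
 have G0: "G (x1, w1) <= 0" using Gmin[of x0 w0] w0 dla hx0 by (simp add: G_def D_def)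
 have x1S: "x1 : S" using x1 DS by auto
 have inter: "dist x0 x1 < dla"
 proof (rule ccontr)
  assume "\<not> dist x0 x1 < dla"
  then have sp: "x1 : sphere x0 dla" using x1 by (simp add: D_def)
  have "G (x1, w1) > 0"
  proof (cases "x1 : cball y R")
   case True
   have "eps * h x1 <= eps * 1" using h1(1) eps by (intro mult_left_mono) auto
   then show ?thesis using kapa(2)[OF sp True x1(2)] eps unfolding G_def fst_conv by linarith
  next
   case False
   have "eps * h x1 < 0" using hneg[OF False] eps by (simp add: mult_pos_neg)
   then show ?thesis using Psnn[OF x1S, of w1] by (simp add: G_def)
  qed
  then show False using G0 by simp
 qed
 obtain b lam where b: "orthobasis b" and lam: "!!j. B x1 *v b j = lam j *R b j" and ord: "!!a j. a : I ==> j \<notin> I ==> lam a <= lam j"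
  using ordered_eigenbasis[OF tB[OF x1S], of I] by blast
 have bb: "b i \<bullet> b j = (if i = j then 1 else 0)" for i j using b by (simp add: orthobasis_def)
 have lnn: "0 <= lam j" for j using pos_semidef_eigenvalue_nonneg[OF psd[OF x1S] lam[unfolded B_def]] bb by simp
 have lc0: "c0 <= lam j" if "j \<notin> I" for j
  by (rule gap[OF _ b lam ord that]) (use dla(4)[of x1] x1 in \<open>auto simp: D_def B_def\<close>)
 define ps where "ps = (\<Sum>a\<in>I. lam a)"
 \<comment> \<open>By Ky Fan's principle the eigenvectors at \<open>x1\<close> do at least as well
   as the minimising frame, so they replace it from here on.\<close>
 have psG: "ps - eps * h x1 <= G (x1, w1)"
  using ky_fan_minimum[OF b lam _ ord, where w = "%i. w1 $ i"] x1(2) by (simp add: ps_def G_def Ps_def Fr_def)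
 have psh: "ps <= eps * h x1" using psG G0 by linarith
 define d where "d = x1 - y"
 define E where "E = ph x1"
 have E: "E > 0" by (simp add: E_def ph_def)
 have d: "norm d <= 2 * R" "R / 2 <= norm d"
 proof -
  have "norm d = dist x1 y" by (simp add: d_def dist_norm)
  then show "norm d <= 2 * R" "R / 2 <= norm d"
   using dist_triangle[of x1 y x0] dist_triangle[of x0 y x1] inter dla(3) R by (simp_all add: dist_commute)
 qed
 \<comment> \<open>The variations \<open>gm a\<close> are orthogonal to the span of the frame, so
   the Gram matrix of \<open>b a + t *R gm a\<close> is the identity plus a nonnegative term of
   second order. \<open>frame_shrink\<close> then makes the moving frame admissible without
   normalisation.\<close>
 have variation: "(\<Sum>a\<in>I. 2 * (gm a \<bullet> (B x1 *v b a)) + b a \<bullet> (mdir B x1 xi *v b a)) = eps * (- 2 * al * (d \<bullet> xi) * E)"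
  "eps * ((4 * al^2 * (d \<bullet> xi)^2 - 2 * al * (xi \<bullet> xi)) * E)
   <= (\<Sum>a\<in>I. 2 * (gm a \<bullet> (B x1 *v gm a)) + 4 * (gm a \<bullet> (mdir B x1 xi *v b a)) + b a \<bullet> (mdir (%x. mdir B x xi) x1 xi *v b a))"
  if perp: "!!a c. a : I ==> c : I ==> gm a \<bullet> b c = 0" for gm xi
 proof -
  define X where "X t = mdir B (x1 + t *R xi) xi" for t
  define W where "W t = mdir (%x. mdir B x xi) (x1 + t *R xi) xi" for t
  define Bf where "Bf t = B (x1 + t *R xi)" for t
  define c where "c a t = b a + t *R gm a" for a t
  define F where "F t = (\<Sum>a\<in>I. c a t \<bullet> (Bf t *v c a t)) - eps * h (x1 + t *R xi)" for t
  define F1 where "F1 t = (\<Sum>a\<in>I. gm a \<bullet> (Bf t *v c a t) + c a t \<bullet> (X t *v c a t) + c a t \<bullet> (Bf t *v gm a))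
   - eps * (- 2 * al * ((x1 + t *R xi - y) \<bullet> xi) * ph (x1 + t *R xi))" for t
  define F2 where "F2 = (\<Sum>a\<in>I. (gm a \<bullet> (Bf 0 *v gm a) + gm a \<bullet> (X 0 *v b a))
    + (b a \<bullet> (X 0 *v gm a) + b a \<bullet> (W 0 *v b a) + gm a \<bullet> (X 0 *v b a)) + (b a \<bullet> (X 0 *v gm a) + gm a \<bullet> (Bf 0 *v gm a)))
   - eps * ((4 * al^2 * (d \<bullet> xi)^2 - 2 * al * (xi \<bullet> xi)) * E)"
  \<comment> \<open>The added 1 keeps the denominator positive when \<open>xi = 0\<close>.\<close>
  define dla1 where "dla1 = (dla - dist x0 x1) / (norm xi + 1)"
  have pos1: "norm xi + 1 > 0" by (simp add: add_nonneg_pos)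
  have dla1: "dla1 > 0" using inter pos1 by (simp add: dla1_def)
  have inD: "x1 + t *R xi : D" if "\<bar>t\<bar> < dla1" for t
  proof -
   have "\<bar>t\<bar> * norm xi <= dla1 * (norm xi + 1)" using that by (intro mult_mono) auto
   also have "... = dla - dist x0 x1" using pos1 by (simp add: dla1_def)
   finally have "\<bar>t\<bar> * norm xi <= dla - dist x0 x1" .
   moreover have "dist x0 (x1 + t *R xi) <= dist x0 x1 + dist x1 (x1 + t *R xi)" by (rule dist_triangle)
   moreover have "dist x1 (x1 + t *R xi) = \<bar>t\<bar> * norm xi" by (simp add: dist_norm)
   ultimately show ?thesis unfolding D_def by simp
  qed
  have inS: "x1 + t *R xi : S" if "\<bar>t\<bar> < dla1" for t using inD[OF that] DS by auto
  have dc: "(c a has_vector_derivative gm a) (at t)" for a t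
   unfolding c_def by (auto intro!: derivative_eq_intros)
  have dB: "(Bf has_vector_derivative X t) (at t)" and dX: "(X has_vector_derivative W t) (at t)" if "\<bar>t\<bar> < dla1" for t
   using jet_lines(3,4)[OF S v inS[OF that]] unfolding Bf_def X_def W_def B_def by auto
  note mv = matrix_vector_has_vector_derivative
  have dph: "((%t. h (x1 + t *R xi)) has_real_derivative - 2 * al * ((x1 + t *R xi - y) \<bullet> xi) * ph (x1 + t *R xi)) (at t)" for t
   using DERIV_diff[OF barrier_derivatives(1)[of al x1 xi y t] DERIV_const[of "exp (- al * R^2)"]]
   unfolding h_def ph_def by simp
  have DF: "(F has_real_derivative F1 t) (at t)" if t: "\<bar>t\<bar> < dla1" for t
   unfolding F_def
   by (rule DERIV_cong[OF DERIV_diff[OF DERIV_sum DERIV_cmult[OF dph]]],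
     rule inner_has_real_derivative[OF dc mv[OF dB[OF t] dc]])
    (simp add: F1_def inner_add_right add_ac)
  have DF1: "(F1 has_real_derivative F2) (at 0)"
  proof -
   have t: "\<bar>0\<bar> < dla1" using dla1 by simp
   have d2: "((%t. - 2 * al * ((x1 + t *R xi - y) \<bullet> xi) * ph (x1 + t *R xi)) has_real_derivative
     (4 * al^2 * (d \<bullet> xi)^2 - 2 * al * (xi \<bullet> xi)) * E) (at 0)"
    using barrier_derivatives(2)[of al x1 xi y 0] unfolding ph_def E_def d_def by simp
   have gmc: "((%t. gm a) has_vector_derivative 0) (at 0)" for a by (rule has_vector_derivative_const)
   have s: "((%t. gm a \<bullet> (Bf t *v c a t) + c a t \<bullet> (X t *v c a t) + c a t \<bullet> (Bf t *v gm a)) has_real_derivative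
     (gm a \<bullet> (Bf 0 *v gm a) + gm a \<bullet> (X 0 *v b a))
    + (b a \<bullet> (X 0 *v gm a) + b a \<bullet> (W 0 *v b a) + gm a \<bullet> (X 0 *v b a)) + (b a \<bullet> (X 0 *v gm a) + gm a \<bullet> (Bf 0 *v gm a))) (at 0)" for a
    by (rule DERIV_cong[OF DERIV_add[OF DERIV_add[OF inner_has_real_derivative[OF gmc mv[OF dB[OF t] dc]]
       inner_has_real_derivative[OF dc mv[OF dX[OF t] dc]]] inner_has_real_derivative[OF dc mv[OF dB[OF t] gmc]]]])
     (simp add: c_def inner_add_right)
   show ?thesis unfolding F1_def F2_def by (rule DERIV_diff[OF DERIV_sum[OF s] DERIV_cmult[OF d2]])
  qed
  have F0: "F 0 = ps - eps * h x1"
   by (simp add: F_def c_def Bf_def lam bb ps_def)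
  have Fmin: "F 0 <= F t" if t: "\<bar>t\<bar> < dla1" for t
  proof -
   have gram: "(\<Sum>a\<in>I. (z a)^2) <= (norm (\<Sum>a\<in>I. z a *R c a t))^2" for z
   proof -
    define zb where "zb = (\<Sum>a\<in>I. z a *R b a)"
    define zg where "zg = (\<Sum>a\<in>I. z a *R gm a)"
    have s: "(\<Sum>a\<in>I. z a *R c a t) = zb + t *R zg"
     by (simp add: zb_def zg_def c_def scaleR_add_right sum.distrib scaleR_sum_right mult.commute)
    have "zg \<bullet> zb = (\<Sum>a\<in>I. \<Sum>c\<in>I. z c * (z a * (gm c \<bullet> b a)))"
     by (simp add: zb_def zg_def inner_sum_left inner_sum_right sum_distrib_left mult.left_commute)
    then have gb: "zg \<bullet> zb = 0" using perp by (simp add: sum.neutral)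
    have zz: "zb \<bullet> zb = (\<Sum>a\<in>I. (z a)^2)"
    proof -
     have "zb \<bullet> zb = (\<Sum>a\<in>I. \<Sum>c\<in>I. if a = c then (z a)^2 else 0)"
      unfolding zb_def inner_sum_left inner_sum_right by (intro sum.cong refl) (auto simp: bb sq_eq)
     then show ?thesis by simp
    qed
    have "(norm (zb + t *R zg))^2 = zb \<bullet> zb + t^2 * (zg \<bullet> zg)"
     unfolding norm_sq using gb by (simp add: inner_add_left inner_add_right inner_commute[of zb zg] sq_eq)
    then show ?thesis unfolding s zz by simp
   qed
   obtain w where w: "orthonormal_on I w" "!!A. pos_semidef A ==> (\<Sum>a\<in>I. w a \<bullet> (A *v w a)) <= (\<Sum>a\<in>I. c a t \<bullet> (A *v c a t))"
    using frame_shrink[OF gram] by blast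
   have "F 0 <= G (x1, w1)" using psG F0 by simp
   also have "... <= G (x1 + t *R xi, \<chi> i. if i : I then w i else 0)" by (rule Gmin[OF inD[OF t] frame_of(1)[OF w(1)]])
   also have "... = (\<Sum>i\<in>I. w i \<bullet> (B (x1 + t *R xi) *v w i)) - eps * h (x1 + t *R xi)"
    by (simp add: G_def frame_of(2)[OF w(1)])
   also have "... <= F t" unfolding F_def Bf_def B_def using w(2)[OF psd[OF inS[OF t]]] by simp
   finally show ?thesis .
  qed
  have tX: "transpose (X 0) = X 0" unfolding X_def B_def using third_transpose[OF S v x1S] by simp
  have Xs: "b a \<bullet> (X 0 *v gm a) = gm a \<bullet> (X 0 *v b a)" for a using symmetric_inner[OF tX, of "b a" "gm a"] by (simp add: inner_commute)
  have Bs: "b a \<bullet> (B x1 *v gm a) = gm a \<bullet> (B x1 *v b a)" for a using symmetric_inner[OF tB[OF x1S], of "b a" "gm a"] by (simp add: inner_commute)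
  have X0: "X 0 = mdir B x1 xi" "W 0 = mdir (%x. mdir B x xi) x1 xi" "Bf 0 = B x1" by (simp_all add: X_def W_def Bf_def)
  have "F1 0 = 0" by (rule second_derivative_test(1)[OF dla1 DF DF1 Fmin])
  moreover have "F1 0 = (\<Sum>a\<in>I. 2 * (gm a \<bullet> (B x1 *v b a)) + b a \<bullet> (mdir B x1 xi *v b a)) - eps * (- 2 * al * (d \<bullet> xi) * E)"
   unfolding F1_def X0 c_def E_def d_def by (simp add: Bs add_ac)
  ultimately show "(\<Sum>a\<in>I. 2 * (gm a \<bullet> (B x1 *v b a)) + b a \<bullet> (mdir B x1 xi *v b a)) = eps * (- 2 * al * (d \<bullet> xi) * E)" by simp
  have "0 <= F2" by (rule second_derivative_test(2)[OF dla1 DF DF1 Fmin])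
  moreover have "F2 = (\<Sum>a\<in>I. 2 * (gm a \<bullet> (B x1 *v gm a)) + 4 * (gm a \<bullet> (mdir B x1 xi *v b a)) + b a \<bullet> (mdir (%x. mdir B x xi) x1 xi *v b a))
    - eps * ((4 * al^2 * (d \<bullet> xi)^2 - 2 * al * (xi \<bullet> xi)) * E)"
   unfolding F2_def Xs unfolding X0 by (simp add: algebra_simps)
  ultimately show "eps * ((4 * al^2 * (d \<bullet> xi)^2 - 2 * al * (xi \<bullet> xi)) * E)
   <= (\<Sum>a\<in>I. 2 * (gm a \<bullet> (B x1 *v gm a)) + 4 * (gm a \<bullet> (mdir B x1 xi *v b a)) + b a \<bullet> (mdir (%x. mdir B x xi) x1 xi *v b a))" by simp
 qed
 define X where "X a = mdir B x1 (b a)" for a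
 define W where "W a = mdir (%x. mdir B x (b a)) x1 (b a)" for a
 define Gm where "Gm a = (\<Sum>j\<in>-I. (1 / lam j) *R outer_prod (X a *v b j) (X a *v b j))" for a
 define g where "g = (\<Sum>a\<in>I. X a *v b a)"
 have tX: "transpose (X a) = X a" for a unfolding X_def B_def by (rule third_transpose[OF S v x1S])
 have tW: "transpose (W a) = W a" for a unfolding W_def B_def by (rule fourth_transpose[OF S v x1S])
 have tG: "transpose (Gm a) = Gm a" for a by (simp add: Gm_def transpose_sum' transpose_scaleR' transpose_outer_prod)
 have Xswap: "mdir B x1 xi *v b a = X a *v xi" for xi a unfolding X_def B_def by (rule third_swap[OF S v x1S])
 have Wswap: "b a \<bullet> (mdir (%x. mdir B x xi) x1 xi *v b a) = xi \<bullet> (W a *v xi)" for xi a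
  unfolding W_def B_def by (rule fourth_swap[OF S v x1S])
 \<comment> \<open>The first variation with the frame held constant and \<open>xi = g\<close> bounds
   \<open>g\<close> by \<open>eps\<close> times the gradient of the barrier.\<close>
 have ng: "norm g <= eps * (2 * al * norm d * E)"
 proof -
  have "g \<bullet> g = eps * (- 2 * al * (d \<bullet> g) * E)"
  proof -
   have "g \<bullet> g = (\<Sum>a\<in>I. (X a *v b a) \<bullet> g)" by (simp only: g_def inner_sum_left)
   also have "... = (\<Sum>a\<in>I. b a \<bullet> (mdir B x1 g *v b a))"
    using symmetric_inner[OF tX] by (simp add: Xswap)
   also have "... = eps * (- 2 * al * (d \<bullet> g) * E)" using variation(1)[of "%_. 0" g] by simp
   finally show ?thesis .
  qed
  also have "... <= eps * (2 * al * (norm d * norm g) * E)"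
  proof -
   have "- (d \<bullet> g) <= norm d * norm g" using Cauchy_Schwarz_ineq2[of d g] by linarith
   then have le: "2 * al * (- (d \<bullet> g)) * E <= 2 * al * (norm d * norm g) * E" using al E by (intro mult_right_mono mult_left_mono) auto
   have r: "- 2 * al * (d \<bullet> g) * E = 2 * al * (- (d \<bullet> g)) * E" by simp
   show ?thesis unfolding r by (rule mult_left_mono[OF le]) (use eps in simp)
  qed
  finally have "norm g * norm g <= (eps * (2 * al * norm d * E)) * norm g"
   by (simp add: power2_norm_eq_inner[symmetric] sq_eq mult_ac)
  then show ?thesis using al eps E by (cases "g = 0") auto
 qed
 obtain ob ta where ob: "orthobasis ob" and ta: "!!i. ta i = 2 * Phi (p x1) (M x1) (outer_prod (ob i) (ob i))"
  and dirs: "!!V. transpose V = V ==> 2 * Phi (p x1) (M x1) V = (\<Sum>i\<in>UNIV. ta i * (ob i \<bullet> (V *v ob i)))"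
  using Phi_eigen_directions[of "p x1" "M x1"] by blast
 have obo: "ob i \<bullet> ob i = 1" "norm (ob i) = 1" for i using ob by (simp_all add: orthobasis_def norm_eq_1)
 have tab: "2 * th <= ta i" "ta i <= 2 * La" for i using th(2)[OF x1(1) obo(2)] La[OF x1(1) obo(2)] by (simp_all add: ta)
 have dir: "eps * ((4 * al^2 * (d \<bullet> xi)^2 - 2 * al * (xi \<bullet> xi)) * E) <= (\<Sum>a\<in>I. xi \<bullet> (W a *v xi) - 2 * (xi \<bullet> (Gm a *v xi)))" for xi
 proof -
  \<comment> \<open>The optimal variation: it minimises \<open>2 * (gm a \<bullet> (B x1 *v gm a)) +
    4 * (gm a \<bullet> (X a *v xi))\<close> on the span of the other eigenvectors, and its value
    there is the second-order perturbation term.\<close>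
  define gm where "gm a = (\<Sum>j\<in>-I. (- (1 / lam j) * ((X a *v b j) \<bullet> xi)) *R b j)" for a
  have gmb: "gm a \<bullet> b c = (if c : I then 0 else - (1 / lam c) * ((X a *v b c) \<bullet> xi))" for a c
  proof -
   have "gm a \<bullet> b c = (\<Sum>j\<in>-I. if j = c then - (1 / lam c) * ((X a *v b c) \<bullet> xi) else 0)"
    unfolding gm_def inner_sum_left by (intro sum.cong refl) (auto simp: bb)
   then show ?thesis by simp
  qed
  have lp: "lam j ~= 0" if "j \<notin> I" for j using lc0[OF that] c0 by simp
  have Gq: "xi \<bullet> (Gm a *v xi) = (\<Sum>j\<in>-I. (1 / lam j) * ((X a *v b j) \<bullet> xi)^2)" for a
   by (simp add: Gm_def matrix_sum_mult scaleR_mv outer_prod_mult inner_sum_right sq_eq inner_commute)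
  have t1: "gm a \<bullet> (B x1 *v gm a) = xi \<bullet> (Gm a *v xi)" for a
  proof -
   have "gm a \<bullet> (B x1 *v gm a) = (\<Sum>j\<in>UNIV. lam j * (b j \<bullet> gm a) * (b j \<bullet> gm a))" by (rule eigenbasis_quadratic[OF b lam])
   also have "... = (\<Sum>j\<in>-I. lam j * (b j \<bullet> gm a) * (b j \<bullet> gm a))"
    by (rule sum.mono_neutral_right) (auto simp: inner_commute[of _ "gm a"] gmb)
   also have "... = xi \<bullet> (Gm a *v xi)"
    unfolding Gq by (rule sum.cong[OF refl]) (use lp in \<open>auto simp: inner_commute[of _ "gm a"] gmb sq_eq\<close>)
   finally show ?thesis .
  qed
  have t2: "gm a \<bullet> (mdir B x1 xi *v b a) = - (xi \<bullet> (Gm a *v xi))" for a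
  proof -
   have "gm a \<bullet> (X a *v xi) = (\<Sum>j\<in>-I. (- (1 / lam j) * ((X a *v b j) \<bullet> xi)) * (b j \<bullet> (X a *v xi)))"
    by (simp add: gm_def inner_sum_left)
   also have "... = - (xi \<bullet> (Gm a *v xi))"
    unfolding Gq sum_negf[symmetric] by (rule sum.cong[OF refl]) (simp add: symmetric_inner[OF tX] sq_eq)
   finally show ?thesis unfolding Xswap .
  qed
  have "eps * ((4 * al^2 * (d \<bullet> xi)^2 - 2 * al * (xi \<bullet> xi)) * E)
   <= (\<Sum>a\<in>I. 2 * (gm a \<bullet> (B x1 *v gm a)) + 4 * (gm a \<bullet> (mdir B x1 xi *v b a)) + b a \<bullet> (mdir (%x. mdir B x xi) x1 xi *v b a))"
   by (rule variation(2)) (simp add: gmb)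
  also have "... = (\<Sum>a\<in>I. xi \<bullet> (W a *v xi) - 2 * (xi \<bullet> (Gm a *v xi)))"
   unfolding t1 t2 Wswap by (intro sum.cong refl) simp
  finally show ?thesis .
 qed
 \<comment> \<open>Weighted with the nonnegative \<open>ta i\<close>, the directional inequalities
   add up to the left side of \<open>main\<close>, with the barrier as lower bound.\<close>
 have "eps * ((\<Sum>i\<in>UNIV. ta i * (4 * al^2 * (d \<bullet> ob i)^2 - 2 * al)) * E)
  = (\<Sum>i\<in>UNIV. ta i * (eps * ((4 * al^2 * (d \<bullet> ob i)^2 - 2 * al * (ob i \<bullet> ob i)) * E)))"
  by (simp add: obo sum_distrib_left sum_distrib_right mult_ac)
 also have "... <= (\<Sum>i\<in>UNIV. ta i * (\<Sum>a\<in>I. ob i \<bullet> (W a *v ob i) - 2 * (ob i \<bullet> (Gm a *v ob i))))"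
  using tab(1) th(1) by (intro sum_mono mult_left_mono dir) (smt (verit))
 also have "... = (\<Sum>a\<in>I. (\<Sum>i\<in>UNIV. ta i * (ob i \<bullet> (W a *v ob i))) - 2 * (\<Sum>i\<in>UNIV. ta i * (ob i \<bullet> (Gm a *v ob i))))"
  unfolding sum_distrib_left sum_subtractf[symmetric] by (subst sum.swap) (simp add: right_diff_distrib mult.left_commute)
 also have "... = (\<Sum>a\<in>I. 2 * Phi (p x1) (M x1) (W a) - 4 * Phi (p x1) (M x1) (Gm a))"
  unfolding dirs[OF tW, symmetric] dirs[OF tG, symmetric] by simp
 also have "... <= C * (ps + norm g)"
 proof -
  have "(\<Sum>j\<in>I. lam j) <= et"
  proof -
   have "eps * h x1 <= eps * 1" using h1(1) eps by (intro mult_left_mono) auto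
   then show ?thesis using psh eps unfolding ps_def[symmetric] by linarith
  qed
  moreover have "x1 : cball x0 dla" using x1 by (simp add: D_def)
  ultimately show ?thesis
   using main[of x1 b lam "-I"] b lam I lc0 unfolding ps_def g_def W_def X_def Gm_def B_def by simp
 qed
 also have "... <= C * (eps * (E + 2 * al * norm d * E))"
 proof (rule mult_left_mono[OF _ C])
  have "eps * h x1 <= eps * E" using h1(2) eps by (simp add: E_def)
  then show "ps + norm g <= eps * (E + 2 * al * norm d * E)" using psh ng by (simp add: distrib_left)
 qed
 finally have "(eps * E) * (\<Sum>i\<in>UNIV. ta i * (4 * al^2 * (d \<bullet> ob i)^2 - 2 * al)) <= (eps * E) * (C * (1 + 2 * al * norm d))"
  by (simp add: algebra_simps)
 then have up: "(\<Sum>i\<in>UNIV. ta i * (4 * al^2 * (d \<bullet> ob i)^2 - 2 * al)) <= C * (1 + 2 * al * norm d)" using eps E by simp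
 \<comment> \<open>The radial part of the barrier's second derivative is of order
   \<open>al^2\<close> because \<open>norm d\<close> is at least \<open>R / 2\<close>; the
   tangential part is only of order \<open>al\<close>.\<close>
 have low: "2 * th * al^2 * R^2 - 4 * n * La * al <= (\<Sum>i\<in>UNIV. ta i * (4 * al^2 * (d \<bullet> ob i)^2 - 2 * al))"
 proof -
  have dd: "(\<Sum>i\<in>UNIV. (d \<bullet> ob i)^2) = (norm d)^2"
   using orthobasis_inner[OF ob, of d d] unfolding norm_sq by (simp add: sq_eq inner_commute)
  have "(R / 2)^2 <= (norm d)^2" using d(2) R by (intro power_mono) auto
  then have "8 * th * al^2 * (R / 2)^2 <= 8 * th * al^2 * (norm d)^2" using th(1) by (intro mult_left_mono) auto
  then have "2 * th * al^2 * R^2 - 4 * n * La * al <= 8 * th * al^2 * (\<Sum>i\<in>UNIV. (d \<bullet> ob i)^2) - n * (4 * La * al)"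
   unfolding dd by (simp add: power_divide algebra_simps)
  also have "... = (\<Sum>i\<in>UNIV. 8 * th * al^2 * (d \<bullet> ob i)^2 - 4 * La * al)"
   by (simp add: sum_subtractf sum_distrib_left n_def)
  also have "... <= (\<Sum>i\<in>UNIV. ta i * (4 * al^2 * (d \<bullet> ob i)^2 - 2 * al))"
  proof (rule sum_mono)
   fix i
   have "2 * th * (4 * al^2 * (d \<bullet> ob i)^2) <= ta i * (4 * al^2 * (d \<bullet> ob i)^2)" using tab(1) by (intro mult_right_mono) auto
   moreover have "ta i * (2 * al) <= 2 * La * (2 * al)" using tab(2) al by (intro mult_right_mono) auto
   ultimately show "8 * th * al^2 * (d \<bullet> ob i)^2 - 4 * La * al <= ta i * (4 * al^2 * (d \<bullet> ob i)^2 - 2 * al)"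
    unfolding right_diff_distrib by linarith
  qed
  finally show ?thesis .
 qed
 have "C * (1 + 2 * al * norm d) <= C * (1 + 2 * al * (2 * R))" using d al C by (intro mult_left_mono add_left_mono) auto
 then have a1: "2 * th * al^2 * R^2 <= al * (4 * n * La + 4 * C * R) + C" using up low by (simp add: algebra_simps)
 have "al * k <= al * (2 * th * R^2 * al)" using al by (intro mult_left_mono) auto
 then have a2: "al * k <= 2 * th * al^2 * R^2" by (simp add: sq_eq mult_ac)
 have "C + 1 <= al * (C + 1)" using al C by simp
 then have "al * (4 * n * La + 4 * C * R) + (C + 1) <= al * k" unfolding k_def by (simp add: distrib_left)
 then show False using a1 a2 by linarith
qed

section \<open>From u to v, and the set of minimal rank\<close>

lemma neg_sqrt_neg_jets:
 fixes u :: "real^'n => real"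
 assumes S: "open S" and u: "Ck_on 4 u S" and neg: "!!x. x : S ==> u x < 0"
 defines "v \<equiv> %x. - sqrt (- u x)"
 assumes x: "x : S"
 shows "gradient u x = (2 * (- v x)) *R gradient v x"
  and "hessian u x = 2 *R ((- v x) *R hessian v x - outer_prod (gradient v x) (gradient v x))"
proof -
 have v: "Ck_on 4 v S" unfolding v_def by (rule Ck_on_neg_sqrt_neg[OF S u neg])
 have vneg: "v x < 0" if "x : S" for x using neg[OF that] by (simp add: v_def)
 have g: "gradient u x $ i = - 2 * v x * gradient v x $ i" if "x : S" for x i
 proof -
  have "u differentiable (at x)" by (rule Ck_on_differentiable[OF S u _ that]) simp
  from gradient_unique[OF neg_sqrt_neg_gradient[OF this neg[OF that]]]
  have "gradient v x = inverse (- 2 * v x) *R gradient u x" by (simp add: v_def)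
  then show ?thesis using vneg[OF that] by simp
 qed
 show "gradient u x = (2 * (- v x)) *R gradient v x" using g[OF x] by (simp add: vec_eq_iff)
 have "hessian u x $ i $ j = - 2 * (gradient v x $ j * gradient v x $ i + v x * hessian v x $ i $ j)" for i j
 proof -
  have d1: "(v has_derivative (%h. gradient v x \<bullet> h)) (at x)"
   by (rule has_derivative_gradient[OF Ck_on_differentiable[OF S v _ x]]) simp
  have d2: "((%x. gradient v x $ i) has_derivative (%h. gradient (%x. gradient v x $ i) x \<bullet> h)) (at x)"
   by (rule has_derivative_gradient[OF Ck_on_differentiable[OF S gradient_entry_Ck[OF S v] _ x]]) simp
  have d3: "((%x. - 2 * v x * gradient v x $ i) has_derivative
    (%h. ((- 2 * gradient v x $ i) *R gradient v x + (- 2 * v x) *R gradient (%x. gradient v x $ i) x) \<bullet> h)) (at x)"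
   by (auto intro!: derivative_eq_intros d1 d2 simp: fun_eq_iff inner_add_left algebra_simps)
  have "hessian u x $ i $ j = gradient (%x. gradient u x $ i) x $ j" by (rule hessian_entry[OF S u x])
  also have "gradient (%x. gradient u x $ i) x = gradient (%x. - 2 * v x * gradient v x $ i) x"
  proof (rule differentiable_cong_open(2)[OF S x])
   show "(%x. - 2 * v x * gradient v x $ i) differentiable at x" using d3 unfolding differentiable_def by blast
  qed (simp add: g)
  also have "... = (- 2 * gradient v x $ i) *R gradient v x + (- 2 * v x) *R gradient (%x. gradient v x $ i) x"
   by (rule gradient_unique[OF d3])
  finally show ?thesis by (simp add: hessian_entry[OF S v x] algebra_simps)
 qed
 then show "hessian u x = 2 *R ((- v x) *R hessian v x - outer_prod (gradient v x) (gradient v x))"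
  by (simp add: vec_eq_iff outer_prod_def algebra_simps)
qed

text \<open>With \<open>I\<close> of the size of the kernel at \<open>x\<close>, the eigenvalue gap
  keeps all eigenvalues off \<open>I\<close> nonzero nearby. Rank zero is treated apart, since then
  \<open>I\<close> would exhaust the indices.\<close>

lemma rank_lower_semicontinuous:
 fixes B :: "real^'n => real^'n^'n"
 assumes B: "continuous_on S B" and psd: "!!x. x : S ==> pos_semidef (B x)" and x: "x : S"
 obtains e where "e > 0" "!!z. z : S ==> dist z x < e ==> rank (B x) <= rank (B z)"
proof (cases "rank (B x) = 0")
 case True
 then show ?thesis using that[of 1] by simp
next
 case False
 have rk: "rank (B x) <= CARD('n)" using rank_bound[of "B x"] by simp
 obtain I :: "'n set" where I: "card I = CARD('n) - rank (B x)"
  using obtain_subset_with_card_n[of "CARD('n) - rank (B x)" "UNIV :: 'n set"] by auto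
 have rI: "rank (B x) + card I = CARD('n)" using I rk by simp
 have "I ~= UNIV" using rI False by auto
 from eigenvalue_gap[OF psd[OF x] rI this]
 obtain c0 rh where c0: "c0 > 0" and rh: "rh > 0"
  and gap: "!!A b lam j. [|norm (A - B x) <= rh; orthobasis b; !!j. A *v b j = lam j *R b j; !!a j. a : I ==> j \<notin> I ==> lam a <= lam j; j \<notin> I|] ==> c0 <= lam j"
  by blast
 obtain e where e: "e > 0" "!!z. z : S ==> dist z x < e ==> dist (B z) (B x) < rh"
  using B x rh unfolding continuous_on_iff by blast
 show ?thesis
 proof (rule that[OF e(1)])
  fix z assume z: "z : S" "dist z x < e"
  have n: "norm (B z - B x) <= rh" using e(2)[OF z] by (simp add: dist_norm)
  have "transpose (B z) = B z" using psd[OF z(1)] by (simp add: pos_semidef_def)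
  then obtain b lam where b: "orthobasis b" and lam: "!!j. B z *v b j = lam j *R b j" and ord: "!!a j. a : I ==> j \<notin> I ==> lam a <= lam j"
   using ordered_eigenbasis[of "B z" I] by blast
  have "- I \<subseteq> {j. lam j ~= 0}" using gap[OF n b lam ord] c0 by force
  then have "card (-I) <= card {j. lam j ~= 0}" by (intro card_mono) auto
  moreover have "card (-I) = rank (B x)" using rI by (simp add: Compl_eq_Diff_UNIV card_Diff_subset)
  ultimately show "rank (B x) <= rank (B z)" unfolding rank_eigenbasis[OF b lam] by simp
 qed
qed

theorem theorem3p1:
  fixes \<Omega> :: "(real^'n) set" and u v :: "real^'n \<Rightarrow> real"
  assumes "CARD('n) \<ge> 3"
    and "open \<Omega>" and "connected \<Omega>"
    and "Ck_on 4 u \<Omega>"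
    and "\<forall>x\<in>\<Omega>. u x < 0"
    and "Gamma2_admissible_on \<Omega> u"
    and "\<forall>x\<in>\<Omega>. sigma2 (principal_curvatures u x) = (1 + (norm (gradient u x))\<^sup>2) powi (-2)"
    and "v = (\<lambda>x. - sqrt (- u x))"
    and "\<forall>x\<in>\<Omega>. pos_semidef (hessian v x)"
  shows "(\<lambda>x. rank (hessian v x)) constant_on \<Omega>"
proof (cases "\<Omega> = {}")
 case True
 then show ?thesis by (simp add: constant_on_def)
next
 case False
 have neg: "u x < 0" and psd: "pos_semidef (hessian v x)" if "x : \<Omega>" for x using assms(5,9) that by auto
 have v: "Ck_on 4 v \<Omega>" unfolding assms(8) by (rule Ck_on_neg_sqrt_neg[OF assms(2,4) neg])
 have vneg: "v x < 0" if "x : \<Omega>" for x using neg[OF that] by (simp add: assms(8))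
 define q where "q = gradient v"
 define p where "p x = (2 * (- v x)) *R gradient v x" for x
 define M where "M x = (- v x) *R hessian v x - outer_prod (gradient v x) (gradient v x)" for x
 have jets: "gradient u x = p x" "hessian u x = 2 *R M x" if "x : \<Omega>" for x
  using neg_sqrt_neg_jets[OF assms(2,4) neg that] unfolding p_def M_def assms(8) by auto
 have eq: "Phi (p x) (M x) (M x) = 1 / 4" and ell: "e ~= 0 ==> 0 < Phi (p x) (M x) (outer_prod e e)" if x: "x : \<Omega>" for x e
 proof -
  have G: "principal_curvatures u x : Gamma2" using assms(6) x by (simp add: Gamma2_admissible_on_def)
  have E: "sigma2 (principal_curvatures u x) = (1 + (norm (gradient u x))^2) powi (-2)" using assms(7) x by blast
  note ce = curvature_equation[OF hessian_transpose[OF assms(2,4) x] G E, unfolded jets[OF x]]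
  show "Phi (p x) (M x) (M x) = 1 / 4" using ce(1) by (simp add: Phi_scale_left Phi_scale_right)
  show "e ~= 0 ==> 0 < Phi (p x) (M x) (outer_prod e e)" using ce(2)[of e] by (simp add: Phi_scale_left)
 qed
 define rk where "rk x = rank (hessian v x)" for x
 obtain xm where xm: "xm : \<Omega>" "!!x. x : \<Omega> ==> rk xm <= rk x"
  using ex_has_least_nat[of "%x. x : \<Omega>" _ rk] False by blast
 have rkn: "rk x <= CARD('n)" for x using rank_bound[of "hessian v x"] by (simp add: rk_def)
 \<comment> \<open>The structural inequality requires two nonzero eigenvalues. The equation provides
   them: at smaller rank its left side would be nonpositive instead of 1 / 4.\<close>
 have rk2: "2 <= rk xm"
 proof (rule ccontr)
  assume "\<not> 2 <= rk xm"
  then have "Phi (p xm) (M xm) (M xm) <= 0"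
   unfolding M_def by (intro Phi_rank_le_1_nonpos psd xm) (use vneg[OF xm(1)] in \<open>auto simp: rk_def p_def\<close>)
  then show False using eq[OF xm(1)] by simp
 qed
 \<comment> \<open>An index set of the size of the kernel at points of minimal rank; only its
   cardinality matters.\<close>
 obtain I :: "'n set" where I: "card I = CARD('n) - rk xm"
  using obtain_subset_with_card_n[of "CARD('n) - rk xm" "UNIV :: 'n set"] by auto
 have cI: "card (-I) >= 2" using I rk2 rkn[of xm] by (simp add: Compl_eq_Diff_UNIV card_Diff_subset)
 define A where "A = {x : \<Omega>. rk x = rk xm}"
 have A_iff: "x : A \<longleftrightarrow> rk x + card I <= CARD('n)" if "x : \<Omega>" for x
  using xm(2)[OF that] that I rkn[of xm] by (auto simp: A_def)
 have openC: "open (\<Omega> - A)"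
  unfolding open_dist
 proof
  fix x assume x: "x : \<Omega> - A"
  then have xO: "x : \<Omega>" by simp
  obtain e1 where e1: "e1 > 0" "!!z. z : \<Omega> ==> dist z x < e1 ==> rk x <= rk z"
   using rank_lower_semicontinuous[OF hessian_continuous[OF assms(2) v] psd xO] unfolding rk_def by blast
  obtain e2 where e2: "e2 > 0" "!!z. dist z x < e2 ==> z : \<Omega>" using assms(2) xO unfolding open_dist by blast
  have "z : \<Omega> - A" if "dist z x < min e1 e2" for z
  proof -
   have "z : \<Omega>" "rk x <= rk z" using e1(2) e2(2) that by auto
   moreover have "rk xm < rk x" using x xm(2)[OF xO] by (auto simp: A_def)
   ultimately show ?thesis by (auto simp: A_def)
  qed
  then show "\<exists>e>0. \<forall>z. dist z x < e --> z : \<Omega> - A" using e1 e2 by (intro exI[of _ "min e1 e2"]) auto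
 qed
 have openA: "open A"
 proof (rule ccontr)
  assume "\<not> open A"
  then obtain xs where xs: "xs : A" and bad: "!!rh. rh > 0 ==> \<exists>z. dist z xs < rh \<and> z \<notin> A" unfolding open_dist by blast
  have "xs : \<Omega>" using xs by (simp add: A_def)
  then obtain rh where rh: "rh > 0" "cball xs rh \<subseteq> \<Omega>" using assms(2) open_contains_cball by blast
  \<comment> \<open>With a quarter of the radius, the ball around \<open>y\<close> that reaches to
    the nearest point of \<open>A\<close> stays inside \<open>cball xs rh\<close>.\<close>
  obtain y where y: "dist y xs < rh / 4" "y \<notin> A" using bad[of "rh / 4"] rh by auto
  \<comment> \<open>\<open>A\<close> is closed only relative to \<Omega>; intersected with a closed
    ball inside \<Omega> it is closed in the whole space, so a nearest point to \<open>y\<close>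
    exists.\<close>
  define K where "K = cball xs rh \<inter> - (\<Omega> - A)"
  have "closed K" unfolding K_def using openC by (intro closed_Int closed_cball closed_Compl)
  moreover have "xs : K" using xs rh by (simp add: K_def)
  then have "K ~= {}" by blast
  ultimately obtain x0 where x0: "x0 : K" "!!x. x : K ==> dist y x0 <= dist y x" using distance_attains_inf[of K y] by blast
  have KA: "x : K \<longleftrightarrow> x : A \<and> x : cball xs rh" for x using rh(2) by (auto simp: K_def A_def)
  have x0A: "x0 : A" "x0 : \<Omega>" using x0(1) by (auto simp: KA A_def)
  define d where "d = dist y x0"
  have d: "d > 0" "d < rh / 4"
  proof -
   show "d > 0" using y(2) x0A by (auto simp: d_def)
   have "xs : K" using xs rh by (simp add: KA)
   then show "d < rh / 4" using x0(2) y(1) by (fastforce simp: d_def)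
  qed
  \<comment> \<open>The ball around \<open>y\<close> may touch \<open>A\<close> in several points.
    The ball of half the radius, internally tangent at \<open>x0\<close>, touches it only
    there.\<close>
  define y' where "y' = (1 / 2) *R (y + x0)"
  \<comment> \<open>The parallelogram law at the midpoint of \<open>y\<close> and \<open>x0\<close>:
    a point of the smaller ball that is no nearer to \<open>y\<close> than \<open>x0\<close> must
    equal \<open>x0\<close>.\<close>
  have para: "(dist y x)^2 + (dist x x0)^2 = 2 * (dist x y')^2 + (dist y x0)^2 / 2" for x
   unfolding dist_norm norm_sq y'_def
   by (simp add: inner_diff_left inner_diff_right inner_add_left inner_add_right inner_commute field_simps)
  have dy: "dist x0 y' = d / 2"
  proof -
   have "x0 - y' = (1 / 2) *R (x0 - y)" by (simp add: y'_def algebra_simps scaleR_2[symmetric])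
   then show ?thesis by (simp add: dist_norm d_def norm_minus_commute)
  qed
  have touch: "x = x0" if x: "x : \<Omega>" "x : cball y' (d / 2)" "rank (hessian v x) + card I <= CARD('n)" for x
  proof -
   have xA: "x : A" using A_iff[OF x(1)] x(3) by (simp add: rk_def)
   have "dist y y' = d / 2"
   proof -
    have "y - y' = (1 / 2) *R (y - x0)" by (simp add: y'_def algebra_simps scaleR_2[symmetric])
    then show ?thesis by (simp add: dist_norm d_def)
   qed
   then have "dist y x <= d" using dist_triangle[of y x y'] x(2) by simp
   then have "dist xs x <= rh" using dist_triangle[of xs x y] y(1) d rh by (simp add: dist_commute)
   then have "x : K" using xA by (simp add: KA)
   then have "d <= dist y x" using x0(2) by (simp add: d_def)
   then have "d^2 <= (dist y x)^2" using d by (intro power_mono) auto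
   moreover have "(dist x y')^2 <= (d / 2)^2" using x(2) by (intro power_mono) (auto simp: dist_commute)
   then have "(dist x y')^2 <= d^2 / 4" by (simp add: power_divide)
   ultimately have "(dist x x0)^2 <= 0" using para[of x, folded d_def] by linarith
   then show ?thesis by simp
  qed
  have "rank (hessian v x0) + card I = CARD('n)"
   using x0A(1) I rkn[of xm] by (simp add: A_def rk_def)
  then show False
   using touching_ball_impossible[OF assms(2) v vneg psd eq[unfolded p_def M_def] ell[unfolded p_def M_def] x0A(2) _ cI, where y = y' and R = "d / 2"]
    d dy touch by (auto simp: half_gt_zero_iff)
 qed
 have "\<Omega> - A = {}"
 proof (rule ccontr)
  assume "\<Omega> - A ~= {}"
  then have "\<Omega> \<subseteq> A \<union> (\<Omega> - A)" "A \<inter> (\<Omega> - A) \<inter> \<Omega> = {}" "A \<inter> \<Omega> ~= {}" "(\<Omega> - A) \<inter> \<Omega> ~= {}"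
   using xm by (auto simp: A_def)
  then show False using assms(3) openA openC unfolding connected_def by blast
 qed
 then have "rk x = rk xm" if "x : \<Omega>" for x using that by (auto simp: A_def)
 then show ?thesis unfolding constant_on_def rk_def by blast
qed

end
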